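(* Let $V$ be a model of ZFC satisfying $2^{\aleph_1}=\aleph_2$, $2^{\aleph_2}=\aleph_3$ and $\diamondsuit_{\{\delta<\aleph_3:\ \mathrm{cof}\,\delta=\aleph_2\}}$. Then in the generic extension of $V$ obtained by adding $\aleph_3$ Cohen reals there are elementarily equivalent countable graphs $\Gamma^1_\omega,\Gamma^2_\omega$ and a nonprincipal ultrafilter $\mathcal F$ on $\omega$ such that $(\Gamma^1_\omega)^\omega/\mathcal F\not\cong(\Gamma^2_\omega)^\omega/\mathcal F$. *)

theory Defs
  imports Main
begin

text \<open>
  A model of set theory is a type carrying a binary relation \<open>E\<close>, which need be neither well-founded
  nor a standard membership relation.  Every set-theoretic notion below is the relativisation of a
  first-order formula: the quantifiers range over the points of the model only, so that for instance
  \<open>equipotent E\<close> asks for a bijection that is an element of the model.  HOL sets of points are only a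
  notation for classes of the model, and \<open>elts E x = X\<close> says that the point \<open>x\<close> has the extent \<open>X\<close>.
\<close>

section \<open>ZFC\<close>

text \<open>Formulas in the language of set theory, with de Bruijn indices, for the two axiom schemes.\<close>

datatype fm = FMem nat nat | FEq nat nat | FNand fm fm | FAll fm

primrec sat :: "('v \<Rightarrow> 'v \<Rightarrow> bool) \<Rightarrow> (nat \<Rightarrow> 'v) \<Rightarrow> fm \<Rightarrow> bool" where
  "sat E \<rho> (FMem i j) \<longleftrightarrow> E (\<rho> i) (\<rho> j)"
| "sat E \<rho> (FEq i j) \<longleftrightarrow> \<rho> i = \<rho> j"
| "sat E \<rho> (FNand \<phi> \<psi>) \<longleftrightarrow> \<not> (sat E \<rho> \<phi> \<and> sat E \<rho> \<psi>)"
| "sat E \<rho> (FAll \<phi>) \<longleftrightarrow> (\<forall>a. sat E (case_nat a \<rho>) \<phi>)"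

context
  fixes E :: "'v \<Rightarrow> 'v \<Rightarrow> bool"
begin

definition elts :: "'v \<Rightarrow> 'v set" where
  "elts x = {y. E y x}"

definition is_inductive :: "'v \<Rightarrow> bool" where
  "is_inductive w \<longleftrightarrow>
     (\<exists>z\<in>elts w. elts z = {}) \<and> (\<forall>x\<in>elts w. \<exists>y\<in>elts w. elts y = insert x (elts x))"

definition ZFC :: bool where
  "ZFC \<longleftrightarrow>
     \<comment> \<open>extensionality\<close>  (\<forall>x y. elts x = elts y \<longrightarrow> x = y) \<and>
     \<comment> \<open>foundation\<close>      (\<forall>x. elts x \<noteq> {} \<longrightarrow> (\<exists>y\<in>elts x. elts y \<inter> elts x = {})) \<and>
     \<comment> \<open>pairing\<close>         (\<forall>x y. \<exists>z. elts z = {x, y}) \<and>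
     \<comment> \<open>union\<close>           (\<forall>x. \<exists>u. elts u = (\<Union>y\<in>elts x. elts y)) \<and>
     \<comment> \<open>power set\<close>       (\<forall>x. \<exists>p. elts p = {y. elts y \<subseteq> elts x}) \<and>
     \<comment> \<open>infinity\<close>        (\<exists>w. is_inductive w) \<and>
     \<comment> \<open>separation\<close>      (\<forall>\<phi> \<rho> x. \<exists>y. elts y = {z \<in> elts x. sat E (case_nat z \<rho>) \<phi>}) \<and>
     \<comment> \<open>replacement\<close>     (\<forall>\<phi> \<rho> a. (\<forall>x\<in>elts a. \<exists>!y. sat E (case_nat x (case_nat y \<rho>)) \<phi>) \<longrightarrow>
                            (\<exists>b. elts b = {y. \<exists>x\<in>elts a. sat E (case_nat x (case_nat y \<rho>)) \<phi>})) \<and>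
     \<comment> \<open>choice\<close>          (\<forall>a. (\<forall>x\<in>elts a. elts x \<noteq> {}) \<and>
                               (\<forall>x\<in>elts a. \<forall>y\<in>elts a. x \<noteq> y \<longrightarrow> elts x \<inter> elts y = {}) \<longrightarrow>
                            (\<exists>c. \<forall>x\<in>elts a. \<exists>!y. y \<in> elts x \<inter> elts c))"


section \<open>Relations, functions, ordinals and cardinals of a model\<close>

definition is_pair :: "'v \<Rightarrow> 'v \<Rightarrow> 'v \<Rightarrow> bool" where
  "is_pair p x y \<longleftrightarrow> (\<exists>a b. elts a = {x} \<and> elts b = {x, y} \<and> elts p = {a, b})"

definition rel :: "'v \<Rightarrow> ('v \<times> 'v) set" where
  "rel r = {(x, y). \<exists>p\<in>elts r. is_pair p x y}"

definition rel_on :: "'v \<Rightarrow> 'v \<Rightarrow> 'v \<Rightarrow> bool" where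
  "rel_on r a b \<longleftrightarrow> (\<forall>p\<in>elts r. \<exists>x\<in>elts a. \<exists>y\<in>elts b. is_pair p x y)"

definition is_fun :: "'v \<Rightarrow> 'v \<Rightarrow> 'v \<Rightarrow> bool" where
  "is_fun f a b \<longleftrightarrow> rel_on f a b \<and> (\<forall>x\<in>elts a. \<exists>!y. (x, y) \<in> rel f)"

definition app :: "'v \<Rightarrow> 'v \<Rightarrow> 'v" where
  "app f x = (THE y. (x, y) \<in> rel f)"

definition equipotent :: "'v \<Rightarrow> 'v \<Rightarrow> bool" where
  "equipotent a b \<longleftrightarrow> (\<exists>f. is_fun f a b \<and> bij_betw (app f) (elts a) (elts b))"

definition is_omega :: "'v \<Rightarrow> bool" where
  "is_omega w \<longleftrightarrow> is_inductive w \<and> (\<forall>x. is_inductive x \<longrightarrow> elts w \<subseteq> elts x)"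

primrec is_num :: "nat \<Rightarrow> 'v \<Rightarrow> bool" where
  "is_num 0 x \<longleftrightarrow> elts x = {}"
| "is_num (Suc n) x \<longleftrightarrow> (\<exists>y. is_num n y \<and> elts x = insert y (elts y))"

text \<open>In the sense of the model, which may have more natural numbers than the metatheory.\<close>

definition is_finite :: "'v \<Rightarrow> bool" where
  "is_finite x \<longleftrightarrow> (\<exists>w. is_omega w \<and> (\<exists>n\<in>elts w. equipotent n x))"

definition is_countable :: "'v \<Rightarrow> bool" where
  "is_countable x \<longleftrightarrow> (\<exists>w f. is_omega w \<and> is_fun f x w \<and> inj_on (app f) (elts x))"

definition is_trans :: "'v \<Rightarrow> bool" where
  "is_trans x \<longleftrightarrow> (\<forall>y\<in>elts x. elts y \<subseteq> elts x)"

definition is_ord :: "'v \<Rightarrow> bool" where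
  "is_ord x \<longleftrightarrow> is_trans x \<and> (\<forall>y\<in>elts x. is_trans y)"

definition is_card :: "'v \<Rightarrow> bool" where
  "is_card k \<longleftrightarrow> is_ord k \<and> (\<forall>x\<in>elts k. \<not> equipotent x k)"

primrec is_aleph :: "nat \<Rightarrow> 'v \<Rightarrow> bool" where
  "is_aleph 0 k \<longleftrightarrow> is_omega k"
| "is_aleph (Suc n) k \<longleftrightarrow>
     is_card k \<and> (\<exists>l\<in>elts k. is_aleph n l \<and> (\<forall>m\<in>elts k. is_card m \<longrightarrow> \<not> E l m))"

text \<open>\<open>2\<^sup>k = l\<close>, for a cardinal \<open>l\<close>.\<close>

definition two_power_eq :: "'v \<Rightarrow> 'v \<Rightarrow> bool" where
  "two_power_eq k l \<longleftrightarrow> is_card l \<and> (\<exists>p. elts p = {x. elts x \<subseteq> elts k} \<and> equipotent p l)"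

definition cofinal_map :: "'v \<Rightarrow> 'v \<Rightarrow> 'v \<Rightarrow> bool" where
  "cofinal_map f \<alpha> \<delta> \<longleftrightarrow>
     is_fun f \<alpha> \<delta> \<and> (\<forall>x\<in>elts \<delta>. \<exists>i\<in>elts \<alpha>. x = app f i \<or> E x (app f i))"

definition is_cof :: "'v \<Rightarrow> 'v \<Rightarrow> bool" where
  "is_cof \<delta> \<alpha> \<longleftrightarrow> is_ord \<delta> \<and> is_ord \<alpha> \<and>
     (\<exists>f. cofinal_map f \<alpha> \<delta>) \<and> (\<forall>\<beta>\<in>elts \<alpha>. \<not> (\<exists>f. cofinal_map f \<beta> \<delta>))"

definition club :: "'v \<Rightarrow> 'v \<Rightarrow> bool" where
  "club k c \<longleftrightarrow> elts c \<subseteq> elts k \<and>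
     (\<forall>x\<in>elts k. \<exists>y\<in>elts c. E x y) \<and>
     (\<forall>\<delta>\<in>elts k. elts \<delta> \<noteq> {} \<and> (\<forall>x\<in>elts \<delta>. \<exists>y\<in>elts c \<inter> elts \<delta>. E x y) \<longrightarrow> \<delta> \<in> elts c)"

definition stationary :: "'v \<Rightarrow> 'v set \<Rightarrow> bool" where
  "stationary k T \<longleftrightarrow> (\<forall>c. club k c \<longrightarrow> elts c \<inter> T \<noteq> {})"

text \<open>The principle \<open>\<diamondsuit>\<^sub>s\<close> for a subset \<open>s\<close> of \<open>k\<close>; \<open>g\<close> is the guessing sequence.\<close>

definition diamond :: "'v \<Rightarrow> 'v \<Rightarrow> bool" where
  "diamond k s \<longleftrightarrow>
     (\<exists>p g. elts p = {x. elts x \<subseteq> elts k} \<and> is_fun g s p \<and>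
        (\<forall>\<delta>\<in>elts s. elts (app g \<delta>) \<subseteq> elts \<delta>) \<and>
        (\<forall>x. elts x \<subseteq> elts k \<longrightarrow>
           stationary k {\<delta> \<in> elts s. elts x \<inter> elts \<delta> = elts (app g \<delta>)}))"


section \<open>Graphs and their ultrapowers in a model\<close>

text \<open>The graph with vertex set \<open>A\<close> and adjacency relation \<open>R\<close>.\<close>

definition is_graph :: "'v \<Rightarrow> 'v \<Rightarrow> bool" where
  "is_graph A R \<longleftrightarrow> elts A \<noteq> {} \<and> rel_on R A A \<and> sym (rel R) \<and> irrefl (rel R)"

definition graph_isomorphic :: "'v \<Rightarrow> 'v \<Rightarrow> 'v \<Rightarrow> 'v \<Rightarrow> bool" where
  "graph_isomorphic A R B S \<longleftrightarrow>
     (\<exists>h. is_fun h A B \<and> bij_betw (app h) (elts A) (elts B) \<and>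
        (\<forall>x\<in>elts A. \<forall>y\<in>elts A. (x, y) \<in> rel R \<longleftrightarrow> (app h x, app h y) \<in> rel S))"

text \<open>
  First-order formulas in the language of graphs, as elements of the model.  With variables indexed
  by the \<open>\<omega>\<close> of the model, the codes are \<open>(0,(i,j))\<close> for \<open>v\<^sub>i R v\<^sub>j\<close>, \<open>(1,(i,j))\<close> for \<open>v\<^sub>i = v\<^sub>j\<close>,
  \<open>(2,(\<phi>,\<psi>))\<close> for \<open>\<not> (\<phi> \<and> \<psi>)\<close> and \<open>(3,(i,\<phi>))\<close> for \<open>\<forall>v\<^sub>i. \<phi>\<close>.
\<close>

definition code :: "nat \<Rightarrow> 'v \<Rightarrow> 'v \<Rightarrow> 'v \<Rightarrow> bool" where
  "code k x y c \<longleftrightarrow> (\<exists>n t. is_num k n \<and> is_pair t x y \<and> is_pair c n t)"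

definition formula_closed :: "'v \<Rightarrow> 'v \<Rightarrow> bool" where
  "formula_closed w X \<longleftrightarrow>
     (\<forall>c. \<forall>i\<in>elts w. \<forall>j\<in>elts w. code 0 i j c \<or> code 1 i j c \<longrightarrow> c \<in> elts X) \<and>
     (\<forall>c. \<forall>\<phi>\<in>elts X. \<forall>\<psi>\<in>elts X. code 2 \<phi> \<psi> c \<longrightarrow> c \<in> elts X) \<and>
     (\<forall>c. \<forall>i\<in>elts w. \<forall>\<phi>\<in>elts X. code 3 i \<phi> c \<longrightarrow> c \<in> elts X)"

definition is_formulas :: "'v \<Rightarrow> 'v \<Rightarrow> bool" where
  "is_formulas w \<Phi> \<longleftrightarrow>
     formula_closed w \<Phi> \<and> (\<forall>X. formula_closed w X \<longrightarrow> elts \<Phi> \<subseteq> elts X)"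

text \<open>\<open>v\<close> maps each formula to its set of free variables.\<close>

definition is_free_vars :: "'v \<Rightarrow> 'v \<Rightarrow> 'v \<Rightarrow> bool" where
  "is_free_vars w \<Phi> v \<longleftrightarrow>
     (\<exists>p. elts p = {x. elts x \<subseteq> elts w} \<and> is_fun v \<Phi> p) \<and>
     (\<forall>c. \<forall>i\<in>elts w. \<forall>j\<in>elts w. code 0 i j c \<or> code 1 i j c \<longrightarrow> elts (app v c) = {i, j}) \<and>
     (\<forall>c. \<forall>\<phi>\<in>elts \<Phi>. \<forall>\<psi>\<in>elts \<Phi>. code 2 \<phi> \<psi> c \<longrightarrow>
        elts (app v c) = elts (app v \<phi>) \<union> elts (app v \<psi>)) \<and>
     (\<forall>c. \<forall>i\<in>elts w. \<forall>\<phi>\<in>elts \<Phi>. code 3 i \<phi> c \<longrightarrow> elts (app v c) = elts (app v \<phi>) - {i})"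

text \<open>\<open>T\<close> relates a formula to the assignments \<open>\<omega> \<rightarrow> A\<close> that satisfy it in the graph \<open>(A, R)\<close>.\<close>

definition is_satisfaction :: "'v \<Rightarrow> 'v \<Rightarrow> 'v \<Rightarrow> 'v \<Rightarrow> 'v \<Rightarrow> bool" where
  "is_satisfaction w \<Phi> A R T \<longleftrightarrow> (\<forall>a c. is_fun a w A \<longrightarrow>
     (\<forall>i\<in>elts w. \<forall>j\<in>elts w. code 0 i j c \<longrightarrow>
        ((c, a) \<in> rel T \<longleftrightarrow> (app a i, app a j) \<in> rel R)) \<and>
     (\<forall>i\<in>elts w. \<forall>j\<in>elts w. code 1 i j c \<longrightarrow>
        ((c, a) \<in> rel T \<longleftrightarrow> app a i = app a j)) \<and>
     (\<forall>\<phi>\<in>elts \<Phi>. \<forall>\<psi>\<in>elts \<Phi>. code 2 \<phi> \<psi> c \<longrightarrow>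
        ((c, a) \<in> rel T \<longleftrightarrow> \<not> ((\<phi>, a) \<in> rel T \<and> (\<psi>, a) \<in> rel T))) \<and>
     (\<forall>i\<in>elts w. \<forall>\<phi>\<in>elts \<Phi>. code 3 i \<phi> c \<longrightarrow>
        ((c, a) \<in> rel T \<longleftrightarrow>
           (\<forall>b. is_fun b w A \<and> (\<forall>j\<in>elts w. j \<noteq> i \<longrightarrow> app b j = app a j) \<longrightarrow> (\<phi>, b) \<in> rel T))))"

definition elem_equivalent :: "'v \<Rightarrow> 'v \<Rightarrow> 'v \<Rightarrow> 'v \<Rightarrow> bool" where
  "elem_equivalent A R B S \<longleftrightarrow>
     (\<exists>w \<Phi> v T U. is_omega w \<and> is_formulas w \<Phi> \<and> is_free_vars w \<Phi> v \<and>
        is_satisfaction w \<Phi> A R T \<and> is_satisfaction w \<Phi> B S U \<and>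
        (\<forall>\<phi>\<in>elts \<Phi>. elts (app v \<phi>) = {} \<longrightarrow>
           ((\<forall>a. is_fun a w A \<longrightarrow> (\<phi>, a) \<in> rel T) \<longleftrightarrow> (\<forall>a. is_fun a w B \<longrightarrow> (\<phi>, a) \<in> rel U))))"

text \<open>The extents of the members of \<open>D\<close>, so that \<open>X \<in> family D\<close> says that \<open>D\<close> has a member with extent \<open>X\<close>.\<close>

definition family :: "'v \<Rightarrow> 'v set set" where
  "family D = elts ` elts D"

definition nonprincipal_ultrafilter :: "'v \<Rightarrow> 'v \<Rightarrow> bool" where
  "nonprincipal_ultrafilter w D \<longleftrightarrow>
     (\<forall>X\<in>family D. X \<subseteq> elts w) \<and> elts w \<in> family D \<and> {} \<notin> family D \<and>
     (\<forall>X\<in>family D. \<forall>Y\<in>family D. X \<inter> Y \<in> family D) \<and>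
     (\<forall>X\<in>family D. \<forall>y. X \<subseteq> elts y \<and> elts y \<subseteq> elts w \<longrightarrow> elts y \<in> family D) \<and>
     (\<forall>x. elts x \<subseteq> elts w \<longrightarrow> elts x \<in> family D \<or> elts w - elts x \<in> family D) \<and>
     (\<forall>n\<in>elts w. {n} \<notin> family D)"

text \<open>The graph \<open>(B, S)\<close> is the ultrapower \<open>(A, R)\<^sup>w / D\<close>; its vertices are equivalence classes of functions.\<close>

definition is_ultrapower :: "'v \<Rightarrow> 'v \<Rightarrow> 'v \<Rightarrow> 'v \<Rightarrow> 'v \<Rightarrow> 'v \<Rightarrow> bool" where
  "is_ultrapower w D A R B S \<longleftrightarrow>
     elts B = {c. \<exists>f. is_fun f w A \<and>
                 elts c = {g. is_fun g w A \<and> {n \<in> elts w. app f n = app g n} \<in> family D}} \<and>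
     rel_on S B B \<and>
     rel S = {(c, d). c \<in> elts B \<and> d \<in> elts B \<and>
               (\<exists>f\<in>elts c. \<exists>g\<in>elts d. {n \<in> elts w. (app f n, app g n) \<in> rel R} \<in> family D)}"


section \<open>Forcing\<close>

text \<open>
  A forcing notion is a set \<open>P\<close> of the model with a set \<open>L\<close> of the model, where \<open>(q, p) \<in> rel L\<close> says
  that \<open>q\<close> is stronger than \<open>p\<close>.  The next definition describes the forcing notion that adds \<open>k\<close> Cohen
  reals: finite partial functions from \<open>k \<times> \<omega>\<close> to \<open>2\<close>, ordered by reverse inclusion.
\<close>

definition is_cohen_forcing :: "'v \<Rightarrow> 'v \<Rightarrow> 'v \<Rightarrow> bool" where
  "is_cohen_forcing k P L \<longleftrightarrow>
     (\<exists>w. is_omega w \<and>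
        elts P = {p. (\<forall>z\<in>elts p. \<exists>\<alpha>\<in>elts k. \<exists>n\<in>elts w. \<exists>x i.
                        is_pair x \<alpha> n \<and> (is_num 0 i \<or> is_num 1 i) \<and> is_pair z x i) \<and>
                     single_valued (rel p) \<and> is_finite p}) \<and>
     rel_on L P P \<and>
     rel L = {(q, p). q \<in> elts P \<and> p \<in> elts P \<and> elts p \<subseteq> elts q}"

text \<open>\<open>G\<close> is an arbitrary class of points; it need not be, and usually is not, an element of the model.\<close>

definition is_generic :: "'v \<Rightarrow> 'v \<Rightarrow> 'v set \<Rightarrow> bool" where
  "is_generic P L G \<longleftrightarrow>
     G \<subseteq> elts P \<and> G \<noteq> {} \<and>
     (\<forall>p\<in>G. \<forall>q\<in>elts P. (p, q) \<in> rel L \<longrightarrow> q \<in> G) \<and>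
     (\<forall>p\<in>G. \<forall>q\<in>G. \<exists>r\<in>G. (r, p) \<in> rel L \<and> (r, q) \<in> rel L) \<and>
     (\<forall>D. elts D \<subseteq> elts P \<and> (\<forall>p\<in>elts P. \<exists>q\<in>elts D. (q, p) \<in> rel L) \<longrightarrow> G \<inter> elts D \<noteq> {})"

text \<open>
  Every point of the model is used as a name: only its elements of the form \<open>(\<pi>, s)\<close> with \<open>s\<close> in \<open>P\<close>
  count, and they say that \<open>\<pi>\<close> is an element as soon as \<open>s\<close> is in the generic filter.
\<close>

definition name_elts :: "'v \<Rightarrow> 'v \<Rightarrow> ('v \<times> 'v) set" where
  "name_elts P \<tau> = {(\<pi>, s) \<in> rel \<tau>. s \<in> elts P}"

definition triple_in :: "'v \<Rightarrow> 'v \<Rightarrow> 'v \<Rightarrow> 'v \<Rightarrow> bool" where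
  "triple_in r p x y \<longleftrightarrow> (\<exists>t. is_pair t x y \<and> (p, t) \<in> rel r)"

definition forces_subset_step ::
    "'v \<Rightarrow> 'v \<Rightarrow> ('v \<Rightarrow> 'v \<Rightarrow> 'v \<Rightarrow> bool) \<Rightarrow> 'v \<Rightarrow> 'v \<Rightarrow> 'v \<Rightarrow> bool" where
  "forces_subset_step P L Q p \<sigma> \<tau> \<longleftrightarrow>
     (\<forall>(\<pi>, s)\<in>name_elts P \<sigma>. \<forall>q\<in>elts P. (q, p) \<in> rel L \<and> (q, s) \<in> rel L \<longrightarrow>
        (\<exists>q'\<in>elts P. (q', q) \<in> rel L \<and>
           (\<exists>(\<pi>', s')\<in>name_elts P \<tau>. (q', s') \<in> rel L \<and> Q q' \<pi> \<pi>')))"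

text \<open>
  The relation \<open>p \<tturnstile> \<sigma> = \<tau>\<close>, defined by recursion on names.  The recursion takes place in the model
  and is therefore expressed by the existence, in the model, of a set \<open>r\<close> that obeys the recursive
  clause on a set \<open>d\<close> of names closed under passing to elements.
\<close>

definition forces_eq :: "'v \<Rightarrow> 'v \<Rightarrow> 'v \<Rightarrow> 'v \<Rightarrow> 'v \<Rightarrow> bool" where
  "forces_eq P L p \<sigma> \<tau> \<longleftrightarrow>
     (\<exists>d r. \<sigma> \<in> elts d \<and> \<tau> \<in> elts d \<and>
        (\<forall>x\<in>elts d. \<forall>(\<pi>, s)\<in>name_elts P x. \<pi> \<in> elts d) \<and>
        (\<forall>q\<in>elts P. \<forall>x\<in>elts d. \<forall>y\<in>elts d. triple_in r q x y \<longleftrightarrow>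
           forces_subset_step P L (triple_in r) q x y \<and>
           forces_subset_step P L (triple_in r) q y x) \<and>
        triple_in r p \<sigma> \<tau>)"

definition forces_mem :: "'v \<Rightarrow> 'v \<Rightarrow> 'v \<Rightarrow> 'v \<Rightarrow> 'v \<Rightarrow> bool" where
  "forces_mem P L p \<sigma> \<tau> \<longleftrightarrow>
     (\<forall>q\<in>elts P. (q, p) \<in> rel L \<longrightarrow>
        (\<exists>q'\<in>elts P. (q', q) \<in> rel L \<and>
           (\<exists>(\<pi>, s)\<in>name_elts P \<tau>. (q', s) \<in> rel L \<and> forces_eq P L q' \<sigma> \<pi>)))"

end

text \<open>
  The model \<open>E'\<close> is the generic extension of \<open>E\<close> by \<open>G\<close>: its points are the values of the names, and
  atomic statements about them hold when some condition in \<open>G\<close> forces them.  This determines \<open>E'\<close> up to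
  isomorphism for every model \<open>E\<close>; for a well-founded one, \<open>val\<close> is the usual evaluation
  \<open>val \<tau> = {val \<pi> | \<pi> s. (\<pi>, s) \<in> \<tau> \<and> s \<in> G}\<close>.
\<close>

definition is_generic_extension ::
    "('v \<Rightarrow> 'v \<Rightarrow> bool) \<Rightarrow> 'v \<Rightarrow> 'v \<Rightarrow> 'v set \<Rightarrow> ('w \<Rightarrow> 'w \<Rightarrow> bool) \<Rightarrow> bool" where
  "is_generic_extension E P L G E' \<longleftrightarrow>
     (\<exists>val :: 'v \<Rightarrow> 'w. surj val \<and>
        (\<forall>\<sigma> \<tau>. val \<sigma> = val \<tau> \<longleftrightarrow> (\<exists>p\<in>G. forces_eq E P L p \<sigma> \<tau>)) \<and>
        (\<forall>\<sigma> \<tau>. E' (val \<sigma>) (val \<tau>) \<longleftrightarrow> (\<exists>p\<in>G. forces_mem E P L p \<sigma> \<tau>)))"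

end

theory Submission imports Defs begin

notation (input) iff (infixr "<->" 25)

text \<open>
  Read the Cohen real \<open>\<xi>\<close> as the function \<open>g\<^sub>\<xi>\<close> that maps \<open>i\<close> to the least \<open>k > i\<close> at which the real has the
  value 1. The guesses of the diamond sequence that are singletons label unboundedly many \<open>\<xi> < \<omega>\<^sub>3\<close> by each
  \<open>\<alpha> < \<omega>\<^sub>2\<close>. In the extension, every family of \<open>\<omega>\<^sub>2\<close> functions on \<open>\<omega>\<close> has a name with coordinates below some
  \<open>\<gamma> < \<omega>\<^sub>3\<close>, and every countable family has one whose coordinates do not have labels above some \<open>\<alpha> < \<omega>\<^sub>2\<close>. Let \<open>f\<close>
  have a name with coordinates below \<open>\<xi>\<close>, and \<open>w\<close> one with coordinates of labels below that of \<open>\<xi>\<close>. The sets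
  of those \<open>i\<close> such that \<open>f(i) < g\<^sub>\<xi>(i)\<close>, and \<open>g\<^sub>\<xi>(i) ~= w(i,l)\<close> for \<open>l < f(i)\<close>, have infinite finite
  intersections, so they extend to a nonprincipal ultrafilter \<open>F\<close>. Modulo \<open>F\<close>, any \<open>\<omega>\<^sub>2\<close> functions have a common
  bound, while for every \<open>f\<close> there are \<open>\<omega>\<^sub>2\<close> functions \<open>g\<^sub>\<xi>\<close> whose values are not captured by the first \<open>f(i)\<close>
  entries of the rows of a single \<open>w\<close>.

  The component \<open>A\<^sub>n\<close> of a graph has as vertices the natural numbers and, essentially, the sets of at most \<open>n + 2\<close> of
  them (in \<open>A\<^sub>0\<close>: all finite sets), adjacent to their elements. The graph with the components \<open>A\<^sub>0, A\<^sub>1, \<dots>\<close> and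
  the one with \<open>A\<^sub>1, A\<^sub>2, \<dots>\<close> are elementarily equivalent by a back-and-forth argument, as \<open>A\<^sub>n\<close> resembles \<open>A\<^sub>0\<close>
  for large \<open>n\<close>. In the ultrapower of the former, any \<open>\<omega>\<^sub>2\<close> vertices of the component coming from \<open>A\<^sub>0\<close> have a
  common neighbour, by the common bounds. In the ultrapower of the latter, in the component coming from
  \<open>A\<^bsub>f(i)\<^esub>\<close>, there are \<open>\<omega>\<^sub>2\<close> points without a common neighbour, since a vertex with neighbours of bounded
  number would capture them.
\<close>

section \<open>Definable classes\<close>

text \<open>The model may be ill-founded and its natural numbers nonstandard, so finite sets, codes
  of formulas and recursions are those of the model, and every induction needs a definable
  predicate; this is why definability is tracked throughout. The extension is only shown to satisfy
  Zermelo's axioms and to have well-orderings.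

  An isomorphism of the ultrapowers need not respect the numbering of components. It does respect
  lying in a common component, since two vertices of a component always have a common neighbour; the
  summand 2 in the limit n + 2 makes room for two points.

  Labels answer another obstacle: the functions that are to evade every w are fixed before w is
  given, and a name of w may then use coordinates above all of them. With labels, values of f are
  settled in the order of the ordinals \<xi> and values of w in the order of the labels, so the two
  kinds of requirements do not block each other.

  Finite sets of points are coded by natural numbers. The codes come from the first \<omega> Cohen
  reals, read as a matrix of bits with the extension property of a random graph.\<close>

definition mix :: "(nat => 'v) => (nat => 'v) => nat => 'v" where
  "mix rh \<sigma> n = (if even n then rh (n div 2) else \<sigma> (n div 2))"

primrec ren :: "(nat => nat) => fm => fm" where
  "ren r (FMem i j) = FMem (r i) (r j)"
| "ren r (FEq i j) = FEq (r i) (r j)"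
| "ren r (FNand \<phi> \<psi>) = FNand (ren r \<phi>) (ren r \<psi>)"
| "ren r (FAll \<phi>) = FAll (ren (case_nat 0 (%n. Suc (r n))) \<phi>)"

lemma sat_ren: "sat E rh (ren r \<phi>) = sat E (%n. rh (r n)) \<phi>"
proof (induction \<phi> arbitrary: rh r)
  case (FAll \<phi>)
  have "(%n. case_nat a rh (case_nat 0 (%n. Suc (r n)) n)) = case_nat a (%n. rh (r n))" for a
    by (auto simp: fun_eq_iff split: nat.splits)
  thus ?case using FAll by simp
qed auto

text \<open>Even variables of the formula are the arguments, odd ones are parameters.\<close>

definition Dn :: "('v => 'v => bool) => ((nat => 'v) => bool) => bool" where
  "Dn E P <-> (EX \<phi> \<sigma>. ALL rh. P rh = sat E (mix rh \<sigma>) \<phi>)"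

text \<open>What has to be definable is the graph of \<open>t\<close>; index 0 holds the value, so
  the arguments move up by one. As \<open>t\<close> is total on environments, operations such as
  \<open>ap\<close>, \<open>chk\<close> and \<open>fs\<close> get definable default values where
  they make no sense.\<close>

definition Fn :: "('v => 'v => bool) => ((nat => 'v) => 'v) => bool" where
  "Fn E t <-> Dn E (%rh. rh 0 = t (%n. rh (Suc n)))"

named_theorems dn

lemma Dn_ren:
  assumes "Dn E P" shows "Dn E (%rh. P (%n. rh (r n)))"
proof -
  obtain \<phi> \<sigma> where 1: "!!rh. P rh = sat E (mix rh \<sigma>) \<phi>" using assms unfolding Dn_def by blast
  define r' where "r' n = (if even n then 2 * r (n div 2) else n)" for n
  have "(%n. mix rh \<sigma> (r' n)) = mix (%n. rh (r n)) \<sigma>" for rh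
    by (auto simp: mix_def r'_def fun_eq_iff)
  hence "P (%n. rh (r n)) = sat E (mix rh \<sigma>) (ren r' \<phi>)" for rh
    by (simp add: sat_ren 1)
  thus ?thesis unfolding Dn_def by blast
qed

text \<open>Each formula comes with its own parameters. They are interleaved into the single
  sequence \<open>mix \<sigma> \<sigma>'\<close>, and the renamings \<open>r1\<close> and
  \<open>r2\<close> send the odd variables to its two halves.\<close>

lemma Dn_nand:
  assumes "Dn E P" "Dn E Q" shows "Dn E (%rh. ~ (P rh & Q rh))"
proof -
  obtain \<phi> \<sigma> where 1: "!!rh. P rh = sat E (mix rh \<sigma>) \<phi>" using assms unfolding Dn_def by blast
  obtain \<phi>' \<sigma>' where 2: "!!rh. Q rh = sat E (mix rh \<sigma>') \<phi>'" using assms unfolding Dn_def by blast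
  define r1 where "r1 n = (if even n then n else Suc (2 * (2 * (n div 2))))" for n :: nat
  define r2 where "r2 n = (if even n then n else Suc (2 * Suc (2 * (n div 2))))" for n :: nat
  have "(%n. mix rh (mix \<sigma> \<sigma>') (r1 n)) = mix rh \<sigma>" "(%n. mix rh (mix \<sigma> \<sigma>') (r2 n)) = mix rh \<sigma>'" for rh
    unfolding mix_def r1_def r2_def fun_eq_iff by (auto elim!: oddE)
  hence "(~ (P rh & Q rh)) = sat E (mix rh (mix \<sigma> \<sigma>')) (FNand (ren r1 \<phi>) (ren r2 \<phi>'))" for rh
    by (simp add: sat_ren 1 2)
  thus ?thesis unfolding Dn_def by blast
qed

lemma Dn_all [dn]:
  assumes "Dn E (%rh. Q (%n. rh (Suc n)) (rh 0))" shows "Dn E (%rh. ALL a. Q rh a)"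
proof -
  obtain \<phi> \<sigma> where 1: "!!rh. Q (%n. rh (Suc n)) (rh 0) = sat E (mix rh \<sigma>) \<phi>"
    using assms unfolding Dn_def by blast
  have Q: "Q rh a = sat E (mix (case_nat a rh) \<sigma>) \<phi>" for rh a using 1[of "case_nat a rh"] by simp
  \<comment> \<open>Below the quantifier all indices have moved by one, while the formula still
    expects arguments at even and parameters at odd variables: argument \<open>Suc k\<close> is
    found at \<open>2 * k + 1\<close> and parameter \<open>k\<close> at
    \<open>2 * k + 2\<close>.\<close>
  define r where "r n = (if n = 0 then 0 else if even n then n - 1 else Suc n)" for n :: nat
  have "case_nat a (mix rh \<sigma>) (r n) = mix (case_nat a rh) \<sigma> n" for rh a n
  proof (cases "even n")
    case True
    then obtain k where "n = 2 * k" by blast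
    thus ?thesis by (cases k) (auto simp: mix_def r_def)
  next
    case False
    hence "n ~= 0" by presburger
    thus ?thesis using False by (auto simp: mix_def r_def)
  qed
  hence "(%n. case_nat a (mix rh \<sigma>) (r n)) = mix (case_nat a rh) \<sigma>" for rh a by blast
  hence "(ALL a. Q rh a) = sat E (mix rh \<sigma>) (FAll (ren r \<phi>))" for rh
    by (simp add: sat_ren Q)
  thus ?thesis unfolding Dn_def by blast
qed

lemma Dn_not [dn]: assumes "Dn E P" shows "Dn E (%rh. ~ P rh)"
  using Dn_nand[OF assms assms] by simp

lemma Dn_conj [dn]: assumes "Dn E P" "Dn E Q" shows "Dn E (%rh. P rh & Q rh)"
  using Dn_not[OF Dn_nand[OF assms]] by simp

lemma Dn_disj [dn]: assumes "Dn E P" "Dn E Q" shows "Dn E (%rh. P rh \<or> Q rh)"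
  using Dn_nand[OF Dn_not[OF assms(1)] Dn_not[OF assms(2)]] by simp

lemma Dn_imp [dn]: assumes "Dn E P" "Dn E Q" shows "Dn E (%rh. P rh --> Q rh)"
  using Dn_disj[OF Dn_not[OF assms(1)] assms(2)] by simp

lemma Dn_iff [dn]: assumes "Dn E P" "Dn E Q" shows "Dn E (%rh. P rh = Q rh)"
proof -
  have "(%rh. P rh = Q rh) = (%rh. (P rh --> Q rh) & (Q rh --> P rh))" by auto
  thus ?thesis using Dn_conj[OF Dn_imp[OF assms] Dn_imp[OF assms(2,1)]] by simp
qed

lemma Dn_const [dn]: "Dn E (%rh. b)"
proof -
  have "Dn E (%rh. rh 0 = rh 0)" unfolding Dn_def by (rule exI[of _ "FEq 0 0"]) (simp add: mix_def)
  from this Dn_not[OF this] show ?thesis by (cases b) simp_all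
qed

lemma Dn_ex [dn]:
  assumes "Dn E (%rh. Q (%n. rh (Suc n)) (rh 0))" shows "Dn E (%rh. EX a. Q rh a)"
proof -
  have "Dn E (%rh. ALL a. ~ Q rh a)" by (rule Dn_all, rule Dn_not, rule assms)
  from Dn_not[OF this] show ?thesis by simp
qed

lemma Fn_var [dn]: "Fn E (%rh. rh i)"
  unfolding Fn_def Dn_def by (rule exI[of _ "FEq 0 (2 * Suc i)"]) (simp add: mix_def)

lemma Fn_const [dn]: "Fn E (%rh. c)"
  unfolding Fn_def Dn_def by (rule exI[of _ "FEq 0 1"], rule exI[of _ "%_. c"]) (simp add: mix_def)

lemma Fn_ren:
  assumes "Fn E t" shows "Fn E (%rh. t (%n. rh (r n)))"
proof -
  have "Dn E (%rh. rh 0 = t (%n. rh (Suc n)))" using assms by (simp add: Fn_def)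
  from Dn_ren[OF this, of "case_nat 0 (%n. Suc (r n))"] show ?thesis by (simp add: Fn_def)
qed

lemma Fn_shift: "Fn E t ==> Fn E (%rh. t (%n. rh (Suc n)))" by (rule Fn_ren)

lemma Dn_sub:
  assumes "Fn E t" "Dn E (%rh. K (rh 0) (%n. rh (Suc n)))" shows "Dn E (%rh. K (t rh) rh)"
proof -
  have "Dn E (%rh. EX a. a = t rh & K a rh)"
    using assms by (intro Dn_ex Dn_conj) (simp_all add: Fn_def)
  thus ?thesis by simp
qed

lemma Dn1: "Dn E (%rh. K (rh 0)) ==> Fn E a ==> Dn E (%rh. K (a rh))"
  using Dn_sub[of E a "%x rh. K x"] .

lemma Dn2:
  assumes "Dn E (%rh. K (rh 0) (rh 1))" "Fn E a" "Fn E b" shows "Dn E (%rh. K (a rh) (b rh))"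
proof -
  have "Dn E (%rh. K (rh 1) (rh 0))" using Dn_ren[OF assms(1), of "%n. 1 - n"] by simp
  hence "Dn E (%rh. K (rh 0) (b (%n. rh (Suc n))))"
    using Dn_sub[OF Fn_shift[OF assms(3)], of "%x rh. K (rh 0) x"] by simp
  thus ?thesis using Dn_sub[OF assms(2), of "%x rh. K x (b rh)"] by simp
qed

lemma Dn3:
  assumes "Dn E (%rh. K (rh 0) (rh 1) (rh 2))" "Fn E a" "Fn E b" "Fn E c"
  shows "Dn E (%rh. K (a rh) (b rh) (c rh))"
proof -
  have "Dn E (%rh. K (rh 2) (rh 0) (rh 1))" using Dn_ren[OF assms(1), of "%n. if n = 0 then 2 else n - 1"] by simp
  hence "Dn E (%rh. K (rh 1) (rh 0) (c (%n. rh (Suc (Suc n)))))"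
    using Dn_ren[OF Dn_sub[OF Fn_ren[OF assms(4), of "%n. Suc (Suc n)"], of "%x rh. K (rh 1) (rh 0) x"], of id]
      Dn_ren[OF assms(1), of "%n. if n = 0 then 2 else if n = 1 then 1 else 0"]
    by (simp add: numeral_2_eq_2)
  hence "Dn E (%rh. K (rh 0) (b (%n. rh (Suc n))) (c (%n. rh (Suc n))))"
    using Dn_sub[OF Fn_shift[OF assms(3)], of "%x rh. K (rh 0) x (c (%n. rh (Suc n)))"] by simp
  thus ?thesis using Dn_sub[OF assms(2), of "%x rh. K x (b rh) (c rh)"] by simp
qed

lemma Dn_mem_var: "Dn E (%rh. rh 0 : elts E (rh 1))"
  unfolding Dn_def by (rule exI[of _ "FMem 0 2"]) (simp add: mix_def elts_def)

lemma Dn_mem [dn]: "Fn E a ==> Fn E b ==> Dn E (%rh. a rh : elts E (b rh))"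
  by (rule Dn2[where K = "%x y. x : elts E y", OF Dn_mem_var])

lemma Dn_eq [dn]: "Fn E a ==> Fn E b ==> Dn E (%rh. a rh = b rh)"
proof (rule Dn2[where K = "(=)"])
  show "Dn E (%rh. rh 0 = rh 1)" unfolding Dn_def by (rule exI[of _ "FEq 0 2"]) (simp add: mix_def)
qed

lemma Dn_ball [dn]:
  assumes "Fn E t" "Dn E (%rh. Q (%n. rh (Suc n)) (rh 0))"
  shows "Dn E (%rh. ALL a:elts E (t rh). Q rh a)"
  unfolding Ball_def using Dn_imp[OF Dn_mem[OF Fn_var[of E 0] Fn_shift[OF assms(1)]] assms(2)] by (rule Dn_all)

lemma Dn_bex [dn]:
  assumes "Fn E t" "Dn E (%rh. Q (%n. rh (Suc n)) (rh 0))"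
  shows "Dn E (%rh. EX a:elts E (t rh). Q rh a)"
  unfolding Bex_def using Dn_conj[OF Dn_mem[OF Fn_var[of E 0] Fn_shift[OF assms(1)]] assms(2)] by (rule Dn_ex)

lemma Dn_subset [dn]:
  assumes "Fn E a" "Fn E b" shows "Dn E (%rh. elts E (a rh) <= elts E (b rh))"
  unfolding subset_eq using assms(1) Dn_mem[OF Fn_var[of E 0] Fn_shift[OF assms(2)]] by (rule Dn_ball)

lemma Dn_ex1 [dn]:
  assumes "Dn E (%rh. Q (%n. rh (Suc n)) (rh 0))" shows "Dn E (%rh. EX! a. Q rh a)"
  unfolding Ex1_def
proof (rule Dn_ex, rule Dn_conj[OF assms], rule Dn_all, rule Dn_imp)
  show "Dn E (%rh. Q (%n. rh (Suc (Suc n))) (rh 0))"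
    using Dn_ren[OF assms, of "%n. if n = 0 then 0 else Suc n"] by simp
qed (rule Dn_eq, rule Fn_var, rule Fn_var)

lemma Fn_comp1:
  assumes "Fn E (%rh. f (rh 0))" "Fn E a" shows "Fn E (%rh. f (a rh))"
proof -
  have "Dn E (%rh. rh 0 = f (rh 1))" using assms(1) by (simp add: Fn_def)
  from Dn2[of E "%x y. x = f y", OF this Fn_var[of E 0] Fn_shift[OF assms(2)]]
  show ?thesis unfolding Fn_def .
qed

lemma Fn_comp2:
  assumes "Fn E (%rh. f (rh 0) (rh 1))" "Fn E a" "Fn E b" shows "Fn E (%rh. f (a rh) (b rh))"
proof -
  have "Dn E (%rh. rh 0 = f (rh 1) (rh 2))" using assms(1) by (simp add: Fn_def numeral_2_eq_2)
  from Dn3[of E "%x y z. x = f y z", OF this Fn_var[of E 0] Fn_shift[OF assms(2)] Fn_shift[OF assms(3)]]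
  show ?thesis unfolding Fn_def .
qed

section \<open>Elementary set theory inside a model\<close>

lemma elts_iff: "y : elts E x <-> E y x" by (simp add: elts_def)

text \<open>Zermelo's axioms without foundation and choice. They are the common ground of the two
  models: whatever is to be used in the extension as well is derived from them.\<close>

locale zs =
  fixes E :: "'v => 'v => bool"
  assumes ext: "elts E x = elts E y ==> x = y"
    and pairing_ax: "EX z. elts E z = {x, y}"
    and union_ax: "EX u. elts E u = (UN y:elts E x. elts E y)"
    and power_ax: "EX p. elts E p = {y. elts E y <= elts E x}"
    and infinity_ax: "EX w. is_inductive E w"
    and sep_ax: "EX y. elts E y = {z : elts E x. sat E (case_nat z rh) \<phi>}"
begin

abbreviation els where "els \<equiv> elts E"

definition ss :: "'v set => bool" where "ss X <-> (EX x. els x = X)"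

definition mk :: "'v set => 'v" where "mk X = (SOME x. els x = X)"

lemma els_mk: "ss X ==> els (mk X) = X" unfolding ss_def mk_def by (rule someI_ex)
lemma mk_els [simp]: "mk (els x) = x" by (rule ext) (simp add: els_mk ss_def exI[of _ x])
lemma ss_els [simp]: "ss (els x)" by (auto simp: ss_def)
lemma els_eq_iff: "x = y <-> els x = els y" using ext by auto
lemma mk_eq_iff: "ss X ==> y = mk X <-> els y = X" using els_mk[of X] ext by auto

lemma sepI:
  assumes "Dn E (%rh. P (rh 0))" shows "ss {z : els x. P z}"
proof -
  obtain \<phi> \<sigma> where 1: "!!rh. P (rh 0) = sat E (mix rh \<sigma>) \<phi>" using assms unfolding Dn_def by blast
  define r where "r n = (if even n then 0 else Suc (n div 2))" for n :: nat
  have "(%n. case_nat z \<sigma> (r n)) = mix (%_. z) \<sigma>" for z by (auto simp: mix_def r_def fun_eq_iff)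
  hence "P z = sat E (case_nat z \<sigma>) (ren r \<phi>)" for z using 1[of "%_. z"] by (simp add: sat_ren)
  thus ?thesis using sep_ax[of x \<sigma> "ren r \<phi>"] by (simp add: ss_def)
qed

lemma ss_sub:
  assumes "ss Y" "X <= Y" "Dn E (%rh. rh 0 : X)" shows "ss X"
proof -
  have "ss {z : els (mk Y). z : X}" by (rule sepI) (rule assms)
  moreover have "{z : els (mk Y). z : X} = X" using assms(1,2) by (auto simp: els_mk)
  ultimately show ?thesis by simp
qed

lemma Dn_ss [dn]: assumes "ss X" "Fn E t" shows "Dn E (%rh. t rh : X)"
  using Dn_mem[OF assms(2) Fn_const[of E "mk X"]] assms(1) by (simp add: els_mk)

text \<open>\<open>mk\<close> is arbitrary on classes that are not sets, hence the demand that
  \<open>X\<close> is a set in every environment. Then equality with \<open>mk X\<close> is a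
  statement about elements only.\<close>

lemma Fn_mk:
  assumes "!!rh. ss (X rh)" "Dn E (%rh. rh 0 : X (%n. rh (Suc n)))" shows "Fn E (%rh. mk (X rh))"
proof -
  have eq: "(rh 0 = mk (X (%n. rh (Suc n)))) = (ALL z. z : els (rh 0) <-> z : X (%n. rh (Suc n)))" for rh
    using mk_eq_iff[OF assms(1)] by auto
  have "Dn E (%rh. rh 0 : X (%n. rh (Suc (Suc n))))"
    using Dn_ren[OF assms(2), of "%n. if n = 0 then 0 else Suc n"] by simp
  thus ?thesis unfolding Fn_def eq by (intro dn)
qed

lemma ss_pair [simp]: "ss {x, y}" using pairing_ax by (simp add: ss_def)
lemma ss_sing [simp]: "ss {x}" using ss_pair[of x x] by simp
lemma ss_Union [simp]: "ss (UN y:els x. els y)" using union_ax by (simp add: ss_def)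
lemma ss_pow [simp]: "ss {y. els y <= els x}" using power_ax by (simp add: ss_def)

lemma ss_empty [simp]: "ss {}"
proof -
  have "ss {z : els x. False}" for x by (intro sepI dn)
  thus ?thesis by simp
qed

lemma ss_Un: assumes "ss X" "ss Y" shows "ss (X \<union> Y)"
proof -
  have "X \<union> Y = (UN y:els (mk {mk X, mk Y}). els y)" using assms by (simp add: els_mk)
  thus ?thesis by simp
qed

lemma ss_insert [simp]: "ss X ==> ss (insert a X)"
  using ss_Un[OF ss_sing[of a]] by simp

lemma ss_inter: "ss X ==> Dn E (%rh. P (rh 0)) ==> ss {z : X. P z}"
  using sepI[of P "mk X"] by (simp add: els_mk)

lemma ss_Int: assumes "ss X" "ss Y" shows "ss (X \<inter> Y)"
proof -
  have "ss {z : X. z : Y}" by (intro ss_inter dn assms)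
  thus ?thesis by (simp add: Int_def)
qed

lemma ss_Diff: assumes "ss X" "ss Y" shows "ss (X - Y)"
proof -
  have "ss {z : X. z ~: Y}" by (intro ss_inter dn assms)
  thus ?thesis by (simp add: set_diff_eq)
qed

definition emp :: 'v where "emp = mk {}"
definition ins :: "'v => 'v => 'v" where "ins a x = mk (insert a (els x))"
definition suc :: "'v => 'v" where "suc x = ins x x"
definition pw :: "'v => 'v" where "pw x = mk {y. els y <= els x}"
definition Uni :: "'v => 'v" where "Uni x = mk (UN y:els x. els y)"
definition un :: "'v => 'v => 'v" where "un x y = mk (els x \<union> els y)"
definition df :: "'v => 'v => 'v" where "df x y = mk (els x - els y)"
definition opr :: "'v => 'v => 'v" where "opr x y = mk {mk {x}, mk {x, y}}"

lemma els_emp [simp]: "els emp = {}" by (simp add: emp_def els_mk)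
lemma els_ins [simp]: "els (ins a x) = insert a (els x)" by (simp add: ins_def els_mk)
lemma els_suc [simp]: "els (suc x) = insert x (els x)" by (simp add: suc_def)
lemma els_pw [simp]: "els (pw x) = {y. els y <= els x}" by (simp add: pw_def els_mk)
lemma els_Un [simp]: "els (Uni x) = (UN y:els x. els y)" by (simp add: Uni_def els_mk)
lemma els_un [simp]: "els (un x y) = els x \<union> els y" by (simp add: un_def els_mk ss_Un)
lemma els_df [simp]: "els (df x y) = els x - els y" by (simp add: df_def els_mk ss_Diff)
lemma empty_iff_emp: "els x = {} <-> x = emp" using ext[of x emp] by auto

lemma is_pair_iff: "is_pair E p x y <-> p = opr x y"
proof
  assume "is_pair E p x y"
  then obtain a b where "els a = {x}" "els b = {x, y}" "els p = {a, b}" unfolding is_pair_def by blast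
  hence "mk {x} = a" "mk {x, y} = b" "els p = {a, b}" by (metis mk_els)+
  thus "p = opr x y" unfolding opr_def by (simp add: mk_eq_iff)
next
  assume "p = opr x y"
  thus "is_pair E p x y" unfolding opr_def is_pair_def
    by (intro exI[of _ "mk {x}"] exI[of _ "mk {x, y}"]) (simp add: els_mk)
qed

lemma opr_eq [simp]: "opr x y = opr x' y' <-> x = x' & y = y'"
proof
  assume eq: "opr x y = opr x' y'"
  have e: "els (opr x y) = {mk {x}, mk {x, y}}" for x y by (simp add: opr_def els_mk)
  have m: "mk X = mk Y <-> X = Y" if "ss X" "ss Y" for X Y using that els_mk by metis
  have "{mk {x}, mk {x, y}} = {mk {x'}, mk {x', y'}}" using eq e by metis
  thus "x = x' & y = y'" by (simp add: doubleton_eq_iff m) auto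
qed simp

lemma Fn_pair [dn]: "Fn E a ==> Fn E b ==> Fn E (%rh. mk {a rh, b rh})"
proof (rule Fn_comp2[where f = "%x y. mk {x, y}"])
  show "Fn E (%rh. mk {rh 0, rh 1})" by (rule Fn_mk) (simp, simp, intro dn)
qed

lemma Fn_sing [dn]: "Fn E a ==> Fn E (%rh. mk {a rh})"
  using Fn_pair[of a a] by simp

lemma Fn_opr [dn]: "Fn E a ==> Fn E b ==> Fn E (%rh. opr (a rh) (b rh))"
  unfolding opr_def by (intro dn)

lemma Fn_ins [dn]: "Fn E a ==> Fn E b ==> Fn E (%rh. ins (a rh) (b rh))"
proof (rule Fn_comp2[where f = ins])
  show "Fn E (%rh. ins (rh 0) (rh 1))" unfolding ins_def by (rule Fn_mk) (simp, simp, intro dn)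
qed

lemma Fn_suc [dn]: "Fn E a ==> Fn E (%rh. suc (a rh))" unfolding suc_def by (intro dn)

lemma Fn_pw [dn]: "Fn E a ==> Fn E (%rh. pw (a rh))"
proof (rule Fn_comp1[where f = pw])
  show "Fn E (%rh. pw (rh 0))" unfolding pw_def by (rule Fn_mk) (simp, simp, intro dn)
qed

lemma Fn_Un [dn]: "Fn E a ==> Fn E (%rh. Uni (a rh))"
proof (rule Fn_comp1[where f = Uni])
  show "Fn E (%rh. Uni (rh 0))" unfolding Uni_def by (rule Fn_mk) (simp, simp, intro dn)
qed

lemma Fn_un [dn]: "Fn E a ==> Fn E b ==> Fn E (%rh. un (a rh) (b rh))"
proof (rule Fn_comp2[where f = un])
  show "Fn E (%rh. un (rh 0) (rh 1))" unfolding un_def by (rule Fn_mk) (simp add: ss_Un, simp, intro dn)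
qed

lemma Fn_df [dn]: "Fn E a ==> Fn E b ==> Fn E (%rh. df (a rh) (b rh))"
proof (rule Fn_comp2[where f = df])
  show "Fn E (%rh. df (rh 0) (rh 1))" unfolding df_def by (rule Fn_mk) (simp add: ss_Diff, simp, intro dn)
qed

subsection \<open>Products, relations and functions\<close>

definition prd :: "'v => 'v => 'v" where "prd a b = mk {opr x y |x y. x : els a & y : els b}"

lemma els_prd: "els (prd a b) = {opr x y |x y. x : els a & y : els b}"
  unfolding prd_def
proof (rule els_mk, rule ss_sub)
  show "ss (els (pw (pw (un a b))))" by (rule ss_els)
  show "{opr x y |x y. x : els a & y : els b} <= els (pw (pw (un a b)))"
    by (auto simp: opr_def els_mk)
  have "(%rh::nat => 'v. rh 0 : {opr x y |x y. x : els a & y : els b})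
      = (%rh. EX x. EX y. rh 0 = opr x y & x : els a & y : els b)" by auto
  thus "Dn E (%rh. rh 0 : {opr x y |x y. x : els a & y : els b})" by (simp only:) (intro dn)
qed

lemma prd_iff [simp]: "opr x y : els (prd a b) <-> x : els a & y : els b"
  by (auto simp: els_prd)

lemma prdE: "z : els (prd a b) ==> (!!x y. z = opr x y ==> x : els a ==> y : els b ==> P) ==> P"
  by (auto simp: els_prd)

lemma Fn_prd [dn]: "Fn E a ==> Fn E b ==> Fn E (%rh. prd (a rh) (b rh))"
proof (rule Fn_comp2[where f = prd])
  have ss: "ss {opr x y |x y. x : els a & y : els b}" for a b using ss_els[of "prd a b"] by (simp add: els_prd)
  have "(%rh::nat => 'v. rh 0 : {opr x y |x y. x : els (rh (Suc 0)) & y : els (rh 2)})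
      = (%rh. EX x. EX y. rh 0 = opr x y & x : els (rh (Suc 0)) & y : els (rh 2))" by auto
  hence "Dn E (%rh. rh 0 : {opr x y |x y. x : els (rh (Suc 0)) & y : els (rh 2)})" by (simp only:) (intro dn)
  thus "Fn E (%rh. prd (rh 0) (rh 1))" unfolding prd_def
    by (intro Fn_mk ss) (simp add: numeral_2_eq_2)
qed

definition rc :: "'v => 'v => ('v => 'v => bool) => 'v" where
  "rc a b K = mk {z. EX x:els a. EX y:els b. z = opr x y & K x y}"

lemma els_rc:
  assumes "Dn E (%rh. K (rh 0) (rh 1))"
  shows "els (rc a b K) = {z. EX x:els a. EX y:els b. z = opr x y & K x y}"
  unfolding rc_def
proof (rule els_mk, rule ss_sub)
  show "ss (els (prd a b))" by simp
  have "Dn E (%rh. K (rh (Suc 0)) (rh 0))" using Dn_ren[OF assms, of "%n. 1 - n"] by simp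
  thus "Dn E (%rh. rh 0 : {z. EX x:els a. EX y:els b. z = opr x y & K x y})"
    unfolding mem_Collect_eq by (intro dn)
qed auto

lemma rc_iff:
  "Dn E (%rh. K (rh 0) (rh 1)) ==> opr x y : els (rc a b K) <-> x : els a & y : els b & K x y"
  by (auto simp: els_rc)

lemma rel_iff: "(x, y) : rel E r <-> opr x y : els r"
  by (auto simp: rel_def is_pair_iff)

lemma rel_on_iff: "rel_on E r a b <-> els r <= els (prd a b)"
  by (auto simp: rel_on_def is_pair_iff els_prd)

lemma is_fun_iff: "is_fun E f a b <-> els f <= els (prd a b) & (ALL x:els a. EX! y. opr x y : els f)"
  by (simp add: is_fun_def rel_on_iff rel_iff)

text \<open>Unlike \<open>app\<close>, this is a definable operation also where the argument is outside of the domain.\<close>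

definition ap :: "'v => 'v => 'v" where
  "ap f x = (if EX! y. opr x y : els f then THE y. opr x y : els f else f)"

lemma ap_iff: "z = ap f x <-> (EX! y. opr x y : els f) & opr x z : els f \<or> ~ (EX! y. opr x y : els f) & z = f"
  unfolding ap_def by (auto intro: theI' the_equality[symmetric])

lemma Fn_ap [dn]: "Fn E a ==> Fn E b ==> Fn E (%rh. ap (a rh) (b rh))"
proof (rule Fn_comp2[where f = ap])
  show "Fn E (%rh. ap (rh 0) (rh 1))" unfolding Fn_def ap_iff by (intro dn)
qed

lemma app_ap: "is_fun E f a b ==> x : els a ==> app E f x = ap f x"
  by (simp add: is_fun_iff app_def ap_def rel_iff)

lemma fun_val:
  assumes "is_fun E f a b" "x : els a"
  shows "opr x (ap f x) : els f" "ap f x : els b" "opr x y : els f <-> y = ap f x"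
proof -
  have u: "EX! y. opr x y : els f" using assms by (simp add: is_fun_iff)
  show 1: "opr x (ap f x) : els f" using ap_iff[of "ap f x" f x] u by auto
  thus "ap f x : els b" using assms by (auto simp: is_fun_iff)
  show "opr x y : els f <-> y = ap f x" using ap_iff[of y f x] u by auto
qed

definition lam :: "'v => 'v => ('v => 'v) => 'v" where
  "lam a b h = rc a b (%x y. y = h x)"

lemma lam:
  assumes "Fn E (%rh. h (rh 0))" "!!x. x : els a ==> h x : els b"
  shows lam_fun: "is_fun E (lam a b h) a b" and lam_ap: "x : els a ==> ap (lam a b h) x = h x"
proof -
  have "Fn E (%rh. h (rh 0))" by (rule assms)
  hence d: "Dn E (%rh. rh 1 = h (rh 0))"
    using Dn_ren[of E "%rh. rh 0 = h (rh 1)" "%n. 1 - n"] by (simp add: Fn_def)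
  have m: "opr x y : els (lam a b h) <-> x : els a & y = h x" for x y
    unfolding lam_def using rc_iff[OF d] assms(2) by auto
  show f: "is_fun E (lam a b h) a b" unfolding is_fun_iff using m assms(2)
    by (auto simp: lam_def els_rc[OF d])
  show "ap (lam a b h) x = h x" if "x : els a" using fun_val(3)[OF f that, of "h x"] m that by simp
qed

lemma Dn_is_fun [dn]: "Fn E f ==> Fn E a ==> Fn E b ==> Dn E (%rh. is_fun E (f rh) (a rh) (b rh))"
proof (rule Dn3[where K = "is_fun E"])
  show "Dn E (%rh. is_fun E (rh 0) (rh 1) (rh 2))" unfolding is_fun_iff by (intro dn)
qed

definition funs :: "'v => 'v => 'v" where "funs a b = mk {f. is_fun E f a b}"

lemma els_funs [simp]: "els (funs a b) = {f. is_fun E f a b}"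
  unfolding funs_def
proof (rule els_mk, rule ss_sub)
  show "ss (els (pw (prd a b)))" by simp
  show "Dn E (%rh. rh 0 : {f. is_fun E f a b})" unfolding mem_Collect_eq by (intro dn)
qed (auto simp: is_fun_iff)

end

section \<open>Natural numbers, finite sets and recursion inside a model\<close>

context zs begin

lemma is_inductive_iff: "is_inductive E w <-> emp : els w & (ALL x:els w. suc x : els w)"
proof -
  have "els y = insert x (els x) <-> y = suc x" for x y by (simp add: els_eq_iff)
  thus ?thesis by (auto simp: is_inductive_def empty_iff_emp)
qed

lemma Dn_inductive [dn]: "Fn E a ==> Dn E (%rh. is_inductive E (a rh))"
proof (rule Dn1[where K = "is_inductive E"])
  show "Dn E (%rh. is_inductive E (rh 0))" unfolding is_inductive_iff by (intro dn)
qed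

definition om :: 'v where
  "om = mk {n : els (SOME w. is_inductive E w). ALL x. is_inductive E x --> n : els x}"

lemma is_omega_om: "is_omega E om"
proof -
  define w where "w = (SOME w. is_inductive E w)"
  have w: "is_inductive E w" unfolding w_def using infinity_ax by (rule someI_ex)
  have "ss {n : els w. ALL x. is_inductive E x --> n : els x}" by (intro sepI dn)
  hence "els om = {n. ALL x. is_inductive E x --> n : els x}"
    unfolding om_def w_def[symmetric] using w by (auto simp: els_mk)
  thus ?thesis by (auto simp: is_omega_def is_inductive_iff)
qed

lemma is_omega_iff: "is_omega E w <-> w = om"
  using is_omega_om ext[of w om] by (auto simp: is_omega_def)

lemma om_0 [simp]: "emp : els om" and om_suc: "n : els om ==> suc n : els om"
  using is_omega_om by (auto simp: is_omega_def is_inductive_iff)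

lemma om_ne [simp]: "EX n. n : els om" using om_0 by blast

lemma om_induct:
  assumes "n : els om" "Dn E (%rh. P (rh 0))" "P emp" "!!n. n : els om ==> P n ==> P (suc n)"
  shows "P n"
proof -
  have ss: "ss {n : els om. P n}" by (rule sepI) (rule assms)
  have "is_inductive E (mk {n : els om. P n})"
    using assms(3,4) ss by (auto simp: is_inductive_iff els_mk om_suc)
  hence "els om <= els (mk {n : els om. P n})" using is_omega_om by (simp add: is_omega_def)
  thus ?thesis using assms(1) ss by (auto simp: els_mk)
qed

lemma om_cases: "n : els om ==> n = emp \<or> (EX m:els om. n = suc m)"
  by (erule om_induct) (intro dn, auto)

lemma om_sub: "n : els om ==> m : els n ==> m : els om"
proof -
  assume "n : els om"
  hence "ALL m:els n. m : els om" by (rule om_induct) (intro dn, auto)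
  thus "m : els n ==> m : els om" by auto
qed

lemma om_trans: assumes "n : els om" "k : els m" "m : els n" shows "k : els n"
proof -
  have "ALL m:els n. ALL k:els m. k : els n" using assms(1) by (rule om_induct) (intro dn, auto)
  thus ?thesis using assms by auto
qed

lemma om_irrefl: "n : els om ==> n ~: els n"
proof (erule om_induct)
  fix n assume n: "n : els om" "n ~: els n"
  show "suc n ~: els (suc n)" using n om_trans[OF n(1), of n "suc n"] by (auto simp: els_eq_iff)
qed (intro dn, simp)

lemma om_suc_mono: "n : els om ==> m : els n ==> suc m : els (suc n)"
proof -
  assume "n : els om"
  hence "ALL m:els n. suc m : els (suc n)" by (rule om_induct) (intro dn, auto)
  thus "m : els n ==> suc m : els (suc n)" by auto
qed

lemma om_0_least: "n : els om ==> n = emp \<or> emp : els n"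
  by (erule om_induct) (intro dn, auto)

lemma om_linear: assumes "m : els om" "n : els om" shows "m : els n \<or> m = n \<or> n : els m"
proof -
  have "ALL n:els om. m : els n \<or> m = n \<or> n : els m" using assms(1)
  proof (rule om_induct)
    show "ALL n:els om. emp : els n \<or> emp = n \<or> n : els emp" using om_0_least by auto
    fix m assume m: "m : els om" "ALL n:els om. m : els n \<or> m = n \<or> n : els m"
    show "ALL n:els om. suc m : els n \<or> suc m = n \<or> n : els (suc m)"
    proof
      fix n assume n: "n : els om"
      consider "m : els n" | "m = n" | "n : els m" using m n by auto
      thus "suc m : els n \<or> suc m = n \<or> n : els (suc m)"
      proof cases
        case 1
        thus ?thesis using om_suc_mono[OF n 1] by auto
      qed auto
    qed
  qed (intro dn)
  thus ?thesis using assms by auto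
qed

lemma om_asym: assumes "n : els om" "m : els n" shows "n ~: els m"
proof
  assume "n : els m"
  from om_trans[OF assms(1) this assms(2)] om_irrefl[OF assms(1)] show False by (rule notE[rotated])
qed

lemma om_least:
  assumes "n : els om" "P n" "Dn E (%rh. P (rh 0))"
  shows "EX n:els om. P n & (ALL m:els n. ~ P m)"
proof (rule ccontr)
  assume c: "~ ?thesis"
  have "ALL m:els n. ~ P m" if "n : els om" for n
    using that
  proof (rule om_induct)
    show "Dn E (%rh. ALL m:els (rh 0). ~ P m)" by (intro dn Dn1[where K = P, OF assms(3)])
  qed (use c in auto)
  from this[OF om_suc[OF assms(1)]] show False using assms(2) by simp
qed

lemma om_bound2: assumes "m : els om" "n : els om" obtains k where "k : els om" "m : els k" "n : els k"
proof (cases "m : els n \<or> m = n")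
  case True
  thus ?thesis using that[of "suc n"] om_suc[OF assms(2)] by auto
next
  case False
  thus ?thesis using that[of "suc m"] om_suc[OF assms(1)] om_linear[OF assms] by auto
qed

subsection \<open>Finite sets\<close>

text \<open>Finiteness in the style of Kuratowski, relative to families that are points of the
  model. It yields induction by adding one element at a time; the agreement with equipotence to a
  natural number is \<open>is_finite_iff\<close>.\<close>

definition fin :: "'v => bool" where
  "fin x <-> (ALL F. emp : els F & (ALL y:els F. ALL z:els x. ins z y : els F) --> x : els F)"

lemma Dn_fin [dn]: "Fn E a ==> Dn E (%rh. fin (a rh))"
proof (rule Dn1[where K = fin])
  show "Dn E (%rh. fin (rh 0))" unfolding fin_def by (intro dn)
qed

lemma fin_induct:
  assumes "fin x" "Dn E (%rh. P (rh 0))" "P emp"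
    "!!y z. els y <= els x ==> z : els x ==> P y ==> P (ins z y)"
  shows "P x"
proof -
  have ss: "ss {y : els (pw x). P y}" by (rule sepI) (rule assms)
  have "emp : els (mk {y : els (pw x). P y})" using ss assms by (simp add: els_mk)
  moreover have "ALL y:els (mk {y : els (pw x). P y}). ALL z:els x. ins z y : els (mk {y : els (pw x). P y})"
    unfolding els_mk[OF ss] using assms(4) by auto
  ultimately have "x : els (mk {y : els (pw x). P y})" using assms(1) unfolding fin_def by blast
  thus ?thesis using ss by (simp add: els_mk)
qed

lemma fin_emp [simp]: "fin emp" by (simp add: fin_def)

lemma fin_ins: assumes "fin x" shows "fin (ins z x)"
  unfolding fin_def
proof (intro allI impI)
  fix F assume F: "emp : els F & (ALL y:els F. ALL z':els (ins z x). ins z' y : els F)"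
  have "x : els F" using assms by (rule fin_induct) (intro dn, use F in auto)
  thus "ins z x : els F" using F by auto
qed

lemma ins_absorb: "z : els x ==> ins z x = x" by (auto simp: els_eq_iff)
lemma ins_df: "z : els x ==> ins z (df x (mk {z})) = x" by (auto simp: els_eq_iff els_mk)
lemma sub_emp: "els y <= els emp ==> y = emp" by (auto simp: els_eq_iff)

lemma fin_subset: assumes "fin x" "els y <= els x" shows "fin y"
proof -
  have "ALL y. els y <= els x --> fin y" using assms(1)
  proof (rule fin_induct)
    fix x' z assume 1: "ALL y. els y <= els x' --> fin y"
    show "ALL y. els y <= els (ins z x') --> fin y"
    proof (intro allI impI)
      fix y assume y: "els y <= els (ins z x')"
      have "els (df y (mk {z})) <= els x'" using y by (auto simp: els_mk)
      hence "fin (df y (mk {z}))" using 1 by blast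
      thus "fin y" using fin_ins[of "df y (mk {z})" z] ins_df[of z y] y 1
        by (cases "z : els y") auto
    qed
  qed (intro dn, use sub_emp fin_emp in metis)
  thus ?thesis using assms by auto
qed

lemma un_ins: "un x (ins z y) = ins z (un x y)" by (simp add: els_eq_iff)
lemma un_emp: "un x emp = x" by (simp add: els_eq_iff)

lemma fin_un: assumes "fin x" "fin y" shows "fin (un x y)"
  using assms(2) by (rule fin_induct) (intro dn, auto simp: un_emp un_ins assms(1) fin_ins)

lemma fin_sing [simp]: "fin (mk {a})"
proof -
  have "mk {a} = ins a emp" by (simp add: ins_def)
  thus ?thesis using fin_ins by simp
qed

lemma fin_image:
  assumes "fin x" "Fn E (%rh. h (rh 0))" shows "ss (h ` els x)" "fin (mk (h ` els x))"
proof -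
  have "EX y. fin y & (ALL u. u : els y <-> (EX z:els x. u = h z))" using assms(1)
  proof (rule fin_induct)
    show "Dn E (%rh. EX y. fin y & (ALL u. u : els y <-> (EX z:els (rh 0). u = h z)))"
      by (intro dn Fn_comp1[OF assms(2)])
    show "EX y. fin y & (ALL u. u : els y <-> (EX z:els emp. u = h z))" by (rule exI[of _ emp]) simp
    fix x' z assume "EX y. fin y & (ALL u. u : els y <-> (EX z:els x'. u = h z))"
    then obtain y where "fin y" "ALL u. u : els y <-> (EX z:els x'. u = h z)" by blast
    thus "EX y. fin y & (ALL u. u : els y <-> (EX z:els (ins z x'). u = h z))"
      by (intro exI[of _ "ins (h z) y"]) (auto simp: fin_ins)
  qed
  then obtain y where y: "fin y" "ALL u. u : els y <-> (EX z:els x. u = h z)" by blast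
  hence "els y = h ` els x" by auto
  thus "ss (h ` els x)" "fin (mk (h ` els x))" using y(1) ss_els[of y] mk_els[of y] by auto
qed

lemma fin_Uni: assumes "fin x" "!!y. y : els x ==> fin y" shows "fin (Uni x)"
proof -
  have "(ALL y:els x. fin y) --> fin (Uni x)" using assms(1)
  proof (rule fin_induct)
    have "Uni emp = emp" by (simp add: els_eq_iff)
    thus "(ALL y:els emp. fin y) --> fin (Uni emp)" by simp
    fix x' z assume 1: "(ALL y:els x'. fin y) --> fin (Uni x')"
    have "Uni (ins z x') = un (Uni x') z" by (auto simp: els_eq_iff)
    thus "(ALL y:els (ins z x'). fin y) --> fin (Uni (ins z x'))" using 1 fin_un by auto
  qed (intro dn)
  thus ?thesis using assms by auto
qed

lemma fin_prd: assumes "fin x" "fin y" shows "fin (prd x y)"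
  using assms(2)
proof (rule fin_induct)
  have "prd x emp = emp" by (simp add: els_eq_iff els_prd)
  thus "fin (prd x emp)" by simp
  fix y' z assume 1: "fin (prd x y')"
  have f: "Fn E (%rh. opr (rh 0) z)" by (intro dn)
  have "els (prd x (ins z y')) = els (un (prd x y') (mk ((%a. opr a z) ` els x)))"
    using fin_image(1)[OF assms(1) f] by (auto simp: els_prd els_mk)
  hence "prd x (ins z y') = un (prd x y') (mk ((%a. opr a z) ` els x))" by (rule ext)
  thus "fin (prd x (ins z y'))" using 1 fin_un fin_image(2)[OF assms(1) f] by simp
qed (intro dn)

lemma fin_om: assumes "n : els om" shows "fin n"
  using assms by (rule om_induct) (intro dn, auto simp: suc_def fin_ins)

lemma fin_om_bound: assumes "fin x" "els x <= els om" shows "EX n:els om. els x <= els n"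
proof -
  have "els x <= els om --> (EX n:els om. els x <= els n)" using assms(1)
  proof (rule fin_induct)
    fix y z assume 1: "els y <= els om --> (EX n:els om. els y <= els n)"
    show "els (ins z y) <= els om --> (EX n:els om. els (ins z y) <= els n)"
    proof
      assume z: "els (ins z y) <= els om"
      then obtain n where n: "n : els om" "els y <= els n" using 1 by auto
      obtain k where "k : els om" "n : els k" "z : els k" using om_bound2[of n z] n z by auto
      thus "EX n:els om. els (ins z y) <= els n"
        using n by (intro bexI[of _ k]) (auto intro: om_trans)
    qed
  qed (intro dn, use om_0 in auto)
  thus ?thesis using assms by auto
qed

text \<open>An upper bound on size: \<open>x\<close> is covered by the values of a function on
  \<open>n\<close>. Values outside of \<open>x\<close> are permitted, so that a bound for a set is
  at once a bound for its subsets.\<close>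

definition szle :: "'v => 'v => bool" where
  "szle n x <-> (EX f Y. is_fun E f n Y & (ALL z:els x. EX k:els n. ap f k = z))"

lemma Dn_szle [dn]: "Fn E a ==> Fn E b ==> Dn E (%rh. szle (a rh) (b rh))"
proof (rule Dn2[where K = szle])
  show "Dn E (%rh. szle (rh 0) (rh 1))" unfolding szle_def by (intro dn)
qed

lemma szleI:
  assumes "Fn E (%rh. h (rh 0))" "!!k. k : els n ==> h k : els Y" "!!z. z : els x ==> EX k:els n. h k = z"
  shows "szle n x"
  unfolding szle_def
  by (rule exI[of _ "lam n Y h"], rule exI[of _ Y]) (use assms in \<open>auto simp: lam_fun lam_ap\<close>)

lemma szle_sub: "szle n x ==> els y <= els x ==> szle n y" unfolding szle_def by blast

lemma szle_0: "szle emp x ==> x = emp" unfolding szle_def by (auto simp: els_eq_iff)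

lemma szle_emp [simp]: "szle n emp"
  by (rule szleI[of "%x. x" _ n]) (intro dn, auto)

lemma Fn_if:
  assumes "Dn E P" "Fn E a" "Fn E b" shows "Fn E (%rh. if P rh then a rh else b rh)"
proof -
  have "(%rh. rh 0 = (if P (%n. rh (Suc n)) then a (%n. rh (Suc n)) else b (%n. rh (Suc n))))
    = (%rh. (P (%n. rh (Suc n)) & rh 0 = a (%n. rh (Suc n))) \<or> (~ P (%n. rh (Suc n)) & rh 0 = b (%n. rh (Suc n))))"
    by auto
  moreover have "Dn E (%rh. P (%n. rh (Suc n)))" by (rule Dn_ren[OF assms(1)])
  ultimately show ?thesis using assms(2,3) unfolding Fn_def by (simp only:) (intro Dn_disj Dn_conj Dn_not)
qed

lemma szle_ins: assumes "szle n x" "n : els om" shows "szle (suc n) (ins z x)"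
proof -
  obtain f Y where f: "is_fun E f n Y" "ALL z:els x. EX k:els n. ap f k = z" using assms unfolding szle_def by blast
  show ?thesis
    by (rule szleI[of "%k. if k = n then z else ap f k" _ "ins z Y"])
      (intro Fn_if dn, use f om_irrefl[OF assms(2)] fun_val(2)[OF f(1)] in \<open>auto, metis\<close>)
qed

lemma szle_remove: assumes "szle (suc n) x" "z : els x" shows "szle n (df x (mk {z}))"
proof -
  obtain f Y where f: "is_fun E f (suc n) Y" "ALL z:els x. EX k:els (suc n). ap f k = z"
    using assms unfolding szle_def by blast
  show ?thesis
  proof (rule szleI[of "%k. if ap f k = z then ap f n else ap f k" _ Y])
    fix u assume u: "u : els (df x (mk {z}))"
    then obtain k where k: "k : els (suc n)" "ap f k = u" "u ~= z" using f(2) by (auto simp: els_mk)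
    obtain l where l: "l : els (suc n)" "ap f l = z" using f(2) assms(2) by auto
    show "EX k:els n. (if ap f k = z then ap f n else ap f k) = u"
      using k l by (cases "k = n") (auto split: if_splits)
  qed (intro Fn_if dn, use fun_val(2)[OF f(1)] in auto)
qed

lemma szle_suc: assumes "szle n x" "n : els om" shows "szle (suc n) x"
  by (rule szle_sub[OF szle_ins[OF assms, of emp]]) auto

lemma szle_mono: assumes "szle n x" "n : els om" "m : els om" "n : els m" shows "szle m x"
proof -
  have "n : els m --> szle m x" using assms(3)
    by (rule om_induct) (intro dn, use assms in \<open>auto intro: szle_suc\<close>)
  thus ?thesis using assms by auto
qed

lemma fin_szle: assumes "fin x" shows "EX n:els om. szle n x"
  using assms
proof (rule fin_induct)
  show "EX n:els om. szle n emp" using om_0 by auto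
  show "EX n:els om. szle n (ins z y)" if "EX n:els om. szle n y" for y z
    using that szle_ins om_suc by blast
qed (intro dn)

lemma szle_fin: assumes "n : els om" "szle n x" shows "fin x"
proof -
  have "ALL x. szle n x --> fin x" using assms(1)
  proof (rule om_induct)
    fix n assume 1: "ALL x. szle n x --> fin x"
    show "ALL x. szle (suc n) x --> fin x"
    proof (intro allI impI)
      fix x assume x: "szle (suc n) x"
      show "fin x"
      proof (cases "x = emp")
        case False
        then obtain z where z: "z : els x" using empty_iff_emp by blast
        thus ?thesis using 1 szle_remove[OF x z] fin_ins ins_df[OF z] by metis
      qed simp
    qed
  qed (intro dn, use szle_0 fin_emp in blast)
  thus ?thesis using assms by auto
qed

text \<open>Supplies the candidates for a pigeonhole argument: however many values are forbidden,
  there are more numbers above \<open>F\<close>. Each step adds a number above all earlier ones, and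
  \<open>szle_remove\<close> carries the lower bound on the size along.\<close>

lemma big_choices:
  assumes "N : els om" "F : els om"
  shows "EX O'. fin O' & els O' <= els om & (ALL k:els O'. F : els k) & ~ szle N O'"
  using assms(1)
proof (rule om_induct)
  show "EX O'. fin O' & els O' <= els om & (ALL k:els O'. F : els k) & ~ szle emp O'"
    by (rule exI[of _ "mk {suc F}"]) (use szle_0[of "mk {suc F}"] assms(2) in \<open>auto simp: els_mk om_suc els_eq_iff\<close>)
  fix N assume "EX O'. fin O' & els O' <= els om & (ALL k:els O'. F : els k) & ~ szle N O'"
  then obtain O' where O': "fin O'" "els O' <= els om" "ALL k:els O'. F : els k" "~ szle N O'" by blast
  obtain n where n: "n : els om" "els O' <= els n" using fin_om_bound O' by blast
  obtain m where m: "m : els om" "n : els m" "F : els m" using om_bound2[OF n(1) assms(2)] .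
  have "m ~: els O'" using n(2) om_asym[OF n(1)] m(2) by auto
  hence "df (ins m O') (mk {m}) = O'" by (auto simp: els_eq_iff els_mk)
  hence "~ szle (suc N) (ins m O')" using szle_remove[of N "ins m O'" m] O'(4) by auto
  thus "EX O'. fin O' & els O' <= els om & (ALL k:els O'. F : els k) & ~ szle (suc N) O'"
    using O' m by (intro exI[of _ "ins m O'"]) (auto simp: fin_ins)
qed (intro dn)

lemma is_finite_iff: "is_finite E x <-> fin x"
proof
  assume "is_finite E x"
  then obtain n f where f: "n : els om" "is_fun E f n x" "bij_betw (app E f) (els n) (els x)"
    unfolding is_finite_def equipotent_def is_omega_iff by blast
  hence "szle n x" unfolding szle_def bij_betw_def using app_ap[OF f(2)]
    by (intro exI[of _ f] exI[of _ x]) force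
  thus "fin x" using szle_fin f(1) by blast
next
  define Q where "Q n f x <-> is_fun E f n x & (ALL k:els n. ALL l:els n. ap f k = ap f l --> k = l)
      & (ALL z:els x. EX k:els n. ap f k = z)" for n f x
  assume "fin x"
  hence "EX n:els om. EX f. Q n f x" unfolding Q_def
  proof (rule fin_induct, fold Q_def)
    show "Dn E (%rh. EX n:els om. EX f. Q n f (rh 0))" unfolding Q_def by (intro dn)
    have "Q emp emp emp" unfolding Q_def by (auto simp: is_fun_iff)
    thus "EX n:els om. EX f. Q n f emp" by (intro bexI[of _ emp]) auto
    fix y z assume "EX n:els om. EX f. Q n f y"
    then obtain n f where n: "n : els om" "Q n f y" by blast
    show "EX n:els om. EX f. Q n f (ins z y)"
    proof (cases "z : els y")
      case True
      thus ?thesis using n ins_absorb by auto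
    next
      case False
      let ?h = "%k. if k = n then z else ap f k"
      have f: "is_fun E f n y" and inj: "!!k l. k : els n ==> l : els n ==> ap f k = ap f l ==> k = l"
        and sur: "!!u. u : els y ==> EX k:els n. ap f k = u" using n(2) unfolding Q_def by auto
      have h: "Fn E (%rh. ?h (rh 0))" by (intro Fn_if dn)
      have v: "k : els (suc n) ==> ?h k : els (ins z y)" for k using fun_val(2)[OF f] by auto
      have L: "ap (lam (suc n) (ins z y) ?h) k = ?h k" if "k : els (suc n)" for k
        by (rule lam_ap[OF h _ that]) (rule v)
      have "Q (suc n) (lam (suc n) (ins z y) ?h) (ins z y)"
        unfolding Q_def
      proof (intro conjI ballI impI)
        show "is_fun E (lam (suc n) (ins z y) ?h) (suc n) (ins z y)" by (rule lam_fun[OF h]) (rule v)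
        show "k = l" if "k : els (suc n)" "l : els (suc n)"
          "ap (lam (suc n) (ins z y) ?h) k = ap (lam (suc n) (ins z y) ?h) l" for k l
        proof -
          have "?h k = ?h l" using that(3) unfolding L[OF that(1)] L[OF that(2)] .
          thus ?thesis using that(1,2) inj[of k l] False fun_val(2)[OF f, of k] fun_val(2)[OF f, of l]
            by (auto split: if_splits)
        qed
        show "EX k:els (suc n). ap (lam (suc n) (ins z y) ?h) k = u" if "u : els (ins z y)" for u
        proof -
          have "EX k:els (suc n). ?h k = u"
          proof (cases "u = z")
            case False
            hence "u : els y" using that by auto
            from sur[OF this] obtain k where "k : els n" "ap f k = u" by blast
            thus ?thesis using om_irrefl[OF n(1)] by (intro bexI[of _ k]) auto
          qed simp
          then obtain k where k: "k : els (suc n)" "?h k = u" by blast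
          thus ?thesis using L[OF k(1)] by auto
        qed
      qed
      thus ?thesis using n om_suc by blast
    qed
  qed
  then obtain n f where n: "n : els om" "Q n f x" by blast
  hence "is_fun E f n x" and inj: "!!k l. k : els n ==> l : els n ==> ap f k = ap f l ==> k = l"
    and sur: "!!u. u : els x ==> EX k:els n. ap f k = u" unfolding Q_def by auto
  moreover from this have "bij_betw (ap f) (els n) (els x)"
    using fun_val(2)[of f n x] unfolding bij_betw_def inj_on_def image_def by blast
  ultimately have "bij_betw (app E f) (els n) (els x)"
    using app_ap[of f n x] bij_betw_cong[of "els n" "app E f" "ap f"] by simp
  thus "is_finite E x" unfolding is_finite_def equipotent_def is_omega_iff using n by (auto simp: Q_def)
qed

definition dom :: "'v => 'v" where "dom x = mk {z : els (Uni (Uni x)). EX s. opr z s : els x}"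

lemma dom: "z : els (dom x) <-> (EX s. opr z s : els x)"
proof -
  have "z : els (Uni (Uni x))" if "opr z s : els x" for s
  proof -
    have "mk {z} : els (opr z s)" "z : els (mk {z})" by (simp_all add: opr_def els_mk)
    thus ?thesis using that unfolding els_Un by blast
  qed
  thus ?thesis unfolding dom_def by (subst els_mk) (intro sepI dn, auto)
qed

lemma fin_dom:
  assumes "fin x" "!!c. c : els x ==> EX a b. c = opr a b" shows "fin (dom x)"
proof -
  have o: "fin (opr a b)" and u: "Uni (opr a b) = ins a (mk {b})" for a b
  proof -
    have 1: "opr a b = ins (mk {a}) (mk {mk {a, b}})" by (rule ext) (auto simp: opr_def els_mk)
    show "fin (opr a b)" unfolding 1 by (rule fin_ins) simp
    show "Uni (opr a b) = ins a (mk {b})" by (rule ext) (auto simp: opr_def els_mk)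
  qed
  have "fin (Uni x)" by (rule fin_Uni[OF assms(1)]) (use assms(2) o in blast)
  hence "fin (Uni (Uni x))"
  proof (rule fin_Uni)
    fix y assume "y : els (Uni x)"
    then obtain a b where "y : els (opr a b)" using assms(2) by (metis UN_E els_Un)
    hence "y = mk {a} \<or> y = mk {a, b}" by (simp add: opr_def els_mk)
    moreover have "mk {a, b} = ins a (mk {b})" by (rule ext) (simp add: els_mk)
    moreover have "fin (ins a (mk {b}))" by (rule fin_ins) simp
    ultimately show "fin y" using fin_sing[of a] by auto
  qed
  thus ?thesis
  proof (rule fin_subset)
    show "els (dom x) <= els (Uni (Uni x))" unfolding dom_def by (subst els_mk) (intro sepI dn, auto)
  qed
qed

end

section \<open>Recursion along a well-founded relation inside a model\<close>

context zs begin

text \<open>The approximations of the recursion theorem: \<open>r\<close> obeys the recursive clause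
  on a domain \<open>D\<close> that is closed downwards in \<open>X\<close>.\<close>

definition apx where
  "apx lt H X Y D r <-> els D <= els X & (ALL x:els D. ALL z:els X. lt z x --> z : els D) &
     els r <= els (prd D Y) & (ALL x:els D. ALL y:els Y. opr x y : els r <-> H x y r)"

lemma apxD:
  assumes "apx lt H X Y D r"
  shows "x : els D ==> x : els X" "x : els D ==> z : els X ==> lt z x ==> z : els D"
    "p : els r ==> p : els (prd D Y)"
    "x : els D ==> y : els Y ==> opr x y : els r <-> H x y r"
proof -
  note 1 = assms[unfolded apx_def]
  show "x : els D ==> x : els X" by (rule subsetD[OF conjunct1[OF 1]])
  show "x : els D ==> z : els X ==> lt z x ==> z : els D"
    by (rule conjunct1[OF conjunct2[OF 1], rule_format])
  show "p : els r ==> p : els (prd D Y)" by (rule subsetD[OF conjunct1[OF conjunct2[OF conjunct2[OF 1]]]])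
  show "x : els D ==> y : els Y ==> opr x y : els r <-> H x y r"
    by (rule conjunct2[OF conjunct2[OF conjunct2[OF 1]], rule_format])
qed

lemma apxI:
  assumes "!!x. x : els D ==> x : els X"
    "!!x z. x : els D ==> z : els X ==> lt z x ==> z : els D"
    "!!p. p : els r ==> p : els (prd D Y)"
    "!!x y. x : els D ==> y : els Y ==> opr x y : els r <-> H x y r"
  shows "apx lt H X Y D r"
  unfolding apx_def using assms by (intro conjI ballI impI subsetI)

text \<open>The object defined is a relation between \<open>X\<close> and a set \<open>Y\<close>
  fixed in advance, so the union of all approximations exists by separation, and the lemma is
  available in the extension too. Two approximations agree because a minimal point of disagreement
  contradicts \<open>loc\<close>, and a minimal point outside the domain of the union could be added
  to it.\<close>

lemma wf_rec:
  assumes lt: "Dn E (%rh. lt (rh 0) (rh 1))"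
    and wf: "!!A. els A <= els X ==> A ~= emp ==> EX x:els A. ALL z:els A. ~ lt z x"
    and H: "Dn E (%rh. H (rh 0) (rh 1) (rh 2))"
    and loc: "!!x y r r'. x : els X ==> y : els Y ==>
      (!!z u. z : els X ==> lt z x ==> opr z u : els r <-> opr z u : els r') ==> H x y r = H x y r'"
  shows "EX R. els R <= els (prd X Y) & (ALL x:els X. ALL y:els Y. opr x y : els R <-> H x y R)"
proof -
  have min: "EX x:els X. P x & (ALL z:els X. P z --> ~ lt z x)"
    if "Dn E (%rh. P (rh 0))" "x : els X" "P x" for P x
  proof -
    have ss: "ss {x : els X. P x}" by (rule sepI) (rule that)
    have "mk {x : els X. P x} ~= emp" using that(2,3) els_mk[OF ss] els_emp by auto
    from wf[OF _ this] show ?thesis unfolding els_mk[OF ss] by auto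
  qed
  have dH [dn]: "Fn E a ==> Fn E b ==> Fn E c ==> Dn E (%rh. H (a rh) (b rh) (c rh))" for a b c
    by (rule Dn3[where K = H, OF H])
  have dl [dn]: "Fn E a ==> Fn E b ==> Dn E (%rh. lt (a rh) (b rh))" for a b
    by (rule Dn2[where K = lt, OF lt])
  let ?apx = "apx lt H X Y"
  have da: "Fn E a ==> Fn E b ==> Dn E (%rh. ?apx (a rh) (b rh))" for a b
  proof (rule Dn2[where K = "?apx"])
    show "Dn E (%rh. ?apx (rh 0) (rh 1))" unfolding apx_def by (intro dn)
  qed
  have memY: "u : els Y" "z : els D" if "?apx D r" "opr z u : els r" for D r z u
    using apxD(3)[OF that(1) that(2)] by auto
  have uniq: "opr x y : els r <-> opr x y : els r'"
    if a: "?apx D r" "?apx D' r'" and x: "x : els D" "x : els D'" for D r D' r' x y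
  proof (rule ccontr)
    assume ne: "~ ?thesis"
    define P where "P x <-> x : els D & x : els D' & (EX y. ~ (opr x y : els r <-> opr x y : els r'))" for x
    have "P x" "x : els X" using ne x apxD(1)[OF a(1) x(1)] unfolding P_def by auto
    moreover have "Dn E (%rh. P (rh 0))" unfolding P_def by (intro dn)
    ultimately obtain m where m: "m : els X" "P m" "ALL z:els X. P z --> ~ lt z m" using min[of P x] by blast
    then obtain y where y: "~ (opr m y : els r <-> opr m y : els r')" unfolding P_def by blast
    have mD: "m : els D" "m : els D'" using m unfolding P_def by blast+
    have "y : els Y" using y memY(1)[OF a(1)] memY(1)[OF a(2)] by blast
    hence "H m y r ~= H m y r'" using y apxD(4)[OF a(1) mD(1)] apxD(4)[OF a(2) mD(2)] by auto
    moreover have "H m y r = H m y r'"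
    proof (rule loc[OF m(1) \<open>y : els Y\<close>])
      fix z u assume z: "z : els X" "lt z m"
      hence "z : els D" "z : els D'" using apxD(2)[OF a(1) mD(1)] apxD(2)[OF a(2) mD(2)] by auto
      thus "opr z u : els r <-> opr z u : els r'" using m(3) z unfolding P_def by auto
    qed
    ultimately show False by blast
  qed
  define U where "U = mk {x : els X. EX D r. ?apx D r & x : els D}"
  have U: "x : els U <-> x : els X & (EX D r. ?apx D r & x : els D)" for x
    unfolding U_def by (subst els_mk) (intro sepI dn da, auto)
  define R where "R = mk {p : els (prd X Y). EX D r. ?apx D r & p : els r}"
  have R0: "p : els R <-> p : els (prd X Y) & (EX D r. ?apx D r & p : els r)" for p
    unfolding R_def by (subst els_mk) (intro sepI dn da, auto)
  have R: "opr x y : els R <-> opr x y : els r" if "?apx D r" "x : els D" for D r x y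
  proof
    assume "opr x y : els R"
    then obtain D' r' where "?apx D' r'" "opr x y : els r'" unfolding R0 by blast
    thus "opr x y : els r" using uniq[of D' r' D r x y] that memY(2)[of D' r' x y] by auto
  next
    assume "opr x y : els r"
    moreover from this have "y : els Y" "x : els X" using memY(1)[OF that(1)] apxD(1)[OF that] by auto
    ultimately show "opr x y : els R" unfolding R0 using that(1)
      by (intro conjI exI[of _ D] exI[of _ r]) simp_all
  qed
  have UR: "?apx U R"
  proof (rule apxI)
    show "x : els X" if "x : els U" for x using that by (simp add: U)
    show "z : els U" if xU: "x : els U" and "z : els X" "lt z x" for x z
    proof -
      obtain D r where "?apx D r" "x : els D" using xU unfolding U by blast
      thus ?thesis using that(2,3) apxD(2)[of lt H X Y D r x z] U[of z] by auto
    qed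
    show "p : els (prd U Y)" if "p : els R" for p
    proof -
      from that obtain D r where p: "p : els (prd X Y)" "?apx D r" "p : els r" unfolding R0 by blast
      from p(1) show "p : els (prd U Y)"
      proof (rule prdE)
        fix x y assume xy: "p = opr x y" "x : els X" "y : els Y"
        hence "x : els D" using memY(2)[OF p(2)] p(3) by auto
        thus ?thesis using xy U[of x] p(2) by auto
      qed
    qed
    show "opr x y : els R <-> H x y R" if x: "x : els U" and y: "y : els Y" for x y
    proof -
    obtain D r where D: "?apx D r" "x : els D" using x U[of x] by auto
    have "H x y R = H x y r"
    proof (rule loc)
      show "x : els X" using x U[of x] by auto
      fix z u assume "z : els X" "lt z x"
      hence "z : els D" using apxD(2)[OF D] by auto
      thus "opr z u : els R <-> opr z u : els r" using R[OF D(1)] by auto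
    qed (rule y)
    thus ?thesis using R[OF D] apxD(4)[OF D y] by auto
    qed
  qed
  have "els U = els X"
  proof (rule ccontr)
    assume "els U ~= els X"
    then obtain x0 where x0: "x0 : els X" "x0 ~: els U" using apxD(1)[OF UR] by (auto simp: set_eq_iff)
    have "Dn E (%rh. rh 0 ~: els U)" by (intro dn)
    then obtain x where x: "x : els X" "x ~: els U" "ALL z:els X. z ~: els U --> ~ lt z x"
      using min[of "%x. x ~: els U", OF _ x0] by blast
    have xx: "~ lt x x" using x by blast
    define r' where "r' = un R (mk {p : els (prd X Y). EX y. p = opr x y & H x y R})"
    have r': "p : els r' <-> p : els R \<or> p : els (prd X Y) & (EX y. p = opr x y & H x y R)" for p
      unfolding r'_def els_un by (subst els_mk) (intro sepI dn, auto)
    have Rx: "opr x y ~: els R" for y using memY(2)[OF UR] x by auto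
    have "?apx (ins x U) r'"
    proof (rule apxI)
      show "a : els X" if "a : els (ins x U)" for a using that apxD(1)[OF UR, of a] x by auto
      show "z : els (ins x U)" if "a : els (ins x U)" "z : els X" "lt z a" for a z
        using that x apxD(2)[OF UR, of a z] by auto
      show "p : els (prd (ins x U) Y)" if "p : els r'" for p
      proof -
        from that show "p : els (prd (ins x U) Y)" unfolding r'
        proof
          assume "p : els R"
          hence "p : els (prd U Y)" by (rule apxD(3)[OF UR])
          thus ?thesis by (rule prdE) auto
        qed auto
      qed
      show "opr a y : els r' <-> H a y r'" if a: "a : els (ins x U)" and y: "y : els Y" for a y
      proof -
      have "a : els X" using a x apxD(1)[OF UR, of a] by auto
      have "H a y r' = H a y R"
      proof (rule loc[OF \<open>a : els X\<close> y])
        fix z u assume "z : els X" "lt z a"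
        hence "z ~= x" using a x xx apxD(2)[OF UR, of a z] by auto
        thus "opr z u : els r' <-> opr z u : els R" unfolding r' by auto
      qed
      moreover have "opr a y : els r' <-> H a y R"
      proof (cases "a = x")
        case True
        thus ?thesis unfolding r' using Rx x y by auto
      next
        case False
        hence "a : els U" using a by auto
        thus ?thesis unfolding r' using apxD(4)[OF UR _ y] False by auto
      qed
      ultimately show ?thesis by simp
      qed
    qed
    thus False using U[of x] x by auto
  qed
  hence "U = X" by (rule ext)
  thus ?thesis using apxD(4)[OF UR] apxD(3)[OF UR] by auto
qed

lemma is_num_0: "is_num E 0 x <-> x = emp" by (simp add: empty_iff_emp)
lemma is_num_1: "is_num E (Suc n) x <-> (EX y. is_num E n y & x = suc y)" by (simp add: els_eq_iff)

end

section \<open>Models of ZFC\<close>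

locale zfc = zs E for E :: "'v => 'v => bool" +
  assumes found_ax: "els x ~= {} ==> EX y:els x. els y \<inter> els x = {}"
    and repl_ax: "ALL x:els a. EX! y. sat E (case_nat x (case_nat y rh)) \<phi> ==>
        EX b. els b = {y. EX x:els a. sat E (case_nat x (case_nat y rh)) \<phi>}"
    and choice_ax: "[|ALL x:els a. els x ~= {}; ALL x:els a. ALL y:els a. x ~= y --> els x \<inter> els y = {}|]
        ==> EX c. ALL x:els a. EX! y. y : els x \<inter> els c"

lemma ZFC_zfc: assumes "ZFC E" shows "zfc E"
proof -
  note Z = assms[unfolded ZFC_def]
  note Z1 = conjunct1[OF Z] and Z' = conjunct2[OF Z]
  note Z2 = conjunct1[OF Z'] and Z' = conjunct2[OF Z']
  note Z3 = conjunct1[OF Z'] and Z' = conjunct2[OF Z']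
  note Z4 = conjunct1[OF Z'] and Z' = conjunct2[OF Z']
  note Z5 = conjunct1[OF Z'] and Z' = conjunct2[OF Z']
  note Z6 = conjunct1[OF Z'] and Z' = conjunct2[OF Z']
  note Z7 = conjunct1[OF Z'] and Z' = conjunct2[OF Z']
  note Z8 = conjunct1[OF Z'] and Z9 = conjunct2[OF Z']
  show ?thesis
  proof unfold_locales
    show "elts E x = elts E y ==> x = y" for x y using Z1 by blast
    show "EX z. elts E z = {x, y}" for x y using Z3 by blast
    show "EX u. elts E u = (UN y:elts E x. elts E y)" for x by (rule Z4[rule_format])
    show "EX p. elts E p = {y. elts E y <= elts E x}" for x by (rule Z5[rule_format])
    show "EX w. is_inductive E w" by (rule Z6)
    show "EX y. elts E y = {z : elts E x. sat E (case_nat z rh) \<phi>}" for x rh \<phi> by (rule Z7[rule_format])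
    show "elts E x ~= {} ==> EX y:elts E x. elts E y \<inter> elts E x = {}" for x by (rule Z2[rule_format])
    show "ALL x:elts E a. EX! y. sat E (case_nat x (case_nat y rh)) \<phi> ==>
        EX b. elts E b = {y. EX x:elts E a. sat E (case_nat x (case_nat y rh)) \<phi>}" for a rh \<phi>
      by (rule Z8[THEN spec, THEN spec, THEN spec, THEN mp])
    show "[|ALL x:elts E a. elts E x ~= {}; ALL x:elts E a. ALL y:elts E a. x ~= y --> elts E x \<inter> elts E y = {}|]
        ==> EX c. ALL x:elts E a. EX! y. y : elts E x \<inter> elts E c" for a
      by (rule Z9[THEN spec, THEN mp, OF conjI])
  qed
qed

context zfc begin

lemma repl:
  assumes "Dn E (%rh. K (rh 0) (rh 1))" "!!x. x : els a ==> EX! y. K x y"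
  shows "ss {y. EX x:els a. K x y}"
proof -
  obtain \<phi> \<sigma> where 1: "!!rh. K (rh 0) (rh 1) = sat E (mix rh \<sigma>) \<phi>" using assms unfolding Dn_def by blast
  define r where "r n = (if even n then (if n = 0 then 0 else 1) else Suc (Suc (n div 2)))" for n :: nat
  have "(%n. case_nat x (case_nat y \<sigma>) (r n)) = mix (case_nat x (%_. y)) \<sigma>" for x y
    by (auto simp: mix_def r_def fun_eq_iff split: nat.splits elim!: evenE)
  hence "K x y = sat E (case_nat x (case_nat y \<sigma>)) (ren r \<phi>)" for x y
    using 1[of "case_nat x (%_. y)"] by (simp add: sat_ren)
  thus ?thesis using repl_ax[of a \<sigma> "ren r \<phi>"] assms(2) by (simp add: ss_def)
qed

lemma repl_fun:
  assumes "Fn E (%rh. h (rh 0))" shows "ss (h ` els a)"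
proof -
  have "Dn E (%rh. rh 1 = h (rh 0))"
    using Dn_ren[of E "%rh. rh 0 = h (rh 1)" "%n. 1 - n"] assms by (simp add: Fn_def)
  from repl[of "%x y. y = h x" a, OF this] show ?thesis by (simp add: image_def)
qed

lemma ss_min:
  assumes "ss A" "A ~= {}" shows "EX y:A. ALL z:A. z ~: els y"
  using found_ax[of "mk A"] assms by (auto simp: els_mk)

lemma el_irrefl: "x ~: els x" using ss_min[of "{x}"] by simp

lemma el_asym: "x : els y ==> y ~: els x" using ss_min[of "{x, y}"] by auto

text \<open>The iterates are the last values of finite recursions \<open>apr n f\<close>, and
  replacement over \<omega> collects them. By \<open>inc\<close> they form a chain, which lets two
  points of their union be found in one iterate.\<close>

lemma iterate:
  assumes G: "Fn E (%rh. G (rh 0))" and inc: "!!z. els z <= els (G z)"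
  shows "EX C. x : els C & (ALL z:els C. G z : els C) & (ALL z:els C. ALL w:els C. els z <= els w \<or> els w <= els z)"
proof -
  have dG [dn]: "Fn E a ==> Fn E (%rh. G (a rh))" for a by (rule Fn_comp1[OF G])
  define apr where "apr n f <-> (EX Y. is_fun E f (suc n) Y) & ap f emp = x & (ALL k:els n. ap f (suc k) = G (ap f k))" for n f
  have da: "Fn E a ==> Fn E b ==> Dn E (%rh. apr (a rh) (b rh))" for a b
  proof (rule Dn2[where K = apr])
    show "Dn E (%rh. apr (rh 0) (rh 1))" unfolding apr_def by (intro dn)
  qed
  have ex: "EX f. apr n f" if "n : els om" for n using that
  proof (rule om_induct)
    show "Dn E (%rh. EX f. apr (rh 0) f)" by (intro dn da)
    have "apr emp (lam (suc emp) (mk {x}) (%_. x))"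
      unfolding apr_def using lam[of "%_. x" "suc emp" "mk {x}"] by (auto simp: els_mk Fn_const)
    thus "EX f. apr emp f" by blast
    fix n assume n: "n : els om" "EX f. apr n f"
    then obtain f Y where f: "is_fun E f (suc n) Y" "ap f emp = x" "ALL k:els n. ap f (suc k) = G (ap f k)"
      unfolding apr_def by blast
    let ?h = "%k. if k = suc n then G (ap f n) else ap f k"
    let ?f = "lam (suc (suc n)) (ins (G (ap f n)) Y) ?h"
    have h: "Fn E (%rh. ?h (rh 0))" by (intro Fn_if dn)
    have v: "?h k : els (ins (G (ap f n)) Y)" if "k : els (suc (suc n))" for k
      using that fun_val(2)[OF f(1)] by auto
    have L: "ap ?f k = ?h k" if "k : els (suc (suc n))" for k by (rule lam_ap[OF h _ that]) (rule v)
    have "is_fun E ?f (suc (suc n)) (ins (G (ap f n)) Y)" by (rule lam_fun[OF h]) (rule v)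
    moreover have "ap ?f emp = x"
    proof -
      have "emp ~= suc n" by (metis els_suc els_emp insert_not_empty)
      moreover have "emp : els (suc (suc n))" using om_0_least[OF om_suc[OF om_suc[OF n(1)]]]
        by (metis els_suc els_emp insert_not_empty)
      ultimately show ?thesis using L f(2) by simp
    qed
    moreover have "ap ?f (suc k) = G (ap ?f k)" if k: "k : els (suc n)" for k
    proof -
      have 1: "suc k : els (suc (suc n))" using om_suc_mono[OF om_suc[OF n(1)] k] .
      have 2: "k ~= suc n" using k om_irrefl[OF om_suc[OF n(1)]] by auto
      show ?thesis
      proof (cases "k = n")
        case True
        thus ?thesis using L[OF 1] L[of k] k 2 by simp
      next
        case False
        hence kn: "k : els n" using k by simp
        have "suc k ~= suc n"
          using om_suc_mono[OF n(1) kn] om_irrefl[OF om_suc[OF n(1)]] by auto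
        thus ?thesis using L[OF 1] L[of k] k 2 f(3) kn by simp
      qed
    qed
    ultimately have "apr (suc n) ?f" unfolding apr_def by blast
    thus "EX f. apr (suc n) f" by blast
  qed
  have uniq: "ALL f g. apr n f & apr n g --> ap f n = ap g n" if "n : els om" for n using that
  proof (rule om_induct)
    show "Dn E (%rh. ALL f g. apr (rh 0) f & apr (rh 0) g --> ap f (rh 0) = ap g (rh 0))" by (intro dn da)
    show "ALL f g. apr emp f & apr emp g --> ap f emp = ap g emp" unfolding apr_def by simp
    fix n assume n: "n : els om" "ALL f g. apr n f & apr n g --> ap f n = ap g n"
    have re: "EX f'. apr n f' & ap f' n = ap f n" if f: "apr (suc n) f" for f
    proof -
      obtain Y where Y: "is_fun E f (suc (suc n)) Y" using f unfolding apr_def by blast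
      let ?f = "lam (suc n) Y (ap f)"
      have h: "Fn E (%rh. ap f (rh 0))" by (intro dn)
      have v: "ap f k : els Y" if "k : els (suc n)" for k using fun_val(2)[OF Y, of k] that by auto
      have L: "ap ?f k = ap f k" if "k : els (suc n)" for k by (rule lam_ap[OF h _ that]) (rule v)
      have "is_fun E ?f (suc n) Y" by (rule lam_fun[OF h]) (rule v)
      moreover have "emp : els (suc n)" using om_0_least[OF om_suc[OF n(1)]] by (metis els_suc els_emp insert_not_empty)
      moreover have "ap ?f (suc k) = G (ap ?f k)" if "k : els n" for k
        using om_suc_mono[OF n(1) that] that L f unfolding apr_def by auto
      ultimately have "apr n ?f" unfolding apr_def using L f unfolding apr_def by auto
      thus ?thesis using L by auto
    qed
    show "ALL f g. apr (suc n) f & apr (suc n) g --> ap f (suc n) = ap g (suc n)"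
    proof (intro allI impI)
      fix f g assume fg: "apr (suc n) f & apr (suc n) g"
      then obtain f' g' where "apr n f'" "ap f' n = ap f n" "apr n g'" "ap g' n = ap g n" using re by blast
      hence "ap f n = ap g n" using n(2) by metis
      moreover have "ap f (suc n) = G (ap f n)" "ap g (suc n) = G (ap g n)" using fg unfolding apr_def by auto
      ultimately show "ap f (suc n) = ap g (suc n)" by simp
    qed
  qed
  define K where "K n y <-> (EX f. apr n f & y = ap f n)" for n y
  have dK: "Fn E a ==> Fn E b ==> Dn E (%rh. K (a rh) (b rh))" for a b
  proof (rule Dn2[where K = K])
    show "Dn E (%rh. K (rh 0) (rh 1))" unfolding K_def by (intro dn da)
  qed
  have K1: "EX! y. K n y" if "n : els om" for n using ex[OF that] uniq[OF that] unfolding K_def by auto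
  have ss: "ss {y. EX n:els om. K n y}" by (rule repl) (intro dK dn, rule K1)
  have K0: "K emp x" using ex[OF om_0] unfolding K_def apr_def by auto
  have Ks: "K (suc n) (G y)" if n: "n : els om" "K n y" for n y
  proof -
    obtain g where g: "apr (suc n) g" using ex om_suc n by blast
    obtain Y where Y: "is_fun E g (suc (suc n)) Y" using g unfolding apr_def by blast
    let ?f = "lam (suc n) Y (ap g)"
    have h: "Fn E (%rh. ap g (rh 0))" by (intro dn)
    have v: "ap g k : els Y" if "k : els (suc n)" for k using fun_val(2)[OF Y, of k] that by auto
    have L: "ap ?f k = ap g k" if "k : els (suc n)" for k by (rule lam_ap[OF h _ that]) (rule v)
    have 1: "is_fun E ?f (suc n) Y" by (rule lam_fun[OF h]) (rule v)
    have 2: "emp : els (suc n)" using om_0_least[OF om_suc[OF n(1)]] by (metis els_suc els_emp insert_not_empty)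
    have 3: "ap ?f (suc k) = G (ap ?f k)" if "k : els n" for k
      using om_suc_mono[OF n(1) that] that L g unfolding apr_def by auto
    have "apr n ?f" unfolding apr_def using 1 2 3 L g unfolding apr_def by auto
    hence "K n (ap g n)" unfolding K_def using L[of n] by auto
    hence "y = ap g n" using K1[OF n(1)] n(2) by blast
    hence "G y = ap g (suc n)" using g unfolding apr_def by auto
    thus ?thesis unfolding K_def using g by blast
  qed
  have mono: "ALL n:els m. ALL y z. K n y & K m z --> els y <= els z" if "m : els om" for m using that
  proof (rule om_induct)
    show "Dn E (%rh. ALL n:els (rh 0). ALL y z. K n y & K (rh 0) z --> els y <= els z)" by (intro dn dK)
    fix m assume m: "m : els om" "ALL n:els m. ALL y z. K n y & K m z --> els y <= els z"
    show "ALL n:els (suc m). ALL y z. K n y & K (suc m) z --> els y <= els z"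
    proof (intro ballI allI impI)
      fix n y z assume n: "n : els (suc m)" "K n y & K (suc m) z"
      obtain u where u: "K m u" using K1 m(1) by blast
      have z: "z = G u" using Ks[OF m(1) u] K1[OF om_suc[OF m(1)]] n(2) by blast
      have "els y <= els u"
      proof (cases "n = m")
        case True
        hence "y = u" using u n(2) K1[OF m(1)] by blast
        thus ?thesis by simp
      next
        case False
        thus ?thesis using m(2) u n by auto
      qed
      thus "els y <= els z" using inc[of u] z by blast
    qed
  qed auto
  show ?thesis
  proof (rule exI[of _ "mk {y. EX n:els om. K n y}"], unfold els_mk[OF ss], intro conjI)
    show "x : {y. EX n:els om. K n y}" using K0 om_0 by blast
    show "ALL z:{y. EX n:els om. K n y}. G z : {y. EX n:els om. K n y}" using Ks om_suc by blast
    show "ALL z:{y. EX n:els om. K n y}. ALL w:{y. EX n:els om. K n y}. els z <= els w \<or> els w <= els z"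
    proof (intro ballI)
      fix z w assume "z : {y. EX n:els om. K n y}" "w : {y. EX n:els om. K n y}"
      then obtain m n where mn: "m : els om" "n : els om" "K m z" "K n w" by blast
      consider "m : els n" | "m = n" | "n : els m" using om_linear[OF mn(1,2)] by blast
      thus "els z <= els w \<or> els w <= els z"
      proof cases
        case 1
        thus ?thesis using mono[OF mn(2)] mn by blast
      next
        case 2
        hence "z = w" using K1[OF mn(1)] mn by blast
        thus ?thesis by simp
      next
        case 3
        thus ?thesis using mono[OF mn(1)] mn by blast
      qed
    qed
  qed
qed

lemma trcl: "EX t. x : els t & is_trans E t"
proof -
  have "Fn E (%rh. un (rh 0) (Uni (rh 0)))" by (intro dn)
  then obtain C where C: "mk {x} : els C" "ALL z:els C. un z (Uni z) : els C"
    using iterate[of "%z. un z (Uni z)" "mk {x}"] by auto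
  have "x : els (Uni C)" using C(1) by (auto simp: els_mk intro!: bexI[of _ "mk {x}"])
  moreover have "is_trans E (Uni C)" unfolding is_trans_def
  proof (intro ballI subsetI)
    fix y z assume "y : els (Uni C)" "z : els y"
    then obtain u where "u : els C" "y : els u" by auto
    hence "z : els (un u (Uni u))" "un u (Uni u) : els C" using C(2) \<open>z : els y\<close> by auto
    thus "z : els (Uni C)" unfolding els_Un by blast
  qed
  ultimately show ?thesis by blast
qed

lemma el_induct:
  assumes "Dn E (%rh. P (rh 0))" "!!x. (!!y. y : els x ==> P y) ==> P x" shows "P x"
proof (rule ccontr)
  assume "~ P x"
  obtain t where t: "x : els t" "is_trans E t" using trcl by blast
  have "ss {y : els t. ~ P y}" by (intro sepI dn) (rule assms)
  from ss_min[OF this] obtain y where y: "y : els t" "~ P y" "ALL z. z : els t & ~ P z --> z ~: els y"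
    using t \<open>~ P x\<close> by blast
  hence "P y" using assms(2)[of y] t(2) unfolding is_trans_def by blast
  thus False using y by simp
qed

text \<open>Adjoining \<open>pw (pw z)\<close> puts the Kuratowski pairs of elements of
  \<open>z\<close> into the next iterate. The closure of \<omega> obtained in this way is the
  universe in which the codes of formulas are found.\<close>

lemma pair_closed: "EX U. els x <= els U & (ALL a:els U. ALL b:els U. opr a b : els U)"
proof -
  have "Fn E (%rh. un (rh 0) (pw (pw (rh 0))))" by (intro dn)
  then obtain C where C: "x : els C" "ALL z:els C. un z (pw (pw z)) : els C"
    "ALL z:els C. ALL w:els C. els z <= els w \<or> els w <= els z"
    using iterate[of "%z. un z (pw (pw z))" x] by auto
  have "opr a b : els (Uni C)" if ab: "a : els (Uni C)" "b : els (Uni C)" for a b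
  proof -
    obtain v w where "v : els C" "a : els v" "w : els C" "b : els w" using ab unfolding els_Un by blast
    moreover from this have "els v <= els w \<or> els w <= els v" using C(3) by blast
    ultimately obtain u where u: "u : els C" "a : els u" "b : els u" by (meson subsetD)
    hence "opr a b : els (un u (pw (pw u)))" by (auto simp: opr_def els_mk)
    moreover have "un u (pw (pw u)) : els C" using C(2) u(1) by blast
    ultimately show ?thesis unfolding els_Un by blast
  qed
  thus ?thesis using C(1) by (intro exI[of _ "Uni C"]) auto
qed

end

section \<open>Basic properties of transitive sets and ordinals\<close>

context zs begin

lemma Dn_trans [dn]: "Fn E a ==> Dn E (%rh. is_trans E (a rh))"
proof (rule Dn1[where K = "is_trans E"])
  show "Dn E (%rh. is_trans E (rh 0))" unfolding is_trans_def by (intro dn)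
qed

lemma Dn_ord [dn]: "Fn E a ==> Dn E (%rh. is_ord E (a rh))"
proof (rule Dn1[where K = "is_ord E"])
  show "Dn E (%rh. is_ord E (rh 0))" unfolding is_ord_def by (intro dn)
qed

lemma ord_trans: "is_ord E a ==> y : els x ==> x : els a ==> y : els a"
  unfolding is_ord_def is_trans_def by blast

lemma ord_el: assumes "is_ord E a" "x : els a" shows "is_ord E x"
proof -
  have "is_trans E x" "els x <= els a" using assms unfolding is_ord_def is_trans_def by auto
  thus ?thesis using assms(1) unfolding is_ord_def by auto
qed

lemma ord_om: "is_ord E om"
  unfolding is_ord_def is_trans_def using om_sub om_trans by blast

end

section \<open>Ordinals, well-orderings and canonical names\<close>

context zfc begin

lemma ord_lin: assumes "is_ord E a" "is_ord E b" shows "a : els b \<or> a = b \<or> b : els a"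
proof -
  define P where "P a b <-> is_ord E a & is_ord E b --> a : els b \<or> a = b \<or> b : els a" for a b
  have d: "Fn E s ==> Fn E t ==> Dn E (%rh. P (s rh) (t rh))" for s t
  proof (rule Dn2[where K = P])
    show "Dn E (%rh. P (rh 0) (rh 1))" unfolding P_def by (intro dn)
  qed
  have "ALL b. P a b"
  proof (rule el_induct[where P = "%a. ALL b. P a b"])
    show "Dn E (%rh. ALL b. P (rh 0) b)" by (intro dn d)
    fix a assume a: "!!x. x : els a ==> ALL b. P x b"
    show "ALL b. P a b"
    proof
      fix b show "P a b"
      proof (rule el_induct[where P = "P a"])
        show "Dn E (%rh. P a (rh 0))" by (intro dn d)
        fix b assume b: "!!y. y : els b ==> P a y"
        show "P a b" unfolding P_def
        proof (intro impI)
          assume o: "is_ord E a & is_ord E b"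
          show "a : els b \<or> a = b \<or> b : els a"
          proof (cases "els a = els b")
            case True
            thus ?thesis using ext by blast
          next
            case False
            then consider x where "x : els a" "x ~: els b" | y where "y : els b" "y ~: els a" by blast
            thus ?thesis
            proof cases
              case 1
              hence "b = x \<or> b : els x" using a[OF 1(1)] o ord_el unfolding P_def by blast
              thus ?thesis using 1 o ord_trans by blast
            next
              case 2
              hence "a = y \<or> a : els y" using b[OF 2(1)] o ord_el unfolding P_def by blast
              thus ?thesis using 2 o ord_trans by blast
            qed
          qed
        qed
      qed
    qed
  qed
  thus ?thesis using assms unfolding P_def by blast
qed

lemma ord_least:
  assumes "is_ord E a" "x : els a" "P x" "Dn E (%rh. P (rh 0))"
  shows "EX x:els a. P x & (ALL y:els x. ~ P y)"
proof -
  have "ss {x : els a. P x}" by (rule sepI) (rule assms)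
  from ss_min[OF this] obtain x where x: "x : els a" "P x" "ALL z. z : els a & P z --> z ~: els x"
    using assms by blast
  thus ?thesis using ord_trans[OF assms(1)] by blast
qed

lemma ord_lin_in:
  assumes "is_ord E a" "x : els a" "y : els a" shows "x : els y \<or> x = y \<or> y : els x"
  using ord_lin ord_el assms by blast

lemma ord_max:
  assumes "is_ord E a" "x : els a" "y : els a"
  obtains z where "z : els a" "x = z \<or> x : els z" "y = z \<or> y : els z"
  using ord_lin_in[OF assms] assms that by blast

subsection \<open>Zermelo's theorem\<close>

lemma choice_fun: "EX f. ALL A. els A <= els S & A ~= emp --> ap f A : els A"
proof -
  define D where "D = mk {A : els (pw S). A ~= emp}"
  have D: "A : els D <-> els A <= els S & A ~= emp" for A
    unfolding D_def by (subst els_mk) (intro sepI dn, auto)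
  \<comment> \<open>The axiom of choice concerns disjoint families, so each \<open>A\<close> is
    replaced by its tagged copy \<open>{A} \<times> A\<close>.\<close>
  have h: "Fn E (%rh. prd (mk {rh 0}) (rh 0))" by (intro dn)
  define F where "F = mk ((%A. prd (mk {A}) A) ` els D)"
  have F: "els F = (%A. prd (mk {A}) A) ` els D" unfolding F_def by (rule els_mk[OF repl_fun[OF h]])
  have m: "p : els (prd (mk {A}) A) <-> (EX z:els A. p = opr A z)" for p A
    unfolding els_prd els_mk[OF ss_sing] by auto
  have "EX c. ALL x:els F. EX! y. y : els x \<inter> els c"
  proof (rule choice_ax, unfold F)
    show "ALL x:(%A. prd (mk {A}) A) ` els D. els x ~= {}"
    proof
      fix x assume "x : (%A. prd (mk {A}) A) ` els D"
      then obtain A where A: "A : els D" "x = prd (mk {A}) A" by auto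
      hence "A ~= emp" using D[of A] by simp
      then obtain z where "z : els A" using empty_iff_emp by blast
      hence "opr A z : els x" unfolding A(2) m by auto
      thus "els x ~= {}" by blast
    qed
    show "ALL x:(%A. prd (mk {A}) A) ` els D. ALL y:(%A. prd (mk {A}) A) ` els D. x ~= y --> els x \<inter> els y = {}"
    proof (intro ballI impI)
      fix x y assume "x : (%A. prd (mk {A}) A) ` els D" "y : (%A. prd (mk {A}) A) ` els D" "x ~= y"
      then obtain A B where "x = prd (mk {A}) A" "y = prd (mk {B}) B" "A ~= B" by auto
      thus "els x \<inter> els y = {}" using m by auto
    qed
  qed
  then obtain c where c: "!!A. A : els D ==> EX! y. y : els (prd (mk {A}) A) \<inter> els c" unfolding F by blast
  define f where "f = mk {p : els c. EX A. EX z:els A. p = opr A z}"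
  have f: "opr A z : els f <-> opr A z : els c & z : els A" for A z
    unfolding f_def by (subst els_mk) (intro sepI dn, auto)
  have "ap f A : els A" if "A : els D" for A
  proof -
    from c[OF that] obtain y where "y : els (prd (mk {A}) A) \<inter> els c &
        (ALL y'. y' : els (prd (mk {A}) A) \<inter> els c --> y' = y)" unfolding Ex1_def ..
    hence y: "y : els (prd (mk {A}) A)" "y : els c"
      and u: "!!y'. y' : els (prd (mk {A}) A) \<inter> els c ==> y' = y" by simp_all
    from y(1) obtain z where z: "z : els A" "y = opr A z" unfolding m by auto
    have "EX! z. opr A z : els f"
    proof (rule ex1I)
      show "opr A z : els f" using y z f by simp
      show "z' = z" if "opr A z' : els f" for z'
        using u[of "opr A z'"] that z(2) unfolding f by (simp add: m)
    qed
    hence "opr A (ap f A) : els f" using ap_iff[of "ap f A" f A] by simp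
    thus ?thesis using f by simp
  qed
  thus ?thesis unfolding D by (intro exI[of _ f] allI impI)
qed

text \<open>Zermelo's argument with the least tower of final segments.\<close>

lemma wellorder:
  "EX W. (ALL x:els S. ALL y:els S. x ~= y --> opr x y : els W \<or> opr y x : els W) &
     (ALL A. els A <= els S & A ~= emp --> (EX x:els A. ALL z:els A. opr z x ~: els W))"
proof -
  obtain f where f: "!!A. els A <= els S ==> A ~= emp ==> ap f A : els A" using choice_fun by blast
  define d where "d A = df A (mk {ap f A})" for A
  have d: "els (d A) = els A - {ap f A}" for A by (simp add: d_def els_mk)
  have Fd [dn]: "Fn E t ==> Fn E (%rh. d (t rh))" for t unfolding d_def by (intro dn)
  define I where "I B = mk {x : els S. ALL A:els B. x : els A}" for B
  have I: "x : els (I B) <-> x : els S & (ALL A:els B. x : els A)" for x B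
    unfolding I_def by (subst els_mk) (intro sepI dn, auto)
  have FI [dn]: "Fn E t ==> Fn E (%rh. I (t rh))" for t
  proof (rule Fn_comp1[where f = I])
    show "Fn E (%rh. I (rh 0))" unfolding I_def by (rule Fn_mk) (intro sepI dn, unfold mem_Collect_eq, intro dn)
  qed
  define Tw where "Tw F <-> els F <= els (pw S) & S : els F & (ALL A:els F. A ~= emp --> d A : els F) &
     (ALL B. els B <= els F & B ~= emp --> I B : els F)" for F
  define T where "T = mk {A : els (pw S). ALL F. Tw F --> A : els F}"
  have T: "A : els T <-> els A <= els S & (ALL F. Tw F --> A : els F)" for A
    unfolding T_def Tw_def by (subst els_mk) (intro sepI dn, auto)
  have TS: "S : els T" unfolding T Tw_def by auto
  have Td: "d A : els T" if "A : els T" "A ~= emp" for A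
    using that unfolding T Tw_def by (auto simp: d)
  have TI: "I B : els T" if B: "els B <= els T" "B ~= emp" for B unfolding T
  proof (intro conjI allI impI)
    show "els (I B) <= els S" by (auto simp: I)
    fix F assume F: "Tw F"
    hence "els B <= els F" using B(1) T by blast
    thus "I B : els F" using F B(2) unfolding Tw_def by blast
  qed
  have ind: "ALL A:els T. P A"
    if P: "Dn E (%rh. P (rh 0))" "P S" "!!A. A : els T ==> A ~= emp ==> P A ==> P (d A)"
      "!!B. els B <= els T ==> B ~= emp ==> ALL A:els B. P A ==> P (I B)" for P
  proof
    fix A assume A: "A : els T"
    define F where "F = mk {A : els T. P A}"
    have F: "A : els F <-> A : els T & P A" for A
      unfolding F_def by (subst els_mk) (rule sepI, rule P, auto)
    have "Tw F" unfolding Tw_def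
    proof (intro conjI ballI allI impI)
      show "els F <= els (pw S)" using F T by auto
      show "S : els F" using F TS P(2) by blast
      show "d A : els F" if "A : els F" "A ~= emp" for A using that F[of A] F[of "d A"] Td P(3) by blast
      show "I B : els F" if B: "els B <= els F & B ~= emp" for B
      proof -
        have "els B <= els T" "ALL A:els B. P A" using B F by blast+
        thus ?thesis using F[of "I B"] TI P(4) B by blast
      qed
    qed
    hence "A : els F" using A T by blast
    thus "P A" using F by blast
  qed
  define C where "C A <-> (ALL U:els T. els U <= els A \<or> els A <= els U)" for A
  have step: "ALL U:els T. els U <= els (d A) \<or> els A <= els U" if A: "A : els T" "C A" "A ~= emp" for A
  proof (rule ind)
    show "Dn E (%rh. els (rh 0) <= els (d A) \<or> els A <= els (rh 0))" by (intro dn)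
    show "els S <= els (d A) \<or> els A <= els S" using A T by blast
    show "els (d U) <= els (d A) \<or> els A <= els (d U)"
      if U: "U : els T" "U ~= emp" "els U <= els (d A) \<or> els A <= els U" for U
    proof (cases "els U <= els (d A)")
      case True
      thus ?thesis by (auto simp: d)
    next
      case False
      hence AU: "els A <= els U" using U by blast
      have "d U : els T" using Td U by blast
      then consider "els A <= els (d U)" | "els (d U) <= els A" using A(2) unfolding C_def by blast
      thus ?thesis
      proof cases
        case 2
        show ?thesis
        proof (cases "ap f U : els A")
          case True
          hence "els A = els U" using 2 AU unfolding d by blast
          hence "A = U" by (rule ext)
          thus ?thesis by simp
        next
          case False
          thus ?thesis using AU unfolding d by blast
        qed
      qed simp
    qed
    show "els (I B) <= els (d A) \<or> els A <= els (I B)"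
      if B: "els B <= els T" "B ~= emp" "ALL U:els B. els U <= els (d A) \<or> els A <= els U" for B
    proof (cases "ALL U:els B. els A <= els U")
      case True
      thus ?thesis using A(1) T I by (meson subsetD subsetI)
    next
      case False
      then obtain U where "U : els B" "els U <= els (d A)" using B(3) by blast
      thus ?thesis using I by (meson subsetD subsetI)
    qed
  qed
  have C: "ALL A:els T. C A"
  proof (rule ind)
    show "Dn E (%rh. C (rh 0))" unfolding C_def by (intro dn)
    show "C S" unfolding C_def using T by blast
    show "C (d A)" if A: "A : els T" "A ~= emp" "C A" for A
      unfolding C_def using step[OF A(1,3,2)] by (auto simp: d)
    show "C (I B)" if B: "els B <= els T" "B ~= emp" "ALL A:els B. C A" for B unfolding C_def
    proof
      fix U assume U: "U : els T"
      show "els U <= els (I B) \<or> els (I B) <= els U"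
      proof (cases "ALL A:els B. els U <= els A")
        case True
        thus ?thesis using U T I by (meson subsetD subsetI)
      next
        case False
        then obtain A where "A : els B" "els A <= els U" using B(3) U unfolding C_def by blast
        thus ?thesis using I by (meson subsetD subsetI)
      qed
    qed
  qed
  define W where "W = rc S S (%x y. EX A:els T. y : els A & x ~: els A)"
  have dW: "Dn E (%rh. EX A:els T. rh 1 : els A & rh 0 ~: els A)" by (intro dn)
  have W: "opr x y : els W <-> x : els S & y : els S & (EX A:els T. y : els A & x ~: els A)" for x y
    unfolding W_def by (rule rc_iff[OF dW])
  have least: "EX x:els A. ALL y:els A. opr y x ~: els W & (y ~= x --> opr x y : els W)"
    if A: "els A <= els S" "A ~= emp" for A
  proof -
    \<comment> \<open>The intersection \<open>I B\<close> is the least member of the tower that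
      includes \<open>A\<close>. The point that the tower removes from it next lies in
      \<open>A\<close>, since otherwise a smaller member would include \<open>A\<close>, and it is
      the minimum of \<open>A\<close>.\<close>
    define B where "B = mk {U : els T. els A <= els U}"
    have B: "U : els B <-> U : els T & els A <= els U" for U
      unfolding B_def by (subst els_mk) (intro sepI dn, auto)
    have "B ~= emp" using B[of S] TS A by auto
    hence M: "I B : els T" using TI B by blast
    have AM: "els A <= els (I B)" using A B I by (meson subsetD subsetI)
    hence "I B ~= emp" using A(2) empty_iff_emp els_emp by auto
    hence dM: "d (I B) : els T" using Td M by blast
    have x: "ap f (I B) : els A"
    proof (rule ccontr)
      assume "ap f (I B) ~: els A"
      hence "d (I B) : els B" using dM AM unfolding B d by blast
      hence "els (I B) <= els (d (I B))" using I by blast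
      moreover have "ap f (I B) : els (I B)" using f[of "I B"] \<open>I B ~= emp\<close> M T by blast
      ultimately show False unfolding d by blast
    qed
    show ?thesis
    proof (intro bexI[OF _ x] ballI conjI impI)
      fix y assume y: "y : els A"
      show "opr y (ap f (I B)) ~: els W"
      proof
        assume "opr y (ap f (I B)) : els W"
        then obtain U where U: "U : els T" "ap f (I B) : els U" "y ~: els U" unfolding W by blast
        hence "els U <= els (d (I B)) \<or> els (I B) <= els U" using step[OF M _ \<open>I B ~= emp\<close>] C M by blast
        thus False using U y AM unfolding d by blast
      qed
      show "opr (ap f (I B)) y : els W" if "y ~= ap f (I B)"
        unfolding W using that dM AM x y A unfolding d
        by (intro conjI bexI[of _ "d (I B)"]) (auto simp: d)
    qed
  qed
  show ?thesis
  proof (rule exI[of _ W], intro conjI ballI allI impI)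
    fix x y assume xy: "x : els S" "y : els S" "x ~= y"
    have e: "els (mk {x, y}) = {x, y}" by (simp add: els_mk)
    hence "mk {x, y} ~= emp" by (metis els_emp insert_not_empty)
    from least[OF _ this] show "opr x y : els W \<or> opr y x : els W" unfolding e using xy by auto
  next
    fix A assume "els A <= els S & A ~= emp"
    thus "EX x:els A. ALL z:els A. opr z x ~: els W" using least by blast
  qed
qed

subsection \<open>Canonical names\<close>

text \<open>A piece of the recursion for canonical names on a transitive set \<open>t\<close>:
  elements enter a name together with the empty condition, which is the weakest one.\<close>

definition chkf :: "'v => 'v => bool" where
  "chkf t f <-> is_trans E t & (EX Y. is_fun E f t Y) &
     (ALL y:els t. ALL u. u : els (ap f y) <-> (EX z:els y. u = opr (ap f z) emp))"

lemma Dn_chkf [dn]: "Fn E a ==> Fn E b ==> Dn E (%rh. chkf (a rh) (b rh))"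
proof (rule Dn2[where K = chkf])
  show "Dn E (%rh. chkf (rh 0) (rh 1))" unfolding chkf_def by (intro dn)
qed

definition CHK :: "'v => 'v => bool" where "CHK x v <-> (EX t f. chkf t f & x : els t & v = ap f x)"

lemma Dn_CHK [dn]: "Fn E a ==> Fn E b ==> Dn E (%rh. CHK (a rh) (b rh))"
proof (rule Dn2[where K = CHK])
  show "Dn E (%rh. CHK (rh 0) (rh 1))" unfolding CHK_def by (intro dn)
qed

lemma chkf_uniq:
  assumes "chkf t f" "chkf t' f'" shows "x : els t & x : els t' --> ap f x = ap f' x"
proof (rule el_induct[where P = "%x. x : els t & x : els t' --> ap f x = ap f' x"])
  show "Dn E (%rh. rh 0 : els t & rh 0 : els t' --> ap f (rh 0) = ap f' (rh 0))" by (intro dn)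
  fix x assume IH: "!!y. y : els x ==> y : els t & y : els t' --> ap f y = ap f' y"
  show "x : els t & x : els t' --> ap f x = ap f' x"
  proof
    assume x: "x : els t & x : els t'"
    hence "els x <= els t" "els x <= els t'" using assms unfolding chkf_def is_trans_def by blast+
    hence e: "z : els x ==> ap f z = ap f' z" for z using IH by blast
    have "u : els (ap f x) <-> (EX z:els x. u = opr (ap f z) emp)"
      "u : els (ap f' x) <-> (EX z:els x. u = opr (ap f' z) emp)" for u
      using x assms unfolding chkf_def by blast+
    hence "els (ap f x) = els (ap f' x)" using e by auto
    thus "ap f x = ap f' x" by (rule ext)
  qed
qed

lemma CHK_uniq: "CHK x v ==> CHK x v' ==> v = v'"
  unfolding CHK_def using chkf_uniq by blast

definition chk :: "'v => 'v" where "chk x = (if EX v. CHK x v then THE v. CHK x v else x)"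

lemma chk_iff: "v = chk x <-> CHK x v \<or> ~ (EX v. CHK x v) & v = x"
proof (cases "EX v. CHK x v")
  case True
  then obtain w where w: "CHK x w" by blast
  hence "(THE v. CHK x v) = w" using CHK_uniq by blast
  thus ?thesis using w CHK_uniq True unfolding chk_def by auto
qed (simp add: chk_def)

lemma Fn_chk [dn]: "Fn E a ==> Fn E (%rh. chk (a rh))"
proof (rule Fn_comp1[where f = chk])
  show "Fn E (%rh. chk (rh 0))" unfolding Fn_def chk_iff by (intro dn)
qed

text \<open>\<open>s\<close> gathers the points of a transitive set that already have a canonical
  name. It is transitive and contains all elements of \<open>x\<close>, so the recursion on
  \<open>s\<close> extends to \<open>x\<close>; replacement collects the values.\<close>

lemma CHK_ex: "EX v. CHK x v"
proof (rule el_induct[where P = "%x. EX v. CHK x v"])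
  show "Dn E (%rh. EX v. CHK (rh 0) v)" by (intro dn)
  fix x assume IH: "!!y. y : els x ==> EX v. CHK y v"
  obtain t where t: "x : els t" "is_trans E t" using trcl by blast
  define s where "s = mk {w : els t. EX v. CHK w v}"
  have s: "w : els s <-> w : els t & (EX v. CHK w v)" for w
    unfolding s_def by (subst els_mk) (intro sepI dn, auto)
  have sub: "z : els s" if "w : els s" "z : els w" for w z
  proof -
    obtain t' f where 1: "chkf t' f" "w : els t'" using \<open>w : els s\<close> unfolding s CHK_def by blast
    hence "z : els t'" using that(2) unfolding chkf_def is_trans_def by blast
    hence "EX v. CHK z v" using 1 unfolding CHK_def by blast
    thus ?thesis using that t(2) unfolding s is_trans_def by blast
  qed
  have "els x <= els t" using t unfolding is_trans_def by blast
  hence xs: "els x <= els s" using IH by (simp add: s subset_eq)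
  have chk: "CHK w (chk w)" if "w : els s" for w using that chk_iff[of "chk w" w] unfolding s by blast
  have chk_mem: "u : els (chk w) <-> (EX z:els w. u = opr (chk z) emp)" if w: "w : els s" for w u
  proof -
    obtain t' f where 1: "chkf t' f" "w : els t'" "chk w = ap f w" using chk[OF w] unfolding CHK_def by blast
    have "chk z = ap f z" if z: "z : els w" for z
    proof -
      have "z : els t'" using z 1 unfolding chkf_def is_trans_def by blast
      hence "CHK z (ap f z)" using 1(1) unfolding CHK_def by blast
      thus ?thesis using CHK_uniq chk[OF sub[OF w z]] by blast
    qed
    moreover have "u : els (ap f w) <-> (EX z:els w. u = opr (ap f z) emp)" using 1 unfolding chkf_def by blast
    ultimately show ?thesis using 1(3) by auto
  qed
  show "EX v. CHK x v"
  proof (cases "x : els s")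
    case True
    thus ?thesis unfolding s by blast
  next
    case False
    have hh: "Fn E (%rh. opr (chk (rh 0)) emp)" by (intro dn)
    define vx where "vx = mk ((%z. opr (chk z) emp) ` els x)"
    have vx: "els vx = (%z. opr (chk z) emp) ` els x" unfolding vx_def by (rule els_mk[OF repl_fun[OF hh]])
    let ?h = "%w. if w = x then vx else chk w"
    have h: "Fn E (%rh. ?h (rh 0))" by (intro Fn_if dn)
    define Y where "Y = mk (?h ` els (ins x s))"
    have Y: "els Y = ?h ` els (ins x s)" unfolding Y_def by (rule els_mk[OF repl_fun[OF h]])
    let ?f = "lam (ins x s) Y ?h"
    have v: "?h w : els Y" if "w : els (ins x s)" for w unfolding Y using that by (rule imageI)
    have L: "ap ?f w = ?h w" if "w : els (ins x s)" for w by (rule lam_ap[OF h _ that]) (rule v)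
    have xw: "x ~: els w" if "w : els (ins x s)" for w
      using that False sub el_irrefl[of x] by auto
    have el: "z : els (ins x s)" "z ~= x" if "w : els (ins x s)" "z : els w" for w z
      using that sub xs xw[OF that(1)] by auto
    have "chkf (ins x s) ?f" unfolding chkf_def
    proof (intro conjI ballI allI)
      show "is_trans E (ins x s)" unfolding is_trans_def using el(1) by blast
      show "EX Y. is_fun E ?f (ins x s) Y" by (rule exI, rule lam_fun[OF h]) (rule v)
      fix w u assume w: "w : els (ins x s)"
      have "ap ?f z = chk z" if "z : els w" for z using L[OF el(1)[OF w that]] el(2)[OF w that] by simp
      moreover have "u : els (ap ?f w) <-> (EX z:els w. u = opr (chk z) emp)"
      proof (cases "w = x")
        case True
        thus ?thesis using L[OF w] vx by auto
      next
        case False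
        thus ?thesis using L[OF w] chk_mem[of w u] w by auto
      qed
      ultimately show "u : els (ap ?f w) <-> (EX z:els w. u = opr (ap ?f z) emp)" by auto
    qed
    hence "CHK x (ap ?f x)" unfolding CHK_def by (intro exI[of _ "ins x s"] exI[of _ ?f]) simp
    thus ?thesis by blast
  qed
qed

lemma chk_mem: "u : els (chk x) <-> (EX z:els x. u = opr (chk z) emp)"
proof -
  have c: "CHK z (chk z)" for z using chk_iff[of "chk z" z] CHK_ex by blast
  then obtain t f where 1: "chkf t f" "x : els t" "chk x = ap f x" unfolding CHK_def by blast
  have "chk z = ap f z" if z: "z : els x" for z
  proof -
    have "z : els t" using z 1 unfolding chkf_def is_trans_def by blast
    hence "CHK z (ap f z)" using 1(1) unfolding CHK_def by blast
    thus ?thesis using CHK_uniq c by blast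
  qed
  moreover have "u : els (ap f x) <-> (EX z:els x. u = opr (ap f z) emp)" using 1 unfolding chkf_def by blast
  ultimately show ?thesis using 1(3) by auto
qed

end

section \<open>Forcing\<close>

locale poset = zfc E for E :: "'v => 'v => bool" +
  fixes P L :: 'v
  assumes le_dom: "opr q p : els L ==> q : els P & p : els P"
    and le_refl: "p : els P ==> opr p p : els L"
    and le_trans: "opr r q : els L ==> opr q p : els L ==> opr r p : els L"
    and top_in: "emp : els P" and le_top: "p : els P ==> opr p emp : els L"
begin

abbreviation le :: "'v => 'v => bool" where "le q p \<equiv> opr q p : els L"

text \<open>A name \<open>z\<close> occurring in \<open>x\<close> lies three membership steps below
  it: in \<open>{z}\<close>, which lies in the pair, which lies in \<open>x\<close>. The induction
  on membership therefore carries the claim for elements and for elements of elements along.\<close>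

lemma name_induct:
  assumes "Dn E (%rh. Q (rh 0))" "!!x. (!!z s. opr z s : els x ==> Q z) ==> Q x" shows "Q x"
proof -
  have dQ [dn]: "Fn E t ==> Dn E (%rh. Q (t rh))" for t by (rule Dn1[where K = Q, OF assms(1)])
  have "Q x & (ALL w:els x. Q w) & (ALL w:els x. ALL v:els w. Q v)"
  proof (rule el_induct[where P = "%x. Q x & (ALL w:els x. Q w) & (ALL w:els x. ALL v:els w. Q v)"])
    show "Dn E (%rh. Q (rh 0) & (ALL w:els (rh 0). Q w) & (ALL w:els (rh 0). ALL v:els w. Q v))"
      by (intro Dn_conj Dn_ball dQ Fn_var)
    fix x assume IH: "!!y. y : els x ==> Q y & (ALL w:els y. Q w) & (ALL w:els y. ALL v:els w. Q v)"
    have "Q x"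
    proof (rule assms(2))
      fix z s assume "opr z s : els x"
      moreover have "mk {z} : els (opr z s)" "z : els (mk {z})" by (simp_all add: opr_def els_mk)
      ultimately show "Q z" using IH by blast
    qed
    thus "Q x & (ALL w:els x. Q w) & (ALL w:els x. ALL v:els w. Q v)" using IH by blast
  qed
  thus ?thesis by blast
qed

definition tri :: "'v => 'v => 'v => 'v => bool" where "tri r q x y <-> opr q (opr x y) : els r"

definition stp :: "('v => 'v => 'v => bool) => 'v => 'v => 'v => bool" where
  "stp Q p x y <-> (ALL z s q. opr z s : els x & le q p & le q s -->
     (EX q' z' s'. le q' q & opr z' s' : els y & le q' s' & Q q' z z'))"

lemma step_iff: "forces_subset_step E P L Q p x y <-> stp Q p x y"
proof -
  have n: "(z, s) : name_elts E P x <-> opr z s : els x & s : els P" for z s x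
    by (simp add: name_elts_def rel_iff)
  show ?thesis
  proof
    assume 1: "forces_subset_step E P L Q p x y"
    show "stp Q p x y" unfolding stp_def
    proof (intro allI impI)
      fix z s q assume a: "opr z s : els x & le q p & le q s"
      hence "(z, s) : name_elts E P x" "q : els P" using le_dom n by auto
      then obtain q' u where q': "(q', q) : rel E L" "u : name_elts E P y"
        "case u of (z', s') => (q', s') : rel E L & Q q' z z'"
        using 1 a unfolding forces_subset_step_def rel_iff by fastforce
      thus "EX q' z' s'. le q' q & opr z' s' : els y & le q' s' & Q q' z z'"
        by (cases u) (auto simp: rel_iff n)
    qed
  next
    assume 1: "stp Q p x y"
    show "forces_subset_step E P L Q p x y" unfolding forces_subset_step_def
    proof (intro ballI, clarify)
      fix z s q assume a: "(z, s) : name_elts E P x" "q : els P" "(q, p) : rel E L" "(q, s) : rel E L"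
      then obtain q' z' s' where "le q' q" "opr z' s' : els y" "le q' s'" "Q q' z z'"
        using 1[unfolded stp_def, rule_format, of z s q] by (auto simp: rel_iff n)
      thus "EX q':els P. (q', q) : rel E L & (EX (z', s'):name_elts E P y. (q', s') : rel E L & Q q' z z')"
        using le_dom by (intro bexI[of _ q'] conjI bexI[of _ "(z', s')"]) (auto simp: rel_iff n)
    qed
  qed
qed

definition good :: "'v => 'v => bool" where
  "good d r <-> (ALL x:els d. ALL z s. opr z s : els x & s : els P --> z : els d) &
     (ALL q:els P. ALL x:els d. ALL y:els d. tri r q x y <-> stp (tri r) q x y & stp (tri r) q y x)"

definition FE :: "'v => 'v => 'v => bool" where
  "FE p x y <-> (EX d r. x : els d & y : els d & good d r & tri r p x y)"

lemma forces_eq_iff: "forces_eq E P L p x y <-> FE p x y"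
proof -
  have t: "triple_in E r = tri r" for r
    by (auto simp: triple_in_def tri_def is_pair_iff rel_iff fun_eq_iff)
  show ?thesis unfolding forces_eq_def FE_def good_def t step_iff name_elts_def
    by (simp add: rel_iff Ball_def conj_ac)
qed

lemma Dn_FE [dn]: "Fn E a ==> Fn E b ==> Fn E c ==> Dn E (%rh. FE (a rh) (b rh) (c rh))"
proof (rule Dn3[where K = FE])
  show "Dn E (%rh. FE (rh 0) (rh 1) (rh 2))" unfolding FE_def good_def stp_def tri_def by (intro dn)
qed

lemma good_uniq:
  assumes g: "good d r" "good d' r'"
  shows "x : els d & x : els d' --> (ALL q:els P. ALL y. y : els d & y : els d' -->
     (tri r q x y <-> tri r' q x y) & (tri r q y x <-> tri r' q y x))"
proof (rule name_induct[where Q = "%x. x : els d & x : els d' --> (ALL q:els P. ALL y. y : els d & y : els d' -->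
     (tri r q x y <-> tri r' q x y) & (tri r q y x <-> tri r' q y x))"])
  fix x assume IH: "!!z s. opr z s : els x ==> z : els d & z : els d' --> (ALL q:els P. ALL y. y : els d & y : els d' -->
     (tri r q z y <-> tri r' q z y) & (tri r q y z <-> tri r' q y z))"
  show "x : els d & x : els d' --> (ALL q:els P. ALL y. y : els d & y : els d' -->
     (tri r q x y <-> tri r' q x y) & (tri r q y x <-> tri r' q y x))"
  proof (intro impI ballI allI)
    fix q y assume x: "x : els d & x : els d'" and q: "q : els P" and y: "y : els d & y : els d'"
    have cl: "z : els d & z : els d'" if "opr z s : els u" "le q s" "u : els d & u : els d'" for z s q u
      using that g le_dom unfolding good_def by blast
    have e: "tri r q z z' <-> tri r' q z z'" "tri r q z' z <-> tri r' q z' z"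
      if "opr z s : els x" "opr z' s' : els y" "le q1 s" "le q2 s'" "le q q3" for q z z' s s' q1 q2 q3
      using IH[OF that(1)] cl[OF that(1,3) x] cl[OF that(2,4) y] le_dom[OF that(5)] by blast+
    have 1: "stp (tri r) q x y <-> stp (tri r') q x y"
      unfolding stp_def using e(1) by (intro iff_allI imp_cong iff_exI conj_cong refl) blast
    have 2: "stp (tri r) q y x <-> stp (tri r') q y x"
      unfolding stp_def using e(2) by (intro iff_allI imp_cong iff_exI conj_cong refl) blast
    have 3: "tri r q x y <-> stp (tri r) q x y & stp (tri r) q y x" "tri r q y x <-> stp (tri r) q y x & stp (tri r) q x y"
      "tri r' q x y <-> stp (tri r') q x y & stp (tri r') q y x" "tri r' q y x <-> stp (tri r') q y x & stp (tri r') q x y"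
      using g x y q unfolding good_def by blast+
    show "(tri r q x y <-> tri r' q x y) & (tri r q y x <-> tri r' q y x)" unfolding 3 1 2 by simp
  qed
qed (unfold tri_def, intro dn)

text \<open>In both halves of the clause, \<open>A\<close> and \<open>B\<close>, the relation is
  consulted with an element of the name \<open>x\<close> as its first entry, so recursion on
  \<open>x\<close> alone is enough although equality compares two names. The orientation that
  \<open>stp\<close> asks for is recovered from the symmetry of the resulting relation.\<close>

lemma good_ex: "EX d r. x : els d & y : els d & good d r"
proof -
  obtain d where d: "mk {x, y} : els d" "is_trans E d" using trcl by blast
  have dt: "!!v w. v : els w ==> w : els d ==> v : els d" using d(2) unfolding is_trans_def by blast
  have xy: "x : els d" "y : els d" using dt[OF _ d(1)] by (simp_all add: els_mk)
  have cl: "z : els d" if "opr z s : els x" "x : els d" for z s x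
  proof -
    have "opr z s : els d" using dt that by blast
    moreover have "mk {z} : els (opr z s)" "z : els (mk {z})" by (simp_all add: opr_def els_mk)
    ultimately show ?thesis using dt by blast
  qed
  define lt where "lt z x <-> (EX s. opr z s : els x)" for z x
  define A where "A x y q R <-> (ALL z s q1. opr z s : els x & le q1 q & le q1 s -->
     (EX q' z' s'. le q' q1 & opr z' s' : els y & le q' s' & opr z (opr q' z') : els R))" for x y q R
  define B where "B x y q R <-> (ALL z s q1. opr z s : els y & le q1 q & le q1 s -->
     (EX q' z' s'. le q' q1 & opr z' s' : els x & le q' s' & opr z' (opr q' z) : els R))" for x y q R
  define H where "H x u R <-> (EX q y. u = opr q y & A x y q R & B x y q R)" for x u R
  have "EX R. els R <= els (prd d (prd P d)) & (ALL x:els d. ALL u:els (prd P d). opr x u : els R <-> H x u R)"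
  proof (rule wf_rec)
    show "Dn E (%rh. lt (rh 0) (rh 1))" unfolding lt_def by (intro dn)
    show "EX x:els C. ALL z:els C. ~ lt z x" if "els C <= els d" "C ~= emp" for C
    proof (rule ccontr)
      assume c: "~ ?thesis"
      have "x ~: els C" for x
      proof (rule name_induct[where Q = "%x. x ~: els C"])
        show "x ~: els C" if "!!z s. opr z s : els x ==> z ~: els C" for x
          using that c unfolding lt_def by blast
      qed (intro dn)
      thus False using \<open>C ~= emp\<close> empty_iff_emp by blast
    qed
    show "Dn E (%rh. H (rh 0) (rh 1) (rh 2))" unfolding H_def A_def B_def by (intro dn)
    fix x u r r' assume x: "x : els d"
      and e: "!!z u. z : els d ==> lt z x ==> opr z u : els r <-> opr z u : els r'"
    have e': "opr z s : els x ==> opr z u : els r <-> opr z u : els r'" for z s u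
      using e[of z u] cl[OF _ x] unfolding lt_def by blast
    have "A x y q r <-> A x y q r'" for y q
      unfolding A_def by (intro iff_allI imp_cong iff_exI conj_cong refl) (use e' in blast)
    moreover have "B x y q r <-> B x y q r'" for y q
      unfolding B_def by (intro iff_allI imp_cong iff_exI conj_cong refl) (use e' in blast)
    ultimately show "H x u r <-> H x u r'" unfolding H_def by simp
  qed
  then obtain R where R: "!!x u. x : els d ==> u : els (prd P d) ==> opr x u : els R <-> H x u R" by blast
  define r where "r = rc P (prd d d) (%q t. EX x y. t = opr x y & opr x (opr q y) : els R)"
  have dr: "Dn E (%rh. EX x y. rh 1 = opr x y & opr x (opr (rh 0) y) : els R)" by (intro dn)
  have r: "tri r q x y <-> opr x (opr q y) : els R" if "q : els P" "x : els d" "y : els d" for q x y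
    unfolding tri_def r_def rc_iff[OF dr] using that by simp
  have rec: "tri r q x y <-> A x y q R & B x y q R" if "q : els P" "x : els d" "y : els d" for q x y
    unfolding r[OF that] using R[of x "opr q y"] that unfolding H_def by simp
  have A: "A x y q R <-> stp (tri r) q x y" if "x : els d" "y : els d" for x y q
  proof -
    have "opr z s : els x ==> opr z' s' : els y ==> le q' q1 ==> opr z (opr q' z') : els R <-> tri r q' z z'"
      for z s z' s' q' q1 using r cl that le_dom by blast
    thus ?thesis unfolding A_def stp_def by (intro iff_allI imp_cong iff_exI conj_cong refl) blast
  qed
  have sym: "x : els d --> (ALL q:els P. ALL y:els d. tri r q x y <-> tri r q y x)" for x
  proof (rule name_induct[where Q = "%x. x : els d --> (ALL q:els P. ALL y:els d. tri r q x y <-> tri r q y x)"])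
    show "Dn E (%rh. rh 0 : els d --> (ALL q:els P. ALL y:els d. tri r q (rh 0) y <-> tri r q y (rh 0)))"
      unfolding tri_def by (intro dn)
    fix x assume IH: "!!z s. opr z s : els x ==> z : els d --> (ALL q:els P. ALL y:els d. tri r q z y <-> tri r q y z)"
    show "x : els d --> (ALL q:els P. ALL y:els d. tri r q x y <-> tri r q y x)"
    proof (intro impI ballI)
      fix q y assume x: "x : els d" and q: "q : els P" and y: "y : els d"
      have e: "opr z s : els x ==> opr z' s' : els y ==> le q' q1 ==>
         opr z (opr q' z') : els R <-> opr z' (opr q' z) : els R" for z s z' s' q' q1
        using IH[of z s] cl[of z s x] cl[of z' s' y] x y r le_dom by blast
      have "A x y q R <-> B y x q R" unfolding A_def B_def
        by (intro iff_allI imp_cong iff_exI conj_cong refl) (use e in blast)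
      moreover have "B x y q R <-> A y x q R" unfolding A_def B_def
        by (intro iff_allI imp_cong iff_exI conj_cong refl) (use e in blast)
      ultimately show "tri r q x y <-> tri r q y x" using rec q x y by blast
    qed
  qed
  have B: "B x y q R <-> stp (tri r) q y x" if "x : els d" "y : els d" for x y q
  proof -
    have "opr z s : els y ==> opr z' s' : els x ==> le q' q1 ==> opr z' (opr q' z) : els R <-> tri r q' z z'"
      for z s z' s' q' q1 using r[of q' z' z] cl[of z s y] cl[of z' s' x] that le_dom[of q' q1] sym[of z] by blast
    thus ?thesis unfolding B_def stp_def by (intro iff_allI imp_cong iff_exI conj_cong refl) blast
  qed
  have "good d r" unfolding good_def
  proof (intro conjI ballI allI impI)
    show "z : els d" if "x : els d" "opr z s : els x & s : els P" for x z s using that cl by blast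
    show "tri r q x y <-> stp (tri r) q x y & stp (tri r) q y x" if "q : els P" "x : els d" "y : els d" for q x y
      using rec[OF that] A[OF that(2,3)] B[OF that(2,3)] by simp
  qed
  thus ?thesis using xy by blast
qed

lemma FE_iff: assumes "p : els P" shows "FE p x y <-> stp FE p x y & stp FE p y x"
proof -
  obtain d r where d: "x : els d" "y : els d" "good d r" using good_ex by blast
  have e: "FE q u v <-> tri r q u v" if "q : els P" "u : els d" "v : els d" for q u v
    unfolding FE_def using that d(3) good_uniq[OF d(3)] by blast
  have cl: "z : els d" if "opr z s : els x" "x : els d" "le q s" for z s x q
    using that d(3) le_dom unfolding good_def by blast
  have s: "stp FE p u v <-> stp (tri r) p u v" if "u : els d" "v : els d" for u v
  proof -
    have "FE q' z z' <-> tri r q' z z'"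
      if "opr z s : els u" "le q s" "opr z' s' : els v" "le q' s'" for z s z' s' q q'
      using e cl that \<open>u : els d\<close> \<open>v : els d\<close> le_dom by blast
    thus ?thesis unfolding stp_def by (intro iff_allI imp_cong iff_exI conj_cong refl) blast
  qed
  have "tri r p x y <-> stp (tri r) p x y & stp (tri r) p y x" using d assms unfolding good_def by blast
  thus ?thesis using e[OF assms d(1,2)] s d by blast
qed

lemma stp_mono: "stp Q p x y ==> le q p ==> stp Q q x y"
  unfolding stp_def using le_trans by meson

lemma stp_dense:
  assumes "!!q. le q p ==> EX r. le r q & stp Q r x y" shows "stp Q p x y"
  unfolding stp_def
proof (intro allI impI)
  fix z s q assume 1: "opr z s : els x & le q p & le q s"
  then obtain r where r: "le r q" "stp Q r x y" using assms by blast
  have "le r s" "le r r" using le_trans[OF r(1)] 1 le_refl le_dom[OF r(1)] by blast+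
  then obtain q' z' s' where "le q' r" "opr z' s' : els y" "le q' s'" "Q q' z z'"
    using r(2) 1 unfolding stp_def by blast
  thus "EX q' z' s'. le q' q & opr z' s' : els y & le q' s' & Q q' z z'" using le_trans[OF _ r(1)] by blast
qed

lemma FE_mono: assumes "FE p x y" "le q p" shows "FE q x y"
proof -
  have "q : els P" "p : els P" using le_dom assms(2) by auto
  thus ?thesis using assms FE_iff[of p x y] FE_iff[of q x y] stp_mono[of FE p x y q] stp_mono[of FE p y x q] by simp
qed

lemma FE_dense:
  assumes "p : els P" "!!q. le q p ==> EX r. le r q & FE r x y" shows "FE p x y"
proof -
  have s: "EX r. le r q & stp FE r x y & stp FE r y x" if q: "le q p" for q
  proof -
    obtain r where r: "le r q" "FE r x y" using assms(2)[OF q] by blast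
    thus ?thesis using FE_iff[of r x y] le_dom[OF r(1)] by blast
  qed
  have "stp FE p x y" by (rule stp_dense) (use s in blast)
  moreover have "stp FE p y x" by (rule stp_dense) (use s in blast)
  ultimately show ?thesis using FE_iff[OF assms(1)] by simp
qed

lemma FE_refl: "p : els P ==> FE p x x"
proof -
  have "ALL p:els P. FE p x x"
  proof (rule name_induct[where Q = "%x. ALL p:els P. FE p x x"])
    fix x assume IH: "!!z s. opr z s : els x ==> ALL p:els P. FE p z z"
    show "ALL p:els P. FE p x x"
    proof
      fix p assume p: "p : els P"
      have "stp FE p x x" unfolding stp_def
      proof (intro allI impI)
        fix z s q assume 1: "opr z s : els x & le q p & le q s"
        thus "EX q' z' s'. le q' q & opr z' s' : els x & le q' s' & FE q' z z'"
          using IH le_dom le_refl by blast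
      qed
      thus "FE p x x" using FE_iff[OF p] by simp
    qed
  qed (intro dn)
  thus "p : els P ==> FE p x x" by blast
qed

definition FM :: "'v => 'v => 'v => bool" where
  "FM p x y <-> (ALL q. le q p --> (EX q' z s. le q' q & opr z s : els y & le q' s & FE q' x z))"

lemma forces_mem_iff: "forces_mem E P L p x y <-> FM p x y"
proof -
  have n: "(z, s) : name_elts E P x <-> opr z s : els x & s : els P" for z s x
    by (simp add: name_elts_def rel_iff)
  have b: "(EX (z, s):name_elts E P y. (q', s) : rel E L & forces_eq E P L q' x z)
      <-> (EX z s. opr z s : els y & le q' s & FE q' x z)" for q'
    using le_dom by (auto simp: rel_iff forces_eq_iff n Bex_def)
  show ?thesis unfolding forces_mem_def b FM_def by (auto simp: rel_iff dest: le_dom) (use le_dom in blast)+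
qed

lemma Dn_FM [dn]: "Fn E a ==> Fn E b ==> Fn E c ==> Dn E (%rh. FM (a rh) (b rh) (c rh))"
proof (rule Dn3[where K = FM])
  show "Dn E (%rh. FM (rh 0) (rh 1) (rh 2))" unfolding FM_def by (intro dn)
qed

lemma FM_mono: "FM p x y ==> le q p ==> FM q x y"
  unfolding FM_def using le_trans by meson

lemma FM_dense: assumes "!!q. le q p ==> EX r. le r q & FM r x y" shows "FM p x y"
  unfolding FM_def
proof (intro allI impI)
  fix q assume "le q p"
  then obtain r where r: "le r q" "FM r x y" using assms by blast
  then obtain q' z s where "le q' r" "opr z s : els y" "le q' s" "FE q' x z"
    using le_refl le_dom[OF r(1)] unfolding FM_def by blast
  thus "EX q' z s. le q' q & opr z s : els y & le q' s & FE q' x z" using le_trans[OF _ r(1)] by blast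
qed

text \<open>Forcing of the formulas that occur in the separation scheme. The recursion is external,
  one formula at a time; by \<open>Dn_fc\<close> every instance is definable in the ground
  model.\<close>

primrec fc :: "fm => 'v => (nat => 'v) => bool" where
  "fc (FMem i j) p rh <-> FM p (rh i) (rh j)"
| "fc (FEq i j) p rh <-> FE p (rh i) (rh j)"
| "fc (FNand \<phi> \<psi>) p rh <-> (ALL q. le q p --> ~ (fc \<phi> q rh & fc \<psi> q rh))"
| "fc (FAll \<phi>) p rh <-> (ALL a. fc \<phi> p (case_nat a rh))"

lemma fc_mono: "fc \<phi> p rh ==> le q p ==> fc \<phi> q rh"
proof (induction \<phi> arbitrary: rh)
  case (FNand \<phi> \<psi>)
  thus ?case using le_trans by auto
qed (auto intro: FM_mono FE_mono)

lemma fc_dense: "p : els P ==> (!!q. le q p ==> EX r. le r q & fc \<phi> r rh) ==> fc \<phi> p rh"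
proof (induction \<phi> arbitrary: rh)
  case (FMem i j)
  thus ?case by (auto intro: FM_dense)
next
  case (FEq i j)
  thus ?case by (auto intro: FE_dense)
next
  case (FNand \<phi> \<psi>)
  show ?case unfolding fc.simps
  proof (intro allI impI notI)
    fix q assume q: "le q p" "fc \<phi> q rh & fc \<psi> q rh"
    obtain r where r: "le r q" "fc (FNand \<phi> \<psi>) r rh" using FNand.prems(2)[OF q(1)] by blast
    thus False using fc_mono[of \<phi> q rh r] fc_mono[of \<psi> q rh r] q(2) le_refl[of r] le_dom[OF r(1)] by auto
  qed
next
  case (FAll \<phi>)
  show ?case unfolding fc.simps
  proof
    fix a show "fc \<phi> p (case_nat a rh)"
      by (rule FAll.IH[OF FAll.prems(1)]) (use FAll.prems(2) in force)
  qed
qed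

lemma Dn_fc: "(!!n. Fn E (e n)) ==> Fn E a ==> Dn E (%rh. fc \<phi> (a rh) (%n. e n rh))"
proof (induction \<phi> arbitrary: e a)
  case (FNand \<phi> \<psi>)
  have s: "Fn E (%rh. e n (%n. rh (Suc n)))" for n by (rule Fn_shift[OF FNand.prems(1)])
  have "Dn E (%rh. fc \<phi> (rh 0) (%n. e n (%n. rh (Suc n))))" "Dn E (%rh. fc \<psi> (rh 0) (%n. e n (%n. rh (Suc n))))"
    by (rule FNand.IH(1)[where e = "%n rh. e n (%n. rh (Suc n))", OF s Fn_var])
      (rule FNand.IH(2)[where e = "%n rh. e n (%n. rh (Suc n))", OF s Fn_var])
  thus ?case unfolding fc.simps
    by (intro Dn_all Dn_imp Dn_not Dn_conj Dn_mem Fn_opr Fn_var Fn_const Fn_shift[OF FNand.prems(2)])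
next
  case (FAll \<phi>)
  define e' where "e' n rh = (case n of 0 => rh 0 | Suc m => e m (%n. rh (Suc n)))" for n and rh :: "nat => 'v"
  have "Fn E (e' n)" for n
  proof (cases n)
    case 0
    hence "e' n = (%rh. rh 0)" unfolding e'_def by (simp add: fun_eq_iff)
    thus ?thesis using Fn_var by simp
  next
    case (Suc m)
    hence "e' n = (%rh. e m (%n. rh (Suc n)))" unfolding e'_def by (simp add: fun_eq_iff)
    thus ?thesis using Fn_shift[OF FAll.prems(1)] by simp
  qed
  from FAll.IH[of e', OF this Fn_shift[OF FAll.prems(2)]]
  have "Dn E (%rh. fc \<phi> (a (%n. rh (Suc n))) (case_nat (rh 0) (%n. e n (%n. rh (Suc n)))))"
    unfolding e'_def by simp
  thus ?case unfolding fc.simps by (rule Dn_all)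
qed (unfold fc.simps, intro Dn_FM Dn_FE; assumption)+

end

section \<open>The generic extension\<close>

locale gen = poset E P L for E :: "'v => 'v => bool" and P L :: 'v +
  fixes G :: "'v set" and E' :: "'w => 'w => bool" and val :: "'v => 'w"
  assumes GP: "p : G ==> p : els P" and Gne: "G ~= {}"
    and Gup: "p : G ==> le p q ==> q : G"
    and Gdir: "p : G ==> q : G ==> EX r:G. le r p & le r q"
    and Gmeet: "els D <= els P ==> (!!p. p : els P ==> EX q:els D. le q p) ==> EX q:G. q : els D"
    and val_surj: "EX x. u = val x"
    and val_eq: "val x = val y <-> (EX p:G. FE p x y)"
    and val_mem: "E' (val x) (val y) <-> (EX p:G. FM p x y)"
begin

lemma Gtop: "emp : G" using Gne Gup le_top GP by blast

text \<open>Genericity is given for dense sets that are points of the model. A definable class that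
  is dense below \<open>p\<close> becomes one by adding the conditions incompatible with
  \<open>p\<close>, and none of those is in \<open>G\<close>.\<close>

lemma generic:
  assumes "Dn E (%rh. D (rh 0))" "p : G" "!!q. le q p ==> EX r. le r q & D r"
  shows "EX r:G. le r p & D r"
proof -
  have dD [dn]: "Fn E t ==> Dn E (%rh. D (t rh))" for t by (rule Dn1[where K = D, OF assms(1)])
  define D' where "D' = mk {r : els P. (D r & le r p) \<or> (ALL t. ~ (le t r & le t p))}"
  have D': "r : els D' <-> r : els P & ((D r & le r p) \<or> (ALL t. ~ (le t r & le t p)))" for r
    unfolding D'_def by (subst els_mk) (intro sepI dn, auto)
  have "EX q:G. q : els D'"
  proof (rule Gmeet)
    show "els D' <= els P" using D' by blast
    fix q assume q: "q : els P"
    show "EX r:els D'. le r q"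
    proof (cases "EX t. le t q & le t p")
      case True
      then obtain t where t: "le t q" "le t p" by blast
      then obtain r where r: "le r t" "D r" using assms(3) by blast
      hence "le r q" "le r p" "r : els P" using le_trans t le_dom by blast+
      thus ?thesis using r D' by blast
    next
      case False
      hence "q : els D'" using D'[of q] q by blast
      thus ?thesis using le_refl[OF q] by blast
    qed
  qed
  then obtain q where q: "q : G" "q : els D'" by blast
  hence "D q & le q p" using D'[of q] Gdir[OF q(1) assms(2)] by blast
  thus ?thesis using q by blast
qed

abbreviation els' where "els' \<equiv> elts E'"

lemma mem_val: "val x : els' (val y) <-> (EX p:G. FM p x y)"
  by (simp add: elts_iff val_mem)

lemma M1: "opr z s : els x ==> s : G ==> val z : els' (val x)"
proof -
  assume 1: "opr z s : els x" "s : G"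
  have "FM s z x" unfolding FM_def
  proof (intro allI impI)
    fix q assume q: "le q s"
    hence "le q q" "FE q z z" using le_dom le_refl FE_refl by blast+
    thus "EX q' z' s. le q' q & opr z' s : els x & le q' s & FE q' z z'" using 1 q by blast
  qed
  thus ?thesis using 1 val_mem elts_iff[of "val z" E' "val x"] by blast
qed

lemma M2: "u : els' (val x) ==> EX z s. opr z s : els x & s : G & u = val z"
proof -
  assume u: "u : els' (val x)"
  obtain y where y: "u = val y" using val_surj by blast
  then obtain p where p: "p : G" "FM p y x" using u val_mem elts_iff[of u E' "val x"] by blast
  have "EX r:G. le r p & (EX z s. opr z s : els x & le r s & FE r y z)"
  proof (rule generic[OF _ p(1)])
    show "Dn E (%rh. EX z s. opr z s : els x & le (rh 0) s & FE (rh 0) y z)" by (intro dn)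
  qed (use p(2) in \<open>auto simp: FM_def\<close>)
  then obtain r z s where r: "r : G" "opr z s : els x" "le r s" "FE r y z" by blast
  hence "s : G" "val y = val z" using Gup val_eq by blast+
  thus ?thesis using r y by blast
qed

lemma els_val: "els' (val x) = {val z |z s. opr z s : els x & s : G}"
  using M1 M2 by blast

text \<open>\<open>N x y r\<close> expresses that \<open>r\<close> puts some element into
  \<open>x\<close> and keeps it out of \<open>y\<close> for good. Failure of \<open>stp\<close>
  produces such a condition, so the conditions that force equality or satisfy \<open>N\<close> in
  one of the two orders are dense; \<open>N\<close> at a condition in \<open>G\<close> makes the
  extents differ.\<close>

lemma val_ext: assumes "els' (val x) = els' (val y)" shows "val x = val y"
proof -
  define N where "N x y r <-> (EX z s. opr z s : els x & le r s &
     (ALL q z' s'. ~ (le q r & opr z' s' : els y & le q s' & FE q z z')))" for x y r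
  have N: False if e: "els' (val x) = els' (val y)" and r: "r : G" "N x y r" for x y r
  proof -
    obtain z s where z: "opr z s : els x" "le r s" "!!q z' s'. ~ (le q r & opr z' s' : els y & le q s' & FE q z z')"
      using r(2) unfolding N_def by blast
    have "val z : els' (val y)" using M1[OF z(1)] Gup[OF r(1) z(2)] e by blast
    then obtain z' s' where z': "opr z' s' : els y" "s' : G" "val z = val z'" using M2 by blast
    then obtain p where p: "p : G" "FE p z z'" using val_eq by blast
    obtain q1 where q1: "q1 : G" "le q1 p" "le q1 s'" using Gdir p(1) z'(2) by blast
    obtain q where q: "q : G" "le q q1" "le q r" using Gdir q1(1) r(1) by blast
    have "le q s'" "FE q z z'" using le_trans[OF q(2)] q1 FE_mono[OF p(2)] by blast+
    thus False using z(3) q z'(1) by blast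
  qed
  have "EX r:G. le r emp & (FE r x y \<or> N x y r \<or> N y x r)"
  proof (rule generic[OF _ Gtop])
    show "Dn E (%rh. FE (rh 0) x y \<or> N x y (rh 0) \<or> N y x (rh 0))" unfolding N_def by (intro dn)
    fix q assume q: "le q emp"
    have n: "EX r. le r q & N x y r" if ns: "~ stp FE q x y" for x y
    proof -
      obtain z s r where r: "opr z s : els x" "le r q" "le r s"
        "~ (EX q' z' s'. le q' r & opr z' s' : els y & le q' s' & FE q' z z')"
        using ns unfolding stp_def by blast
      hence "N x y r" unfolding N_def by blast
      thus ?thesis using r(2) by blast
    qed
    show "EX r. le r q & (FE r x y \<or> N x y r \<or> N y x r)"
      using n[of x y] n[of y x] FE_iff[of q x y] le_dom[OF q] le_refl[of q] by blast
  qed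
  then obtain r where "r : G" "FE r x y \<or> N x y r \<or> N y x r" by blast
  thus ?thesis using N assms val_eq by metis
qed

lemma ext': "els' u = els' v ==> u = v"
  using val_surj[of u] val_surj[of v] val_ext by auto

text \<open>The forcing theorem. The density arguments behind \<open>FNand\<close> and
  \<open>FAll\<close> rest on the definability of forcing for a fixed formula.\<close>

lemma truth: "sat E' (%n. val (rh n)) \<phi> <-> (EX p:G. fc \<phi> p rh)"
proof (induction \<phi> arbitrary: rh)
  case (FNand \<phi> \<psi>)
  have d: "Dn E (%rh'. fc \<chi> (rh' 0) rh)" for \<chi> by (rule Dn_fc[of "%n _. rh n" "%rh. rh 0" \<chi>]) (rule Fn_const, rule Fn_var)
  show ?case
  proof
    assume s: "sat E' (%n. val (rh n)) (FNand \<phi> \<psi>)"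
    have "EX r:G. le r emp & (fc (FNand \<phi> \<psi>) r rh \<or> (fc \<phi> r rh & fc \<psi> r rh))"
    proof (rule generic[OF _ Gtop])
      show "Dn E (%rh'. fc (FNand \<phi> \<psi>) (rh' 0) rh \<or> (fc \<phi> (rh' 0) rh & fc \<psi> (rh' 0) rh))"
        by (intro Dn_disj Dn_conj d)
      fix q assume "le q emp"
      thus "EX r. le r q & (fc (FNand \<phi> \<psi>) r rh \<or> (fc \<phi> r rh & fc \<psi> r rh))"
        using le_refl[of q] le_dom[of q emp] by auto
    qed
    thus "EX p:G. fc (FNand \<phi> \<psi>) p rh" using s FNand.IH by (metis sat.simps(3))
  next
    assume "EX p:G. fc (FNand \<phi> \<psi>) p rh"
    then obtain p where p: "p : G" "fc (FNand \<phi> \<psi>) p rh" by blast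
    show "sat E' (%n. val (rh n)) (FNand \<phi> \<psi>)" unfolding sat.simps
    proof
      assume "sat E' (%n. val (rh n)) \<phi> & sat E' (%n. val (rh n)) \<psi>"
      then obtain q1 q2 where q: "q1 : G" "fc \<phi> q1 rh" "q2 : G" "fc \<psi> q2 rh" using FNand.IH by blast
      obtain r where r: "r : G" "le r q1" "le r q2" using Gdir q by blast
      obtain t where t: "t : G" "le t r" "le t p" using Gdir r p by blast
      have "fc \<phi> t rh" "fc \<psi> t rh" using fc_mono q r t by blast+
      thus False using p(2) t(3) by auto
    qed
  qed
next
  case (FAll \<phi>)
  have c: "case_nat (val a) (%n. val (rh n)) = (%n. val (case_nat a rh n))" for a
    by (auto simp: fun_eq_iff split: nat.splits)
  have "sat E' (%n. val (rh n)) (FAll \<phi>) <-> (ALL a. sat E' (case_nat (val a) (%n. val (rh n))) \<phi>)"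
    using val_surj by (metis sat.simps(4))
  hence s: "sat E' (%n. val (rh n)) (FAll \<phi>) <-> (ALL a. EX p:G. fc \<phi> p (case_nat a rh))"
    unfolding c FAll.IH .
  show ?case
  proof
    assume a: "sat E' (%n. val (rh n)) (FAll \<phi>)"
    have e: "Fn E (%rh'. case n of 0 => rh' 0 | Suc m => rh m)" for n by (cases n) (auto intro: Fn_const Fn_var)
    have "Dn E (%rh'. fc \<phi> (rh' 1) (%n. case n of 0 => rh' 0 | Suc m => rh m))"
      using Dn_fc[of "%n rh'. case n of 0 => rh' 0 | Suc m => rh m" "%rh'. rh' 1" \<phi>] e Fn_var by blast
    hence d: "Fn E s ==> Fn E t ==> Dn E (%rh'. fc \<phi> (t rh') (case_nat (s rh') rh))" for s t
      by (rule Dn2[where K = "%x y. fc \<phi> y (case_nat x rh)"])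
    have "EX r:G. le r emp & ((ALL a. fc \<phi> r (case_nat a rh)) \<or> (EX a. ALL t. le t r --> ~ fc \<phi> t (case_nat a rh)))"
    proof (rule generic[OF _ Gtop])
      show "Dn E (%rh'. (ALL a. fc \<phi> (rh' 0) (case_nat a rh)) \<or> (EX a. ALL t. le t (rh' 0) --> ~ fc \<phi> t (case_nat a rh)))"
        by (intro Dn_disj Dn_all Dn_ex Dn_imp Dn_not d Dn_mem Fn_opr Fn_var Fn_const)
      fix q assume q: "le q emp"
      show "EX r. le r q & ((ALL a. fc \<phi> r (case_nat a rh)) \<or> (EX a. ALL t. le t r --> ~ fc \<phi> t (case_nat a rh)))"
        using fc_dense[of q \<phi>] le_dom[OF q] le_refl[of q] by blast
    qed
    then obtain r where r: "r : G" "(ALL a. fc \<phi> r (case_nat a rh)) \<or> (EX a. ALL t. le t r --> ~ fc \<phi> t (case_nat a rh))" by blast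
    have "~ (ALL t. le t r --> ~ fc \<phi> t (case_nat a rh))" for a
    proof -
      obtain p where p: "p : G" "fc \<phi> p (case_nat a rh)" using s a by blast
      obtain t where "le t r" "le t p" using Gdir r(1) p(1) by blast
      thus ?thesis using fc_mono[OF p(2)] by blast
    qed
    thus "EX p:G. fc (FAll \<phi>) p rh" using r by auto
  qed (use s in auto)
qed (auto simp: val_mem val_eq)

text \<open>The name \<open>\<nu>\<close> pairs a name \<open>z\<close> occurring in
  \<open>\<tau>\<close> with every condition that both guarantees its membership and forces the
  formula.\<close>

lemma sep': "EX y. els' y = {z : els' x. sat E' (case_nat z rh') \<phi>}"
proof -
  obtain \<tau> where \<tau>: "x = val \<tau>" using val_surj by blast
  define rh where "rh n = (SOME x. rh' n = val x)" for n
  have rh: "rh' n = val (rh n)" for n unfolding rh_def by (rule someI_ex[OF val_surj])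
  have e: "Fn E (%rh'. case n of 0 => rh' 0 | Suc m => rh m)" for n by (cases n) (auto intro: Fn_const Fn_var)
  have "Dn E (%rh'. fc \<phi> (rh' 1) (%n. case n of 0 => rh' 0 | Suc m => rh m))"
    using Dn_fc[of "%n rh'. case n of 0 => rh' 0 | Suc m => rh m" "%rh'. rh' 1" \<phi>] e Fn_var by blast
  hence d: "Fn E s ==> Fn E t ==> Dn E (%rh'. fc \<phi> (t rh') (case_nat (s rh') rh))" for s t
    by (rule Dn2[where K = "%x y. fc \<phi> y (case_nat x rh)"])
  define K where "K z p <-> (EX s. opr z s : els \<tau> & le p s & fc \<phi> p (case_nat z rh))" for z p
  have dK: "Dn E (%rh. K (rh 0) (rh 1))" unfolding K_def by (intro dn d)
  have c: "case_nat (val z) rh' = (%n. val (case_nat z rh n))" for z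
    by (auto simp: fun_eq_iff rh split: nat.splits)
  define \<nu> where "\<nu> = rc (dom \<tau>) P K"
  have \<nu>: "opr z p : els \<nu> <-> z : els (dom \<tau>) & p : els P & K z p" for z p unfolding \<nu>_def by (rule rc_iff[OF dK])
  have "u : els' (val \<nu>) <-> u : els' (val \<tau>) & sat E' (case_nat u rh') \<phi>" for u
  proof
    assume "u : els' (val \<nu>)"
    then obtain z p where z: "opr z p : els \<nu>" "p : G" "u = val z" using M2 by blast
    then obtain s where s: "opr z s : els \<tau>" "le p s" "fc \<phi> p (case_nat z rh)" unfolding \<nu> K_def by blast
    have "u : els' (val \<tau>)" using M1[OF s(1)] Gup z s by blast
    moreover have "sat E' (case_nat u rh') \<phi>" unfolding z(3) c truth using s z by blast
    ultimately show "u : els' (val \<tau>) & sat E' (case_nat u rh') \<phi>" by blast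
  next
    assume u: "u : els' (val \<tau>) & sat E' (case_nat u rh') \<phi>"
    then obtain z s where z: "opr z s : els \<tau>" "s : G" "u = val z" using M2 by blast
    then obtain p where p: "p : G" "fc \<phi> p (case_nat z rh)" using u unfolding z(3) c truth by blast
    obtain q where q: "q : G" "le q p" "le q s" using Gdir p z by blast
    have "K z q" unfolding K_def using z q fc_mono[OF p(2) q(2)] by blast
    hence "opr z q : els \<nu>" unfolding \<nu> dom using z(1) GP[OF q(1)] by blast
    thus "u : els' (val \<nu>)" using M1 q(1) z(3) by blast
  qed
  thus ?thesis using \<tau> by (intro exI[of _ "val \<nu>"]) blast
qed

definition j :: "'v => 'w" where "j x = val (chk x)"

lemma els_j: "els' (j x) = j ` els x"
  unfolding j_def els_val chk_mem using Gtop by auto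

lemma j_empty: "els' (j emp) = {}" by (simp add: els_j)

lemma pair': "EX z. els' z = {u, v}"
proof -
  obtain x y where x: "u = val x" "v = val y" using val_surj by metis
  have "els' (val (mk {opr x emp, opr y emp})) = {u, v}"
    unfolding els_val x using Gtop by (auto simp: els_mk)
  thus ?thesis by blast
qed

sublocale W: zs E'
proof
  show "els' x = els' y ==> x = y" for x y by (rule ext')
  show "EX z. els' z = {x, y}" for x y by (rule pair')
  show sep: "EX y. els' y = {z : els' x. sat E' (case_nat z rh) \<phi>}" for x rh \<phi> by (rule sep')
  show "EX w. is_inductive E' w"
  proof
    have "els' (j (suc x)) = insert (j x) (els' (j x))" for x by (simp add: els_j)
    moreover have "n : els om ==> j (suc n) : els' (j om)" "j emp : els' (j om)" for n
      using om_suc om_0 by (auto simp: els_j)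
    ultimately show "is_inductive E' (j om)" unfolding is_inductive_def
      using j_empty unfolding els_j[of om] by blast
  qed
  show "EX u. els' u = (UN y:els' x. els' y)" for x
  proof -
    obtain \<tau> where \<tau>: "x = val \<tau>" using val_surj by blast
    define B where "B = prd (Uni (Uni (Uni (dom \<tau>)))) (mk {emp})"
    have sub: "z : els (Uni (Uni (Uni (dom \<tau>))))" if "y : els (dom \<tau>)" "opr z t : els y" for y z t
    proof -
      have "mk {z} : els (opr z t)" "z : els (mk {z})" by (simp_all add: opr_def els_mk)
      thus ?thesis using that unfolding els_Un by blast
    qed
    have B: "els' y <= els' (val B)" if "y : els' x" for y
    proof
      fix u assume u: "u : els' y"
      obtain z s where z: "opr z s : els \<tau>" "y = val z" using \<open>y : els' x\<close> \<tau> M2 by blast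
      then obtain w t where w: "opr w t : els z" "u = val w" using u M2 by blast
      have "opr w emp : els B" unfolding B_def using sub[OF _ w(1)] z dom by (auto simp: els_mk)
      thus "u : els' (val B)" using M1 Gtop w by blast
    qed
    \<comment> \<open>In the environment used here, index 0 is \<open>z\<close> and all others are
      \<open>x\<close>; under the quantifier they become 1 and 2. Thus \<open>\<psi>\<close> says
      that no element of \<open>x\<close> contains \<open>z\<close>, and
      \<open>FNand \<psi> \<psi>\<close> negates it.\<close>
    define \<psi> where "\<psi> = FAll (FNand (FMem 0 2) (FMem 1 0))"
    obtain y where "els' y = {z : els' (val B). sat E' (case_nat z (%_. x)) (FNand \<psi> \<psi>)}" using sep by blast
    moreover have "sat E' (case_nat z (%_. x)) (FNand \<psi> \<psi>) <-> (EX y:els' x. z : els' y)" for z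
      unfolding \<psi>_def by (auto simp: numeral_2_eq_2 elts_iff)
    ultimately show ?thesis using B by (intro exI[of _ y]) auto
  qed
  show "EX p. els' p = {y. els' y <= els' x}" for x
  proof -
    obtain \<tau> where \<tau>: "x = val \<tau>" using val_surj by blast
    \<comment> \<open>Every subset of \<open>x\<close> has a name that is a relation between the
      names occurring in \<open>\<tau>\<close> and the conditions, namely \<open>\<mu>\<close>
      below, and these relations form a set of the ground model.\<close>
    define B where "B = prd (pw (prd (dom \<tau>) P)) (mk {emp})"
    have B: "y : els' (val B)" if y: "els' y <= els' x" for y
    proof -
      obtain \<nu> where \<nu>: "y = val \<nu>" using val_surj by blast
      have dK: "Dn E (%rh. FM (rh 1) (rh 0) \<nu>)" by (intro dn)
      define \<mu> where "\<mu> = rc (dom \<tau>) P (%z p. FM p z \<nu>)"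
      have \<mu>: "opr z p : els \<mu> <-> z : els (dom \<tau>) & p : els P & FM p z \<nu>" for z p
        unfolding \<mu>_def by (rule rc_iff[OF dK])
      have "els' (val \<mu>) = els' y"
      proof (intro equalityI subsetI)
        fix u assume "u : els' (val \<mu>)"
        then obtain z p where z: "opr z p : els \<mu>" "p : G" "u = val z" using M2 by blast
        have "FM p z \<nu>" using z(1) unfolding \<mu> by simp
        thus "u : els' y" unfolding \<nu> z(3) mem_val using z(2) by blast
      next
        fix u assume u: "u : els' y"
        hence "u : els' (val \<tau>)" using y \<tau> by blast
        then obtain z s where z: "opr z s : els \<tau>" "u = val z" using M2 by blast
        then obtain p where p: "p : G" "FM p z \<nu>" using u unfolding \<nu> z(2) mem_val by blast
        have "opr z p : els \<mu>" unfolding \<mu> dom using z(1) p GP[OF p(1)] by blast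
        thus "u : els' (val \<mu>)" using M1[OF _ p(1)] z(2) by simp
      qed
      hence "y = val \<mu>" using ext' by blast
      moreover have "els \<mu> <= els (prd (dom \<tau>) P)" unfolding \<mu>_def els_rc[OF dK] by auto
      hence "opr \<mu> emp : els B" unfolding B_def by (simp add: els_mk)
      ultimately show ?thesis using M1 Gtop by blast
    qed
    define \<psi> where "\<psi> = FAll (FNand (FMem 0 1) (FNand (FMem 0 2) (FMem 0 2)))"
    obtain y where "els' y = {z : els' (val B). sat E' (case_nat z (%_. x)) \<psi>}" using sep by blast
    moreover have "sat E' (case_nat z (%_. x)) \<psi> <-> els' z <= els' x" for z
      unfolding \<psi>_def by (auto simp: numeral_2_eq_2 elts_iff)
    ultimately show ?thesis using B by (intro exI[of _ y]) auto
  qed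
qed

subsection \<open>The ground model inside the extension\<close>

lemma FE_sym: "p : els P ==> FE p x y ==> FE p y x"
  using FE_iff by blast

lemma FE_chk: "ALL y. ALL p:els P. FE p (chk x) (chk y) --> x = y"
proof (rule el_induct[where P = "%x. ALL y. ALL p:els P. FE p (chk x) (chk y) --> x = y"])
  fix x assume IH: "!!z. z : els x ==> ALL y. ALL p:els P. FE p (chk z) (chk y) --> z = y"
  show "ALL y. ALL p:els P. FE p (chk x) (chk y) --> x = y"
  proof (intro allI ballI impI)
    fix y p assume p: "p : els P" "FE p (chk x) (chk y)"
    have s: "stp FE p (chk x) (chk y)" "stp FE p (chk y) (chk x)" using p FE_iff by blast+
    have "z : els y" if z: "z : els x" for z
    proof -
      have "opr (chk z) emp : els (chk x)" using z chk_mem by blast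
      then obtain q z' s' where q: "le q p" "opr z' s' : els (chk y)" "FE q (chk z) z'"
        using s(1)[unfolded stp_def, rule_format, of "chk z" emp p] le_refl[OF p(1)] le_top[OF p(1)] by blast
      then obtain w where w: "w : els y" "z' = chk w" unfolding chk_mem by auto
      hence "z = w" using IH[OF z] q le_dom by blast
      thus ?thesis using w by simp
    qed
    moreover have "w : els x" if w: "w : els y" for w
    proof -
      have "opr (chk w) emp : els (chk y)" using w chk_mem by blast
      then obtain q z' s' where q: "le q p" "opr z' s' : els (chk x)" "FE q (chk w) z'"
        using s(2)[unfolded stp_def, rule_format, of "chk w" emp p] le_refl[OF p(1)] le_top[OF p(1)] by blast
      then obtain z where z: "z : els x" "z' = chk z" unfolding chk_mem by auto
      hence "FE q (chk z) (chk w)" using q FE_sym le_dom by blast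
      hence "z = w" using IH[OF z(1)] q le_dom by blast
      thus ?thesis using z by simp
    qed
    ultimately have "els x = els y" by blast
    thus "x = y" by (rule ext)
  qed
qed (intro dn)

lemma j_eq [simp]: "j x = j y <-> x = y"
  unfolding j_def val_eq using FE_chk[of x] FE_refl[of _ "chk x"] GP Gtop by blast

lemma j_mem [simp]: "j x : els' (j y) <-> x : els y"
  by (auto simp: els_j)

lemma j_emp: "W.emp = j emp" by (rule W.ext) (simp add: els_j)
lemma j_suc: "W.suc (j x) = j (suc x)" by (rule W.ext) (simp add: els_j)

lemma j_pair: "W.mk {j x, j y} = j (mk {x, y})"
proof -
  have "els' (j (mk {x, y})) = {j x, j y}" by (simp add: els_j els_mk)
  thus ?thesis using W.mk_els by metis
qed

lemma j_opr: "W.opr (j x) (j y) = j (opr x y)"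
  unfolding W.opr_def opr_def using j_pair[of x x] j_pair[of x y] j_pair[of "mk {x}" "mk {x, y}"] by simp

text \<open>Well-foundedness of a ground relation persists to sets of the extension. Below any
  \<open>q\<close>, take a minimal \<open>y\<close> that some condition \<open>t\<close> below
  \<open>q\<close> forces into \<open>X\<close>; nothing below \<open>t\<close> forces a smaller
  element into \<open>X\<close>, so such conditions are dense. This stands in for foundation in the
  extension.\<close>

lemma j_least:
  assumes "x : els S" "j x : els' X" and lt: "Dn E (%rh. lt (rh 0) (rh 1))"
    and wf: "!!A. els A <= els S ==> A ~= emp ==> EX x:els A. ALL z:els A. ~ lt z x"
  shows "EX x:els S. j x : els' X & (ALL y:els S. lt y x --> j y ~: els' X)"
proof -
  have dl: "Fn E a ==> Fn E b ==> Dn E (%rh. lt (a rh) (b rh))" for a b by (rule Dn2[where K = lt, OF lt])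
  obtain \<tau> where \<tau>: "X = val \<tau>" using val_surj by blast
  have m: "j y : els' X <-> (EX p:G. FM p (chk y) \<tau>)" for y unfolding \<tau> j_def elts_iff val_mem ..
  obtain p where p: "p : G" "FM p (chk x) \<tau>" using assms(2) m by blast
  have "EX r:G. le r p & (EX x:els S. FM r (chk x) \<tau> & (ALL y:els S. lt y x --> (ALL t. le t r --> ~ FM t (chk y) \<tau>)))"
  proof (rule generic[OF _ p(1)])
    show "Dn E (%rh. EX x:els S. FM (rh 0) (chk x) \<tau> & (ALL y:els S. lt y x --> (ALL t. le t (rh 0) --> ~ FM t (chk y) \<tau>)))"
      by (intro dn dl)
    fix q assume q: "le q p"
    define A where "A = mk {y : els S. EX t. le t q & FM t (chk y) \<tau>}"
    have A: "y : els A <-> y : els S & (EX t. le t q & FM t (chk y) \<tau>)" for y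
      unfolding A_def by (subst els_mk) (intro sepI dn, auto)
    have "x : els A" unfolding A using assms(1) FM_mono[OF p(2) q] le_refl le_dom[OF q] by blast
    then obtain y where y: "y : els A" "ALL z:els A. ~ lt z y" using wf[of A] A els_emp by (metis empty_iff subsetI)
    then obtain t where t: "le t q" "FM t (chk y) \<tau>" "y : els S" unfolding A by blast
    have "~ FM t' (chk z) \<tau>" if "z : els S" "lt z y" "le t' t" for z t'
      using y(2) that A[of z] le_trans[OF that(3) t(1)] by blast
    thus "EX r. le r q & (EX x:els S. FM r (chk x) \<tau> & (ALL y:els S. lt y x --> (ALL t. le t r --> ~ FM t (chk y) \<tau>)))"
      using t by blast
  qed
  then obtain r y where r: "r : G" "y : els S" "FM r (chk y) \<tau>"
    "ALL z:els S. lt z y --> (ALL t. le t r --> ~ FM t (chk z) \<tau>)" by blast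
  have "j z ~: els' X" if "z : els S" "lt z y" for z
  proof
    assume "j z : els' X"
    then obtain q where q: "q : G" "FM q (chk z) \<tau>" using m by blast
    obtain t where "le t r" "le t q" using Gdir r q by blast
    thus False using r(4) that FM_mono[OF q(2)] by blast
  qed
  thus ?thesis using r m by blast
qed

lemma j_om: "W.om = j om"
proof -
  have "is_inductive E' (j om)" unfolding W.is_inductive_iff j_emp
    using j_suc om_suc by (auto simp: els_j[of om])
  moreover have "els' (j om) <= els' x" if x: "is_inductive E' x" for x
  proof (rule ccontr)
    assume "~ els' (j om) <= els' x"
    then obtain n where n: "n : els om" "j n ~: els' x" by (auto simp: els_j[of om])
    have "EX n:els om. j n : els' (W.df (j om) x) & (ALL m:els om. m : els n --> j m ~: els' (W.df (j om) x))"
    proof (rule j_least[OF n(1)])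
      show "j n : els' (W.df (j om) x)" using n by simp
      show "EX x:els A. ALL z:els A. z ~: els x" if "A ~= emp" for A
        using ss_min[of "els A"] that empty_iff_emp by auto
    qed (intro dn)
    then obtain n where n: "n : els om" "j n ~: els' x" "ALL m:els om. m : els n --> j m : els' x" by auto
    consider "n = emp" | m where "m : els om" "n = suc m" using om_cases[OF n(1)] by blast
    thus False
    proof cases
      case 1
      thus False using n x unfolding W.is_inductive_iff j_emp by simp
    next
      case 2
      hence "j m : els' x" using n(3) by simp
      thus False using n(2) x 2 unfolding W.is_inductive_iff by (auto simp: j_suc)
    qed
  qed
  ultimately have "is_omega E' (j om)" unfolding is_omega_def by blast
  thus ?thesis unfolding W.is_omega_iff by simp
qed

text \<open>The forcing relation for membership in \<open>f\<close>, restricted to ground elements,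
  is a set of the ground model. Functions between ground sets are handled later through such
  relations \<open>R\<close>.\<close>

lemma jname:
  "EX R. els R <= els (prd P a) & (ALL x:els a. j x : els' f <-> (EX p:G. opr p x : els R)) &
     (ALL p q x. opr p x : els R & le q p --> opr q x : els R)"
proof -
  obtain \<tau> where \<tau>: "f = val \<tau>" using val_surj by blast
  have d: "Dn E (%rh. FM (rh 0) (chk (rh 1)) \<tau>)" by (intro dn)
  have R: "opr p x : els (rc P a (%p x. FM p (chk x) \<tau>)) <-> p : els P & x : els a & FM p (chk x) \<tau>" for p x
    by (rule rc_iff[OF d])
  show ?thesis
  proof (rule exI[of _ "rc P a (%p x. FM p (chk x) \<tau>)"], intro conjI ballI allI impI)
    show "els (rc P a (%p x. FM p (chk x) \<tau>)) <= els (prd P a)" unfolding els_rc[OF d] by auto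
    show "j x : els' f <-> (EX p:G. opr p x : els (rc P a (%p x. FM p (chk x) \<tau>)))" if "x : els a" for x
    proof -
      have "j x : els' f <-> (EX p:G. FM p (chk x) \<tau>)" unfolding \<tau> j_def elts_iff val_mem ..
      thus ?thesis unfolding R using GP that by blast
    qed
    show "opr q x : els (rc P a (%p x. FM p (chk x) \<tau>))"
      if "opr p x : els (rc P a (%p x. FM p (chk x) \<tau>)) & le q p" for p q x
      using that le_dom FM_mono unfolding R by blast
  qed
qed

definition g :: 'w where "g = val (mk ((%p. opr (chk p) p) ` els P))"

lemma els_g: "els' g = j ` G"
proof -
  have f: "Fn E (%rh. opr (chk (rh 0)) (rh 0))" by (intro dn)
  have "els (mk ((%p. opr (chk p) p) ` els P)) = (%p. opr (chk p) p) ` els P" by (rule els_mk[OF repl_fun[OF f]])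
  thus ?thesis unfolding g_def els_val j_def using GP by auto blast
qed

definition upn :: "'v => 'v => 'v" where "upn x y = mk {opr x emp, opr y emp}"

lemma val_upn: "val (upn x y) = W.mk {val x, val y}"
proof -
  have "els' (val (upn x y)) = {val x, val y}" unfolding els_val upn_def using Gtop by (auto simp: els_mk)
  thus ?thesis using W.mk_els by metis
qed

text \<open>The canonical name of each name \<open>x\<close> in the domain of \<open>\<tau>\<close>
  is paired with \<open>x\<close> itself; the result \<open>H\<close> names the evaluation map on
  this domain, whose values include all elements of \<open>a\<close>. Well-orderings of the
  extension are derived from it.\<close>

lemma enum:
  "EX S h Y. is_fun E' h (j S) Y & (ALL u:els' a. EX s:els S. W.ap h (j s) = u)"
proof -
  obtain \<tau> where \<tau>: "a = val \<tau>" using val_surj by blast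
  define opn where "opn x y = upn (upn x x) (upn x y)" for x y
  have opn: "val (opn x y) = W.opr (val x) (val y)" for x y unfolding opn_def val_upn W.opr_def by simp
  have f: "Fn E (%rh. opr (opn (chk (rh 0)) (rh 0)) emp)" unfolding opn_def upn_def by (intro dn)
  define H where "H = mk ((%x. opr (opn (chk x) x) emp) ` els (dom \<tau>))"
  have H: "els H = (%x. opr (opn (chk x) x) emp) ` els (dom \<tau>)" unfolding H_def by (rule els_mk[OF repl_fun[OF f]])
  have h: "els' (val H) = {W.opr (j x) (val x) |x. x : els (dom \<tau>)}"
    unfolding els_val H j_def opn[symmetric] using Gtop by auto
  have Y: "els' (val (prd (dom \<tau>) (mk {emp}))) = {val x |x. x : els (dom \<tau>)}"
    unfolding els_val using Gtop by (auto simp: els_mk)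
  have fn: "is_fun E' (val H) (j (dom \<tau>)) (val (prd (dom \<tau>) (mk {emp})))"
    unfolding W.is_fun_iff h els_j
  proof (intro conjI ballI subsetI)
    fix p assume "p : {W.opr (j x) (val x) |x. x : els (dom \<tau>)}"
    thus "p : els' (W.prd (j (dom \<tau>)) (val (prd (dom \<tau>) (mk {emp}))))" using Y els_j[of "dom \<tau>"] by auto
  next
    fix u assume "u : j ` els (dom \<tau>)"
    thus "EX! y. W.opr u y : {W.opr (j x) (val x) |x. x : els (dom \<tau>)}" by auto
  qed
  show ?thesis
  proof (intro exI conjI ballI)
    show "is_fun E' (val H) (j (dom \<tau>)) (val (prd (dom \<tau>) (mk {emp})))" by (rule fn)
    fix u assume "u : els' a"
    then obtain z s where z: "opr z s : els \<tau>" "u = val z" using M2 \<tau> by blast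
    hence zd: "z : els (dom \<tau>)" using dom by blast
    have "W.opr (j z) (val z) : els' (val H)" unfolding h using zd by blast
    hence "W.ap (val H) (j z) = val z" using W.fun_val(3)[OF fn, of "j z" "val z"] zd by simp
    thus "EX s:els (dom \<tau>). W.ap (val H) (j s) = u" using z zd by blast
  qed
qed

end

section \<open>Regularity from the diamond\<close>

context zfc begin

lemma is_aleph_uniq: "is_aleph E n k ==> is_aleph E n k' ==> k = k'"
proof (induction n arbitrary: k k')
  case 0
  thus ?case by (simp add: is_omega_iff)
next
  case (Suc n)
  obtain l where l: "l : els k" "is_aleph E n l" "!!m. m : els k ==> is_card E m ==> ~ E l m" "is_card E k"
    using Suc.prems(1) by auto
  obtain l' where l': "l' : els k'" "is_aleph E n l'" "!!m. m : els k' ==> is_card E m ==> ~ E l' m" "is_card E k'"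
    using Suc.prems(2) by auto
  have ll: "l = l'" using Suc.IH l l' by blast
  have "k ~: els k'" using l'(3)[of k] l ll by (auto simp: elts_iff)
  moreover have "k' ~: els k" using l(3)[of k'] l' ll by (auto simp: elts_iff)
  ultimately show ?case using ord_lin[of k k'] l(4) l'(4) unfolding is_card_def by blast
qed

lemma aleph_ord: "is_aleph E n k ==> is_ord E k"
  by (cases n) (auto simp: is_omega_iff ord_om is_card_def)

text \<open>The form in which regularity is used: the cofinality of \<open>t\<close> exceeds the
  size of \<open>a\<close>. Boundedness is strict, so for nonempty \<open>a\<close> it also excludes
  a last element of \<open>t\<close>.\<close>

definition bnd :: "'v => 'v => bool" where
  "bnd a t <-> (ALL f. is_fun E f a t --> (EX b:els t. ALL i:els a. ap f i : els b))"

lemma Dn_bnd [dn]: "Fn E a ==> Fn E b ==> Dn E (%rh. bnd (a rh) (b rh))"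
proof (rule Dn2[where K = bnd])
  show "Dn E (%rh. bnd (rh 0) (rh 1))" unfolding bnd_def by (intro dn)
qed

text \<open>The least element of \<open>t\<close> satisfying \<open>Q\<close>, presented as the set
  of its predecessors, which makes it visibly definable.\<close>

definition lst :: "'v => ('v => bool) => 'v" where "lst t Q = mk {x : els t. ALL y:els (suc x). ~ Q y}"

lemma lst:
  assumes t: "is_ord E t" and Q: "Dn E (%rh. Q (rh 0))" and ex: "EX b:els t. Q b"
  shows "lst t Q : els t & Q (lst t Q) & (ALL y:els (lst t Q). ~ Q y)"
proof -
  obtain b where b: "b : els t" "Q b" "ALL y:els b. ~ Q y" using ord_least[OF t _ _ Q] ex by blast
  have "{x : els t. ALL y:els (suc x). ~ Q y} = els b"
  proof (intro equalityI subsetI)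
    fix x assume x: "x : {x : els t. ALL y:els (suc x). ~ Q y}"
    hence "x ~= b" "b ~: els x" using b(2) by auto
    thus "x : els b" using ord_lin_in[OF t b(1)] x by blast
  next
    fix x assume "x : els b"
    thus "x : {x : els t. ALL y:els (suc x). ~ Q y}"
      using b ord_trans[OF t] ord_trans[OF ord_el[OF t b(1)]] by auto
  qed
  hence "lst t Q = b" unfolding lst_def by simp
  thus ?thesis using b by simp
qed

lemma Fn_lst:
  assumes "Dn E (%rh. Q (rh 0) (rh 1))" shows "Fn E (%rh. lst t (Q (rh 0)))"
proof -
  have d: "Fn E a ==> Fn E b ==> Dn E (%rh. Q (a rh) (b rh))" for a b by (rule Dn2[where K = Q, OF assms])
  show ?thesis unfolding lst_def
    by (rule Fn_mk) (intro sepI dn d, unfold mem_Collect_eq, intro dn d)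
qed

lemma bnd_coll:
  assumes t: "is_ord E t" and b: "bnd a t" and Q: "Dn E (%rh. Q (rh 0) (rh 1))"
    and ex: "!!x. x : els a ==> EX b:els t. Q x b"
    and mono: "!!x b b'. x : els a ==> Q x b ==> b : els b' ==> b' : els t ==> Q x b'"
  shows "EX b:els t. ALL x:els a. Q x b"
proof -
  have h: "Fn E (%rh. lst t (Q (rh 0)))" by (rule Fn_lst[OF Q])
  have l: "lst t (Q x) : els t & Q x (lst t (Q x))" if "x : els a" for x
  proof -
    have "Dn E (%rh. Q x (rh 0))" by (rule Dn2[where K = Q, OF Q]) (intro dn)+
    thus ?thesis using lst[OF t _ ex[OF that]] by blast
  qed
  let ?f = "lam a t (%x. lst t (Q x))"
  have v: "!!x. x : els a ==> lst t (Q x) : els t" using l by blast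
  have "is_fun E ?f a t" by (rule lam_fun[OF h]) (rule v)
  then obtain b where b: "b : els t" "ALL i:els a. ap ?f i : els b" using b unfolding bnd_def by blast
  have L: "ap ?f x = lst t (Q x)" if "x : els a" for x by (rule lam_ap[OF h _ that]) (rule v)
  have "Q x b" if "x : els a" for x using mono[OF that] l[OF that] L[OF that] b that by fastforce
  thus ?thesis using b by blast
qed

lemma fin_coll:
  assumes t: "is_ord E t" "els t ~= {}" and x: "fin x" and Q: "Dn E (%rh. Q (rh 0) (rh 1))"
    and ex: "!!z. z : els x ==> EX b:els t. Q z b"
    and mono: "!!z b b'. z : els x ==> Q z b ==> b : els b' ==> b' : els t ==> Q z b'"
  shows "EX b:els t. ALL z:els x. Q z b"
proof -
  have d: "Fn E a ==> Fn E b ==> Dn E (%rh. Q (a rh) (b rh))" for a b by (rule Dn2[where K = Q, OF Q])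
  have "els x <= els x --> (EX b:els t. ALL z:els x. Q z b)"
  proof (rule fin_induct[where P = "%y. els y <= els x --> (EX b:els t. ALL z:els y. Q z b)", OF x])
    show "Dn E (%rh. els (rh 0) <= els x --> (EX b:els t. ALL z:els (rh 0). Q z b))" by (intro dn d)
    show "els emp <= els x --> (EX b:els t. ALL z:els emp. Q z b)" using t(2) by auto
    fix y z assume y: "els y <= els x" "z : els x" "els y <= els x --> (EX b:els t. ALL z:els y. Q z b)"
    then obtain b where b: "b : els t" "ALL z:els y. Q z b" by blast
    obtain b' where b': "b' : els t" "Q z b'" using ex y(2) by blast
    obtain c where c: "c : els t" "b = c \<or> b : els c" "b' = c \<or> b' : els c" using ord_max[OF t(1) b(1) b'(1)] .
    have "Q z c" using c(3) b'(2) mono[OF y(2) b'(2) _ c(1)] by blast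
    moreover have "Q u c" if "u : els y" for u
      using c(2) b(2) that mono[of u b c] y(1) c(1) by blast
    ultimately show "els (ins z y) <= els x --> (EX b:els t. ALL z:els (ins z y). Q z b)" using c(1) by auto
  qed
  thus ?thesis by blast
qed

text \<open>If \<open>suc x\<close> is not below \<open>k\<close>, then \<open>k\<close> consists of
  the elements of \<open>x\<close> and \<open>x\<close> itself. As \<open>x\<close> includes
  \<omega>, a shift along \<omega> is a bijection from \<open>x\<close> to \<open>k\<close>,
  contrary to \<open>k\<close> being a cardinal.\<close>

lemma card_limit: assumes k: "is_card E k" "om : els k" and x: "x : els k" shows "suc x : els k"
proof (rule ccontr)
  assume n: "suc x ~: els k"
  have ok: "is_ord E k" using k unfolding is_card_def by blast
  have ek: "els k = insert x (els x)"
  proof (intro equalityI subsetI)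
    fix y assume y: "y : els k"
    have ox: "is_ord E x" by (rule ord_el[OF ok x])
    have "is_ord E (suc x)" using ox unfolding is_ord_def is_trans_def by auto
    hence "suc x = k \<or> k : els (suc x)" using ord_lin[OF _ ok] n by blast
    thus "y : insert x (els x)"
    proof
      assume "suc x = k"
      thus ?thesis using y by auto
    next
      assume "k : els (suc x)"
      thus ?thesis using x el_asym el_irrefl by auto
    qed
  next
    fix y assume "y : insert x (els x)"
    thus "y : els k" using x ord_trans[OF ok] by blast
  qed
  have omx: "els om <= els x"
  proof -
    have "om = x \<or> om : els x" using k(2) ek by auto
    thus ?thesis using ord_trans[OF ord_el[OF ok x]] by blast
  qed
  \<comment> \<open>\<open>emp\<close> is sent to the extra point \<open>x\<close>, a successor to
    its predecessor, which is its union, and everything outside of \<omega> to itself.\<close>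
  let ?h = "%y. if y = emp then x else if y : els om then Uni y else y"
  have U: "Uni (suc m) = m" if "m : els om" for m
    using om_trans[OF that] by (auto simp: els_eq_iff)
  have h: "Fn E (%rh. ?h (rh 0))" by (intro Fn_if dn)
  have Uom: "EX m:els om. y = suc m & Uni y = m" if "y : els om" "y ~= emp" for y
    using om_cases[OF that(1)] that(2) U by blast
  have v: "?h y : els k" if "y : els x" for y
    using that ek omx Uom[of y] x by auto
  let ?f = "lam x k ?h"
  have f: "is_fun E ?f x k" by (rule lam_fun[OF h]) (rule v)
  have L: "ap ?f y = ?h y" if "y : els x" for y by (rule lam_ap[OF h _ that]) (rule v)
  have xom: "x ~: els om" using omx el_irrefl[of x] by blast
  have inj: "y = z" if yz: "y : els x" "z : els x" "?h y = ?h z" for y z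
  proof -
    have xx: "y ~= x" "z ~= x" using yz el_irrefl by auto
    consider "y = emp" | "y ~= emp" "y : els om" | "y ~: els om" by blast
    thus ?thesis
    proof cases
      case 1
      thus ?thesis using yz xx xom Uom[of z] by (auto split: if_splits)
    next
      case 2
      then obtain m where m: "m : els om" "y = suc m" "Uni y = m" using Uom by blast
      thus ?thesis using 2 yz xx xom Uom[of z] by (auto split: if_splits)
    next
      case 3
      hence "y ~= emp" using om_0 by blast
      thus ?thesis using 3 yz xx xom Uom[of z] by (auto split: if_splits)
    qed
  qed
  have sur: "EX y:els x. ?h y = z" if z: "z : els k" for z
  proof -
    consider "z = x" | "z : els om" | "z : els x" "z ~: els om" using z ek by auto
    thus ?thesis
    proof cases
      case 1
      thus ?thesis using omx om_0 by (intro bexI[of _ emp]) auto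
    next
      case 2
      have "suc z ~= emp" using empty_iff_emp[of "suc z"] by simp
      thus ?thesis using omx om_suc[OF 2] U[OF 2] by (intro bexI[of _ "suc z"]) auto
    next
      case 3
      hence "z ~= emp" using om_0 by blast
      thus ?thesis using 3 by (intro bexI[of _ z]) auto
    qed
  qed
  have "bij_betw (ap ?f) (els x) (els k)" unfolding bij_betw_def inj_on_def
  proof (intro conjI ballI impI)
    show "y = z" if "y : els x" "z : els x" "ap ?f y = ap ?f z" for y z
      using inj[OF that(1,2)] that(3) unfolding L[OF that(1)] L[OF that(2)] .
    show "ap ?f ` els x = els k"
    proof (intro equalityI subsetI)
      fix z assume "z : ap ?f ` els x"
      thus "z : els k" using fun_val(2)[OF f] by blast
    next
      fix z assume "z : els k"
      then obtain y where "y : els x" "?h y = z" using sur by blast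
      thus "z : ap ?f ` els x" using L[of y] by (intro image_eqI[of _ _ y]) auto
    qed
  qed
  hence "bij_betw (app E ?f) (els x) (els k)"
    using app_ap[OF f] bij_betw_cong[of "els x" "app E ?f" "ap ?f"] by simp
  hence "equipotent E x k" using f unfolding equipotent_def by blast
  thus False using k x unfolding is_card_def by blast
qed

end

section \<open>Labels from the diamond, and regularity of \<open>k2\<close> and
  \<open>k3\<close>\<close>

locale ground = zfc E for E :: "'v => 'v => bool" +
  fixes k2 k3 s P L :: 'v
  assumes al2: "is_aleph E 2 k2" and al3: "is_aleph E 3 k3"
    and s_def: "els s = {\<delta> : els k3. is_cof E \<delta> k2}" and dia: "diamond E k3 s"
    and coh: "is_cohen_forcing E k3 P L"
begin

lemma ord_k2: "is_ord E k2" and ord_k3: "is_ord E k3" using al2 al3 aleph_ord by blast+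

lemma om_k2: "om : els k2"
proof -
  obtain l where l: "l : els k2" "is_aleph E 1 l" using al2 by (auto simp: numeral_2_eq_2)
  hence "om : els l" by (auto simp: is_omega_iff)
  thus ?thesis using ord_trans[OF ord_k2] l by blast
qed

lemma k2_k3: "k2 : els k3"
proof -
  have "(3::nat) = Suc 2" by simp
  then obtain l where l: "l : els k3" "is_aleph E 2 l" using al3 by (metis is_aleph.simps(2))
  thus ?thesis using is_aleph_uniq[OF al2] by blast
qed

lemma om_k3: "om : els k3" using ord_trans[OF ord_k3 om_k2 k2_k3] .

lemma k3_suc: "x : els k3 ==> suc x : els k3"
proof (rule card_limit)
  have "(3::nat) = Suc 2" by simp
  thus "is_card E k3" using al3 by (metis is_aleph.simps(2))
qed (rule om_k3)

lemma s_bnd: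
  assumes "\<delta> : els s" "b : els k2" shows "bnd b \<delta>"
  unfolding bnd_def
proof (intro allI impI)
  fix f assume f: "is_fun E f b \<delta>"
  have c: "is_cof E \<delta> k2" "\<delta> : els k3" using assms s_def by auto
  hence "~ cofinal_map E f b \<delta>" using assms(2) unfolding is_cof_def by blast
  then obtain x where x: "x : els \<delta>" "ALL i:els b. ~ (x = ap f i \<or> x : els (ap f i))"
    using f app_ap[OF f] unfolding cofinal_map_def by (auto simp: elts_iff)
  have "ap f i : els x" if "i : els b" for i
    using ord_lin_in[OF ord_el[OF ord_k3 c(2)] x(1) fun_val(2)[OF f that]] x(2) that by blast
  thus "EX x:els \<delta>. ALL i:els b. ap f i : els x" using x by blast
qed

definition gd :: 'v where
  "gd = (SOME g. EX p. els p = {x. els x <= els k3} & is_fun E g s p &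
        (ALL x. els x <= els k3 --> stationary E k3 {\<delta> : els s. els x \<inter> els \<delta> = els (app E g \<delta>)}))"

lemma gd:
  assumes "els x <= els k3" "els c <= els k3" "!!x. x : els k3 ==> EX y:els c. x : els y"
    "!!\<delta>. \<delta> : els k3 ==> \<delta> ~= emp ==> (!!x. x : els \<delta> ==> EX y:els c. y : els \<delta> & x : els y) ==> \<delta> : els c"
  shows "EX \<delta>:els s. \<delta> : els c & els x \<inter> els \<delta> = els (ap gd \<delta>)"
proof -
  have "EX g p. els p = {x. els x <= els k3} & is_fun E g s p &
        (ALL x. els x <= els k3 --> stationary E k3 {\<delta> : els s. els x \<inter> els \<delta> = els (app E g \<delta>)})"
    using dia unfolding diamond_def by blast
  from someI_ex[OF this] obtain p where p: "is_fun E gd s p"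
    "!!x. els x <= els k3 ==> stationary E k3 {\<delta> : els s. els x \<inter> els \<delta> = els (app E gd \<delta>)}"
    unfolding gd_def[symmetric] by blast
  have "club E k3 c" unfolding club_def
  proof (intro conjI ballI impI)
    show "EX y:els c. E x y" if "x : els k3" for x using assms(3)[OF that] by (auto simp: elts_iff)
    fix \<delta> assume d: "\<delta> : els k3" "els \<delta> ~= {} & (ALL x:els \<delta>. EX y:els c \<inter> els \<delta>. E x y)"
    show "\<delta> : els c"
    proof (rule assms(4)[OF d(1)])
      show "\<delta> ~= emp" using d(2) by auto
      show "EX y:els c. y : els \<delta> & x : els y" if "x : els \<delta>" for x
        using d(2) that elts_iff[of x E] by blast
    qed
  qed (rule assms)
  then obtain \<delta> where "\<delta> : els c" "\<delta> : els s" "els x \<inter> els \<delta> = els (app E gd \<delta>)"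
    using p(2)[OF assms(1)] unfolding stationary_def by blast
  thus ?thesis using app_ap[OF p(1)] by auto
qed

text \<open>The diamond sequence labels ordinals below \<open>k3\<close> by ordinals below \<open>k2\<close>: \<open>\<xi>\<close> gets the label \<open>\<alpha>\<close> if the
  guess at \<open>\<xi>\<close> is \<open>{\<alpha>}\<close>.\<close>

definition lab :: "'v => 'v => bool" where "lab \<xi> \<alpha> <-> \<xi> : els s & els (ap gd \<xi>) = {\<alpha>}"

lemma Dn_lab [dn]: "Fn E a ==> Fn E b ==> Dn E (%rh. lab (a rh) (b rh))"
proof (rule Dn2[where K = lab])
  have "lab x y <-> x : els s & (ALL z. z : els (ap gd x) <-> z = y)" for x y unfolding lab_def by auto
  thus "Dn E (%rh. lab (rh 0) (rh 1))" by (simp only:) (intro dn)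
qed

lemma lab_uniq: "lab \<xi> \<alpha> ==> lab \<xi> \<beta> ==> \<alpha> = \<beta>" by (simp add: lab_def)
lemma lab_k3: "lab \<xi> \<alpha> ==> \<xi> : els k3" by (simp add: lab_def s_def)

text \<open>The set \<open>{\<alpha>}\<close> is guessed on a stationary set, which meets the club
  of ordinals above \<open>\<alpha>\<close> and \<open>\<gamma>\<close>; there the guess is all of
  \<open>{\<alpha>}\<close>.\<close>

lemma lab_ex: assumes "\<alpha> : els k3" "\<gamma> : els k3" shows "EX \<xi>. lab \<xi> \<alpha> & \<gamma> : els \<xi>"
proof -
  define c where "c = mk {\<xi> : els k3. \<gamma> : els \<xi> & \<alpha> : els \<xi>}"
  have c: "\<xi> : els c <-> \<xi> : els k3 & \<gamma> : els \<xi> & \<alpha> : els \<xi>" for \<xi>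
    unfolding c_def by (subst els_mk) (intro sepI dn, auto)
  have "EX \<delta>:els s. \<delta> : els c & els (mk {\<alpha>}) \<inter> els \<delta> = els (ap gd \<delta>)"
  proof (rule gd)
    show "els (mk {\<alpha>}) <= els k3" using assms by (simp add: els_mk)
    show "els c <= els k3" using c by blast
    fix x assume x: "x : els k3"
    obtain y where y: "y : els k3" "x = y \<or> x : els y" "\<gamma> = y \<or> \<gamma> : els y" using ord_max[OF ord_k3 x assms(2)] .
    obtain z where z: "z : els k3" "y = z \<or> y : els z" "\<alpha> = z \<or> \<alpha> : els z" using ord_max[OF ord_k3 y(1) assms(1)] .
    have "x : els (suc z)" "\<gamma> : els (suc z)" "\<alpha> : els (suc z)"
      using y z ord_trans[OF ord_el[OF ord_k3 z(1)]] by auto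
    thus "EX y:els c. x : els y" using c k3_suc[OF z(1)] by blast
  next
    fix \<delta> assume d: "\<delta> : els k3" "\<delta> ~= emp" "!!x. x : els \<delta> ==> EX y:els c. y : els \<delta> & x : els y"
    then obtain x where "x : els \<delta>" using empty_iff_emp by blast
    then obtain y where "y : els c" "y : els \<delta>" using d by blast
    thus "\<delta> : els c" using c d(1) ord_trans[OF ord_el[OF ord_k3 d(1)]] by blast
  qed
  then obtain \<delta> where d: "\<delta> : els s" "\<delta> : els c" "els (mk {\<alpha>}) \<inter> els \<delta> = els (ap gd \<delta>)" by blast
  hence "els (ap gd \<delta>) = {\<alpha>}" using c by (auto simp: els_mk)
  thus ?thesis using d c unfolding lab_def by blast
qed

lemma s_ne: "EX \<delta>. \<delta> : els s"
  using lab_ex[OF om_k3 om_k3] unfolding lab_def by blast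

lemma one_k2: "suc emp : els k2"
  using ord_trans[OF ord_k2 om_suc[OF om_0] om_k2] .

text \<open>\<open>k2\<close> is the cofinality of some \<open>\<delta>\<close>, and cofinalities
  are regular. With a cofinal \<open>h\<close> into \<open>\<delta>\<close>, the values of
  \<open>h\<close> up to \<open>f i\<close> have a bound in \<open>\<delta>\<close> for each
  \<open>i\<close>, and so have these bounds for all \<open>i\<close> in \<open>b\<close>; an
  \<open>h l\<close> not below the final bound makes \<open>l\<close> a bound of
  \<open>f\<close>.\<close>

lemma bnd_k2: assumes "b : els k2" shows "bnd b k2"
  unfolding bnd_def
proof (intro allI impI)
  fix f assume f: "is_fun E f b k2"
  obtain \<delta> where d: "\<delta> : els s" using s_ne by blast
  hence dc: "is_cof E \<delta> k2" "\<delta> : els k3" using s_def by auto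
  hence od: "is_ord E \<delta>" using ord_el ord_k3 by blast
  obtain h where h: "is_fun E h k2 \<delta>" "ALL x:els \<delta>. EX i:els k2. x = ap h i \<or> x : els (ap h i)"
    using dc(1) app_ap[of h k2 \<delta>] unfolding is_cof_def cofinal_map_def by (metis app_ap elts_iff)
  define Q where "Q i c <-> (ALL l:els k2. l : els (ap f i) \<or> l = ap f i --> ap h l : els c)" for i c
  \<comment> \<open>That \<open>\<delta>\<close> is a limit is read off from the strict boundedness
    of maps on a one-element set.\<close>
  have dlim: "EX c:els \<delta>. x : els c" if "x : els \<delta>" for x
  proof -
    let ?f = "lam (suc emp) \<delta> (%_. x)"
    have h: "Fn E (%rh. x)" by (intro dn)
    have f: "is_fun E ?f (suc emp) \<delta>" by (rule lam_fun[OF h]) (rule that)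
    have "ap ?f emp = x" by (rule lam_ap[OF h]) (use that in simp_all)
    moreover obtain c where "c : els \<delta>" "ALL i:els (suc emp). ap ?f i : els c"
      using s_bnd[OF d one_k2] f unfolding bnd_def by blast
    ultimately show ?thesis by auto
  qed
  have "EX c:els \<delta>. ALL i:els b. Q i c"
  proof (rule bnd_coll[OF od s_bnd[OF d assms]])
    show "Dn E (%rh. Q (rh 0) (rh 1))" unfolding Q_def by (intro dn)
    fix i assume i: "i : els b"
    have fi: "ap f i : els k2" using fun_val(2)[OF f i] .
    have "EX c:els \<delta>. ALL l:els (ap f i). ap h l : els c"
    proof (rule bnd_coll[OF od s_bnd[OF d fi]])
      show "Dn E (%rh. ap h (rh 0) : els (rh 1))" by (intro dn)
      show "EX c:els \<delta>. ap h l : els c" if "l : els (ap f i)" for l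
        using dlim fun_val(2)[OF h(1)] ord_trans[OF ord_k2 that fi] by blast
      show "ap h l : els c'" if "ap h l : els c" "c : els c'" "c' : els \<delta>" for l c c'
        using that ord_trans[OF ord_el[OF od]] by blast
    qed
    then obtain c where c: "c : els \<delta>" "ALL l:els (ap f i). ap h l : els c" by blast
    obtain c2 where c2: "c2 : els \<delta>" "ap h (ap f i) : els c2" using dlim fun_val(2)[OF h(1) fi] by blast
    obtain c3 where c3: "c3 : els \<delta>" "c = c3 \<or> c : els c3" "c2 = c3 \<or> c2 : els c3" using ord_max[OF od c(1) c2(1)] .
    have "Q i c3" unfolding Q_def using c c2 c3 ord_trans[OF ord_el[OF od c3(1)]] by blast
    thus "EX c:els \<delta>. Q i c" using c3(1) by blast
  next
    show "Q i c'" if "Q i c" "c : els c'" "c' : els \<delta>" for i c c'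
      using that ord_trans[OF ord_el[OF od that(3)]] unfolding Q_def by blast
  qed
  then obtain c where c: "c : els \<delta>" "ALL i:els b. Q i c" by blast
  obtain l where l: "l : els k2" "c = ap h l \<or> c : els (ap h l)" using h(2) c(1) by blast
  have "ap f i : els l" if i: "i : els b" for i
  proof (rule ccontr)
    assume "ap f i ~: els l"
    hence "l : els (ap f i) \<or> l = ap f i" using ord_lin_in[OF ord_k2 l(1) fun_val(2)[OF f i]] by blast
    hence "ap h l : els c" using c(2) i l(1) unfolding Q_def by blast
    thus False using l(2) el_irrefl el_asym by blast
  qed
  thus "EX l:els k2. ALL i:els b. ap f i : els l" using l by blast
qed

text \<open>For a least unbounded map into \<open>k3\<close>, its suprema would form a club avoiding \<open>s\<close>.\<close>

lemma bnd_k3: "bnd k2 k3"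
proof (rule ccontr)
  assume n: "~ bnd k2 k3"
  have "k2 : els (suc k2)" by simp
  moreover have "is_ord E (suc k2)" using ord_k2 unfolding is_ord_def is_trans_def by auto
  moreover have "Dn E (%rh. ~ bnd (rh 0) k3)" by (intro dn)
  ultimately obtain b where b: "b : els (suc k2)" "~ bnd b k3" "ALL i:els b. bnd i k3"
    using ord_least[of "suc k2" k2 "%b. ~ bnd b k3"] n by blast
  have ob: "is_ord E b" using b(1) ord_k2 ord_el by auto
  have bk: "els b <= els k2" using b(1) ord_trans[OF ord_k2] by auto
  obtain f where f: "is_fun E f b k3" "!!x. x : els k3 ==> EX i:els b. ap f i ~: els x" using b(2) unfolding bnd_def by blast
  define Q where "Q i c <-> (ALL l:els i. ap f l : els c)" for i c
  have dQ: "Dn E (%rh. Q (rh 0) (rh 1))" unfolding Q_def by (intro dn)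
  have tr: "!!x y z. z : els k3 ==> y : els z ==> x : els y ==> x : els z" using ord_trans ord_el ord_k3 by blast
  have ex: "EX c:els k3. Q i c" if i: "i : els b" for i
    unfolding Q_def
  proof (rule bnd_coll[OF ord_k3])
    show "bnd i k3" using b(3) i by blast
    show "Dn E (%rh. ap f (rh 0) : els (rh 1))" by (intro dn)
    show "EX c:els k3. ap f l : els c" if "l : els i" for l
      using k3_suc[OF fun_val(2)[OF f(1) ord_trans[OF ob that i]]] by (intro bexI[of _ "suc (ap f l)"]) auto
  qed (use tr in blast)
  \<comment> \<open>The least strict bound of \<open>f\<close> on the predecessors of
    \<open>i\<close>. It exists below \<open>k3\<close> because \<open>b\<close> is the least place
    where boundedness fails.\<close>
  define f' where "f' i = lst k3 (Q i)" for i
  have Ff: "Fn E (%rh. f' (rh 0))" unfolding f'_def by (rule Fn_lst[OF dQ])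
  have f': "f' i : els k3" "!!l. l : els i ==> ap f l : els (f' i)" "!!y. y : els (f' i) ==> ~ Q i y"
    if "i : els b" for i
  proof -
    have "Dn E (%rh. Q i (rh 0))" by (rule Dn2[where K = Q, OF dQ]) (intro dn)+
    from lst[OF ord_k3 this ex[OF that]]
    show "f' i : els k3" "!!l. l : els i ==> ap f l : els (f' i)" "!!y. y : els (f' i) ==> ~ Q i y"
      unfolding f'_def Q_def by auto
  qed
  have blim: "suc i : els b" if i: "i : els b" for i
  proof (rule ccontr)
    assume "suc i ~: els b"
    hence "~ suc i : els b" .
    have oi: "is_ord E (suc i)" using ord_el[OF ob i] unfolding is_ord_def is_trans_def by auto
    have e: "!!l. l : els b ==> l = i \<or> l : els i"
    proof -
      fix l assume l: "l : els b"
      show "l = i \<or> l : els i"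
      proof (rule ccontr)
        assume "~ (l = i \<or> l : els i)"
        hence il: "i : els l" using ord_lin_in[OF ob l i] by blast
        have "suc i = l \<or> suc i : els l \<or> l : els (suc i)" using ord_lin[OF oi ord_el[OF ob l]] by blast
        thus False
          using il l \<open>suc i ~: els b\<close> ord_trans[OF ob] el_asym[of i l] el_irrefl[of i] by auto
      qed
    qed
    obtain c where c: "c : els k3" "f' i = c \<or> f' i : els c" "suc (ap f i) = c \<or> suc (ap f i) : els c"
      using ord_max[OF ord_k3 f'(1)[OF i] k3_suc[OF fun_val(2)[OF f(1) i]]] .
    have "ap f l : els c" if "l : els b" for l
    proof -
      have "ap f l : els (f' i) \<or> ap f l : els (suc (ap f i))" using e[OF that] f'(2)[OF i] by auto
      moreover have "els (f' i) <= els c" using c(2) tr[OF c(1)] by blast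
      moreover have "els (suc (ap f i)) <= els c" using c(3) tr[OF c(1)] by blast
      ultimately show ?thesis by blast
    qed
    thus False using f(2)[OF c(1)] by blast
  qed
  have mono: "f' l = f' i \<or> f' l : els (f' i)" if "i : els b" "l : els i" for i l
  proof (rule ccontr)
    assume c: "~ ?thesis"
    have lb: "l : els b" using ord_trans[OF ob that(2,1)] .
    hence "f' i : els (f' l)" using c ord_lin_in[OF ord_k3 f'(1)[OF lb] f'(1)[OF that(1)]] by blast
    moreover have "Q l (f' i)" unfolding Q_def using f'(2)[OF that(1)] ord_trans[OF ob] ord_trans[OF ord_el[OF ob that(1)] _ that(2)] by blast
    ultimately show False using f'(3)[OF lb] by blast
  qed
  define C where "C = mk (f' ` els b)"
  have C: "els C = f' ` els b" unfolding C_def by (rule els_mk[OF repl_fun[OF Ff]])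
  have unb: "EX y:els C. x : els y" if x: "x : els k3" for x
  proof -
    obtain i where i: "i : els b" "ap f i ~: els x" using f(2)[OF x] by blast
    have "x = ap f i \<or> x : els (ap f i)" using ord_lin_in[OF ord_k3 x fun_val(2)[OF f(1) i(1)]] i(2) by blast
    moreover have "ap f i : els (f' (suc i))" using f'(2)[OF blim[OF i(1)]] by simp
    ultimately have "x : els (f' (suc i))" using tr[OF f'(1)[OF blim[OF i(1)]]] by blast
    thus ?thesis unfolding C using blim[OF i(1)] by blast
  qed
  \<comment> \<open>Applied to the empty set, the diamond says that the club \<open>C\<close> meets
    \<open>s\<close>. A point \<open>f' i\<close> of \<open>s\<close> has cofinality
    \<open>k2\<close>, so \<open>f\<close> is already bounded below \<open>f' i\<close> on
    \<open>i\<close>, against the choice of \<open>f' i\<close>.\<close>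
  have "EX \<delta>:els s. \<delta> : els C & els emp \<inter> els \<delta> = els (ap gd \<delta>)"
  proof (rule gd)
    show "els C <= els k3" unfolding C using f'(1) by blast
    show "EX y:els C. x : els y" if "x : els k3" for x using unb that by blast
    fix \<delta> assume d: "\<delta> : els k3" "\<delta> ~= emp" "!!x. x : els \<delta> ==> EX y:els C. y : els \<delta> & x : els y"
    obtain m where m: "m : els b" "\<delta> : els (f' m)" using unb[OF d(1)] unfolding C by blast
    have Fd: "Fn E t ==> Fn E (%rh. f' (t rh))" for t by (rule Fn_comp1[where f = f', OF Ff])
    have "Dn E (%rh. f' (rh 0) ~: els \<delta>)" by (intro dn Fd)
    moreover have "f' m ~: els \<delta>" using el_asym m(2) by blast
    \<comment> \<open>The first \<open>i\<close> whose value is not below the limit point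
      \<open>\<delta>\<close> of \<open>C\<close> has value exactly \<open>\<delta>\<close>; this
      shows that \<open>C\<close> is closed.\<close>
    ultimately obtain i where i: "i : els b" "f' i ~: els \<delta>" "ALL l:els i. f' l : els \<delta>"
      using ord_least[OF ob m(1), of "%i. f' i ~: els \<delta>"] by blast
    have "ap f l : els \<delta>" if l: "l : els i" for l
    proof -
      obtain m where m: "m : els b" "f' m : els \<delta>" "f' l : els (f' m)"
        using d(3)[of "f' l"] i(3) l unfolding C by blast
      have lb: "l : els b" using ord_trans[OF ob l i(1)] .
      have "l : els m"
        using ord_lin_in[OF ob lb m(1)] mono[OF lb, of m] m(3) el_irrefl el_asym by metis
      thus ?thesis using f'(2)[OF m(1)] ord_trans[OF ord_el[OF ord_k3 d(1)] _ m(2)] by blast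
    qed
    hence "Q i \<delta>" unfolding Q_def by blast
    hence "\<delta> ~: els (f' i)" using f'(3)[OF i(1)] by blast
    hence "f' i = \<delta>" using ord_lin_in[OF ord_k3 f'(1)[OF i(1)] d(1)] i(2) by blast
    thus "\<delta> : els C" unfolding C using i(1) by blast
  qed simp
  then obtain i where i: "i : els b" "f' i : els s" unfolding C by blast
  have "bnd i (f' i)" using s_bnd[OF i(2)] i(1) bk by blast
  have "EX c:els (f' i). ALL l:els i. ap f l : els c"
  proof -
    let ?g = "lam i (f' i) (ap f)"
    have h: "Fn E (%rh. ap f (rh 0))" by (intro dn)
    have "is_fun E ?g i (f' i)" by (rule lam_fun[OF h]) (rule f'(2)[OF i(1)])
    then obtain c where c: "c : els (f' i)" "ALL l:els i. ap ?g l : els c"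
      using \<open>bnd i (f' i)\<close> unfolding bnd_def by blast
    have "ap ?g l = ap f l" if "l : els i" for l by (rule lam_ap[OF h _ that]) (rule f'(2)[OF i(1)])
    thus ?thesis using c by auto
  qed
  thus False using f'(3)[OF i(1)] unfolding Q_def by blast
qed

lemma bnd_om_k2: "bnd om k2" using bnd_k2[OF om_k2] .

lemma bnd_sub: assumes "bnd a t" "els b <= els a" "b ~= emp" shows "bnd b t"
  unfolding bnd_def
proof (intro allI impI)
  fix f assume f: "is_fun E f b t"
  obtain x where x: "x : els b" using assms(3) empty_iff_emp by blast
  let ?h = "%i. if i : els b then ap f i else ap f x"
  have h: "Fn E (%rh. ?h (rh 0))" by (intro Fn_if dn)
  have v: "?h i : els t" if "i : els a" for i using fun_val(2)[OF f] x by auto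
  have "is_fun E (lam a t ?h) a t" by (rule lam_fun[OF h]) (rule v)
  then obtain c where c: "c : els t" "ALL i:els a. ap (lam a t ?h) i : els c" using assms(1) unfolding bnd_def by blast
  have "ap (lam a t ?h) i = ?h i" if "i : els a" for i by (rule lam_ap[OF h _ that]) (rule v)
  hence "ap f i : els c" if "i : els b" for i using c(2) that assms(2) by fastforce
  thus "EX c:els t. ALL i:els b. ap f i : els c" using c by blast
qed

lemma bnd_om_k3: "bnd om k3"
proof (rule bnd_sub[OF bnd_k3])
  show "els om <= els k2" using ord_trans[OF ord_k2 _ om_k2] by blast
  show "om ~= emp" using om_0 els_emp by (metis empty_iff)
qed

end

section \<open>Cohen conditions\<close>

context zs begin

definition bit :: "'v => bool" where "bit b <-> b = emp \<or> b = suc emp"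

lemma Dn_bit [dn]: "Fn E a ==> Dn E (%rh. bit (a rh))" unfolding bit_def by (intro dn)

lemma bit_simps [simp]: "bit emp" "bit (suc emp)" "suc emp ~= emp" "emp ~= suc emp"
proof -
  have "els (suc emp) ~= els emp" by simp
  thus "suc emp ~= emp" "emp ~= suc emp" by metis+
qed (simp_all add: bit_def)


end

context ground begin

lemma P_iff: "p : els P <-> (ALL z:els p. EX \<alpha>:els k3. EX n:els om. EX b. bit b & z = opr (opr \<alpha> n) b) &
    (ALL c b b'. opr c b : els p & opr c b' : els p --> b = b') & fin p"
  and le_iff: "opr q p : els L <-> q : els P & p : els P & els p <= els q"
proof -
  obtain w where w: "is_omega E w" "elts E P = {p. (ALL z:elts E p. EX \<alpha>:elts E k3. EX n:elts E w. EX x i.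
                        is_pair E x \<alpha> n & (is_num E 0 i \<or> is_num E 1 i) & is_pair E z x i) &
                     single_valued (rel E p) & is_finite E p}"
    "rel E L = {(q, p). q : elts E P & p : elts E P & elts E p <= elts E q}"
    using coh unfolding is_cohen_forcing_def by blast
  have 1: "is_num E 1 i <-> i = suc emp" for i unfolding One_nat_def is_num_1 is_num_0 by auto
  have w: "w = om" using w(1) by (simp add: is_omega_iff)
  have "single_valued (rel E p) <-> (ALL c b b'. opr c b : els p & opr c b' : els p --> b = b')" for p
    unfolding single_valued_def rel_iff by blast
  thus "p : els P <-> (ALL z:els p. EX \<alpha>:els k3. EX n:els om. EX b. bit b & z = opr (opr \<alpha> n) b) &
    (ALL c b b'. opr c b : els p & opr c b' : els p --> b = b') & fin p"
    unfolding \<open>elts E P = _\<close> is_pair_iff is_finite_iff 1 is_num_0 w bit_def by simp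
  show "opr q p : els L <-> q : els P & p : els P & els p <= els q"
    unfolding rel_iff[symmetric] \<open>rel E L = _\<close> by simp
qed

lemma P_cell:
  assumes "p : els P" "opr c b : els p" shows "EX \<alpha>:els k3. EX n:els om. c = opr \<alpha> n" "bit b"
  using assms P_iff[of p] by fastforce+

lemma P_atom: "p : els P ==> z : els p ==> EX \<alpha>:els k3. EX n:els om. EX b. bit b & z = opr (opr \<alpha> n) b"
  unfolding P_iff[of p] by blast

lemma P_fun: "p : els P ==> opr c b : els p ==> opr c b' : els p ==> b = b'"
  using P_iff[of p] by blast

lemma P_fin: "p : els P ==> fin p" using P_iff[of p] by blast

lemma P_emp: "emp : els P" by (simp add: P_iff)

lemma P_sub: "p : els P ==> els q <= els p ==> q : els P"
  using P_iff[of p] P_iff[of q] fin_subset[of p q] by blast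

lemma P_un:
  assumes "p : els P" "q : els P" "!!c b b'. opr c b : els p ==> opr c b' : els q ==> b = b'"
  shows "un p q : els P"
proof -
  have "b = b'" if "opr c b : els (un p q)" "opr c b' : els (un p q)" for c b b'
    using that assms(3)[of c b b'] assms(3)[of c b' b] P_fun[OF assms(1)] P_fun[OF assms(2)] by auto
  thus ?thesis unfolding P_iff[of "un p q"] using fin_un[OF P_fin P_fin] assms P_atom by simp blast
qed

lemma P_add:
  assumes "p : els P" "\<alpha> : els k3" "n : els om" "bit b" "!!b'. opr (opr \<alpha> n) b' ~: els p"
  shows "ins (opr (opr \<alpha> n) b) p : els P"
  unfolding P_iff[of "ins (opr (opr \<alpha> n) b) p"]
proof (intro conjI)
  show "ALL c e e'. opr c e : els (ins (opr (opr \<alpha> n) b) p) & opr c e' : els (ins (opr (opr \<alpha> n) b) p) --> e = e'"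
    using P_fun[OF assms(1)] assms(5) by auto
  show "fin (ins (opr (opr \<alpha> n) b) p)" by (rule fin_ins[OF P_fin[OF assms(1)]])
  show "ALL z:els (ins (opr (opr \<alpha> n) b) p). EX \<alpha>:els k3. EX n:els om. EX b. bit b & z = opr (opr \<alpha> n) b"
    using P_atom[OF assms(1)] assms(2-4) by auto
qed

sublocale poset E P L
  by unfold_locales (auto simp: le_iff P_emp)

lemma bit_swap: "bit b ==> EX b'. bit b' & b' ~= b & (ALL b''. bit b'' --> b'' = b \<or> b'' = b')"
  unfolding bit_def by (metis bit_simps(3))

text \<open>This replaces the countable chain condition: \<open>\<theta>\<close> only needs to have uncountable cofinality.\<close>

lemma predense_bound:
  assumes t: "is_ord E \<theta>" "els \<theta> ~= {}" and b: "bnd om \<theta>" and H: "Dn E (%rh. H (rh 0) (rh 1))"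
    and mono: "!!q b b'. H q b ==> b : els b' ==> b' : els \<theta> ==> H q b'"
    and D: "els D <= els P" "!!q. q : els D ==> EX b:els \<theta>. H q b"
  shows "EX b:els \<theta>. ALL q:els D. EX r:els D. H r b & un q r : els P"
proof -
  have dH [dn]: "Fn E x ==> Fn E y ==> Dn E (%rh. H (x rh) (y rh))" for x y by (rule Dn2[where K = H, OF H])
  \<comment> \<open>The size of the conditions is the induction parameter. \<open>u\<close> holds
    the cells that have been split off on the way; they count again when \<open>H\<close> is
    evaluated.\<close>
  define S where "S n <-> (ALL D u. els D <= els P & (ALL q:els D. szle n q) & (ALL q:els D. EX b:els \<theta>. H (un q u) b) -->
     (EX b:els \<theta>. ALL q:els D. EX r:els D. H (un r u) b & un q r : els P))" for n
  have S: "S n" if "n : els om" for n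
  proof (rule om_induct[OF that])
    show "Dn E (%rh. S (rh 0))" unfolding S_def by (intro dn)
    show "S emp" unfolding S_def
    proof (intro allI impI, elim conjE)
      fix D u assume D: "els D <= els P" "ALL q:els D. szle emp q" "ALL q:els D. EX b:els \<theta>. H (un q u) b"
      show "EX b:els \<theta>. ALL q:els D. EX r:els D. H (un r u) b & un q r : els P"
      proof (cases "els D = {}")
        case True thus ?thesis using t(2) by auto
      next
        case False
        have e: "q = emp" if "q : els D" for q using szle_0 D(2) that by blast
        hence D': "els D = {emp}" using False by blast
        then obtain b where "b : els \<theta>" "H (un emp u) b" using D(3) by blast
        moreover have "un emp emp = emp" by (rule un_emp)
        ultimately show ?thesis unfolding D' using P_emp by auto
      qed
    qed
    fix n assume n: "n : els om" "S n"
    show "S (suc n)" unfolding S_def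
    proof (intro allI impI, elim conjE)
      fix D u assume D: "els D <= els P" "ALL q:els D. szle (suc n) q" "ALL q:els D. EX b:els \<theta>. H (un q u) b"
      show "EX b:els \<theta>. ALL q:els D. EX r:els D. H (un r u) b & un q r : els P"
      proof (cases "els D = {}")
        case True thus ?thesis using t(2) by auto
      next
        case False
        \<comment> \<open>A condition \<open>q\<close> of \<open>D\<close> that is incompatible with
          the fixed \<open>d\<close> contains one of the finitely many cells of \<open>d\<close>
          with the opposite bit. The conditions containing a given flipped cell \<open>?y\<close>
          become smaller when it is split off, so the induction hypothesis treats them.\<close>
        then obtain d where d: "d : els D" by blast
        obtain b0 where b0: "b0 : els \<theta>" "H (un d u) b0" using D(3) d by blast
        define Q where "Q z b <-> (ALL c e e'. z = opr c e & bit e' & e' ~= e -->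
          (ALL q:els D. opr c e' : els q --> (EX r:els D. H (un r u) b & un q r : els P)))" for z b
        have "EX b:els \<theta>. ALL z:els d. Q z b"
        proof (rule fin_coll[OF t P_fin])
          show "d : els P" using d D(1) by blast
          show "Dn E (%rh. Q (rh 0) (rh 1))" unfolding Q_def by (intro dn)
          show "Q z b'" if "Q z b" "b : els b'" "b' : els \<theta>" for z b b'
            unfolding Q_def
          proof (intro allI impI ballI)
            fix c e e' q assume "z = opr c e & bit e' & e' ~= e" "q : els D" "opr c e' : els q"
            then obtain r where "r : els D" "H (un r u) b" "un q r : els P" using \<open>Q z b\<close> unfolding Q_def by blast
            thus "EX r:els D. H (un r u) b' & un q r : els P" using mono[of "un r u" b b'] that(2,3) by blast
          qed
          fix z assume z: "z : els d"
          then obtain c e where ce: "z = opr c e" "bit e" using P_iff[of d] d D(1) by blast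
          obtain e' where e': "bit e'" "e' ~= e" "!!e''. bit e'' ==> e'' = e \<or> e'' = e'" using bit_swap[OF ce(2)] by blast
          let ?y = "opr c e'"
          define D1 where "D1 = mk {q' : els P. ?y ~: els q' & ins ?y q' : els D}"
          have D1: "q : els D1 <-> q : els P & ?y ~: els q & ins ?y q : els D" for q
            unfolding D1_def by (subst els_mk) (intro sepI dn, auto)
          have "EX b:els \<theta>. ALL q:els D1. EX r:els D1. H (un r (ins ?y u)) b & un q r : els P"
          proof (rule n(2)[unfolded S_def, rule_format], intro conjI ballI)
            show "els D1 <= els P" using D1 by blast
            fix q assume q: "q : els D1"
            hence q': "ins ?y q : els D" "?y ~: els q" using D1 by blast+
            have "szle n (df (ins ?y q) (mk {?y}))"
              by (rule szle_remove) (use D(2) q' in auto)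
            moreover have "df (ins ?y q) (mk {?y}) = q" using q'(2) by (intro ext) (auto simp: els_mk)
            ultimately show "szle n q" by simp
            have "un q (ins ?y u) = un (ins ?y q) u" by (rule ext) auto
            thus "EX b:els \<theta>. H (un q (ins ?y u)) b" using D(3) q' by auto
          qed
          then obtain b where b: "b : els \<theta>"
            "ALL q:els D1. EX r:els D1. H (un r (ins ?y u)) b & un q r : els P" by blast
          have "Q z b" unfolding Q_def
          proof (intro allI impI ballI)
            fix c2 e2 e2' q
            assume a: "z = opr c2 e2 & bit e2' & e2' ~= e2" "q : els D" "opr c2 e2' : els q"
            have c2: "c2 = c" "e2 = e" "e2' = e'" using a(1) ce e'(3) by auto
            define q1 where "q1 = df q (mk {?y})"
            have q1: "els q1 = els q - {?y}" unfolding q1_def by (simp add: els_mk)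
            have iq: "ins ?y q1 = q" using q1 a(3) c2 by (intro ext) auto
            have "q1 : els P" by (rule P_sub[of q]) (use a(2) D(1) q1 in auto)
            hence "q1 : els D1" using D1[of q1] iq a(2) q1 by simp
            then obtain r where r: "r : els D1" "H (un r (ins ?y u)) b" "un q1 r : els P" using b(2) by blast
            have r': "ins ?y r : els D" using r(1) D1 by blast
            have "un (ins ?y r) u = un r (ins ?y u)" by (rule ext) auto
            hence "H (un (ins ?y r) u) b" using r(2) by simp
            moreover have "un q (ins ?y r) : els P"
            proof (rule P_un)
              show "q : els P" "ins ?y r : els P" using a(2) r' D(1) by auto
              fix c3 b3 b3' assume 3: "opr c3 b3 : els q" "opr c3 b3' : els (ins ?y r)"
              show "b3 = b3'"
              proof (cases "c3 = c")
                case True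
                thus ?thesis using 3 a c2 P_fun[of q c b3 e'] P_fun[of "ins ?y r" c b3' e'] r' D(1) by auto
              next
                case False
                hence "opr c3 b3 : els (un q1 r)" "opr c3 b3' : els (un q1 r)" using 3 q1 by auto
                thus ?thesis using P_fun[OF r(3)] by blast
              qed
            qed
            ultimately show "EX r:els D. H (un r u) b & un q r : els P" using r' by blast
          qed
          thus "EX b:els \<theta>. Q z b" using b(1) by blast
        qed
        then obtain b1 where b1: "b1 : els \<theta>" "ALL z:els d. Q z b1" by blast
        obtain m where m: "m : els \<theta>" "b0 = m \<or> b0 : els m" "b1 = m \<or> b1 : els m" using ord_max[OF t(1) b0(1) b1(1)] .
        have "EX r:els D. H (un r u) m & un q r : els P" if q: "q : els D" for q
        proof (cases "un q d : els P")
          case True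
          thus ?thesis using d b0(2) m mono[of _ b0 m] by blast
        next
          case False
          have qd: "q : els P" "d : els P" using q d D(1) by auto
          obtain c e e' where c: "opr c e' : els q" "opr c e : els d" "e' ~= e" using P_un[OF qd] False by blast
          have "bit e'" using P_cell(2)[OF qd(1) c(1)] .
          then obtain r where "r : els D" "H (un r u) b1" "un q r : els P" using b1(2) c q unfolding Q_def by blast
          thus ?thesis using m mono[of _ b1 m] by blast
        qed
        thus ?thesis using m(1) by blast
      qed
    qed
  qed
  \<comment> \<open>The bounds for the various sizes are collected over \<omega>; this is where the
    cofinality of \<open>\<theta>\<close> has to be uncountable.\<close>
  define Q where "Q n b <-> (ALL q:els D. szle n q --> (EX r:els D. H r b & un q r : els P))" for n b
  have "EX b:els \<theta>. ALL n:els om. Q n b"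
  proof (rule bnd_coll[OF t(1) b])
    show "Dn E (%rh. Q (rh 0) (rh 1))" unfolding Q_def by (intro dn)
    show "Q n b'" if 1: "Q n b" "b : els b'" "b' : els \<theta>" for n b b'
      unfolding Q_def
    proof (intro ballI impI)
      fix q assume "q : els D" "szle n q"
      then obtain r where "r : els D" "H r b" "un q r : els P" using 1(1) unfolding Q_def by blast
      thus "EX r:els D. H r b' & un q r : els P" using mono[OF _ 1(2,3)] by blast
    qed
    fix n assume n: "n : els om"
    define D1 where "D1 = mk {q : els D. szle n q}"
    have D1: "els D1 = {q : els D. szle n q}" unfolding D1_def by (rule els_mk) (intro sepI dn)
    have "EX b:els \<theta>. ALL q:els D1. EX r:els D1. H (un r emp) b & un q r : els P"
      by (rule S[OF n, unfolded S_def, rule_format], unfold un_emp) (use D D1 in blast)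
    thus "EX b:els \<theta>. Q n b" unfolding Q_def un_emp D1 by blast
  qed
  then obtain b where b: "b : els \<theta>" "ALL n:els om. Q n b" by blast
  have "EX r:els D. H r b & un q r : els P" if "q : els D" for q
    using fin_szle[OF P_fin, of q] D(1) b(2) that unfolding Q_def by blast
  thus ?thesis using b(1) by blast
qed

section \<open>Supports of names of functions\<close>

definition sup :: "'v => 'v => bool" where "sup r K <-> (ALL \<xi> n b. opr (opr \<xi> n) b : els r --> \<xi> : els K)"

lemma Dn_sup [dn]: "Fn E a ==> Fn E b ==> Dn E (%rh. sup (a rh) (b rh))"
  unfolding sup_def by (intro dn Fn_shift)

text \<open>\<open>R\<close> is read as a name of a function. Below \<open>p\<close>, conditions with coordinates in \<open>K\<close> suffice to find its
  value at \<open>x\<close>.\<close>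

definition tot :: "'v => 'v => 'v => 'v => 'v => bool" where
  "tot p R x b K <-> (ALL q. le q p --> (EX r v. v : els b & opr r (opr x v) : els R & un q r : els P & sup r K))"

lemma Dn_tot [dn]:
  "Fn E a ==> Fn E b ==> Fn E c ==> Fn E d ==> Fn E e ==> Dn E (%rh. tot (a rh) (b rh) (c rh) (d rh) (e rh))"
  unfolding tot_def by (intro dn Fn_shift)

lemma tot_mono: "tot p R x b K ==> els K <= els K' ==> tot p R x b K'"
  unfolding tot_def sup_def by blast

text \<open>\<open>D\<close> consists of the conditions that contain one deciding the value at
  \<open>x\<close>, and \<open>H q \<beta>\<close> says that the deciding one can be taken with
  coordinates in \<open>K \<beta>\<close>. By \<open>predense_bound\<close>, some
  \<open>\<beta>\<close> serves a predense part of \<open>D\<close>, which is enough to meet every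
  condition below \<open>p\<close>. The chain \<open>K\<close> is instantiated by the ordinals below
  \<open>k3\<close> and by the sets \<open>Kl \<beta>\<close>.\<close>

lemma support_bound:
  assumes t: "is_ord E \<theta>" "els \<theta> ~= {}" and b: "bnd om \<theta>" and K: "Fn E (%rh. K (rh 0))"
    and cov: "!!\<xi>. \<xi> : els k3 ==> EX \<beta>:els \<theta>. \<xi> : els (K \<beta>)"
    and mono: "!!\<beta> \<beta>'. \<beta> : els \<beta>' ==> \<beta>' : els \<theta> ==> els (K \<beta>) <= els (K \<beta>')"
    and tot: "tot p R x b k3"
  shows "EX \<beta>:els \<theta>. tot p R x b (K \<beta>)"
proof -
  have FK [dn]: "Fn E y ==> Fn E (%rh. K (y rh))" for y by (rule Fn_comp1[where f = K, OF K])
  define A where "A r <-> (EX v:els b. opr r (opr x v) : els R)" for r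
  define H where "H q \<beta> <-> (EX r. A r & els r <= els q & sup r (K \<beta>))" for q \<beta>
  define D where "D = mk {q : els P. EX r. A r & els r <= els q}"
  have D: "els D = {q : els P. EX r. A r & els r <= els q}" unfolding D_def A_def by (rule els_mk) (intro sepI dn)
  have "EX \<beta>:els \<theta>. ALL q:els D. EX r:els D. H r \<beta> & un q r : els P"
  proof (rule predense_bound[OF t b])
    show "Dn E (%rh. H (rh 0) (rh 1))" unfolding H_def A_def by (intro dn)
    show "H q \<beta>'" if "H q \<beta>" "\<beta> : els \<beta>'" "\<beta>' : els \<theta>" for q \<beta> \<beta>'
      using that(1) mono[OF that(2,3)] unfolding H_def sup_def by blast
    show "els D <= els P" using D by blast
    fix q assume "q : els D"
    then obtain r where r: "A r" "els r <= els q" "q : els P" using D by blast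
    define Q where "Q z \<beta> <-> (ALL \<xi> n b. z = opr (opr \<xi> n) b --> \<xi> : els (K \<beta>))" for z \<beta>
    have "EX \<beta>:els \<theta>. ALL z:els r. Q z \<beta>"
    proof (rule fin_coll[OF t])
      show "fin r" using fin_subset[OF P_fin] r by blast
      show "Dn E (%rh. Q (rh 0) (rh 1))" unfolding Q_def by (intro dn)
      show "Q z \<beta>'" if "Q z \<beta>" "\<beta> : els \<beta>'" "\<beta>' : els \<theta>" for z \<beta> \<beta>'
        using that(1) mono[OF that(2,3)] unfolding Q_def by blast
      fix z assume "z : els r"
      then obtain \<xi> n b where z: "z = opr (opr \<xi> n) b" "\<xi> : els k3" using r P_atom[of q z] by blast
      then obtain \<beta> where "\<beta> : els \<theta>" "\<xi> : els (K \<beta>)" using cov by blast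
      thus "EX \<beta>:els \<theta>. Q z \<beta>" unfolding Q_def z by auto
    qed
    then obtain \<beta> where \<beta>: "\<beta> : els \<theta>" "ALL z:els r. Q z \<beta>" by blast
    have "sup r (K \<beta>)" unfolding sup_def
    proof (intro allI impI)
      fix \<xi> n b assume "opr (opr \<xi> n) b : els r"
      hence "Q (opr (opr \<xi> n) b) \<beta>" using \<beta>(2) by blast
      thus "\<xi> : els (K \<beta>)" unfolding Q_def by simp
    qed
    thus "EX \<beta>:els \<theta>. H q \<beta>" unfolding H_def using r(1,2) \<beta>(1) by blast
  qed
  then obtain \<beta> where \<beta>: "\<beta> : els \<theta>" "!!q. q : els D ==> EX r:els D. H r \<beta> & un q r : els P" by blast
  have "tot p R x b (K \<beta>)" unfolding tot_def
  proof (intro allI impI)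
    fix q assume "le q p"
    then obtain r v where r: "v : els b" "opr r (opr x v) : els R" "un q r : els P" using tot unfolding tot_def by blast
    hence "un q r : els D" unfolding D A_def by auto
    then obtain q' where q': "H q' \<beta>" "un (un q r) q' : els P" using \<beta>(2) by blast
    then obtain r' where r': "A r'" "els r' <= els q'" "sup r' (K \<beta>)" unfolding H_def by blast
    have "un q r' : els P" by (rule P_sub[OF q'(2)]) (use r'(2) in auto)
    thus "EX r v. v : els b & opr r (opr x v) : els R & un q r : els P & sup r (K \<beta>)" using r' unfolding A_def by blast
  qed
  thus ?thesis using \<beta>(1) by blast
qed

lemma support_coll:
  assumes t: "is_ord E \<theta>" "els \<theta> ~= {}" and b: "bnd om \<theta>" and K: "Fn E (%rh. K (rh 0))"
    and cov: "!!\<xi>. \<xi> : els k3 ==> EX \<beta>:els \<theta>. \<xi> : els (K \<beta>)"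
    and mono: "!!\<beta> \<beta>'. \<beta> : els \<beta>' ==> \<beta>' : els \<theta> ==> els (K \<beta>) <= els (K \<beta>')"
    and A: "bnd A \<theta>" and B: "bnd B \<theta>"
    and tot: "!!x y. x : els A ==> y : els B ==> tot p R (opr x y) b k3"
  shows "EX \<beta>:els \<theta>. ALL x:els A. ALL y:els B. tot p R (opr x y) b (K \<beta>)"
proof (rule bnd_coll[OF t(1) A])
  have FK [dn]: "Fn E y ==> Fn E (%rh. K (y rh))" for y by (rule Fn_comp1[where f = K, OF K])
  show "Dn E (%rh. ALL y:els B. tot p R (opr (rh 0) y) b (K (rh 1)))" by (intro dn)
  show "ALL y:els B. tot p R (opr x y) b (K \<beta>')"
    if "ALL y:els B. tot p R (opr x y) b (K \<beta>)" "\<beta> : els \<beta>'" "\<beta>' : els \<theta>" for x \<beta> \<beta>'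
    using that(1) tot_mono mono[OF that(2,3)] by blast
  fix x assume x: "x : els A"
  show "EX \<beta>:els \<theta>. ALL y:els B. tot p R (opr x y) b (K \<beta>)"
  proof (rule bnd_coll[OF t(1) B])
    show "Dn E (%rh. tot p R (opr x (rh 0)) b (K (rh 1)))" by (intro dn)
    show "EX \<beta>:els \<theta>. tot p R (opr x y) b (K \<beta>)" if "y : els B" for y
      by (rule support_bound[OF t b K cov mono tot[OF x that]])
    show "tot p R (opr x y) b (K \<beta>')"
      if "tot p R (opr x y) b (K \<beta>)" "\<beta> : els \<beta>'" "\<beta>' : els \<theta>" for y \<beta> \<beta>'
      using that(1) tot_mono mono[OF that(2,3)] by blast
  qed
qed

end

section \<open>Intersections of basic sets\<close>

context ground begin

text \<open>Strengthening that adds cells only at coordinates in \<open>K\<close>. It records which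
  cells are left untouched while values of names are being decided.\<close>

definition ex :: "'v => 'v => 'v => bool" where
  "ex K r q <-> le r q & (ALL \<xi> n b. opr (opr \<xi> n) b : els r --> opr (opr \<xi> n) b : els q \<or> \<xi> : els K)"

lemma Dn_extends [dn]: "Fn E a ==> Fn E b ==> Fn E c ==> Dn E (%rh. ex (a rh) (b rh) (c rh))"
  unfolding ex_def by (intro dn Fn_shift)

lemma ex_refl: "q : els P ==> ex K q q" unfolding ex_def using le_refl by blast

lemma ex_trans: "ex K r q ==> ex K q p ==> ex K r p"
  unfolding ex_def using le_trans[of r q p] by blast

lemma exD: "ex K r q ==> opr (opr \<xi> n) b : els r ==> \<xi> ~: els K ==> opr (opr \<xi> n) b : els q"
  unfolding ex_def by blast

lemma ex_le: "ex K r q ==> le r q" unfolding ex_def by blast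

lemma leD: "le q p ==> q : els P" "le q p ==> p : els P" "le q p ==> z : els p ==> z : els q"
  using le_iff[of q p] by blast+

definition dec :: "'v => 'v => 'v => 'v => bool" where
  "dec q R x v <-> (EX r. els r <= els q & opr r (opr x v) : els R)"

lemma Dn_dec [dn]: "Fn E a ==> Fn E b ==> Fn E c ==> Fn E d ==> Dn E (%rh. dec (a rh) (b rh) (c rh) (d rh))"
  unfolding dec_def by (intro dn Fn_shift)

lemma dec_mono: "dec q R x v ==> le q' q ==> dec q' R x v"
  unfolding dec_def using le_iff[of q' q] by blast

lemma tot_dec: assumes "tot p R x b K" "le q p" shows "EX r v. ex K r q & v : els b & dec r R x v"
proof -
  obtain r v where r: "v : els b" "opr r (opr x v) : els R" "un q r : els P" "sup r K"
    using assms unfolding tot_def by blast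
  have "ex K (un q r) q" unfolding ex_def using r(3,4) leD(1)[OF assms(2)] by (auto simp: le_iff sup_def)
  moreover have "dec (un q r) R x v" unfolding dec_def using r(2) by auto
  ultimately show ?thesis using r(1) by blast
qed

text \<open>Finitely many requirements are met one after the other; the bound \<open>N\<close> grows
  with each of them, and the earlier ones survive by \<open>mono\<close>.\<close>

lemma collect_ext:
  assumes x: "fin x" and R: "Dn E (%rh. R (rh 0) (rh 1) (rh 2))"
    and mono: "!!z q q' N N'. R z q N ==> le q' q ==> N' : els om ==> N : els N' \<or> N = N' ==> R z q' N'"
    and step: "!!z q. z : els x ==> le q p ==> EX r N. N : els om & ex K r q & R z r N"
    and q: "le q p"
  shows "EX r N. N : els om & ex K r q & (ALL z:els x. R z r N)"
proof -
  have dR [dn]: "Fn E a ==> Fn E b ==> Fn E c ==> Dn E (%rh. R (a rh) (b rh) (c rh))" for a b c by (rule Dn3[where K = R, OF R])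
  show ?thesis
  proof (rule fin_induct[OF x])
    show "Dn E (%rh. EX r N. N : els om & ex K r q & (ALL z:els (rh 0). R z r N))" by (intro dn)
    show "EX r N. N : els om & ex K r q & (ALL z:els emp. R z r N)"
      using ex_refl[OF leD(1)[OF q]] om_0 by auto
    fix y z assume y: "els y <= els x" "z : els x" "EX r N. N : els om & ex K r q & (ALL z:els y. R z r N)"
    then obtain r N where r: "N : els om" "ex K r q" "ALL z:els y. R z r N" by blast
    have "le r p" using le_trans ex_le[OF r(2)] q by blast
    then obtain r' N' where r': "N' : els om" "ex K r' r" "R z r' N'" using step[OF y(2)] by blast
    obtain M where M: "M : els om" "N : els M" "N' : els M" using om_bound2[OF r(1) r'(1)] .
    have "R u r' M" if "u : els y" for u using mono[OF _ ex_le[OF r'(2)] M(1)] r(3) that M(2) by blast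
    moreover have "R z r' M" using mono[OF r'(3) _ M(1)] le_refl leD(1)[OF ex_le[OF r'(2)]] M(3) by blast
    ultimately have "ALL u:els (ins z y). R u r' M" by simp
    thus "EX r N. N : els om & ex K r q & (ALL z:els (ins z y). R z r N)"
      using M(1) ex_trans[OF r'(2) r(2)] by blast
  qed
qed

definition avoids :: "'v => 'v => bool" where "avoids q Z <-> (ALL z:els Z. ALL b. opr z b ~: els q)"
definition decides :: "'v => 'v => bool" where "decides q Z <-> (ALL z:els Z. EX b. opr z b : els q)"

lemma Dn_avoids [dn]: "Fn E a ==> Fn E b ==> Dn E (%rh. avoids (a rh) (b rh))" unfolding avoids_def by (intro dn Fn_shift)
lemma Dn_decides [dn]: "Fn E a ==> Fn E b ==> Dn E (%rh. decides (a rh) (b rh))" unfolding decides_def by (intro dn Fn_shift)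

text \<open>Induction on \<open>Z\<close>: extend below the value \<open>0\<close> of a new cell, erase that cell, and extend again below the
  value \<open>1\<close>. The larger of the two bounds remains valid once the cell is erased.\<close>

lemma bound_all_fillings:
  assumes Z: "fin Z" "els Z <= els (prd k3 om)" and U: "Dn E (%rh. U (rh 0) (rh 1))"
    and mono: "!!q q' N N'. U q N ==> le q' q ==> N' : els om ==> N : els N' \<or> N = N' ==> U q' N'"
    and step: "!!q. le q p ==> EX r N. N : els om & ex K r q & U r N"
    and t: "le t p" "avoids t Z"
  shows "EX s' N. N : els om & ex K s' t & avoids s' Z & (ALL q. le q s' & decides q Z --> U q N)"
proof -
  have dU [dn]: "Fn E a ==> Fn E b ==> Dn E (%rh. U (a rh) (b rh))" for a b by (rule Dn2[where K = U, OF U])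
  define S where "S Z <-> (ALL s. le s p & avoids s Z -->
    (EX s' N. N : els om & ex K s' s & avoids s' Z & (ALL q. le q s' & decides q Z --> U q N)))" for Z
  have "S Z"
  proof (rule fin_induct[OF Z(1)])
    show "Dn E (%rh. S (rh 0))" unfolding S_def by (intro dn)
    show "S emp" unfolding S_def
    proof (intro allI impI, elim conjE)
      fix s assume "le s p"
      then obtain r N where r: "N : els om" "ex K r s" "U r N" using step by blast
      have "U q N" if "le q r" for q using mono[OF r(3) that r(1)] by blast
      moreover have "avoids r emp" unfolding avoids_def by simp
      ultimately show "EX s' N. N : els om & ex K s' s & avoids s' emp & (ALL q. le q s' & decides q emp --> U q N)"
        using r(1,2) by blast
    qed
    fix y z assume y: "els y <= els Z" "z : els Z" "S y"
    show "S (ins z y)"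
    proof (cases "z : els y")
      case True
      thus ?thesis using y(3) ins_absorb by simp
    next
      case False
      obtain \<alpha> n where z: "z = opr \<alpha> n" "\<alpha> : els k3" "n : els om" using prdE Z(2) y(2) by blast
      have av: "avoids (ins (opr z e) t) y" if "avoids t y" for e t
        using that False unfolding avoids_def by auto
      show ?thesis unfolding S_def
      proof (intro allI impI, elim conjE)
        fix s assume s: "le s p" "avoids s (ins z y)"
        have sz: "!!b. opr z b ~: els s" and sy: "avoids s y" using s(2) unfolding avoids_def by auto
        have sP: "s : els P" using leD(1)[OF s(1)] .
        let ?s0 = "ins (opr z emp) s"
        have s0: "?s0 : els P" unfolding z(1) by (rule P_add[OF sP z(2,3)]) (use sz z(1) in auto)
        have "le ?s0 s" using s0 sP by (auto simp: le_iff)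
        hence "le ?s0 p" using le_trans s(1) by blast
        then obtain s1 N1 where s1: "N1 : els om" "ex K s1 ?s0" "avoids s1 y"
          "!!q. le q s1 ==> decides q y ==> U q N1" using y(3) av[OF sy] unfolding S_def by blast
        have s1P: "s1 : els P" using leD(1)[OF ex_le[OF s1(2)]] .
        have z0: "opr z emp : els s1" using leD(3)[OF ex_le[OF s1(2)]] by simp
        define t where "t = df s1 (mk {opr z emp})"
        have t: "els t = els s1 - {opr z emp}" unfolding t_def by (simp add: els_mk)
        have tP: "t : els P" by (rule P_sub[OF s1P]) (use t in blast)
        have tz: "!!b. opr z b ~: els t" using t P_fun[OF s1P z0] by auto
        have st: "els s <= els t" using leD(3)[OF ex_le[OF s1(2)]] sz t by auto
        have ty: "avoids t y" using s1(3) t unfolding avoids_def by blast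
        have te: "\<xi> : els K \<or> opr (opr \<xi> n) b : els s" if "opr (opr \<xi> n) b : els t" for \<xi> n b
        proof -
          have "opr (opr \<xi> n) b : els s1" "opr (opr \<xi> n) b ~= opr z emp" using that t by auto
          thus ?thesis using exD[OF s1(2), of \<xi> n b] by auto
        qed
        let ?t0 = "ins (opr z (suc emp)) t"
        have t0: "?t0 : els P" unfolding z(1) by (rule P_add[OF tP z(2,3)]) (use tz z(1) in auto)
        have "le ?t0 s" using t0 sP st by (auto simp: le_iff)
        hence "le ?t0 p" using le_trans s(1) by blast
        then obtain s2 N2 where s2: "N2 : els om" "ex K s2 ?t0" "avoids s2 y"
          "!!q. le q s2 ==> decides q y ==> U q N2" using y(3) av[OF ty] unfolding S_def by blast
        have s2P: "s2 : els P" using leD(1)[OF ex_le[OF s2(2)]] .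
        have z1: "opr z (suc emp) : els s2" using leD(3)[OF ex_le[OF s2(2)]] by simp
        define s' where "s' = df s2 (mk {opr z (suc emp)})"
        have s': "els s' = els s2 - {opr z (suc emp)}" unfolding s'_def by (simp add: els_mk)
        have s'P: "s' : els P" by (rule P_sub[OF s2P]) (use s' in blast)
        have s'z: "!!b. opr z b ~: els s'" using s' P_fun[OF s2P z1] by auto
        have ts': "els t <= els s'" using leD(3)[OF ex_le[OF s2(2)]] tz s' by auto
        obtain N where N: "N : els om" "N1 : els N" "N2 : els N" using om_bound2[OF s1(1) s2(1)] .
        have "ex K s' s" unfolding ex_def
        proof (intro conjI allI impI)
          show "le s' s" using s'P sP st ts' by (auto simp: le_iff)
          fix \<xi> n b assume b: "opr (opr \<xi> n) b : els s'"
          hence "opr (opr \<xi> n) b : els s2" "opr (opr \<xi> n) b ~= opr z (suc emp)" using s' by auto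
          hence "\<xi> : els K \<or> opr (opr \<xi> n) b : els t" using exD[OF s2(2), of \<xi> n b] by auto
          thus "opr (opr \<xi> n) b : els s \<or> \<xi> : els K" using te by blast
        qed
        moreover have "avoids s' (ins z y)" using s'z s2(3) s' unfolding avoids_def by auto
        moreover have "U q N" if q: "le q s'" "decides q (ins z y)" for q
        proof -
          have dy: "decides q y" and "EX b. opr z b : els q" using q(2) unfolding decides_def by auto
          then obtain b where b: "opr z b : els q" by blast
          have qP: "q : els P" using leD(1)[OF q(1)] .
          have "b = emp \<or> b = suc emp" using P_cell(2)[OF qP b] unfolding bit_def .
          thus ?thesis
          proof
            assume e: "b = emp"
            have "els s1 <= els q" using t ts' leD(3)[OF q(1)] b e by blast
            hence "le q s1" using qP s1P by (simp add: le_iff)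
            thus ?thesis using mono[OF s1(4)[OF _ dy] _ N(1)] N(2) le_refl[OF qP] by blast
          next
            assume e: "b = suc emp"
            have "els s2 <= els q" using s' leD(3)[OF q(1)] b e by blast
            hence "le q s2" using qP s2P by (simp add: le_iff)
            thus ?thesis using mono[OF s2(4)[OF _ dy] _ N(1)] N(3) le_refl[OF qP] by blast
          qed
        qed
        ultimately show "EX s' N. N : els om & ex K s' s & avoids s' (ins z y) & (ALL q. le q s' & decides q (ins z y) --> U q N)"
          using N(1) by blast
      qed
    qed
  qed
  thus ?thesis using t unfolding S_def by blast
qed

text \<open>A pigeonhole that adapts to the conditions: the value found for one \<open>z\<close> is
  struck from the candidates before the next \<open>z\<close> is decided. As \<open>O'\<close> has
  more than \<open>n\<close> elements and \<open>x\<close> at most \<open>n\<close>, a candidate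
  remains.\<close>

lemma pick:
  assumes n: "n : els om" and R: "Dn E (%rh. R (rh 0) (rh 1) (rh 2))"
    and mono: "!!z q q' y. R z q y ==> le q' q ==> R z q' y"
    and step: "!!z q. z : els X ==> le q p ==> EX r y. ex K r q & R z r y"
    and x: "els x <= els X" "szle n x" "~ szle n O'" "le t p"
  shows "EX r k. ex K r t & k : els O' & (ALL z:els x. EX y. y ~= k & R z r y)"
proof -
  have dR [dn]: "Fn E a ==> Fn E b ==> Fn E c ==> Dn E (%rh. R (a rh) (b rh) (c rh))" for a b c by (rule Dn3[where K = R, OF R])
  define S where "S n <-> (ALL x O' t. els x <= els X & szle n x & ~ szle n O' & le t p -->
    (EX r k. ex K r t & k : els O' & (ALL z:els x. EX y. y ~= k & R z r y)))" for n
  have base: "EX r k. ex K r t & k : els O' & (ALL z:els x. EX y. y ~= k & R z r y)"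
    if "x = emp" "~ szle n O'" "le t p" for n x O' t
  proof -
    have "O' ~= emp" using that(2) by auto
    then obtain k where "k : els O'" using empty_iff_emp by blast
    thus ?thesis using ex_refl[OF leD(1)[OF that(3)]] that(1) by auto
  qed
  have "S n"
  proof (rule om_induct[OF n])
    show "Dn E (%rh. S (rh 0))" unfolding S_def by (intro dn)
    show "S emp" unfolding S_def using base szle_0 by blast
    fix n assume n: "n : els om" "S n"
    show "S (suc n)" unfolding S_def
    proof (intro allI impI, elim conjE)
      fix x O' t assume x: "els x <= els X" "szle (suc n) x" "~ szle (suc n) O'" "le t p"
      show "EX r k. ex K r t & k : els O' & (ALL z:els x. EX y. y ~= k & R z r y)"
      proof (cases "x = emp")
        case True
        thus ?thesis using base x(3,4) by blast
      next
        case False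
        then obtain z where z: "z : els x" using empty_iff_emp by blast
        then obtain r y where r: "ex K r t" "R z r y" using step[of z t] x(1,4) by blast
        let ?x = "df x (mk {z})" and ?O = "df O' (mk {y})"
        have "els ?x <= els X" using x(1) by auto
        moreover have "szle n ?x" by (rule szle_remove[OF x(2) z])
        moreover have "~ szle n ?O"
        proof
          assume "szle n ?O"
          hence "szle (suc n) (ins y ?O)" by (rule szle_ins) (rule n(1))
          hence "szle (suc n) O'" by (rule szle_sub) (auto simp: els_mk)
          thus False using x(3) by blast
        qed
        moreover have "le r p" using le_trans ex_le[OF r(1)] x(4) by blast
        ultimately obtain r' k where r': "ex K r' r" "k : els ?O" "ALL z:els ?x. EX y. y ~= k & R z r' y"
          using n(2) unfolding S_def by blast
        have k: "k : els O'" "k ~= y" using r'(2) by (auto simp: els_mk)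
        have "EX y. y ~= k & R u r' y" if u: "u : els x" for u
        proof (cases "u = z")
          case True
          show ?thesis unfolding True using k(2) mono[OF r(2) ex_le[OF r'(1)]] by metis
        next
          case False
          hence "u : els ?x" using u by (simp add: els_mk)
          thus ?thesis using r'(3) by blast
        qed
        thus ?thesis using ex_trans[OF r'(1) r(1)] k(1) by blast
      qed
    qed
  qed
  thus ?thesis using x unfolding S_def by blast
qed

end

section \<open>Simultaneous satisfaction of finitely many requirements at one argument\<close>

context ground begin

text \<open>The coordinates open to a name \<open>w\<close> that is to be evaded at label
  \<open>\<alpha>\<close>. Unlabelled coordinates are always included, so that these sets increase
  to all of \<open>k3\<close>.\<close>

definition Kl :: "'v => 'v" where "Kl \<alpha> = mk {\<xi> : els k3. ALL \<alpha>':els k2. lab \<xi> \<alpha>' --> \<alpha>' : els \<alpha>}"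

lemma Kl: "\<xi> : els (Kl \<alpha>) <-> \<xi> : els k3 & (ALL \<alpha>':els k2. lab \<xi> \<alpha>' --> \<alpha>' : els \<alpha>)"
  unfolding Kl_def by (subst els_mk) (intro sepI dn, auto)

lemma Fn_Kl [dn]: "Fn E a ==> Fn E (%rh. Kl (a rh))"
proof (rule Fn_comp1[where f = Kl])
  show "Fn E (%rh. Kl (rh 0))" unfolding Kl_def
    by (rule Fn_mk) (intro sepI dn, unfold mem_Collect_eq, intro dn)
qed

definition valid :: "'v => 'v => 'v => 'v => bool" where
  "valid p \<xi> f w <-> (EX \<alpha>:els k2. lab \<xi> \<alpha> & (ALL i:els om. tot p f i om \<xi>) &
     (ALL i:els om. ALL l:els om. tot p w (opr i l) om (Kl \<alpha>)))"

lemma Dn_valid [dn]: "Fn E a ==> Fn E b ==> Fn E c ==> Fn E d ==> Dn E (%rh. valid (a rh) (b rh) (c rh) (d rh))"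
  unfolding valid_def by (intro dn Fn_shift)

text \<open>In \<open>q\<close>, the first \<open>k > i\<close> with value \<open>1\<close> in the real \<open>\<xi>\<close> exceeds the \<open>i\<close>th value of \<open>f\<close> and differs
  from the first values of the \<open>i\<close>th row of \<open>w\<close>.\<close>

definition first_one :: "'v => 'v => 'v => 'v => bool" where
  "first_one q \<xi> i k <-> k : els om & i : els k & opr (opr \<xi> k) (suc emp) : els q &
     (ALL m:els k. i : els m --> opr (opr \<xi> m) emp : els q)"

definition meets :: "'v => 'v => 'v => 'v => 'v => bool" where
  "meets q i \<xi> f w <-> (EX k v. first_one q \<xi> i k & v : els k & dec q f i v &
     (ALL l:els v. EX y. y ~= k & dec q w (opr i l) y))"

lemma Dn_first_one [dn]: "Fn E a ==> Fn E b ==> Fn E c ==> Fn E d ==> Dn E (%rh. first_one (a rh) (b rh) (c rh) (d rh))"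
  unfolding first_one_def by (intro dn Fn_shift)

lemma Dn_meets [dn]:
  "Fn E a ==> Fn E b ==> Fn E c ==> Fn E d ==> Fn E e ==> Dn E (%rh. meets (a rh) (b rh) (c rh) (d rh) (e rh))"
  unfolding meets_def by (intro dn Fn_shift)

text \<open>The filling of the cells reserved for slot \<open>\<xi>\<close>: the columns strictly
  between \<open>i\<close> and \<open>M\<close> get the value 0, except for a single 1 at
  \<open>k\<close>.\<close>

definition pat :: "'v => 'v => 'v => 'v => 'v" where
  "pat \<xi> i M k = mk ((%m. opr (opr \<xi> m) (if m = k then suc emp else emp)) ` els (mk {m : els M. i : els m}))"

lemma pat:
  assumes "M : els om"
  shows "opr (opr \<eta> m) b : els (pat \<xi> i M k) <-> \<eta> = \<xi> & m : els M & i : els m & b = (if m = k then suc emp else emp)"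
    and "\<xi> : els k3 ==> pat \<xi> i M k : els P"
proof -
  let ?h = "%m. opr (opr \<xi> m) (if m = k then suc emp else emp)" and ?S = "mk {m : els M. i : els m}"
  have S: "els ?S = {m : els M. i : els m}" by (rule els_mk) (intro sepI dn)
  have fS: "fin ?S" by (rule fin_subset[OF fin_om[OF assms]]) (use S in blast)
  have h: "Fn E (%rh. ?h (rh 0))" by (intro dn Fn_if)
  have e: "els (pat \<xi> i M k) = ?h ` els ?S" unfolding pat_def by (rule els_mk[OF fin_image(1)[OF fS h]])
  show *: "opr (opr \<eta> m) b : els (pat \<xi> i M k) <-> \<eta> = \<xi> & m : els M & i : els m & b = (if m = k then suc emp else emp)" for \<eta> m b
    unfolding e S by auto
  assume x: "\<xi> : els k3"
  show "pat \<xi> i M k : els P" unfolding P_iff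
  proof (intro conjI ballI allI impI)
    show "fin (pat \<xi> i M k)" unfolding pat_def by (rule fin_image(2)[OF fS h])
    fix z assume "z : els (pat \<xi> i M k)"
    then obtain m where m: "m : els M" "z = ?h m" unfolding e S by blast
    have "m : els om" using om_sub[OF assms m(1)] .
    thus "EX \<alpha>:els k3. EX n:els om. EX b. bit b & z = opr (opr \<alpha> n) b" using m(2) x by auto
  next
    fix c b b' assume c: "opr c b : els (pat \<xi> i M k) & opr c b' : els (pat \<xi> i M k)"
    then obtain m where m: "c = opr \<xi> m" unfolding e by auto
    show "b = b'" using c unfolding m * by simp
  qed
qed

definition fiber :: "'v => 'v => 'v" where "fiber C \<xi> = mk {c : els C. EX y. c = opr \<xi> y}"

lemma els_fiber: "els (fiber C \<xi>) = {c : els C. EX y. c = opr \<xi> y}"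
  unfolding fiber_def by (rule els_mk) (intro sepI dn)

lemma Fn_fiber [dn]: "Fn E a ==> Fn E b ==> Fn E (%rh. fiber (a rh) (b rh))"
proof (rule Fn_comp2[where f = fiber])
  show "Fn E (%rh. fiber (rh 0) (rh 1))" unfolding fiber_def
    by (rule Fn_mk) (intro sepI dn, unfold mem_Collect_eq, intro dn)
qed

text \<open>\<open>d\<close> assigns to the slot \<open>\<xi>\<close> a bound \<open>F\<close> for the values of \<open>f\<close> and a bound \<open>M\<close> such that between them
  there are enough candidates for the first one; \<open>Z\<close> is the set of the cells between \<open>i\<close> and \<open>M\<close>.
  The slots are processed in increasing order, so that \<open>f\<close> is bounded however the cells of the earlier slots
  are filled. The cells are filled afterwards in the order of the labels, when \<open>w\<close> is known.\<close>

definition stage where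
  "stage p C i d Z t <-> le t p & fin Z & els Z <= els (prd k3 om) & avoids t Z &
     (ALL \<eta> z. opr \<eta> z : els d --> \<eta> : els (dom C) & (EX F:els om. EX M:els om. z = opr F M & i : els F &
        (EX \<mu>:els om. szle \<mu> (prd (fiber C \<eta>) F) & ~ szle \<mu> (mk {k : els M. F : els k})))) &
     (ALL \<eta> z z'. opr \<eta> z : els d & opr \<eta> z' : els d --> z = z') &
     (ALL \<eta> m. opr \<eta> m : els Z <-> (EX F M. opr \<eta> (opr F M) : els d & i : els m & m : els M)) &
     (ALL \<eta>:els (dom C). (ALL z. opr \<eta> z ~: els d) --> (ALL m b. i : els m --> opr (opr \<eta> m) b ~: els t)) &
     (ALL \<eta> F M f w. opr \<eta> (opr F M) : els d & opr \<eta> (opr f w) : els C -->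
        (ALL q. le q t & decides q Z --> (EX v:els F. dec q f i v)))"

lemma stageD:
  assumes "stage p C i d Z t"
  shows "le t p" "fin Z" "els Z <= els (prd k3 om)" "avoids t Z"
    "opr \<eta> z : els d ==> \<eta> : els (dom C)"
    "opr \<eta> z : els d ==> EX F:els om. EX M:els om. z = opr F M & i : els F &
        (EX \<mu>:els om. szle \<mu> (prd (fiber C \<eta>) F) & ~ szle \<mu> (mk {k : els M. F : els k}))"
    "opr \<eta> z : els d ==> opr \<eta> z' : els d ==> z = z'"
    "opr \<eta> m : els Z <-> (EX F M. opr \<eta> (opr F M) : els d & i : els m & m : els M)"
    "\<eta> : els (dom C) ==> (!!z. opr \<eta> z ~: els d) ==> i : els m ==> opr (opr \<eta> m) b ~: els t"
    "opr \<eta> (opr F M) : els d ==> opr \<eta> (opr f w) : els C ==> le q t ==> decides q Z ==> EX v:els F. dec q f i v"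
proof -
  note a = assms[unfolded stage_def]
  from a show "le t p" "fin Z" "els Z <= els (prd k3 om)" "avoids t Z"
    "opr \<eta> z : els d ==> \<eta> : els (dom C)"
    "opr \<eta> z : els d ==> EX F:els om. EX M:els om. z = opr F M & i : els F &
        (EX \<mu>:els om. szle \<mu> (prd (fiber C \<eta>) F) & ~ szle \<mu> (mk {k : els M. F : els k}))"
    "opr \<eta> z : els d ==> opr \<eta> z' : els d ==> z = z'"
    "opr \<eta> m : els Z <-> (EX F M. opr \<eta> (opr F M) : els d & i : els m & m : els M)"
    "\<eta> : els (dom C) ==> (!!z. opr \<eta> z ~: els d) ==> i : els m ==> opr (opr \<eta> m) b ~: els t" by simp_all
  show "opr \<eta> (opr F M) : els d ==> opr \<eta> (opr f w) : els C ==> le q t ==> decides q Z ==> EX v:els F. dec q f i v"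
    using a[THEN conjunct2, THEN conjunct2, THEN conjunct2, THEN conjunct2, THEN conjunct2, THEN conjunct2,
      THEN conjunct2, THEN conjunct2] by blast
qed

lemma Dn_stage [dn]:
  "Fn E a ==> Fn E b ==> Fn E c ==> Fn E d ==> Fn E e ==> Fn E f ==>
    Dn E (%rh. stage (a rh) (b rh) (c rh) (d rh) (e rh) (f rh))"
proof -
  have m: "Fn E (%rh. mk {k : els (M rh). F rh : els k})" if "Fn E F" "Fn E M" for F M
  proof (rule Fn_comp2[where f = "%F M. mk {k : els M. F : els k}", OF _ that])
    show "Fn E (%rh. mk {k : els (rh 1). rh 0 : els k})" by (rule Fn_mk) (intro sepI dn, unfold mem_Collect_eq, intro dn)
  qed
  have dm: "Fn E (%rh. dom (a rh))" if "Fn E a" for a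
  proof (rule Fn_comp1[where f = dom, OF _ that])
    show "Fn E (%rh. dom (rh 0))" unfolding dom_def by (rule Fn_mk) (intro sepI dn, unfold mem_Collect_eq, intro dn)
  qed
  show "Fn E a ==> Fn E b ==> Fn E c ==> Fn E d ==> Fn E e ==> Fn E f ==>
    Dn E (%rh. stage (a rh) (b rh) (c rh) (d rh) (e rh) (f rh))"
    unfolding stage_def by (intro dn m dm Fn_shift)
qed

text \<open>The values of the functions \<open>f\<close> belonging to the least unprocessed slot
  \<open>\<xi>\<close> can be decided with coordinates below \<open>\<xi>\<close>, so the added
  cells belong neither to \<open>\<xi>\<close> nor to any later slot, whose cells beyond
  \<open>i\<close> stay empty. The cells reserved earlier are still open, and
  \<open>bound_all_fillings\<close> gives one bound for all of their fillings.\<close>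

lemma stage_step:
  assumes C: "fin C" "!!c. c : els C ==> EX \<xi> f w. c = opr \<xi> (opr f w) & valid p \<xi> f w" and i: "i : els om"
    and st: "stage p C i d Z t" and \<xi>: "\<xi> : els (dom C)" "!!z. opr \<xi> z ~: els d"
    and least: "!!\<eta>. \<eta> : els (dom C) ==> (!!z. opr \<eta> z ~: els d) ==> \<eta> ~: els \<xi>"
  shows "EX d' Z' t'. stage p C i d' Z' t' & els d <= els d' & (EX z. opr \<xi> z : els d')"
proof -
  note st' = stageD[OF st]
  let ?B = "fiber C \<xi>"
  have finB: "fin ?B" by (rule fin_subset[OF C(1)]) (simp add: els_fiber)
  obtain c0 where "opr \<xi> c0 : els C" using \<xi>(1) dom by blast
  hence "EX f w. valid p \<xi> f w" using C(2) by force
  hence \<xi>k: "\<xi> : els k3" unfolding valid_def using lab_k3 by blast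
  define U where "U q N <-> (ALL c:els ?B. ALL f w. c = opr \<xi> (opr f w) --> (EX v:els N. dec q f i v))" for q N
  have dU: "Dn E (%rh. U (rh 0) (rh 1))" unfolding U_def by (intro dn)
  have Umono: "U q' N'" if "U q N" "le q' q" "N' : els om" "N : els N' \<or> N = N'" for q q' N N'
  proof -
    have "els N <= els N'" using om_trans[OF that(3)] that(4) by blast
    thus ?thesis using that(1) dec_mono[OF _ that(2)] unfolding U_def by blast
  qed
  have step: "EX r N. N : els om & ex \<xi> r q & U r N" if q: "le q p" for q
  proof -
    define R where "R c q N <-> (ALL f w. c = opr \<xi> (opr f w) --> (EX v:els N. dec q f i v))" for c q N
    have "EX r N. N : els om & ex \<xi> r q & (ALL c:els ?B. R c r N)"
    proof (rule collect_ext[OF finB])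
      show "Dn E (%rh. R (rh 0) (rh 1) (rh 2))" unfolding R_def by (intro dn)
      show "R c q' N'" if "R c q N" "le q' q" "N' : els om" "N : els N' \<or> N = N'" for c q q' N N'
      proof -
        have "els N <= els N'" using om_trans[OF that(3)] that(4) by blast
        thus ?thesis using that(1) dec_mono[OF _ that(2)] unfolding R_def by blast
      qed
      fix c q assume c: "c : els ?B" "le q p"
      hence "c : els C" "EX y. c = opr \<xi> y" unfolding els_fiber by auto
      then obtain f w where f: "c = opr \<xi> (opr f w)" "valid p \<xi> f w" using C(2) by force
      have "tot p f i om \<xi>" using f(2) i unfolding valid_def by blast
      then obtain r v where r: "ex \<xi> r q" "v : els om" "dec r f i v" using tot_dec c(2) by blast
      have "R c r (suc v)" unfolding R_def f(1) using r(3) by auto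
      thus "EX r N. N : els om & ex \<xi> r q & R c r N" using r(1) om_suc[OF r(2)] by blast
    qed (rule q)
    thus ?thesis unfolding R_def U_def by blast
  qed
  have "EX t' N. N : els om & ex \<xi> t' t & avoids t' Z & (ALL q. le q t' & decides q Z --> U q N)"
  proof (rule bound_all_fillings[OF st'(2,3) dU _ _ st'(1,4)])
    show "U q' N'" if "U q N" "le q' q" "N' : els om" "N : els N' \<or> N = N'" for q q' N N' by (rule Umono[OF that])
    show "EX r N. N : els om & ex \<xi> r q & U r N" if "le q p" for q by (rule step[OF that])
  qed
  then obtain t' N where
    t': "N : els om" "ex \<xi> t' t" "avoids t' Z" "!!q. le q t' ==> decides q Z ==> U q N" by blast
  obtain F where F: "F : els om" "N : els F" "i : els F" using om_bound2[OF t'(1) i] .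
  have "fin (prd ?B F)" by (rule fin_prd[OF finB fin_om[OF F(1)]])
  \<comment> \<open>At most one value is forbidden for each requirement of the slot and each
    \<open>l\<close> below \<open>F\<close>, hence at most \<open>\<mu>\<close> in total.
    \<open>M\<close> is taken so large that more than \<open>\<mu>\<close> candidates lie between
    \<open>F\<close> and \<open>M\<close>.\<close>
  then obtain \<mu> where \<mu>: "\<mu> : els om" "szle \<mu> (prd ?B F)" using fin_szle by blast
  obtain O' where O': "fin O'" "els O' <= els om" "ALL k:els O'. F : els k" "~ szle \<mu> O'" using big_choices[OF \<mu>(1) F(1)] by blast
  obtain M where M: "M : els om" "els O' <= els M" using fin_om_bound[OF O'(1,2)] by blast
  have "els (mk {k : els M. F : els k}) = {k : els M. F : els k}" by (rule els_mk) (intro sepI dn)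
  hence big: "~ szle \<mu> (mk {k : els M. F : els k})" using szle_sub[of \<mu> _ O'] O'(3,4) M(2) by blast
  let ?S = "mk {m : els M. i : els m}"
  have S: "els ?S = {m : els M. i : els m}" by (rule els_mk) (intro sepI dn)
  have Sf: "fin ?S" by (rule fin_subset[OF fin_om[OF M(1)]]) (use S in blast)
  let ?d = "ins (opr \<xi> (opr F M)) d" and ?Z = "un Z (prd (mk {\<xi>}) ?S)"
  have old: "!!\<eta> z. opr \<eta> z : els d ==> \<eta> ~= \<xi>" using \<xi>(2) by blast
  have t\<xi>: "opr (opr \<eta> m) b ~: els t'" if "\<eta> : els (dom C)" "!!z. opr \<eta> z ~: els d" "i : els m" for \<eta> m b
    using exD[OF t'(2)] least[OF that(1,2)] st'(9)[OF that] by blast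
  have "stage p C i ?d ?Z t'" unfolding stage_def
  proof (intro conjI allI impI ballI)
    show "le t' p" using le_trans ex_le[OF t'(2)] st'(1) by blast
    show "fin ?Z" by (rule fin_un[OF st'(2) fin_prd[OF fin_sing Sf]])
    have "els ?S <= els om" using S om_sub[OF M(1)] by blast
    thus "els ?Z <= els (prd k3 om)" using st'(3) \<xi>k by (auto simp: els_prd els_mk)
    show "avoids t' ?Z" unfolding avoids_def
    proof (intro ballI allI)
      fix z b assume "z : els ?Z"
      then consider "z : els Z" | m where "z = opr \<xi> m" "i : els m" using S by (auto simp: els_prd els_mk)
      thus "opr z b ~: els t'"
      proof cases
        case 1 thus ?thesis using t'(3) unfolding avoids_def by blast
      next
        case 2 thus ?thesis using t\<xi>[OF \<xi>] by blast
      qed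
    qed
    show "\<eta> : els (dom C)" if "opr \<eta> z : els ?d" for \<eta> z using that st'(5)[of \<eta> z] \<xi>(1) by auto
    show "EX F:els om. EX M:els om. z = opr F M & i : els F &
        (EX \<mu>:els om. szle \<mu> (prd (fiber C \<eta>) F) & ~ szle \<mu> (mk {k : els M. F : els k}))" if "opr \<eta> z : els ?d" for \<eta> z
    proof (cases "opr \<eta> z : els d")
      case True show ?thesis by (rule st'(6)[OF True])
    next
      case False
      hence e: "\<eta> = \<xi>" "z = opr F M" using that by auto
      show ?thesis unfolding e
        by (intro bexI[of _ F] bexI[of _ M] conjI bexI[of _ \<mu>]) (use F M \<mu> big in blast)+
    qed
    show "z = z'" if "opr \<eta> z : els ?d & opr \<eta> z' : els ?d" for \<eta> z z'
      using that st'(7)[of \<eta> z z'] old[of \<eta> z] old[of \<eta> z'] by auto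
    show "opr \<eta> m : els ?Z <-> (EX F M. opr \<eta> (opr F M) : els ?d & i : els m & m : els M)" for \<eta> m
    proof -
      have "opr \<eta> m : els ?Z <-> opr \<eta> m : els Z \<or> \<eta> = \<xi> & m : els M & i : els m" using S by (simp add: els_mk)
      thus ?thesis unfolding st'(8) by auto
    qed
    show "opr (opr \<eta> m) b ~: els t'" if "\<eta> : els (dom C)" "ALL z. opr \<eta> z ~: els ?d" "i : els m" for \<eta> m b
      by (rule t\<xi>) (use that in auto)
    fix \<eta> F' M' f w q assume a: "opr \<eta> (opr F' M') : els ?d & opr \<eta> (opr f w) : els C" "le q t' & decides q ?Z"
    have q: "decides q Z" "le q t" using a(2) le_trans[OF _ ex_le[OF t'(2)]] unfolding decides_def by auto
    show "EX v:els F'. dec q f i v"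
    proof (cases "opr \<eta> (opr F' M') : els d")
      case True
      thus ?thesis using st'(10) a(1) q by blast
    next
      case False
      hence e: "\<eta> = \<xi>" "F' = F" using a(1) by auto
      have "U q N" using t'(4) a(2) q(1) by blast
      moreover have "opr \<xi> (opr f w) : els ?B" using a(1) e by (simp add: els_fiber)
      ultimately have "EX v:els N. dec q f i v" unfolding U_def by blast
      thus ?thesis unfolding e using om_trans[OF F(1) _ F(2)] by blast
    qed
  qed
  moreover have "opr \<xi> (opr F M) : els ?d" by simp
  ultimately show ?thesis by (intro exI[of _ ?d] exI[of _ ?Z] exI[of _ t']) auto
qed

lemma Fn_dom [dn]: "Fn E a ==> Fn E (%rh. dom (a rh))"
proof (rule Fn_comp1[where f = dom])
  show "Fn E (%rh. dom (rh 0))" unfolding dom_def by (rule Fn_mk) (intro sepI dn, unfold mem_Collect_eq, intro dn)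
qed

text \<open>Induction on the number of slots not yet processed. The start is possible because all
  columns mentioned by \<open>p\<close> are below \<open>i\<close>.\<close>

lemma stage_full:
  assumes C: "fin C" "!!c. c : els C ==> EX \<xi> f w. c = opr \<xi> (opr f w) & valid p \<xi> f w" and i: "i : els om"
    and p: "p : els P" "!!\<alpha> n b. opr (opr \<alpha> n) b : els p ==> n : els i"
  shows "EX d Z t. stage p C i d Z t & (ALL \<eta>:els (dom C). EX z. opr \<eta> z : els d)"
proof -
  define X where "X d = mk {\<xi> : els (dom C). ALL z. opr \<xi> z ~: els d}" for d
  have X: "els (X d) = {\<xi> : els (dom C). ALL z. opr \<xi> z ~: els d}" for d unfolding X_def by (rule els_mk) (intro sepI dn)
  have FX [dn]: "Fn E a ==> Fn E (%rh. X (a rh))" for a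
  proof (rule Fn_comp1[where f = X])
    show "Fn E (%rh. X (rh 0))" unfolding X_def by (rule Fn_mk) (intro sepI dn, unfold mem_Collect_eq, intro dn)
  qed
  have finC: "fin (dom C)" by (rule fin_dom[OF C(1)]) (use C(2) in blast)
  have domC: "els (dom C) <= els k3"
  proof
    fix \<xi> assume "\<xi> : els (dom C)"
    then obtain y where "opr \<xi> y : els C" using dom by blast
    hence "EX f w. valid p \<xi> f w" using C(2) by force
    thus "\<xi> : els k3" unfolding valid_def using lab_k3 by blast
  qed
  define S where "S n <-> (ALL d Z t. stage p C i d Z t & szle n (X d) --> (EX d Z t. stage p C i d Z t & X d = emp))" for n
  have S: "S n" if "n : els om" for n
  proof (rule om_induct[OF that])
    show "Dn E (%rh. S (rh 0))" unfolding S_def by (intro dn)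
    show "S emp" unfolding S_def using szle_0 by blast
    fix n assume n: "n : els om" "S n"
    show "S (suc n)" unfolding S_def
    proof (intro allI impI, elim conjE)
      fix d Z t assume st: "stage p C i d Z t" and sz: "szle (suc n) (X d)"
      show "EX d Z t. stage p C i d Z t & X d = emp"
      proof (cases "X d = emp")
        case True thus ?thesis using st by blast
      next
        case False
        then obtain \<xi>0 where x0: "\<xi>0 : els (X d)" using empty_iff_emp by blast
        hence "\<xi>0 : els k3" using X domC by blast
        moreover have "Dn E (%rh. rh 0 : els (X d))" by (intro dn)
        ultimately obtain \<xi> where x: "\<xi> : els (X d)" "ALL \<eta>:els \<xi>. \<eta> ~: els (X d)"
          using ord_least[where P = "%\<xi>. \<xi> : els (X d)", OF ord_k3 _ x0] by blast
        have "EX d' Z' t'. stage p C i d' Z' t' & els d <= els d' & (EX z. opr \<xi> z : els d')"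
        proof (rule stage_step[OF C i st])
          show "\<xi> : els (dom C)" "!!z. opr \<xi> z ~: els d" using x(1) X by auto
          show "\<eta> ~: els \<xi>" if "\<eta> : els (dom C)" "!!z. opr \<eta> z ~: els d" for \<eta>
          proof -
            have "\<eta> : els (X d)" unfolding X using that by simp
            thus ?thesis using x(2) by blast
          qed
        qed
        then obtain d' Z' t' where d': "stage p C i d' Z' t'" "els d <= els d'" "EX z. opr \<xi> z : els d'" by blast
        have "szle n (df (X d) (mk {\<xi>}))" by (rule szle_remove[OF sz x(1)])
        hence "szle n (X d')" by (rule szle_sub) (use X d'(2,3) in \<open>auto simp: els_mk\<close>)
        thus ?thesis using n(2) d'(1) unfolding S_def by blast
      qed
    qed
  qed
  have st: "stage p C i emp emp p" unfolding stage_def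
  proof (intro conjI allI impI ballI)
    show "le p p" by (rule le_refl[OF p(1)])
    show "opr (opr \<eta> m) b ~: els p" if "i : els m" for \<eta> m b
      using p(2)[of \<eta> m b] that el_asym by blast
  qed (auto simp: avoids_def)
  have "fin (X emp)" by (rule fin_subset[OF finC]) (use X in blast)
  then obtain n where "n : els om" "szle n (X emp)" using fin_szle by blast
  then obtain d Z t where "stage p C i d Z t" "X d = emp" using S st unfolding S_def by blast
  moreover have "EX z. opr \<eta> z : els d" if "\<eta> : els (dom C)" for \<eta> using X[of d] that \<open>X d = emp\<close> by auto
  ultimately show ?thesis by blast
qed

lemma tot_le: "tot p R x b K ==> le p' p ==> tot p' R x b K"
  unfolding tot_def using le_trans by blast

lemma valid_le: "valid p \<xi> f w ==> le p' p ==> valid p' \<xi> f w"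
  unfolding valid_def using tot_le by blast

text \<open>For an unfilled slot of least label \<open>\<alpha>\<close>, the values of
  \<open>w\<close> are decided with coordinates in \<open>Kl \<alpha>\<close>, which contains none
  of the unfilled slots; \<open>pick\<close> then gives a place \<open>k\<close> for the first 1,
  beyond \<open>F\<close> and distinct from these values. Once all reserved cells are filled, the
  values of \<open>f\<close> are below \<open>F\<close>, as prepared by the stages, and hence below
  \<open>k\<close>.\<close>

lemma basic_meet:
  assumes C: "fin C" "!!c. c : els C ==> EX \<xi> f w. c = opr \<xi> (opr f w) & valid p \<xi> f w" and i: "i : els om"
    and p: "p : els P" "!!\<alpha> n b. opr (opr \<alpha> n) b : els p ==> n : els i"
  shows "EX q. le q p & (ALL \<xi> f w. opr \<xi> (opr f w) : els C --> meets q i \<xi> f w)"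
proof -
  have "EX d Z t. stage p C i d Z t & (ALL \<eta>:els (dom C). EX z. opr \<eta> z : els d)"
    by (rule stage_full[OF C i p])
  then obtain d Z t where st: "stage p C i d Z t" and full: "!!\<eta>. \<eta> : els (dom C) ==> EX z. opr \<eta> z : els d" by blast
  note st' = stageD[OF st]
  define req where "req q \<eta> k c l <-> (ALL f w. c = opr \<eta> (opr f w) --> (EX y. y ~= k & dec q w (opr i l) y))" for q \<eta> k c l
  define don where "don q \<eta> <-> (ALL F M. opr \<eta> (opr F M) : els d --> (EX k:els M. F : els k & first_one q \<eta> i k &
     (ALL m:els M. i : els m --> (EX b. opr (opr \<eta> m) b : els q)) & (ALL c:els (fiber C \<eta>). ALL l:els F. req q \<eta> k c l)))" for q \<eta>
  define avo where "avo q \<eta> <-> (ALL F M. opr \<eta> (opr F M) : els d --> (ALL m:els M. ALL b. i : els m --> opr (opr \<eta> m) b ~: els q))" for q \<eta>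
  have don_mono: "don q' \<eta>" if dq: "don q \<eta>" "le q' q" for q q' \<eta>
    unfolding don_def
  proof (intro allI impI)
    fix F M assume "opr \<eta> (opr F M) : els d"
    then obtain k where k: "k : els M" "F : els k" "first_one q \<eta> i k" "ALL m:els M. i : els m --> (EX b. opr (opr \<eta> m) b : els q)"
      "ALL c:els (fiber C \<eta>). ALL l:els F. req q \<eta> k c l" using dq(1) unfolding don_def by blast
    have "first_one q' \<eta> i k" using k(3) leD(3)[OF dq(2)] unfolding first_one_def by blast
    moreover have "req q' \<eta> k c l" if "req q \<eta> k c l" for c l using that dec_mono[OF _ \<open>le q' q\<close>] unfolding req_def by blast
    ultimately show "EX k:els M. F : els k & first_one q' \<eta> i k &
     (ALL m:els M. i : els m --> (EX b. opr (opr \<eta> m) b : els q')) & (ALL c:els (fiber C \<eta>). ALL l:els F. req q' \<eta> k c l)"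
      using k(1,2,4,5) leD(3)[OF dq(2)] by blast
  qed
  define X where "X q = mk {\<eta> : els (dom C). ~ don q \<eta>}" for q
  have Ddon [dn]: "Fn E a ==> Fn E b ==> Dn E (%rh. don (a rh) (b rh))" for a b
    unfolding don_def req_def by (intro dn Fn_shift)
  have Davo [dn]: "Fn E a ==> Fn E b ==> Dn E (%rh. avo (a rh) (b rh))" for a b
    unfolding avo_def by (intro dn Fn_shift)
  have X: "els (X q) = {\<eta> : els (dom C). ~ don q \<eta>}" for q unfolding X_def by (rule els_mk) (intro sepI dn)
  have FX [dn]: "Fn E a ==> Fn E (%rh. X (a rh))" for a
  proof (rule Fn_comp1[where f = X])
    show "Fn E (%rh. X (rh 0))" unfolding X_def by (rule Fn_mk) (intro sepI dn, unfold mem_Collect_eq, intro dn)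
  qed
  have vC: "EX f w. opr \<eta> (opr f w) : els C & valid p \<eta> f w" if "\<eta> : els (dom C)" for \<eta>
    using that C(2) dom by force
  have finC: "fin (dom C)" by (rule fin_dom[OF C(1)]) (use C(2) in blast)
  \<comment> \<open>The invariant: a slot is either done or has all of its reserved cells open, so
    that its pattern can be added as a whole.\<close>
  define S where "S n <-> (ALL q. le q t & (ALL \<eta>:els (dom C). don q \<eta> \<or> avo q \<eta>) & szle n (X q) --> (EX q. le q t & X q = emp))" for n
  have S: "S n" if "n : els om" for n
  proof (rule om_induct[OF that])
    show "Dn E (%rh. S (rh 0))" unfolding S_def by (intro dn)
    show "S emp" unfolding S_def using szle_0 by blast
    fix n assume n: "n : els om" "S n"
    show "S (suc n)" unfolding S_def
    proof (intro allI impI, elim conjE)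
      fix q assume q: "le q t" "ALL \<eta>:els (dom C). don q \<eta> \<or> avo q \<eta>" and sz: "szle (suc n) (X q)"
      have qP: "q : els P" using leD(1)[OF q(1)] .
      show "EX q. le q t & X q = emp"
      proof (cases "X q = emp")
        case True thus ?thesis using q(1) by blast
      next
        case False
        then obtain \<eta>0 where e0: "\<eta>0 : els (X q)" using empty_iff_emp by blast
        have l0: "EX \<alpha>:els k2. lab \<eta> \<alpha>" if "\<eta> : els (X q)" for \<eta>
          using that vC[of \<eta>] unfolding X valid_def by blast
        obtain \<alpha>0 where a0: "\<alpha>0 : els k2" "EX \<eta>:els (X q). lab \<eta> \<alpha>0" using l0[OF e0] e0 by blast
        have "Dn E (%rh. EX \<eta>:els (X q). lab \<eta> (rh 0))" by (intro dn)
        then obtain \<alpha> where a: "\<alpha> : els k2" "EX \<eta>:els (X q). lab \<eta> \<alpha>" "ALL \<beta>:els \<alpha>. ~ (EX \<eta>:els (X q). lab \<eta> \<beta>)"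
          using ord_least[where P = "%\<alpha>. EX \<eta>:els (X q). lab \<eta> \<alpha>", OF ord_k2 a0] by blast
        then obtain \<xi> where x: "\<xi> : els (X q)" "lab \<xi> \<alpha>" by blast
        have xC: "\<xi> : els (dom C)" "~ don q \<xi>" "avo q \<xi>" using x(1) X q(2) by auto
        \<comment> \<open>The label of an unfilled slot is not below the minimal
          \<open>\<alpha>\<close>, so the slot is outside of \<open>Kl \<alpha>\<close> and its
          cells are not touched when \<open>w\<close> is decided.\<close>
        have Kx: "\<eta> ~: els (Kl \<alpha>)" if eX: "\<eta> : els (X q)" for \<eta>
        proof
          assume k: "\<eta> : els (Kl \<alpha>)"
          obtain \<beta> where b: "\<beta> : els k2" "lab \<eta> \<beta>" using l0[OF eX] by blast
          hence "\<beta> : els \<alpha>" using k unfolding Kl by blast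
          thus False using a(3) b(2) eX by blast
        qed
        obtain z where z: "opr \<xi> z : els d" using full[OF xC(1)] by blast
        obtain F M \<mu> where F: "opr \<xi> (opr F M) : els d" "F : els om" "M : els om" "i : els F"
          "\<mu> : els om" "szle \<mu> (prd (fiber C \<xi>) F)" "~ szle \<mu> (mk {k : els M. F : els k})"
          using st'(6)[OF z] z by blast
        have uniq: "F' = F & M' = M" if "opr \<xi> (opr F' M') : els d" for F' M' using st'(7)[OF that F(1)] by simp
        define R where "R z q y <-> (ALL f w l. z = opr (opr \<xi> (opr f w)) l --> dec q w (opr i l) y)" for z q y
        have "EX r k. ex (Kl \<alpha>) r q & k : els (mk {k : els M. F : els k}) & (ALL z:els (prd (fiber C \<xi>) F). EX y. y ~= k & R z r y)"
        proof (rule pick[OF F(5) _ _ _ subset_refl F(6,7)])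
          show "Dn E (%rh. R (rh 0) (rh 1) (rh 2))" unfolding R_def by (intro dn)
          show "R z q' y" if "R z q y" "le q' q" for z q q' y
            using that(1) dec_mono[OF _ that(2)] unfolding R_def by blast
          show "le q p" using le_trans[OF q(1) st'(1)] .
          fix z q assume z: "z : els (prd (fiber C \<xi>) F)" and q: "le q p"
          obtain c l where c: "z = opr c l" "c : els (fiber C \<xi>)" "l : els F" using prdE[OF z] .
          then obtain f w where f: "c = opr \<xi> (opr f w)" "valid p \<xi> f w" using C(2)[of c] unfolding els_fiber by auto
          obtain \<beta> where "lab \<xi> \<beta>" "ALL i:els om. ALL l:els om. tot p w (opr i l) om (Kl \<beta>)" using f(2) unfolding valid_def by blast
          hence "tot p w (opr i l) om (Kl \<alpha>)" using lab_uniq x(2) i om_sub[OF F(2) c(3)] by blast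
          then obtain r v where "ex (Kl \<alpha>) r q" "dec r w (opr i l) v" using tot_dec q by blast
          thus "EX r y. ex (Kl \<alpha>) r q & R z r y" unfolding R_def c(1) f(1) by auto
        qed
        then obtain r k where r: "ex (Kl \<alpha>) r q" "k : els (mk {k : els M. F : els k})"
          "ALL z:els (prd (fiber C \<xi>) F). EX y. y ~= k & R z r y" by blast
        have "els (mk {k : els M. F : els k}) = {k : els M. F : els k}" by (rule els_mk) (intro sepI dn)
        hence k: "k : els M" "F : els k" using r(2) by auto
        have kom: "k : els om" using om_sub[OF F(3) k(1)] .
        have ik: "i : els k" using om_trans[OF kom F(4) k(2)] .
        have rP: "r : els P" using leD(1)[OF ex_le[OF r(1)]] .
        have xk: "\<xi> : els k3" using lab_k3 x(2) by blast
        note pt = pat(1)[OF F(3), where i = i and k = k and \<xi> = \<xi>]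
        let ?pt = "pat \<xi> i M k" let ?q = "un r ?pt"
        have ravo: "opr (opr \<eta> m) b ~: els r" if "\<eta> : els (X q)" "opr \<eta> (opr F' M') : els d" "m : els M'" "i : els m" for \<eta> m b F' M'
        proof
          assume "opr (opr \<eta> m) b : els r"
          hence "opr (opr \<eta> m) b : els q" using exD[OF r(1)] Kx[OF that(1)] by blast
          moreover have "avo q \<eta>" using that(1) X q(2) by auto
          ultimately show False using that(2-4) unfolding avo_def by blast
        qed
        have q'P: "?q : els P"
        proof (rule P_un[OF rP pat(2)[OF F(3) xk]])
          fix c b b' assume c: "opr c b : els r" "opr c b' : els ?pt"
          obtain \<eta> m where "c = opr \<eta> m" using P_cell(1)[OF rP c(1)] by blast
          thus "b = b'" using c ravo[OF x(1) F(1)] pt by auto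
        qed
        have qr: "le ?q r" using q'P rP by (simp add: le_iff)
        have qq: "le ?q q" using le_trans[OF qr ex_le[OF r(1)]] .
        have "don ?q \<xi>" unfolding don_def
        proof (intro allI impI)
          fix F' M' assume "opr \<xi> (opr F' M') : els d"
          hence e: "F' = F" "M' = M" using uniq by blast+
          have "first_one ?q \<xi> i k" unfolding first_one_def
          proof (intro conjI ballI impI)
            show "opr (opr \<xi> k) (suc emp) : els ?q" using pt k ik by simp
            fix m assume m: "m : els k" "i : els m"
            have "m ~= k" "m : els M" using m(1) el_irrefl om_trans[OF F(3) m(1) k(1)] by auto
            thus "opr (opr \<xi> m) emp : els ?q" using pt m by simp
          qed (rule kom, rule ik)
          moreover have "EX b. opr (opr \<xi> m) b : els ?q" if "m : els M" "i : els m" for m using pt that by auto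
          moreover have "req ?q \<xi> k c l" if cl: "c : els (fiber C \<xi>)" "l : els F" for c l
            unfolding req_def
          proof (intro allI impI)
            fix f w assume c: "c = opr \<xi> (opr f w)"
            have "opr c l : els (prd (fiber C \<xi>) F)" using cl by simp
            then obtain y where y: "y ~= k" "R (opr c l) r y" using r(3) by blast
            hence "dec r w (opr i l) y" unfolding R_def c by simp
            thus "EX y. y ~= k & dec ?q w (opr i l) y" using y(1) dec_mono[OF _ qr] by blast
          qed
          ultimately show "EX k:els M'. F' : els k & first_one ?q \<xi> i k &
            (ALL m:els M'. i : els m --> (EX b. opr (opr \<xi> m) b : els ?q)) & (ALL c:els (fiber C \<xi>). ALL l:els F'. req ?q \<xi> k c l)"
            unfolding e using k by blast
        qed
        have "don ?q \<eta> \<or> avo ?q \<eta>" if h: "\<eta> : els (dom C)" for \<eta>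
        proof (cases "don q \<eta> \<or> \<eta> = \<xi>")
          case True
          thus ?thesis using don_mono[OF _ qq] \<open>don ?q \<xi>\<close> by blast
        next
          case False
          hence hX: "\<eta> : els (X q)" unfolding X using h by simp
          have "avo ?q \<eta>" unfolding avo_def
          proof (intro allI impI ballI)
            fix F' M' m b assume "opr \<eta> (opr F' M') : els d" "m : els M'" "i : els m"
            thus "opr (opr \<eta> m) b ~: els ?q" using ravo[OF hX] pt False by simp
          qed
          thus ?thesis by blast
        qed
        moreover have "szle n (X ?q)"
        proof (rule szle_sub[OF szle_remove[OF sz x(1)]])
          show "els (X ?q) <= els (df (X q) (mk {\<xi>}))"
            using don_mono[OF _ qq] \<open>don ?q \<xi>\<close> by (auto simp: X els_mk)
        qed
        ultimately show ?thesis using n(2) le_trans[OF qq q(1)] unfolding S_def by blast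
      qed
    qed
  qed
  have "fin (X t)" by (rule fin_subset[OF finC]) (use X in blast)
  then obtain n where n: "n : els om" "szle n (X t)" using fin_szle by blast
  have "avo t \<eta>" for \<eta> unfolding avo_def using st'(4) st'(8)[of \<eta>] unfolding avoids_def by blast
  then obtain q where q: "le q t" "X q = emp" using S[OF n(1)] n(2) le_refl[OF leD(1)[OF st'(1)]] unfolding S_def by blast
  have dq: "don q \<eta>" if "\<eta> : els (dom C)" for \<eta> using X[of q] q(2) that by auto
  \<comment> \<open>With every slot done, all reserved cells are decided; this is the hypothesis
    under which the stages bounded \<open>f\<close>.\<close>
  have dec: "decides q Z" unfolding decides_def
  proof
    fix z assume z: "z : els Z"
    then obtain \<eta> m where e: "z = opr \<eta> m" using prdE st'(3) by blast
    then obtain F M where F: "opr \<eta> (opr F M) : els d" "i : els m" "m : els M" using z st'(8) by blast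
    thus "EX b. opr z b : els q" using dq[OF st'(5)[OF F(1)]] unfolding don_def e by blast
  qed
  have "meets q i \<xi> f w" if c: "opr \<xi> (opr f w) : els C" for \<xi> f w
  proof -
    have xC: "\<xi> : els (dom C)" using dom c by blast
    then obtain z where z: "opr \<xi> z : els d" using full by blast
    obtain F M where F: "opr \<xi> (opr F M) : els d" using st'(6)[OF z] z by blast
    have oF: "F : els om" using st'(6)[OF F] by simp
    obtain k where k: "F : els k" "first_one q \<xi> i k" "ALL c:els (fiber C \<xi>). ALL l:els F. req q \<xi> k c l"
      using dq[OF xC] F unfolding don_def by blast
    obtain v where v: "v : els F" "dec q f i v" using st'(10)[OF F c q(1) dec] by blast
    have "k : els om" using k(2) unfolding first_one_def by blast
    hence vk: "v : els k" using om_trans v(1) k(1) by blast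
    have "EX y. y ~= k & dec q w (opr i l) y" if l: "l : els v" for l
    proof -
      have "opr \<xi> (opr f w) : els (fiber C \<xi>)" unfolding els_fiber using c by simp
      hence "req q \<xi> k (opr \<xi> (opr f w)) l" using k(3) om_trans[OF oF l v(1)] by blast
      thus ?thesis unfolding req_def by simp
    qed
    thus ?thesis unfolding meets_def using k(2) vk v(2) by blast
  qed
  thus ?thesis using le_trans[OF q(1) st'(1)] by blast
qed

text \<open>Every \<open>i\<close> beyond the columns of \<open>p\<close> is suitable for
  \<open>basic_meet\<close>, so there are suitable ones above any \<open>m\<close>: the finite
  intersections are unbounded.\<close>

lemma basic_meet':
  assumes C: "fin C" "!!c. c : els C ==> EX \<xi> f w. c = opr \<xi> (opr f w) & valid p \<xi> f w"
    and p: "p : els P" and m: "m : els om"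
  shows "EX i:els om. m : els i & (EX q. le q p & (ALL \<xi> f w. opr \<xi> (opr f w) : els C --> meets q i \<xi> f w))"
proof -
  define Q where "Q z b <-> (ALL \<alpha> n e. z = opr (opr \<alpha> n) e --> n : els b)" for z b
  have "EX b:els om. ALL z:els p. Q z b"
  proof (rule fin_coll[OF ord_om _ P_fin[OF p]])
    show "els om ~= {}" using om_0 by blast
    show "Dn E (%rh. Q (rh 0) (rh 1))" unfolding Q_def by (intro dn)
    show "Q z b'" if "Q z b" "b : els b'" "b' : els om" for z b b'
      using that(1) om_trans[OF that(3) _ that(2)] unfolding Q_def by blast
    fix z assume z: "z : els p"
    obtain \<alpha> n e where n: "n : els om" "z = opr (opr \<alpha> n) e" using P_atom[OF p z] by blast
    have "Q z (suc n)" unfolding Q_def n(2) by auto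
    thus "EX b:els om. Q z b" using om_suc[OF n(1)] by blast
  qed
  then obtain b where b: "b : els om" "ALL z:els p. Q z b" by blast
  obtain i where i: "i : els om" "m : els i" "b : els i" using om_bound2[OF m b(1)] .
  have pi: "n : els i" if "opr (opr \<alpha> n) e : els p" for \<alpha> n e
  proof -
    have "n : els b" using b(2) that unfolding Q_def by blast
    thus ?thesis using om_trans[OF i(1) _ i(3)] by blast
  qed
  have "EX q. le q p & (ALL \<xi> f w. opr \<xi> (opr f w) : els C --> meets q i \<xi> f w)"
    by (rule basic_meet[OF C i(1) p pi])
  thus ?thesis using i(1,2) by blast
qed

end

section \<open>Choice and ultrafilters in the extension\<close>

text \<open>Choice enters as a relation on every set that compares distinct points and has minima;
  this is the form that passes to the extension.\<close>

locale zwo = zs E for E :: "'v => 'v => bool" +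
  assumes wo_ax: "EX W. (ALL x:els S. ALL y:els S. x ~= y --> opr x y : els W \<or> opr y x : els W) &
     (ALL A. els A <= els S & A ~= emp --> (EX x:els A. ALL z:els A. opr z x ~: els W))"
begin

lemma choice:
  assumes K: "Dn E (%rh. K (rh 0) (rh 1))" and ex: "!!x. x : els a ==> EX y:els b. K x y"
  shows "EX f. is_fun E f a b & (ALL x:els a. K x (ap f x))"
proof -
  obtain W where tot: "!!x y. x : els b ==> y : els b ==> x ~= y ==> opr x y : els W \<or> opr y x : els W"
    and wf: "!!A. els A <= els b ==> A ~= emp ==> EX x:els A. ALL z:els A. opr z x ~: els W" using wo_ax[of b] by blast
  have dK: "Fn E s ==> Fn E t ==> Dn E (%rh. K (s rh) (t rh))" for s t by (rule Dn2[where K = K, OF K])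
  define K' where "K' x y <-> K x y & (ALL z:els b. K x z --> opr z y ~: els W)" for x y
  have dK': "Dn E (%rh. K' (rh 0) (rh 1))" unfolding K'_def by (intro dn dK)
  have K': "EX! y. y : els b & K' x y" if x: "x : els a" for x
  proof -
    have "Dn E (%rh. K x (rh 0))" by (intro dK dn)
    hence S: "els (mk {y : els b. K x y}) = {y : els b. K x y}" by (intro els_mk sepI)
    have "mk {y : els b. K x y} ~= emp"
    proof
      assume "mk {y : els b. K x y} = emp"
      hence "{y : els b. K x y} = {}" using S by simp
      thus False using ex[OF x] by blast
    qed
    then obtain y where "y : els b" "K x y" "ALL z:els b. K x z --> opr z y ~: els W"
      using wf[of "mk {y : els b. K x y}"] unfolding S by blast
    thus ?thesis unfolding K'_def using tot by blast
  qed
  let ?f = "rc a b K'"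
  have f: "opr x y : els ?f <-> x : els a & y : els b & K' x y" for x y by (rule rc_iff[OF dK'])
  have fn: "is_fun E ?f a b" unfolding is_fun_iff
  proof (intro conjI ballI)
    show "els ?f <= els (prd a b)" unfolding els_rc[OF dK'] by auto
    show "EX! y. opr x y : els ?f" if "x : els a" for x using K'[OF that] that unfolding f by simp
  qed
  have "K x (ap ?f x)" if "x : els a" for x
    using fun_val(1)[OF fn that] unfolding f K'_def by blast
  thus ?thesis using fn by blast
qed

text \<open>Recursion along a well-ordering of the power set takes the place of Zorn's lemma. The
  row of \<open>R\<close> at \<open>u\<close> is the filter obtained once \<open>u\<close> has been
  considered: \<open>u\<close> is added if it meets every member collected before, that is, every
  member of \<open>B\<close> or of an earlier row.\<close>

lemma ultrafilter:
  assumes B: "els B <= els (pw a)" "b0 : els B" and ne: "emp ~: els B"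
    and dir: "!!x y. x : els B ==> y : els B ==> EX z:els B. els z <= els x \<inter> els y"
  shows "EX F. els B <= els F & els F <= els (pw a) & emp ~: els F &
    (ALL x:els F. ALL y. els x <= els y & els y <= els a --> y : els F) &
    (ALL x:els F. ALL y:els F. EX z:els F. els z <= els x \<inter> els y) &
    (ALL x. els x <= els a --> x : els F \<or> df a x : els F)"
proof -
  let ?X = "pw a"
  obtain W where tot: "!!x y. x : els ?X ==> y : els ?X ==> x ~= y ==> opr x y : els W \<or> opr y x : els W"
    and wf: "!!A. els A <= els ?X ==> A ~= emp ==> EX x:els A. ALL z:els A. opr z x ~: els W" using wo_ax[of ?X] by blast
  define N where "N u y r <-> y : els B \<or> (EX z:els ?X. opr z u : els W & opr z y : els r)" for u y r
  define H where "H u x r <-> (EX y. N u y r & (els y <= els x \<or>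
    ((ALL y'. N u y' r --> (EX i:els y'. i : els u)) & (ALL i:els y. i : els u --> i : els x))))" for u x r
  have "EX R. els R <= els (prd ?X ?X) & (ALL u:els ?X. ALL x:els ?X. opr u x : els R <-> H u x R)"
  proof (rule wf_rec[where lt = "%z u. opr z u : els W"])
    show "Dn E (%rh. opr (rh 0) (rh 1) : els W)" by (intro dn)
    show "Dn E (%rh. H (rh 0) (rh 1) (rh 2))" unfolding H_def N_def by (intro dn)
    fix u x r r'
    assume "!!z v. z : els ?X ==> opr z u : els W ==> opr z v : els r <-> opr z v : els r'"
    hence "N u y r = N u y r'" for y unfolding N_def by blast
    thus "H u x r = H u x r'" unfolding H_def by simp
  qed (rule wf)
  then obtain R where Rs: "els R <= els (prd ?X ?X)" and R0: "!!u x. u : els ?X ==> x : els ?X ==> opr u x : els R <-> H u x R" by blast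
  have Rd: "u : els ?X & x : els ?X" if "opr u x : els R" for u x
  proof -
    have "opr u x : els (prd ?X ?X)" using that Rs by blast
    thus ?thesis by simp
  qed
  have NX: "y : els ?X" if "N u y R" for u y using that B(1) Rd unfolding N_def by blast
  have NR: "opr u x : els R" if "u : els ?X" "x : els ?X" "N u y R" "els y <= els x" for u x y
    using R0[OF that(1,2)] that(3,4) unfolding H_def by blast
  have up: "opr u x' : els R" if "opr u x : els R" "els x <= els x'" "x' : els ?X" for u x x'
  proof -
    have u: "u : els ?X" "x : els ?X" using Rd[OF that(1)] by auto
    have "H u x R" using R0[OF u] that(1) by blast
    hence "H u x' R" using that(2) unfolding H_def by blast
    thus ?thesis using R0[OF u(1) that(3)] by blast
  qed
  have inc: "opr u x : els R" if "opr z x : els R" "opr z u : els W" "u : els ?X" for z u x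
  proof (rule NR[OF that(3) _ _ subset_refl])
    show "x : els ?X" "N u x R" using Rd[OF that(1)] that unfolding N_def by blast+
  qed
  have NB: "opr u x : els R" if "x : els B" "u : els ?X" for x u
    by (rule NR[OF that(2) _ _ subset_refl]) (use that B(1) in \<open>auto simp: N_def\<close>)
  define good where "good u <-> opr u emp ~: els R &
    (ALL x y. opr u x : els R & opr u y : els R --> (EX z. opr u z : els R & els z <= els x & els z <= els y))" for u
  have Ndir: "EX z. N u z R & els z <= els x & els z <= els y"
    if u: "u : els ?X" "!!v. v : els ?X ==> opr v u : els W ==> good v" and n: "N u x R" "N u y R" for u x y
  proof (cases "x : els B & y : els B")
    case True
    thus ?thesis using dir[of x y] unfolding N_def by blast
  next
    case False
    have "EX v:els ?X. opr v u : els W & opr v x : els R & opr v y : els R"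
    proof -
      consider v where "x : els B" "v : els ?X" "opr v u : els W" "opr v y : els R"
        | v where "y : els B" "v : els ?X" "opr v u : els W" "opr v x : els R"
        | v v' where "v : els ?X" "opr v u : els W" "opr v x : els R" "v' : els ?X" "opr v' u : els W" "opr v' y : els R"
        using False n unfolding N_def by blast
      thus ?thesis
      proof cases
        case 1 thus ?thesis using NB by blast
      next
        case 2 thus ?thesis using NB by blast
      next
        case 3
        consider "v = v'" | "opr v v' : els W" | "opr v' v : els W" using tot[OF 3(1,4)] by blast
        thus ?thesis using 3 inc by cases blast+
      qed
    qed
    then obtain v where v: "v : els ?X" "opr v u : els W" "opr v x : els R" "opr v y : els R" by blast
    then obtain z where "opr v z : els R" "els z <= els x" "els z <= els y" using u(2)[OF v(1,2)] unfolding good_def by blast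
    thus ?thesis using v(1,2) unfolding N_def by blast
  qed
  have good_step: "good u" if u: "u : els ?X" "!!v. v : els ?X ==> opr v u : els W ==> good v" for u
  proof -
    have Nne: "y ~= emp" if "N u y R" for y
      using that ne u(2) unfolding N_def good_def by blast
    let ?c = "ALL y'. N u y' R --> (EX i:els y'. i : els u)"
    have Ru: "opr u x : els R <-> (EX y. N u y R & (els y <= els x \<or> ?c & (ALL i:els y. i : els u --> i : els x)))"
      if "x : els ?X" for x using R0[OF u(1) that] unfolding H_def .
    have 1: "opr u emp ~: els R"
    proof
      assume a: "opr u emp : els R"
      have "emp : els ?X" by simp
      then obtain y where y: "N u y R" "els y <= els emp \<or> ?c & (ALL i:els y. i : els u --> i : els emp)" using Ru a by blast
      thus False using Nne[OF y(1)] empty_iff_emp[of y] by auto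
    qed
    have 2: "EX z. opr u z : els R & els z <= els x & els z <= els x'" if x: "opr u x : els R" "opr u x' : els R" for x x'
    proof -
      have xX: "x : els ?X" "x' : els ?X" using Rd x by blast+
      obtain y where y: "N u y R" "els y <= els x \<or> ?c & (ALL i:els y. i : els u --> i : els x)" using Ru[OF xX(1)] x(1) by blast
      obtain y' where y': "N u y' R" "els y' <= els x' \<or> ?c & (ALL i:els y'. i : els u --> i : els x')" using Ru[OF xX(2)] x(2) by blast
      obtain z where z: "N u z R" "els z <= els y" "els z <= els y'" using Ndir[OF u y(1) y'(1)] by blast
      show ?thesis
      proof (cases ?c)
        case True
        have S: "els (mk {i : els z. i : els u}) = {i : els z. i : els u}" by (intro els_mk sepI dn)
        have "opr u (mk {i : els z. i : els u}) : els R"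
        proof (rule Ru[THEN iffD2])
          show "mk {i : els z. i : els u} : els ?X" using NX[OF z(1)] S by auto
          show "EX y. N u y R & (els y <= els (mk {i : els z. i : els u}) \<or> ?c & (ALL i:els y. i : els u --> i : els (mk {i : els z. i : els u})))"
            using z(1) True unfolding S by blast
        qed
        moreover have "els (mk {i : els z. i : els u}) <= els x" "els (mk {i : els z. i : els u}) <= els x'"
          unfolding S using y(2) y'(2) z(2,3) by blast+
        ultimately show ?thesis by blast
      next
        case False
        hence "els z <= els x" "els z <= els x'" using y(2) y'(2) z(2,3) by blast+
        moreover have "opr u z : els R" by (rule NR[OF u(1) NX[OF z(1)] z(1) subset_refl])
        ultimately show ?thesis by blast
      qed
    qed
    show ?thesis unfolding good_def using 1 2 by blast
  qed
  have good: "good u" if "u : els ?X" for u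
  proof (rule ccontr)
    assume n: "~ good u"
    have S: "els (mk {u : els ?X. ~ good u}) = {u : els ?X. ~ good u}" unfolding good_def by (intro els_mk sepI dn)
    have "mk {u : els ?X. ~ good u} ~= emp"
    proof
      assume "mk {u : els ?X. ~ good u} = emp"
      hence "{u : els ?X. ~ good u} = {}" using S by simp
      thus False using n that by blast
    qed
    then obtain v where "v : els ?X" "~ good v" "ALL z:els ?X. ~ good z --> opr z v ~: els W"
      using wf[of "mk {u : els ?X. ~ good u}"] unfolding S by blast
    thus False using good_step by blast
  qed
  define F where "F = mk {x : els ?X. EX u:els ?X. opr u x : els R}"
  have F: "els F = {x : els ?X. EX u:els ?X. opr u x : els R}" unfolding F_def by (intro els_mk sepI dn)
  show ?thesis
  proof (rule exI[of _ F], intro conjI ballI allI impI)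
    show "els B <= els F" unfolding F using NB B by (auto intro!: bexI[of _ b0])
    show "els F <= els (pw a)" unfolding F by blast
    show "emp ~: els F" unfolding F using good unfolding good_def by blast
    show "y : els F" if "x : els F" "els x <= els y & els y <= els a" for x y
      using that up unfolding F by auto
    show "EX z:els F. els z <= els x \<inter> els y" if x: "x : els F" "y : els F" for x y
    proof -
      obtain u v where u: "u : els ?X" "opr u x : els R" "v : els ?X" "opr v y : els R" using x unfolding F by blast
      have "EX u:els ?X. opr u x : els R & opr u y : els R"
      proof -
        consider "u = v" | "opr u v : els W" | "opr v u : els W" using tot[OF u(1,3)] by blast
        thus ?thesis using u inc by cases blast+
      qed
      then obtain u where u: "u : els ?X" "opr u x : els R" "opr u y : els R" by blast
      then obtain z where "opr u z : els R" "els z <= els x" "els z <= els y" using good[OF u(1)] unfolding good_def by blast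
      thus ?thesis using u(1) Rd unfolding F by blast
    qed
    fix x assume "els x <= els a"
    hence xX: "x : els ?X" by simp
    have dX: "df a x : els ?X" by auto
    show "x : els F \<or> df a x : els F"
    proof (cases "ALL y'. N x y' R --> (EX i:els y'. i : els x)")
      case True
      have "N x b0 R" using B(2) unfolding N_def by blast
      hence "H x x R" unfolding H_def using True by blast
      thus ?thesis using R0[OF xX xX] xX unfolding F by blast
    next
      case False
      then obtain y where y: "N x y R" "ALL i:els y. i ~: els x" by blast
      have "els y <= els (df a x)" using NX[OF y(1)] y(2) by auto
      hence "opr x (df a x) : els R" by (rule NR[OF xX dX y(1)])
      thus ?thesis using xX dX unfolding F by blast
    qed
  qed
qed

end

context gen begin

text \<open>By \<open>enum\<close> a set of the extension is covered by the values of a function on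
  a ground set \<open>T\<close>. Points are compared by their least preimages in a ground
  well-ordering of \<open>T\<close>, and \<open>j_least\<close> provides these preimages as well as
  the minima of sets of the extension.\<close>

lemma wellorder_ext:
  "EX W. (ALL x:els' S. ALL y:els' S. x ~= y --> W.opr x y : els' W \<or> W.opr y x : els' W) &
     (ALL A. els' A <= els' S & A ~= W.emp --> (EX x:els' A. ALL z:els' A. W.opr z x ~: els' W))"
proof -
  obtain T h Y where h: "is_fun E' h (j T) Y" "!!u. u : els' S ==> EX s:els T. W.ap h (j s) = u" using enum[of S] by blast
  obtain V where tot: "!!x y. x : els T ==> y : els T ==> x ~= y ==> opr x y : els V \<or> opr y x : els V"
    and wf: "!!A. els A <= els T ==> A ~= emp ==> EX x:els A. ALL z:els A. opr z x ~: els V" using wellorder[of T] by blast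
  have least: "EX x:els T. j x : els' X & (ALL y:els T. opr y x : els V --> j y ~: els' X)" if "x : els T" "j x : els' X" for x X
    by (rule j_least[OF that, where lt = "%y x. opr y x : els V"]) (intro dn, rule wf)
  have jV: "W.opr (j x) (j y) : els' (j V) <-> opr x y : els V" for x y by (simp add: j_opr)
  define l where "l s u <-> s : els' (j T) & W.ap h s = u & (ALL t:els' (j T). W.opr t s : els' (j V) --> W.ap h t ~= u)" for s u
  have dl [dn]: "Fn E' a ==> Fn E' b ==> Dn E' (%rh. l (a rh) (b rh))" for a b unfolding l_def by (intro dn Fn_shift)
  have lex: "EX s:els T. l (j s) u" if u: "u : els' S" for u
  proof -
    have S: "els' (W.mk {s : els' (j T). W.ap h s = u}) = {s : els' (j T). W.ap h s = u}" by (intro W.els_mk W.sepI dn)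
    obtain s where s: "s : els T" "W.ap h (j s) = u" using h(2)[OF u] by blast
    hence "j s : els' (W.mk {s : els' (j T). W.ap h s = u})" unfolding S by simp
    from least[OF s(1) this] show ?thesis unfolding S l_def by (auto simp: els_j[of T] jV)
  qed
  have luniq: "s = s'" if l: "l (j s) u" "l (j s') u" for s s' u
  proof (rule ccontr)
    assume n: "s ~= s'"
    have a: "s : els T" "W.ap h (j s) = u" "!!t. t : els T ==> opr t s : els V ==> W.ap h (j t) ~= u"
      using l(1) unfolding l_def by (auto simp: els_j[of T] jV)
    have b: "s' : els T" "W.ap h (j s') = u" "!!t. t : els T ==> opr t s' : els V ==> W.ap h (j t) ~= u"
      using l(2) unfolding l_def by (auto simp: els_j[of T] jV)
    show False using tot[OF a(1) b(1) n] a b by blast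
  qed
  define K where "K u v <-> (EX s t. l s u & l t v & W.opr s t : els' (j V))" for u v
  have dK: "Dn E' (%rh. K (rh 0) (rh 1))" unfolding K_def by (intro dn)
  have K: "W.opr u v : els' (W.rc S S K) <-> u : els' S & v : els' S & K u v" for u v by (rule W.rc_iff[OF dK])
  show ?thesis
  proof (rule exI[of _ "W.rc S S K"], intro conjI ballI allI impI)
    fix u v assume u: "u : els' S" "v : els' S" "u ~= v"
    obtain s where s: "s : els T" "l (j s) u" using lex u by blast
    obtain t where t: "t : els T" "l (j t) v" using lex u by blast
    have "s ~= t" using s(2) t(2) u(3) unfolding l_def by blast
    hence "opr s t : els V \<or> opr t s : els V" using tot s(1) t(1) by blast
    hence "K u v \<or> K v u" unfolding K_def using s(2) t(2) jV by blast
    thus "W.opr u v : els' (W.rc S S K) \<or> W.opr v u : els' (W.rc S S K)" unfolding K using u by blast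
  next
    fix A assume A: "els' A <= els' S & A ~= W.emp"
    then obtain u where u: "u : els' A" using W.empty_iff_emp by blast
    have S: "els' (W.mk {s : els' (j T). EX u:els' A. l s u}) = {s : els' (j T). EX u:els' A. l s u}" by (intro W.els_mk W.sepI dn)
    obtain s where s: "s : els T" "l (j s) u" using lex u A by blast
    hence "j s : els' (W.mk {s : els' (j T). EX u:els' A. l s u})" unfolding S using u by auto
    from least[OF s(1) this] obtain s where s: "s : els T" "EX u:els' A. l (j s) u"
      "!!t. t : els T ==> opr t s : els V ==> ~ (EX u:els' A. l (j t) u)" unfolding S by auto
    then obtain u where u: "u : els' A" "l (j s) u" by blast
    have "~ K z u" if z: "z : els' A" for z
    proof
      assume "K z u"
      then obtain t s' where t: "l t z" "l s' u" "W.opr t s' : els' (j V)" unfolding K_def by blast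
      obtain t0 where t0: "t = j t0" "t0 : els T" using t(1) unfolding l_def els_j[of T] by blast
      obtain s0 where s0: "s' = j s0" "s0 : els T" using t(2) unfolding l_def els_j[of T] by blast
      have "s0 = s" using luniq t(2) u(2) s0(1) by blast
      hence "opr t0 s : els V" using t(3) t0(1) s0(1) jV by simp
      thus False using s(3)[OF t0(2)] t(1) t0(1) z by blast
    qed
    hence "ALL z:els' A. W.opr z u ~: els' (W.rc S S K)" unfolding K by blast
    thus "EX x:els' A. ALL z:els' A. W.opr z x ~: els' (W.rc S S K)" using u(1) by blast
  qed
qed

sublocale W: zwo E'
  by unfold_locales (rule wellorder_ext)

end

section \<open>The Cohen extension\<close>

locale cohen = ground E k2 k3 s P L + gen E P L G E' val
  for E :: "'v => 'v => bool" and k2 k3 s P L :: 'v and G :: "'v set" and E' :: "'w => 'w => bool" and val :: "'v => 'w"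
begin

lemma Gsub: "p : G ==> els q <= els p ==> q : G"
proof (rule Gup)
  assume p: "p : G" "els q <= els p"
  thus "le p q" using GP[OF p(1)] P_sub[OF GP[OF p(1)] p(2)] by (simp add: le_iff)
qed

lemma Gun: assumes "p : G" "q : G" shows "un p q : els P"
proof -
  obtain r where r: "r : G" "le r p" "le r q" using Gdir assms by blast
  have "els (un p q) <= els r" using leD(3)[OF r(2)] leD(3)[OF r(3)] by auto
  thus ?thesis using P_sub GP r(1) by blast
qed

lemma Gfun: "p : G ==> q : G ==> opr c b : els p ==> opr c b' : els q ==> b = b'"
  using P_fun[OF Gun[of p q], of c b b'] by simp

definition one :: "'v => 'v => bool" where "one \<xi> n <-> (EX p:G. opr (opr \<xi> n) (suc emp) : els p)"

lemma one_iff: "p : G ==> opr (opr \<xi> n) (if Q then suc emp else emp) : els p ==> one \<xi> n <-> Q"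
proof -
  assume p: "p : G" "opr (opr \<xi> n) (if Q then suc emp else emp) : els p"
  show "one \<xi> n <-> Q"
  proof (cases Q)
    case True
    thus ?thesis unfolding one_def using p by auto
  next
    case False
    have "~ one \<xi> n"
    proof
      assume "one \<xi> n"
      then obtain q where q: "q : G" "opr (opr \<xi> n) (suc emp) : els q" unfolding one_def by blast
      have "opr (opr \<xi> n) emp : els p" using p(2) False by simp
      hence "emp = suc emp" using Gfun[OF p(1) q(1) _ q(2)] by blast
      thus False by simp
    qed
    thus ?thesis using False by simp
  qed
qed

lemma fill_cells:
  assumes Z: "fin Z" "els Z <= els (prd k3 om)" and q: "q : els P" "avoids q Z"
  shows "EX r. le r q & (ALL z:els Z. opr z (if z : els S then suc emp else emp) : els r)"
proof -
  let ?h = "%z. opr z (if z : els S then suc emp else emp)"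
  have h: "Fn E (%rh. ?h (rh 0))" by (intro dn Fn_if)
  let ?t = "mk (?h ` els Z)"
  have t: "els ?t = ?h ` els Z" by (rule els_mk[OF fin_image(1)[OF Z(1) h]])
  have tP: "?t : els P" unfolding P_iff
  proof (intro conjI ballI allI impI)
    show "fin ?t" by (rule fin_image(2)[OF Z(1) h])
    fix z assume "z : els ?t"
    then obtain c where c: "c : els Z" "z = ?h c" unfolding t by blast
    obtain a n where "c = opr a n" "a : els k3" "n : els om" using prdE[of c k3 om] c(1) Z(2) by blast
    thus "EX \<alpha>:els k3. EX n:els om. EX b. bit b & z = opr (opr \<alpha> n) b" using c(2) by auto
  next
    fix c b b' assume "opr c b : els ?t & opr c b' : els ?t"
    thus "b = b'" unfolding t by auto
  qed
  have "un q ?t : els P"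
  proof (rule P_un[OF q(1) tP])
    fix c b b' assume c: "opr c b : els q" "opr c b' : els ?t"
    hence "c : els Z" unfolding t by auto
    thus "b = b'" using c(1) q(2) unfolding avoids_def by blast
  qed
  hence "le (un q ?t) q" using q(1) by (simp add: le_iff)
  moreover have "ALL z:els Z. ?h z : els (un q ?t)" using t by auto
  ultimately show ?thesis by blast
qed

lemma om_sub_k3: "els om <= els k3" using ord_trans[OF ord_k3 _ om_k3] by blast

text \<open>The reals with index in \<omega> are the rows of a matrix of bits. A condition mentions
  finitely many rows and columns, so for large \<open>m\<close> the cells of column \<open>m\<close>
  above the diagonal and the first \<open>N\<close> cells of row \<open>m\<close> are free. They do
  not overlap and can be filled according to \<open>A\<close> and \<open>B\<close>.\<close>

lemma extension_property:
  assumes N: "N : els om"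
  shows "EX m:els om. N : els m & (ALL k:els m. one k m <-> k : els A) & (ALL k:els N. one m k <-> k : els B)"
proof -
  let ?v = "%k A. if k : els A then suc emp else emp"
  let ?D = "%r. EX m:els om. N : els m & (ALL k:els m. opr (opr k m) (?v k A) : els r) & (ALL k:els N. opr (opr m k) (?v k B) : els r)"
  have "EX r:G. le r emp & ?D r"
  proof (rule generic[OF _ Gtop])
    show "Dn E (%rh. ?D (rh 0))" by (intro dn Fn_if)
    fix q assume "le q emp"
    hence q: "q : els P" using leD(1) by blast
    define Q where "Q z b <-> (ALL \<alpha> n e. z = opr (opr \<alpha> n) e --> n : els b & (\<alpha> : els om --> \<alpha> : els b))" for z b
    have "EX b:els om. ALL z:els q. Q z b"
    proof (rule fin_coll[OF ord_om _ P_fin[OF q]])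
      show "els om ~= {}" using om_0 by blast
      show "Dn E (%rh. Q (rh 0) (rh 1))" unfolding Q_def by (intro dn)
      show "Q z b'" if "Q z b" "b : els b'" "b' : els om" for z b b'
        using that(1) om_trans[OF that(3) _ that(2)] unfolding Q_def by blast
      fix z assume z: "z : els q"
      obtain \<alpha> n e where n: "n : els om" "z = opr (opr \<alpha> n) e" using P_atom[OF q z] by blast
      have "EX b:els om. n : els b & (\<alpha> : els om --> \<alpha> : els b)"
      proof (cases "\<alpha> : els om")
        case True
        thus ?thesis using om_bound2[OF n(1) True] by metis
      next
        case False
        thus ?thesis using om_suc[OF n(1)] by (intro bexI[of _ "suc n"]) auto
      qed
      thus "EX b:els om. Q z b" unfolding Q_def n(2) by auto
    qed
    then obtain b where b: "b : els om" "ALL z:els q. Q z b" by blast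
    obtain m where m: "m : els om" "b : els m" "N : els m" using om_bound2[OF b(1) N] .
    have mb: "m ~: els b" using om_asym[OF m(1,2)] .
    have no: "opr (opr \<alpha> n) e ~: els q" if "n = m \<or> \<alpha> = m" for \<alpha> n e
    proof
      assume "opr (opr \<alpha> n) e : els q"
      hence "n : els b & (\<alpha> : els om --> \<alpha> : els b)" using b(2) unfolding Q_def by blast
      thus False using that m(1) mb by blast
    qed
    let ?Z = "un (prd m (mk {m})) (prd (mk {m}) N)" and ?S = "un (prd A (mk {m})) (prd (mk {m}) B)"
    have "EX r. le r q & (ALL z:els ?Z. opr z (?v z ?S) : els r)"
    proof (rule fill_cells[OF _ _ q])
      show "fin ?Z" by (intro fin_un fin_prd fin_om fin_sing m(1) N)
      show "els ?Z <= els (prd k3 om)"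
        using om_sub[OF m(1)] om_sub[OF N] subsetD[OF om_sub_k3] m(1) by (auto simp: els_prd els_mk)
      show "avoids q ?Z" unfolding avoids_def using no by (auto simp: els_prd els_mk)
    qed
    then obtain r where r: "le r q" "!!z. z : els ?Z ==> opr z (?v z ?S) : els r" by blast
    have "opr (opr k m) (?v k A) : els r" if k: "k : els m" for k
    proof -
      have "k ~= m" using k om_irrefl[OF m(1)] by blast
      hence "opr k m : els ?S <-> k : els A" by (simp add: els_mk)
      moreover have "opr k m : els ?Z" using k by (simp add: els_mk)
      ultimately show ?thesis using r(2)[of "opr k m"] by simp
    qed
    moreover have "opr (opr m k) (?v k B) : els r" if k: "k : els N" for k
    proof -
      have "k ~= m" using k om_asym[OF m(1,3)] by blast
      hence "opr m k : els ?S <-> k : els B" by (simp add: els_mk)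
      moreover have "opr m k : els ?Z" using k by (simp add: els_mk)
      ultimately show ?thesis using r(2)[of "opr m k"] by simp
    qed
    ultimately show "EX r. le r q & ?D r" using r(1) m(1,3) by blast
  qed
  then obtain r m where r: "r : G" "m : els om" "N : els m"
    "ALL k:els m. opr (opr k m) (?v k A) : els r" "ALL k:els N. opr (opr m k) (?v k B) : els r" by blast
  thus ?thesis using one_iff[OF r(1)] by blast
qed

definition ONE :: "'w => 'w => bool" where "ONE x y <-> (EX q:els' g. W.opr (W.opr x y) (W.suc W.emp) : els' q)"

lemma Dn_ONE: "Fn E' a ==> Fn E' b ==> Dn E' (%rh. ONE (a rh) (b rh))" unfolding ONE_def by (intro dn Fn_shift)

lemma ONE_j: "ONE (j k) (j m) <-> one k m"
  unfolding ONE_def one_def els_g by (simp add: j_emp j_suc j_opr)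

lemma j_ins: "W.ins (j x) (j y) = j (ins x y)" by (rule W.ext) (auto simp: els_j)

text \<open>No new subsets of a natural number are added. Hence \<open>extension_property\<close>,
  stated for ground sets, applies to sets of the extension.\<close>

lemma sub_nat: assumes "n : els' W.om" shows "ALL x. els' x <= els' n --> x : els' (j (pw om))"
proof (rule W.om_induct[OF assms])
  show "Dn E' (%rh. ALL x. els' x <= els' (rh 0) --> x : els' (j (pw om)))" by (intro dn)
  show "ALL x. els' x <= els' W.emp --> x : els' (j (pw om))"
  proof (intro allI impI)
    fix x assume "els' x <= els' W.emp"
    hence "x = j emp" using W.sub_emp j_emp by metis
    thus "x : els' (j (pw om))" by simp
  qed
  fix n assume n: "n : els' W.om" "ALL x. els' x <= els' n --> x : els' (j (pw om))"
  show "ALL x. els' x <= els' (W.suc n) --> x : els' (j (pw om))"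
  proof (intro allI impI)
    fix x assume x: "els' x <= els' (W.suc n)"
    have "els' (W.df x (W.mk {n})) <= els' n" using x by (auto simp: W.els_mk)
    hence "W.df x (W.mk {n}) : els' (j (pw om))" using n(2) by blast
    then obtain a where a: "W.df x (W.mk {n}) = j a" "els a <= els om" unfolding els_j[of "pw om"] by auto
    obtain n0 where n0: "n = j n0" "n0 : els om" using n(1) unfolding j_om els_j[of om] by blast
    show "x : els' (j (pw om))"
    proof (cases "n : els' x")
      case True
      hence "x = W.ins n (j a)" unfolding a(1)[symmetric] using W.ins_df[OF True] by simp
      hence "x = j (ins n0 a)" using n0(1) j_ins by simp
      thus ?thesis using a(2) n0(2) by simp
    next
      case False
      hence "x = W.df x (W.mk {n})" by (intro W.ext) (auto simp: W.els_mk)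
      thus ?thesis using a by simp
    qed
  qed
qed

lemma EP:
  assumes N: "N : els' W.om" and A: "els' A <= els' N" "els' B <= els' N"
  shows "EX m:els' W.om. N : els' m & (ALL k:els' m. ONE k m <-> k : els' A) & (ALL k:els' N. ONE m k <-> k : els' B)"
proof -
  obtain n where n: "N = j n" "n : els om" using N unfolding j_om els_j[of om] by blast
  have "A : els' (j (pw om))" "B : els' (j (pw om))" using sub_nat[OF N] A by blast+
  then obtain a b where ab: "A = j a" "B = j b" unfolding els_j[of "pw om"] by blast
  obtain m where m: "m : els om" "n : els m" "ALL k:els m. one k m <-> k : els a" "ALL k:els n. one m k <-> k : els b"
    using extension_property[OF n(2)] by blast
  have "ALL k:els' (j m). ONE k (j m) <-> k : els' A" using m(3) by (auto simp: els_j[of m] ONE_j ab)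
  moreover have "ALL k:els' N. ONE (j m) k <-> k : els' B" using m(4) by (auto simp: els_j[of n] ONE_j ab n(1))
  ultimately show ?thesis using m(1,2) n(1) j_om by (intro bexI[of _ "j m"]) auto
qed

lemma j_prd: "W.prd (j a) (j b) = j (prd a b)"
  by (rule W.ext) (force simp: W.els_prd els_j els_prd j_opr[symmetric])

text \<open>By density some condition in \<open>G\<close> either makes \<open>R\<close> total or is,
  for some \<open>x\<close>, incompatible with every condition listed for \<open>x\<close>. The
  latter is refuted by the value that \<open>f\<close> takes at \<open>x\<close>, since a condition
  listed for this value belongs to \<open>G\<close>.\<close>

lemma total_name:
  assumes f: "is_fun E' f (j a) (j b)"
  shows "EX R p. p : G & els R <= els (prd P (prd a b)) & (ALL x:els a. tot p R x b k3) &
    (ALL q x v. q : G & dec q R x v --> W.ap f (j x) = j v)"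
proof -
  obtain R where R: "els R <= els (prd P (prd a b))" "!!x. x : els (prd a b) ==> j x : els' f <-> (EX p:G. opr p x : els R)"
    using jname[of "prd a b" f] by blast
  have Rd: "r : els P & x : els a & v : els b" if "opr r (opr x v) : els R" for r x v
  proof -
    have "opr r (opr x v) : els (prd P (prd a b))" using that R(1) by blast
    thus ?thesis by simp
  qed
  have val: "W.ap f (j x) = j v" if q: "q : G" "dec q R x v" for q x v
  proof -
    obtain r where r: "els r <= els q" "opr r (opr x v) : els R" using q(2) unfolding dec_def by blast
    have "r : G" using Gsub q(1) r(1) by blast
    moreover have x: "opr x v : els (prd a b)" "x : els a" using Rd[OF r(2)] by simp_all
    ultimately have "j (opr x v) : els' f" using R(2) r(2) by blast
    hence "W.opr (j x) (j v) : els' f" by (simp add: j_opr)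
    thus ?thesis using W.fun_val(3)[OF f, of "j x" "j v"] x(2) by simp
  qed
  let ?D = "%r. (ALL x:els a. tot r R x b k3) \<or> (EX x:els a. ALL t v. opr t (opr x v) : els R --> un r t ~: els P)"
  have "EX r:G. le r emp & ?D r"
  proof (rule generic[OF _ Gtop])
    show "Dn E (%rh. ?D (rh 0))" by (intro dn)
    fix q assume q: "le q emp"
    show "EX r. le r q & ?D r"
    proof (cases "ALL x:els a. tot q R x b k3")
      case True
      thus ?thesis using le_refl[OF leD(1)[OF q]] by blast
    next
      case False
      then obtain x r where x: "x : els a" "le r q"
        "!!t v. v : els b ==> opr t (opr x v) : els R ==> un r t : els P ==> ~ sup t k3" unfolding tot_def by blast
      have "un r t ~: els P" if t: "opr t (opr x v) : els R" for t v
      proof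
        assume u: "un r t : els P"
        have "sup t k3" unfolding sup_def
        proof (intro allI impI)
          fix \<xi> n b assume "opr (opr \<xi> n) b : els t"
          hence "EX \<alpha>:els k3. EX n':els om. opr \<xi> n = opr \<alpha> n'" using P_cell(1)[of t] Rd[OF t] by blast
          thus "\<xi> : els k3" by auto
        qed
        thus False using x(3)[OF _ t u] Rd[OF t] by blast
      qed
      thus ?thesis using x(1,2) by blast
    qed
  qed
  then obtain r where r: "r : G" "?D r" by blast
  have "~ (EX x:els a. ALL t v. opr t (opr x v) : els R --> un r t ~: els P)"
  proof
    assume "EX x:els a. ALL t v. opr t (opr x v) : els R --> un r t ~: els P"
    then obtain x where x: "x : els a" "!!t v. opr t (opr x v) : els R ==> un r t ~: els P" by blast
    have xa: "j x : els' (j a)" using x(1) by simp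
    have "W.ap f (j x) : els' (j b)" using W.fun_val(2)[OF f xa] .
    then obtain v where v: "v : els b" "W.ap f (j x) = j v" unfolding els_j[of b] by blast
    hence "j (opr x v) : els' f" using W.fun_val(1)[OF f xa] by (simp add: j_opr)
    then obtain t where "t : G" "opr t (opr x v) : els R" using R(2)[of "opr x v"] x(1) v(1) by auto
    thus False using x(2) Gun[OF r(1)] by blast
  qed
  thus ?thesis using r R(1) val by blast
qed

text \<open>The value 1 is placed at a column \<open>k\<close> beyond \<open>i\<close> that the
  condition does not mention, and all columns up to \<open>k\<close> are decided, so that the first
  1 after \<open>i\<close> is known.\<close>

lemma first_one_ex:
  assumes "\<xi> : els k3" "i : els om" shows "EX k:els om. EX q:G. first_one q \<xi> i k"
proof -
  have "EX r:G. le r emp & (EX k:els om. first_one r \<xi> i k)"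
  proof (rule generic[OF _ Gtop])
    show "Dn E (%rh. EX k:els om. first_one (rh 0) \<xi> i k)" by (intro dn)
    fix q assume "le q emp"
    hence q: "q : els P" using leD(1) by blast
    define Q where "Q z b <-> (ALL \<alpha> n e. z = opr (opr \<alpha> n) e --> n : els b)" for z b
    have "EX b:els om. ALL z:els q. Q z b"
    proof (rule fin_coll[OF ord_om _ P_fin[OF q]])
      show "els om ~= {}" using om_0 by blast
      show "Dn E (%rh. Q (rh 0) (rh 1))" unfolding Q_def by (intro dn)
      show "Q z b'" if "Q z b" "b : els b'" "b' : els om" for z b b'
        using that(1) om_trans[OF that(3) _ that(2)] unfolding Q_def by blast
      fix z assume z: "z : els q"
      obtain \<alpha> n e where n: "n : els om" "z = opr (opr \<alpha> n) e" using P_atom[OF q z] by blast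
      have "Q z (suc n)" unfolding Q_def n(2) by auto
      thus "EX b:els om. Q z b" using om_suc[OF n(1)] by blast
    qed
    then obtain b where b: "b : els om" "ALL z:els q. Q z b" by blast
    obtain k where k: "k : els om" "i : els k" "b : els k" using om_bound2[OF assms(2) b(1)] .
    define Z where "Z = mk {z : els (prd (mk {\<xi>}) (suc k)). ALL e. opr z e ~: els q}"
    have Z: "els Z = {z : els (prd (mk {\<xi>}) (suc k)). ALL e. opr z e ~: els q}" unfolding Z_def by (intro els_mk sepI dn)
    have fZ: "fin Z" by (rule fin_subset[OF fin_prd[OF fin_sing fin_om[OF om_suc[OF k(1)]]]]) (use Z in blast)
    have "els Z <= els (prd k3 om)" using Z assms(1) om_sub[OF om_suc[OF k(1)]] by (auto simp: els_prd els_mk)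
    moreover have "avoids q Z" using Z unfolding avoids_def by blast
    ultimately obtain r where r: "le r q" "!!z. z : els Z ==> opr z (if z : els (mk {opr \<xi> k}) then suc emp else emp) : els r"
      using fill_cells[OF fZ _ q, of "mk {opr \<xi> k}"] by blast
    have rP: "r : els P" using leD(1)[OF r(1)] .
    have "opr \<xi> k : els Z"
    proof -
      have "opr (opr \<xi> k) e ~: els q" for e
      proof
        assume "opr (opr \<xi> k) e : els q"
        hence "k : els b" using b(2) unfolding Q_def by blast
        thus False using om_asym[OF k(1,3)] by blast
      qed
      thus ?thesis unfolding Z by (simp add: els_mk)
    qed
    hence r1: "opr (opr \<xi> k) (suc emp) : els r" using r(2)[of "opr \<xi> k"] by (simp add: els_mk)
    have bits: "EX e. opr (opr \<xi> m) e : els r" if m: "m : els k" for m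
    proof (cases "opr \<xi> m : els Z")
      case True
      thus ?thesis using r(2) by blast
    next
      case False
      have "opr \<xi> m : els (prd (mk {\<xi>}) (suc k))" using m by (simp add: els_mk)
      then obtain e where "opr (opr \<xi> m) e : els q" using False unfolding Z by blast
      thus ?thesis using leD(3)[OF r(1)] by blast
    qed
    have "Dn E (%rh. i : els (rh 0) & opr (opr \<xi> (rh 0)) (suc emp) : els r)" by (intro dn)
    hence "EX k:els om. (i : els k & opr (opr \<xi> k) (suc emp) : els r) & (ALL m:els k. ~ (i : els m & opr (opr \<xi> m) (suc emp) : els r)) & (k : els om)"
      using om_least[OF k(1), of "%k. i : els k & opr (opr \<xi> k) (suc emp) : els r"] k(2) r1 by blast
    then obtain k' where k': "k' : els om" "i : els k'" "opr (opr \<xi> k') (suc emp) : els r"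
      "ALL m:els k'. ~ (i : els m & opr (opr \<xi> m) (suc emp) : els r)" by blast
    have k'k: "m : els k" if "m : els k'" for m
    proof (rule ccontr)
      assume "m ~: els k"
      hence "m = k \<or> k : els m" using om_linear[OF om_sub[OF k'(1) that] k(1)] by blast
      hence "k : els k'" using that om_trans[OF k'(1) _ that] by blast
      thus False using k'(4) k(2) r1 by blast
    qed
    have "first_one r \<xi> i k'" unfolding first_one_def
    proof (intro conjI ballI impI)
      fix m assume m: "m : els k'" "i : els m"
      obtain e where e: "opr (opr \<xi> m) e : els r" using bits[OF k'k[OF m(1)]] by blast
      have "e = emp \<or> e = suc emp" using P_cell(2)[OF rP e] unfolding bit_def .
      thus "opr (opr \<xi> m) emp : els r" using e k'(4) m by blast
    qed (rule k')+
    thus "EX r. le r q & (EX k:els om. first_one r \<xi> i k)" using r(1) k'(1) by blast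
  qed
  thus ?thesis by blast
qed

lemma first_one_uniq:
  assumes "q : G" "first_one q \<xi> i k" "q' : G" "first_one q' \<xi> i k'" shows "k = k'"
proof -
  have no: "k ~: els k'" if "q : G" "first_one q \<xi> i k" "q' : G" "first_one q' \<xi> i k'" for q q' k k'
  proof
    assume "k : els k'"
    hence "opr (opr \<xi> k) emp : els q'" "opr (opr \<xi> k) (suc emp) : els q" using that unfolding first_one_def by blast+
    hence "emp = suc emp" using Gfun[OF that(3,1)] by blast
    thus False by simp
  qed
  have "k : els om" "k' : els om" using assms unfolding first_one_def by blast+
  thus ?thesis using om_linear no[OF assms] no[OF assms(3,4,1,2)] by blast
qed

end

section \<open>The ultrafilter generated by the basic sets\<close>

context cohen begin

text \<open>\<open>gr\<close> is the map from \<open>(\<xi>, i)\<close> to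
  \<open>g\<^sub>\<xi>(i)\<close> as one object of the extension. A value is chosen from the ground
  relation \<open>S\<close> restricted to the generic filter.\<close>

lemma gen_ordinal: "EX gr. is_fun E' gr (j (prd k3 om)) (j om) &
  (ALL \<xi>:els k3. ALL i:els om. EX q:G. EX k. W.ap gr (j (opr \<xi> i)) = j k & first_one q \<xi> i k)"
proof -
  define S where "S = rc P (prd (prd k3 om) om) (%q y. EX \<xi> i k. y = opr (opr \<xi> i) k & first_one q \<xi> i k)"
  have "Dn E (%rh. EX \<xi> i k. rh 1 = opr (opr \<xi> i) k & first_one (rh 0) \<xi> i k)" by (intro dn)
  hence S: "opr q (opr (opr \<xi> i) k) : els S <-> q : els P & \<xi> : els k3 & i : els om & k : els om & first_one q \<xi> i k" for q \<xi> i k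
    unfolding S_def by (subst rc_iff) auto
  have "EX gr. is_fun E' gr (j (prd k3 om)) (j om) & (ALL x:els' (j (prd k3 om)). EX q:els' g. W.opr q (W.opr x (W.ap gr x)) : els' (j S))"
  proof (rule W.choice)
    show "Dn E' (%rh. EX q:els' g. W.opr q (W.opr (rh 0) (rh 1)) : els' (j S))" by (intro dn)
    fix x assume "x : els' (j (prd k3 om))"
    then obtain \<xi> i where x: "x = j (opr \<xi> i)" "\<xi> : els k3" "i : els om" unfolding els_j[of "prd k3 om"] els_prd by blast
    obtain k q where k: "k : els om" "q : G" "first_one q \<xi> i k" using first_one_ex[OF x(2,3)] by blast
    hence "opr q (opr (opr \<xi> i) k) : els S" unfolding S using GP x(2,3) by blast
    hence "W.opr (j q) (W.opr x (j k)) : els' (j S)" unfolding x(1) j_opr by simp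
    thus "EX y:els' (j om). EX q:els' g. W.opr q (W.opr x y) : els' (j S)" using k(1,2) unfolding els_g els_j[of om] by blast
  qed
  then obtain gr where gr: "is_fun E' gr (j (prd k3 om)) (j om)"
    "!!x. x : els' (j (prd k3 om)) ==> EX q:els' g. W.opr q (W.opr x (W.ap gr x)) : els' (j S)" by blast
  have "EX q:G. EX k. W.ap gr (j (opr \<xi> i)) = j k & first_one q \<xi> i k" if x: "\<xi> : els k3" "i : els om" for \<xi> i
  proof -
    have m: "j (opr \<xi> i) : els' (j (prd k3 om))" using x by simp
    obtain k where k: "W.ap gr (j (opr \<xi> i)) = j k" using W.fun_val(2)[OF gr(1) m] unfolding els_j[of om] by blast
    obtain q where q: "q : G" "W.opr (j q) (W.opr (j (opr \<xi> i)) (j k)) : els' (j S)" using gr(2)[OF m] unfolding k els_g by blast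
    hence "opr q (opr (opr \<xi> i) k) : els S" unfolding j_opr by simp
    thus ?thesis using S q(1) k by blast
  qed
  thus ?thesis using gr(1) by blast
qed

definition Con :: 'v where "Con = prd k3 (prd (pw (prd P (prd om om))) (pw (prd P (prd (prd om om) om))))"

definition allvalid :: "'v => 'v => bool" where
  "allvalid p C <-> fin C & els C <= els Con & (ALL c:els C. EX \<xi> f w. c = opr \<xi> (opr f w) & valid p \<xi> f w)"

definition allmeet :: "'v => 'v => 'v => 'v => bool" where
  "allmeet q C m i <-> m : els i & (ALL \<xi> f w. opr \<xi> (opr f w) : els C --> meets q i \<xi> f w)"

text \<open>A finite intersection and a final segment are combined into one basic set, so that
  directedness reduces to the union of two sets of requirements and a larger
  \<open>m\<close>.\<close>

definition basic :: "'w => 'v => 'v => bool" where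
  "basic b C m <-> m : els om & (EX p:G. allvalid p C) & els' b <= els' (j om) &
     (ALL i:els om. j i : els' b <-> (EX q:G. allmeet q C m i))"

text \<open>The basic sets have to form a set of the extension before they can generate a filter.
  They are indexed by pairs \<open>(C, m)\<close> from the ground model, with validity and the
  decision of membership available as ground relations \<open>V\<close> and
  \<open>M\<close>.\<close>

lemma basic_set: "EX B. ALL b. b : els' B <-> (EX C m. basic b C m)"
proof -
  let ?CS = "prd (pw Con) om"
  define V where "V = rc P ?CS (%p x. EX C m. x = opr C m & allvalid p C)"
  define M where "M = rc P (prd ?CS om) (%q y. EX C m i. y = opr (opr C m) i & allmeet q C m i)"
  have "Dn E (%rh. EX C m. rh 1 = opr C m & allvalid (rh 0) C)" unfolding allvalid_def by (intro dn)
  hence V: "opr p (opr C m) : els V <-> p : els P & C : els (pw Con) & m : els om & allvalid p C" for p C m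
    unfolding V_def by (subst rc_iff) auto
  have "Dn E (%rh. EX C m i. rh 1 = opr (opr C m) i & allmeet (rh 0) C m i)" unfolding allmeet_def by (intro dn)
  hence M: "opr q (opr (opr C m) i) : els M <-> q : els P & C : els (pw Con) & m : els om & i : els om & allmeet q C m i" for q C m i
    unfolding M_def by (subst rc_iff) auto
  let ?Q = "%b. EX x:els' (j ?CS). (EX p:els' g. W.opr p x : els' (j V)) &
    (ALL i:els' (j om). i : els' b <-> (EX q:els' g. W.opr q (W.opr x i) : els' (j M)))"
  have S: "els' (W.mk {b : els' (W.pw (j om)). ?Q b}) = {b : els' (W.pw (j om)). ?Q b}" by (intro W.els_mk W.sepI dn)
  have eq: "els' b <= els' (j om) & ?Q b <-> (EX C m. basic b C m)" for b
  proof -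
    have 1: "(EX p:els' g. W.opr p (j (opr C m)) : els' (j V)) <-> (EX p:G. allvalid p C)" if "C : els (pw Con)" "m : els om" for C m
      unfolding els_g using that GP by (auto simp: j_opr V)
    have 2: "(ALL i:els' (j om). i : els' b <-> (EX q:els' g. W.opr q (W.opr (j (opr C m)) i) : els' (j M))) <->
       (ALL i:els om. j i : els' b <-> (EX q:G. allmeet q C m i))" if "C : els (pw Con)" "m : els om" for C m
      unfolding els_g els_j[of om] using that GP by (auto simp: j_opr M)
    have "?Q b <-> (EX C:els (pw Con). EX m:els om. (EX p:G. allvalid p C) & (ALL i:els om. j i : els' b <-> (EX q:G. allmeet q C m i)))"
    proof
      assume "?Q b"
      then obtain x where x: "x : els' (j ?CS)" "EX p:els' g. W.opr p x : els' (j V)"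
        "ALL i:els' (j om). i : els' b <-> (EX q:els' g. W.opr q (W.opr x i) : els' (j M))" by blast
      obtain C m where C: "x = j (opr C m)" "C : els (pw Con)" "m : els om" using x(1) unfolding els_j[of ?CS] els_prd by blast
      show "EX C:els (pw Con). EX m:els om. (EX p:G. allvalid p C) & (ALL i:els om. j i : els' b <-> (EX q:G. allmeet q C m i))"
        using x(2,3) unfolding C(1) 1[OF C(2,3)] 2[OF C(2,3)] using C(2,3) by blast
    next
      assume "EX C:els (pw Con). EX m:els om. (EX p:G. allvalid p C) & (ALL i:els om. j i : els' b <-> (EX q:G. allmeet q C m i))"
      then obtain C m where C: "C : els (pw Con)" "m : els om" "EX p:G. allvalid p C" "ALL i:els om. j i : els' b <-> (EX q:G. allmeet q C m i)" by blast
      have "j (opr C m) : els' (j ?CS)" using C(1,2) by simp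
      thus "?Q b" using C(3,4) unfolding 1[OF C(1,2), symmetric] 2[OF C(1,2), symmetric] by blast
    qed
    thus ?thesis unfolding basic_def allvalid_def by auto
  qed
  show ?thesis by (rule exI[of _ "W.mk {b : els' (W.pw (j om)). ?Q b}"]) (unfold S, use eq in auto)
qed

lemma basic_ex:
  assumes "p : G" "allvalid p C" "m : els om" shows "EX b. basic b C m"
proof -
  define M where "M = rc P om (%q i. allmeet q C m i)"
  have "Dn E (%rh. allmeet (rh 0) C m (rh 1))" unfolding allmeet_def by (intro dn)
  hence M: "opr q i : els M <-> q : els P & i : els om & allmeet q C m i" for q i
    unfolding M_def by (rule rc_iff)
  let ?Q = "%i. EX q:els' g. W.opr q i : els' (j M)"
  have S: "els' (W.mk {i : els' (j om). ?Q i}) = {i : els' (j om). ?Q i}" by (intro W.els_mk W.sepI dn)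
  have "?Q (j i) <-> (EX q:G. allmeet q C m i)" if "i : els om" for i
    unfolding els_g using that GP by (auto simp: j_opr M)
  hence "basic (W.mk {i : els' (j om). ?Q i}) C m" unfolding basic_def S using assms by auto
  thus ?thesis by blast
qed

lemma basic_ne: assumes b: "basic b C m" shows "b ~= W.emp"
proof -
  obtain p where p: "p : G" "allvalid p C" "m : els om" using b unfolding basic_def by blast
  have "EX r:G. le r p & (EX i:els om. allmeet r C m i)"
  proof (rule generic[OF _ p(1)])
    show "Dn E (%rh. EX i:els om. allmeet (rh 0) C m i)" unfolding allmeet_def by (intro dn)
    fix q assume q: "le q p"
    have "EX i:els om. m : els i & (EX r. le r q & (ALL \<xi> f w. opr \<xi> (opr f w) : els C --> meets r i \<xi> f w))"
    proof (rule basic_meet')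
      show "fin C" using p(2) unfolding allvalid_def by blast
      show "EX \<xi> f w. c = opr \<xi> (opr f w) & valid q \<xi> f w" if "c : els C" for c
        using p(2) that valid_le[OF _ q] unfolding allvalid_def by blast
    qed (rule leD(1)[OF q], rule p(3))
    thus "EX r. le r q & (EX i:els om. allmeet r C m i)" unfolding allmeet_def by blast
  qed
  then obtain r i where "r : G" "i : els om" "allmeet r C m i" by blast
  hence "j i : els' b" using b unfolding basic_def by blast
  thus ?thesis by auto
qed

lemma basic_dir:
  assumes b: "basic b C m" "basic b' C' m'"
  shows "EX c D n. basic c D n & els' c <= els' b & els' c <= els' b'"
proof -
  obtain p where p: "p : G" "allvalid p C" "m : els om" using b(1) unfolding basic_def by blast
  obtain p' where p': "p' : G" "allvalid p' C'" "m' : els om" using b(2) unfolding basic_def by blast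
  obtain r where r: "r : G" "le r p" "le r p'" using Gdir p(1) p'(1) by blast
  obtain n where n: "n : els om" "m : els n" "m' : els n" using om_bound2[OF p(3) p'(3)] .
  let ?D = "un C C'"
  have "allvalid r ?D" unfolding allvalid_def
  proof (intro conjI ballI)
    show "fin ?D" using fin_un p(2) p'(2) unfolding allvalid_def by blast
    show "els ?D <= els Con" using p(2) p'(2) unfolding allvalid_def by auto
    fix c assume "c : els ?D"
    hence "(EX \<xi> f w. c = opr \<xi> (opr f w) & valid p \<xi> f w) \<or> (EX \<xi> f w. c = opr \<xi> (opr f w) & valid p' \<xi> f w)"
      using p(2) p'(2) unfolding allvalid_def by auto
    thus "EX \<xi> f w. c = opr \<xi> (opr f w) & valid r \<xi> f w" using valid_le[OF _ r(2)] valid_le[OF _ r(3)] by blast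
  qed
  then obtain c where c: "basic c ?D n" using basic_ex[OF r(1) _ n(1)] by blast
  have "u : els' b & u : els' b'" if u: "u : els' c" for u
  proof -
    obtain i where i: "u = j i" "i : els om" using u c unfolding basic_def els_j[of om] by blast
    then obtain q where q: "q : G" "allmeet q ?D n i" using u c unfolding basic_def by blast
    have "allmeet q C m i" "allmeet q C' m' i"
      using q(2) om_trans[OF i(2) n(2)] om_trans[OF i(2) n(3)] unfolding allmeet_def by auto
    thus ?thesis using b i q(1) unfolding basic_def by blast
  qed
  thus ?thesis using c by blast
qed

text \<open>The last two clauses record what the base contributes: final segments, which make the
  ultrafilter nonprincipal, and sets on which a given valid requirement is met.\<close>

definition base_ultrafilter :: "'w => bool" where
  "base_ultrafilter F <-> els' F <= els' (W.pw W.om) & W.emp ~: els' F &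
    (ALL x:els' F. ALL y. els' x <= els' y & els' y <= els' W.om --> y : els' F) &
    (ALL x:els' F. ALL y:els' F. EX z:els' F. els' z <= els' x \<inter> els' y) &
    (ALL x. els' x <= els' W.om --> x : els' F \<or> W.df W.om x : els' F) &
    (ALL m:els om. EX b:els' F. ALL i:els om. j i : els' b --> m : els i) &
    (ALL p \<xi> f w. p : G & els f <= els (prd P (prd om om)) & els w <= els (prd P (prd (prd om om) om)) & valid p \<xi> f w -->
      (EX b:els' F. ALL i:els om. j i : els' b --> (EX q:G. meets q i \<xi> f w)))"

lemma base_ultrafilter_ex: "EX F. base_ultrafilter F"
proof -
  obtain B where B: "!!b. b : els' B <-> (EX C m. basic b C m)" using basic_set by blast
  have v0: "allvalid emp emp" unfolding allvalid_def by simp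
  obtain b0 where b0: "b0 : els' B" using basic_ex[OF Gtop v0 om_0] B by blast
  have 1: "els' B <= els' (W.pw (j om))" using B unfolding basic_def by auto
  have 2: "W.emp ~: els' B" using B basic_ne by blast
  have 3: "EX z:els' B. els' z <= els' x \<inter> els' y" if "x : els' B" "y : els' B" for x y
  proof -
    obtain C m C' m' where "basic x C m" "basic y C' m'" using \<open>x : els' B\<close> \<open>y : els' B\<close> B by blast
    from basic_dir[OF this] obtain c D n where c: "basic c D n" "els' c <= els' x" "els' c <= els' y" by blast
    hence "c : els' B" using B by blast
    thus ?thesis using c(2,3) by blast
  qed
  obtain F where F: "els' B <= els' F" "els' F <= els' (W.pw (j om))" "W.emp ~: els' F"
    "ALL x:els' F. ALL y. els' x <= els' y & els' y <= els' (j om) --> y : els' F"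
    "ALL x:els' F. ALL y:els' F. EX z:els' F. els' z <= els' x \<inter> els' y"
    "ALL x. els' x <= els' (j om) --> x : els' F \<or> W.df (j om) x : els' F" using W.ultrafilter[OF 1 b0 2 3] by blast
  show ?thesis unfolding base_ultrafilter_def j_om
  proof (rule exI[of _ F], intro conjI)
    show "ALL m:els om. EX b:els' F. ALL i:els om. j i : els' b --> m : els i"
    proof
      fix m assume "m : els om"
      then obtain b where b: "basic b emp m" using basic_ex[OF Gtop v0] by blast
      hence "b : els' F" using B F(1) by blast
      thus "EX b:els' F. ALL i:els om. j i : els' b --> m : els i" using b unfolding basic_def allmeet_def by blast
    qed
    show "ALL p \<xi> f w. p : G & els f <= els (prd P (prd om om)) & els w <= els (prd P (prd (prd om om) om)) & valid p \<xi> f w -->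
      (EX b:els' F. ALL i:els om. j i : els' b --> (EX q:G. meets q i \<xi> f w))"
    proof (intro allI impI, elim conjE)
      fix p \<xi> f w assume a: "p : G" "els f <= els (prd P (prd om om))" "els w <= els (prd P (prd (prd om om) om))" "valid p \<xi> f w"
      have "\<xi> : els k3" using a(4) lab_k3 unfolding valid_def by blast
      hence "opr \<xi> (opr f w) : els Con" unfolding Con_def using a(2,3) by simp
      hence "allvalid p (mk {opr \<xi> (opr f w)})" unfolding allvalid_def using a(4) by (auto simp: els_mk)
      then obtain b where b: "basic b (mk {opr \<xi> (opr f w)}) emp" using basic_ex[OF a(1) _ om_0] by blast
      have bF: "b : els' F" using b B F(1) by blast
      have "EX q:G. meets q i \<xi> f w" if i: "i : els om" "j i : els' b" for i
      proof -
        obtain q where q: "q : G" "allmeet q (mk {opr \<xi> (opr f w)}) emp i" using b i unfolding basic_def by blast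
        have "opr \<xi> (opr f w) : els (mk {opr \<xi> (opr f w)})" by (simp add: els_mk)
        thus ?thesis using q unfolding allmeet_def by blast
      qed
      thus "EX b:els' F. ALL i:els om. j i : els' b --> (EX q:G. meets q i \<xi> f w)" using bF by blast
    qed
  qed (rule F)+
qed

end

section \<open>Domination and evasion modulo the ultrafilter\<close>

context cohen begin

lemma k2_suc: "x : els k2 ==> suc x : els k2"
proof (rule card_limit)
  show "is_card E k2" using al2 by (simp add: numeral_2_eq_2)
qed (rule om_k2)

lemma Kl_cover: assumes "\<xi> : els k3" shows "EX \<beta>:els k2. \<xi> : els (Kl \<beta>)"
proof (cases "EX \<alpha>:els k2. lab \<xi> \<alpha>")
  case True
  then obtain \<alpha> where a: "\<alpha> : els k2" "lab \<xi> \<alpha>" by blast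
  have "\<xi> : els (Kl (suc \<alpha>))" unfolding Kl using assms lab_uniq[OF a(2)] by auto
  thus ?thesis using k2_suc[OF a(1)] by blast
next
  case False
  hence "\<xi> : els (Kl om)" unfolding Kl using assms by blast
  thus ?thesis using om_k2 by blast
qed

lemma Kl_mono: "\<beta> : els \<beta>' ==> \<beta>' : els k2 ==> els (Kl \<beta>) <= els (Kl \<beta>')"
proof
  assume b: "\<beta> : els \<beta>'" "\<beta>' : els k2"
  fix \<xi> assume "\<xi> : els (Kl \<beta>)"
  thus "\<xi> : els (Kl \<beta>')" unfolding Kl using ord_trans[OF ord_el[OF ord_k2 b(2)] _ b(1)] by blast
qed

lemma k_ne: "els k2 ~= {}" "els k3 ~= {}" using om_k2 om_k3 by blast+

lemma ord_mono: "\<beta> : els \<beta>' ==> \<beta>' : els k3 ==> els \<beta> <= els \<beta>'"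
  using ord_trans[OF ord_el[OF ord_k3]] by blast

lemma k3_cover: "\<xi> : els k3 ==> EX \<beta>:els k3. \<xi> : els \<beta>"
  using k3_suc by (intro bexI[of _ "suc \<xi>"]) auto

definition F :: 'w where "F = (SOME F. base_ultrafilter F)"

lemma F:
  "els' F <= els' (W.pw W.om)" "W.emp ~: els' F"
  "x : els' F ==> els' x <= els' y ==> els' y <= els' W.om ==> y : els' F"
  "x : els' F ==> y : els' F ==> EX z:els' F. els' z <= els' x \<inter> els' y"
  "els' x <= els' W.om ==> x : els' F \<or> W.df W.om x : els' F"
  "m : els om ==> EX b:els' F. ALL i:els om. j i : els' b --> m : els i"
  "p : G ==> els f <= els (prd P (prd om om)) ==> els w <= els (prd P (prd (prd om om) om)) ==> valid p \<xi> f w ==>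
     EX b:els' F. ALL i:els om. j i : els' b --> (EX q:G. meets q i \<xi> f w)"
proof -
  note a = someI_ex[OF base_ultrafilter_ex, folded F_def, unfolded base_ultrafilter_def]
  from a show "els' F <= els' (W.pw W.om)" by (elim conjE)
  from a show "W.emp ~: els' F" by (elim conjE)
  from a show "x : els' F ==> els' x <= els' y ==> els' y <= els' W.om ==> y : els' F" by blast
  from a show "x : els' F ==> y : els' F ==> EX z:els' F. els' z <= els' x \<inter> els' y" by blast
  from a show "els' x <= els' W.om ==> x : els' F \<or> W.df W.om x : els' F" by blast
  from a show "m : els om ==> EX b:els' F. ALL i:els om. j i : els' b --> m : els i" by blast
  from a show "p : G ==> els f <= els (prd P (prd om om)) ==> els w <= els (prd P (prd (prd om om) om)) ==> valid p \<xi> f w ==>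
     EX b:els' F. ALL i:els om. j i : els' b --> (EX q:G. meets q i \<xi> f w)" by blast
qed

text \<open>The values of \<open>h\<close> can be decided with coordinates below some
  \<open>\<gamma>\<close> in \<open>k3\<close>, because \<open>k2\<close> many bounds in
  \<open>k3\<close> have a common bound. A labelled \<open>\<xi>\<close> above
  \<open>\<gamma>\<close> then gives a dominating function; the label \<open>emp\<close> will do,
  since no proper \<open>w\<close> is to be evaded.\<close>

lemma domination:
  assumes h: "is_fun E' h (W.prd (j k2) W.om) W.om"
  shows "EX f. is_fun E' f W.om W.om & (ALL \<alpha>:els' (j k2). EX b:els' F. ALL i:els' b. W.ap h (W.opr \<alpha> i) : els' (W.ap f i))"
proof -
  obtain gr where gr: "is_fun E' gr (j (prd k3 om)) (j om)"
    "!!\<xi> i. \<xi> : els k3 ==> i : els om ==> EX q:G. EX k. W.ap gr (j (opr \<xi> i)) = j k & first_one q \<xi> i k" using gen_ordinal by blast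
  have "is_fun E' h (j (prd k2 om)) (j om)" using h unfolding j_om j_prd .
  from total_name[OF this] obtain R p where R: "p : G" "els R <= els (prd P (prd (prd k2 om) om))"
    "!!x. x : els (prd k2 om) ==> tot p R x om k3" "!!q x v. q : G ==> dec q R x v ==> W.ap h (j x) = j v" by blast
  have "EX \<gamma>:els k3. ALL \<alpha>:els k2. ALL i:els om. tot p R (opr \<alpha> i) om \<gamma>"
  proof (rule support_coll[where K = "%\<gamma>. \<gamma>", OF ord_k3 k_ne(2) bnd_om_k3 _ k3_cover ord_mono bnd_k3 bnd_om_k3])
    show "Fn E (%rh. rh 0)" by (intro dn)
    show "tot p R (opr \<alpha> i) om k3" if "\<alpha> : els k2" "i : els om" for \<alpha> i using R(3) that by simp
  qed
  then obtain \<gamma> where \<gamma>: "\<gamma> : els k3" "!!\<alpha> i. \<alpha> : els k2 ==> i : els om ==> tot p R (opr \<alpha> i) om \<gamma>" by blast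
  have e2: "emp : els k2" using ord_trans[OF ord_k2 om_0 om_k2] .
  hence "emp : els k3" using ord_trans[OF ord_k3 _ k2_k3] by blast
  then obtain \<xi> where \<xi>: "lab \<xi> emp" "\<gamma> : els \<xi>" using lab_ex \<gamma>(1) by blast
  have \<xi>k: "\<xi> : els k3" using lab_k3[OF \<xi>(1)] .
  define f where "f = W.lam W.om W.om (%i. W.ap gr (W.opr (j \<xi>) i))"
  have Ff: "Fn E' (%rh. W.ap gr (W.opr (j \<xi>) (rh 0)))" by (intro dn)
  have v: "W.ap gr (W.opr (j \<xi>) i) : els' W.om" if i: "i : els' W.om" for i
  proof -
    obtain i0 where "i = j i0" "i0 : els om" using i unfolding j_om els_j[of om] by blast
    hence "W.opr (j \<xi>) i : els' (j (prd k3 om))" using \<xi>k by (simp add: j_opr)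
    thus ?thesis using W.fun_val(2)[OF gr(1)] j_om by simp
  qed
  have f: "is_fun E' f W.om W.om" unfolding f_def by (rule W.lam_fun[OF Ff]) (rule v)
  have fi: "W.ap f i = W.ap gr (W.opr (j \<xi>) i)" if "i : els' W.om" for i
    unfolding f_def by (rule W.lam_ap[OF Ff _ that]) (rule v)
  have "EX b:els' F. ALL i:els' b. W.ap h (W.opr \<alpha> i) : els' (W.ap f i)" if ak: "\<alpha> : els' (j k2)" for \<alpha>
  proof -
    obtain \<alpha>0 where a: "\<alpha> = j \<alpha>0" "\<alpha>0 : els k2" using ak unfolding els_j[of k2] by blast
    \<comment> \<open>The row of \<open>h\<close> at \<open>\<alpha>0\<close>, as the name of a
      function on \<omega>.\<close>
    define R' where "R' = rc P (prd om om) (%r y. EX i v. y = opr i v & opr r (opr (opr \<alpha>0 i) v) : els R)"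
    have dR: "Dn E (%rh. EX i v. rh 1 = opr i v & opr (rh 0) (opr (opr \<alpha>0 i) v) : els R)" by (intro dn)
    have R': "opr r (opr i v) : els R' <-> r : els P & i : els om & v : els om & opr r (opr (opr \<alpha>0 i) v) : els R" for r i v
      unfolding R'_def by (subst rc_iff[OF dR]) auto
    have R's: "els R' <= els (prd P (prd om om))" unfolding R'_def els_rc[OF dR] els_prd by blast
    have RP: "r : els P" if "opr r x : els R" for r x
    proof -
      have "opr r x : els (prd P (prd (prd k2 om) om))" using that R(2) by blast
      thus ?thesis by simp
    qed
    \<comment> \<open>A name of the constant function with value 0. The empty condition decides it,
      so its support lies in every \<open>Kl \<alpha>\<close>, even in
      \<open>Kl emp\<close>.\<close>
    define w where "w = rc (mk {emp}) (prd (prd om om) om) (%r y. EX x. y = opr x emp)"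
    have dw: "Dn E (%rh. EX x. rh 1 = opr x emp)" by (intro dn)
    have w: "opr emp (opr x emp) : els w" if "x : els (prd om om)" for x
      unfolding w_def by (subst rc_iff[OF dw]) (use that om_0 in \<open>auto simp: els_mk\<close>)
    have ws: "els w <= els (prd P (prd (prd om om) om))" unfolding w_def els_rc[OF dw] els_prd using P_emp by (auto simp: els_mk)
    have "valid p \<xi> R' w" unfolding valid_def
    proof (intro bexI[of _ emp] conjI ballI)
      show "tot p R' i om \<xi>" if i: "i : els om" for i
        unfolding tot_def
      proof (intro allI impI)
        fix q assume "le q p"
        then obtain r v where r: "v : els om" "opr r (opr (opr \<alpha>0 i) v) : els R" "un q r : els P" "sup r \<gamma>"
          using \<gamma>(2)[OF a(2) i] unfolding tot_def by blast
        have "sup r \<xi>" using r(4) ord_mono[OF \<xi>(2) \<xi>k] unfolding sup_def by blast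
        moreover have "opr r (opr i v) : els R'" unfolding R' using RP[OF r(2)] i r(1,2) by blast
        ultimately show "EX r v. v : els om & opr r (opr i v) : els R' & un q r : els P & sup r \<xi>" using r(1,3) by blast
      qed
      show "tot p w (opr i l) om (Kl emp)" if il: "i : els om" "l : els om" for i l
        unfolding tot_def
      proof (intro allI impI exI conjI)
        fix q assume "le q p"
        thus "un q emp : els P" unfolding un_emp by (rule leD(1))
        show "opr emp (opr (opr i l) emp) : els w" by (rule w) (use il in simp)
        show "sup emp (Kl emp)" unfolding sup_def by simp
      qed (rule om_0)
    qed (rule \<xi>(1), rule e2)
    then obtain b where b: "b : els' F" "ALL i:els om. j i : els' b --> (EX q:G. meets q i \<xi> R' w)" using F(7)[OF R(1) R's ws] by blast
    have "W.ap h (W.opr \<alpha> i) : els' (W.ap f i)" if i: "i : els' b" for i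
    proof -
      have io: "i : els' W.om" using i b(1) F(1) by auto
      then obtain i0 where i0: "i = j i0" "i0 : els om" unfolding j_om els_j[of om] by blast
      then obtain q where q: "q : G" "meets q i0 \<xi> R' w" using b(2) i by blast
      then obtain k v where k: "first_one q \<xi> i0 k" "v : els k" "dec q R' i0 v" unfolding meets_def by blast
      have "dec q R (opr \<alpha>0 i0) v" using k(3) unfolding dec_def R' by blast
      hence 1: "W.ap h (W.opr \<alpha> i) = j v" using R(4)[OF q(1)] unfolding a(1) i0(1) j_opr by blast
      obtain q' k' where "q' : G" "W.ap gr (j (opr \<xi> i0)) = j k'" "first_one q' \<xi> i0 k'" using gr(2)[OF \<xi>k i0(2)] by blast
      hence "W.ap gr (j (opr \<xi> i0)) = j k" using first_one_uniq[OF q(1) k(1)] by simp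
      hence "W.ap f i = j k" using fi[OF io] unfolding i0(1) j_opr by simp
      thus ?thesis unfolding 1 using k(2) by simp
    qed
    thus ?thesis using b(1) by blast
  qed
  thus ?thesis using f by blast
qed

text \<open>\<open>\<gamma>\<close> bounds the coordinates used by \<open>f\<close>, and
  \<open>sl\<close> picks for every label \<open>\<alpha>\<close> an ordinal above
  \<open>\<gamma>\<close>; all this is fixed before \<open>w\<close> is given. The countably many
  values of \<open>w\<close> can be decided with coordinates in some \<open>Kl \<alpha>\<close>, and
  for this \<open>\<alpha>\<close> the function at \<open>sl \<alpha>\<close> evades
  \<open>w\<close>.\<close>

lemma evasion:
  assumes f: "is_fun E' f W.om W.om"
  shows "EX x. is_fun E' x (W.prd (j k2) W.om) W.om & (ALL w. is_fun E' w (W.prd W.om W.om) W.om -->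
    (EX \<alpha>:els' (j k2). EX b:els' F. ALL i:els' b. ALL l:els' (W.ap f i). W.ap w (W.opr i l) ~= W.ap x (W.opr \<alpha> i)))"
proof -
  obtain gr where gr: "is_fun E' gr (j (prd k3 om)) (j om)"
    "!!\<xi> i. \<xi> : els k3 ==> i : els om ==> EX q:G. EX k. W.ap gr (j (opr \<xi> i)) = j k & first_one q \<xi> i k" using gen_ordinal by blast
  have "is_fun E' f (j om) (j om)" using f unfolding j_om .
  from total_name[OF this] obtain R p where R: "p : G" "els R <= els (prd P (prd om om))"
    "!!x. x : els om ==> tot p R x om k3" "!!q x v. q : G ==> dec q R x v ==> W.ap f (j x) = j v" by blast
  have "EX \<gamma>:els k3. ALL i:els om. tot p R i om \<gamma>"
  proof (rule bnd_coll[OF ord_k3 bnd_om_k3])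
    show "Dn E (%rh. tot p R (rh 0) om (rh 1))" by (intro dn)
    show "EX \<gamma>:els k3. tot p R i om \<gamma>" if "i : els om" for i
    proof (rule support_bound[where K = "%\<gamma>. \<gamma>", OF ord_k3 k_ne(2) bnd_om_k3 _ k3_cover ord_mono R(3)[OF that]])
      show "Fn E (%rh. rh 0)" by (intro dn)
    qed
    show "tot p R i om \<gamma>'" if "tot p R i om \<gamma>" "\<gamma> : els \<gamma>'" "\<gamma>' : els k3" for i \<gamma> \<gamma>'
      using that(1) tot_mono ord_mono[OF that(2,3)] by blast
  qed
  then obtain \<gamma> where \<gamma>: "\<gamma> : els k3" "!!i. i : els om ==> tot p R i om \<gamma>" by blast
  define LAB where "LAB = rc k3 k2 (%\<xi> \<alpha>. lab \<xi> \<alpha> & \<gamma> : els \<xi>)"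
  have "Dn E (%rh. lab (rh 0) (rh 1) & \<gamma> : els (rh 0))" by (intro dn)
  hence LAB: "opr \<xi> \<alpha> : els LAB <-> \<xi> : els k3 & \<alpha> : els k2 & lab \<xi> \<alpha> & \<gamma> : els \<xi>" for \<xi> \<alpha>
    unfolding LAB_def by (rule rc_iff)
  have "EX sl. is_fun E' sl (j k2) (j k3) & (ALL \<alpha>:els' (j k2). W.opr (W.ap sl \<alpha>) \<alpha> : els' (j LAB))"
  proof (rule W.choice)
    show "Dn E' (%rh. W.opr (rh 1) (rh 0) : els' (j LAB))" by (intro dn)
    fix \<alpha> assume "\<alpha> : els' (j k2)"
    then obtain \<alpha>0 where a: "\<alpha> = j \<alpha>0" "\<alpha>0 : els k2" unfolding els_j[of k2] by blast
    have "\<alpha>0 : els k3" using ord_trans[OF ord_k3 a(2) k2_k3] .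
    then obtain \<xi> where x: "lab \<xi> \<alpha>0" "\<gamma> : els \<xi>" using lab_ex \<gamma>(1) by blast
    have "W.opr (j \<xi>) \<alpha> : els' (j LAB)" unfolding a(1) j_opr j_mem LAB using x a(2) lab_k3 by blast
    thus "EX y:els' (j k3). W.opr y \<alpha> : els' (j LAB)" using lab_k3[OF x(1)] by (intro bexI[of _ "j \<xi>"]) auto
  qed
  then obtain sl where sl: "is_fun E' sl (j k2) (j k3)" "!!\<alpha>. \<alpha> : els' (j k2) ==> W.opr (W.ap sl \<alpha>) \<alpha> : els' (j LAB)" by blast
  let ?K = "%z y. EX \<alpha> i. z = W.opr \<alpha> i & y = W.ap gr (W.opr (W.ap sl \<alpha>) i)"
  have "EX x. is_fun E' x (W.prd (j k2) W.om) W.om & (ALL z:els' (W.prd (j k2) W.om). ?K z (W.ap x z))"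
  proof (rule W.choice[where K = ?K])
    show "Dn E' (%rh. ?K (rh 0) (rh 1))" by (intro dn)
    fix z assume "z : els' (W.prd (j k2) W.om)"
    then obtain \<alpha> i where z: "z = W.opr \<alpha> i" "\<alpha> : els' (j k2)" "i : els' W.om" using W.prdE by blast
    have "W.ap sl \<alpha> : els' (j k3)" using W.fun_val(2)[OF sl(1) z(2)] .
    hence "W.opr (W.ap sl \<alpha>) i : els' (W.prd (j k3) (j om))" using z(3) unfolding j_om by simp
    hence "W.ap gr (W.opr (W.ap sl \<alpha>) i) : els' W.om" using W.fun_val(2)[OF gr(1)] unfolding j_prd j_om by blast
    thus "EX y:els' W.om. ?K z y" using z(1) by blast
  qed
  then obtain x where x: "is_fun E' x (W.prd (j k2) W.om) W.om" "!!z. z : els' (W.prd (j k2) W.om) ==> ?K z (W.ap x z)" by blast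
  have xv: "W.ap x (W.opr \<alpha> i) = W.ap gr (W.opr (W.ap sl \<alpha>) i)" if "\<alpha> : els' (j k2)" "i : els' W.om" for \<alpha> i
    using x(2)[of "W.opr \<alpha> i"] that by simp
  have "EX \<alpha>:els' (j k2). EX b:els' F. ALL i:els' b. ALL l:els' (W.ap f i). W.ap w (W.opr i l) ~= W.ap x (W.opr \<alpha> i)"
    if w: "is_fun E' w (W.prd W.om W.om) W.om" for w
  proof -
    have "is_fun E' w (j (prd om om)) (j om)" using w unfolding j_om j_prd .
    from total_name[OF this] obtain S p' where S: "p' : G" "els S <= els (prd P (prd (prd om om) om))"
      "!!x. x : els (prd om om) ==> tot p' S x om k3" "!!q x v. q : G ==> dec q S x v ==> W.ap w (j x) = j v" by blast
    have "EX \<alpha>:els k2. ALL i:els om. ALL l:els om. tot p' S (opr i l) om (Kl \<alpha>)"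
    proof (rule support_coll[OF ord_k2 k_ne(1) bnd_om_k2 _ Kl_cover Kl_mono bnd_om_k2 bnd_om_k2])
      show "Fn E (%rh. Kl (rh 0))" by (intro dn)
      show "tot p' S (opr i l) om k3" if "i : els om" "l : els om" for i l using S(3) that by simp
    qed
    then obtain \<alpha> where \<alpha>: "\<alpha> : els k2" "!!i l. i : els om ==> l : els om ==> tot p' S (opr i l) om (Kl \<alpha>)" by blast
    have ja: "j \<alpha> : els' (j k2)" using \<alpha>(1) by simp
    obtain \<xi> where \<xi>: "W.ap sl (j \<alpha>) = j \<xi>" using W.fun_val(2)[OF sl(1) ja] unfolding els_j[of k3] by blast
    have "opr \<xi> \<alpha> : els LAB" using sl(2)[OF ja] unfolding \<xi> j_opr by simp
    hence l: "\<xi> : els k3" "lab \<xi> \<alpha>" "\<gamma> : els \<xi>" unfolding LAB by blast+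
    obtain r where r: "r : G" "le r p" "le r p'" using Gdir R(1) S(1) by blast
    have "valid r \<xi> R S" unfolding valid_def
    proof (intro bexI[of _ \<alpha>] conjI ballI)
      show "tot r R i om \<xi>" if "i : els om" for i by (rule tot_mono[OF tot_le[OF \<gamma>(2)[OF that] r(2)] ord_mono[OF l(3,1)]])
      show "tot r S (opr i l) om (Kl \<alpha>)" if "i : els om" "l : els om" for i l by (rule tot_le[OF \<alpha>(2)[OF that] r(3)])
    qed (rule l(2), rule \<alpha>(1))
    then obtain b where b: "b : els' F" "ALL i:els om. j i : els' b --> (EX q:G. meets q i \<xi> R S)" using F(7)[OF r(1) R(2) S(2)] by blast
    have "W.ap w (W.opr i l) ~= W.ap x (W.opr (j \<alpha>) i)" if i: "i : els' b" "l : els' (W.ap f i)" for i l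
    proof -
      have io: "i : els' W.om" using i(1) b(1) F(1) by auto
      then obtain i0 where i0: "i = j i0" "i0 : els om" unfolding j_om els_j[of om] by blast
      then obtain q where q: "q : G" "meets q i0 \<xi> R S" using b(2) i(1) by blast
      then obtain k v where k: "first_one q \<xi> i0 k" "dec q R i0 v" "ALL l:els v. EX y. y ~= k & dec q S (opr i0 l) y" unfolding meets_def by blast
      have "W.ap f i = j v" using R(4)[OF q(1) k(2)] unfolding i0(1) .
      hence "l : els' (j v)" using i(2) by simp
      then obtain l0 where l0: "l = j l0" "l0 : els v" unfolding els_j[of v] by blast
      obtain y where y: "y ~= k" "dec q S (opr i0 l0) y" using k(3) l0(2) by blast
      have 1: "W.ap w (W.opr i l) = j y" using S(4)[OF q(1) y(2)] unfolding i0(1) l0(1) j_opr .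
      obtain q' k' where "q' : G" "W.ap gr (j (opr \<xi> i0)) = j k'" "first_one q' \<xi> i0 k'" using gr(2)[OF l(1) i0(2)] by blast
      hence "W.ap gr (j (opr \<xi> i0)) = j k" using first_one_uniq[OF q(1) k(1)] by simp
      hence "W.ap x (W.opr (j \<alpha>) i) = j k" using xv[OF ja io] unfolding \<xi> i0(1) j_opr by simp
      thus ?thesis unfolding 1 using y(1) by simp
    qed
    thus ?thesis using ja b(1) by blast
  qed
  thus ?thesis using x(1) by blast
qed

end

section \<open>Formulas and satisfaction\<close>

context zs begin

definition fs :: "'v => 'v" where "fs p = (if EX x y. p = opr x y then THE x. EX y. p = opr x y else p)"
definition sn :: "'v => 'v" where "sn p = (if EX x y. p = opr x y then THE y. EX x. p = opr x y else p)"

lemma fs_opr [simp]: "fs (opr x y) = x" and sn_opr [simp]: "sn (opr x y) = y"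
  unfolding fs_def sn_def by auto

lemma fs_iff: "z = fs p <-> (EX y. p = opr z y) \<or> ~ (EX x y. p = opr x y) & z = p"
  by (cases "EX x y. p = opr x y") (auto simp: fs_def)

lemma sn_iff: "z = sn p <-> (EX x. p = opr x z) \<or> ~ (EX x y. p = opr x y) & z = p"
  by (cases "EX x y. p = opr x y") (auto simp: sn_def)

lemma Fn_fs [dn]: "Fn E a ==> Fn E (%rh. fs (a rh))"
proof (rule Fn_comp1[where f = fs])
  show "Fn E (%rh. fs (rh 0))" unfolding Fn_def fs_iff by (intro dn)
qed

lemma Fn_sn [dn]: "Fn E a ==> Fn E (%rh. sn (a rh))"
proof (rule Fn_comp1[where f = sn])
  show "Fn E (%rh. sn (rh 0))" unfolding Fn_def sn_iff by (intro dn)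
qed

definition n1 :: 'v where "n1 = suc emp"
definition n2 :: 'v where "n2 = suc n1"
definition n3 :: 'v where "n3 = suc n2"

lemma num_om: "n1 : els om" "n2 : els om" "n3 : els om" unfolding n1_def n2_def n3_def by (simp_all add: om_suc)

lemma num_in: "emp : els n1" "n1 : els n2" "n2 : els n3" unfolding n1_def n2_def n3_def by simp_all

lemma num_ne [simp]: "n1 ~= emp" "n2 ~= emp" "n3 ~= emp" "n2 ~= n1" "n3 ~= n1" "n3 ~= n2"
   "emp ~= n1" "emp ~= n2" "emp ~= n3" "n1 ~= n2" "n1 ~= n3" "n2 ~= n3"
proof -
  have 1: "emp : els n2" using om_trans[OF num_om(2) num_in(1,2)] .
  have 2: "n1 : els n3" using om_trans[OF num_om(3) num_in(2,3)] .
  have 3: "emp : els n3" using om_trans[OF num_om(3) 1 num_in(3)] .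
  have e: "x ~: els emp" for x by simp
  show a: "n1 ~= emp" using num_in(1) e by metis
  show b: "n2 ~= emp" using num_in(2) e by metis
  show c: "n3 ~= emp" using num_in(3) e by metis
  show d: "n2 ~= n1" using num_in(2) om_irrefl[OF num_om(1)] by metis
  show f: "n3 ~= n1" using 2 om_irrefl[OF num_om(1)] by metis
  show g: "n3 ~= n2" using num_in(3) om_irrefl[OF num_om(2)] by metis
  show "emp ~= n1" "emp ~= n2" "emp ~= n3" "n1 ~= n2" "n1 ~= n3" "n2 ~= n3" using a b c d f g by metis+
qed

lemma is_num_n: "is_num E 0 x <-> x = emp" "is_num E 1 x <-> x = n1" "is_num E 2 x <-> x = n2" "is_num E 3 x <-> x = n3"
proof -
  show a: "is_num E 0 x <-> x = emp" for x by (rule is_num_0)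
  show b: "is_num E 1 x <-> x = n1" for x unfolding One_nat_def is_num_1 a n1_def by blast
  have s: "(2::nat) = Suc 1" "(3::nat) = Suc 2" by simp_all
  show c: "is_num E 2 x <-> x = n2" for x unfolding s(1) is_num_1 b n2_def by blast
  show "is_num E 3 x <-> x = n3" for x unfolding s(2) is_num_1 c n3_def by blast
qed

lemma code_iff:
  "code E 0 x y c <-> c = opr emp (opr x y)" "code E 1 x y c <-> c = opr n1 (opr x y)"
  "code E 2 x y c <-> c = opr n2 (opr x y)" "code E 3 x y c <-> c = opr n3 (opr x y)"
  unfolding code_def is_num_n is_pair_iff by simp_all

lemma formula_closed_iff: "formula_closed E om X <->
  (ALL i:els om. ALL j:els om. opr emp (opr i j) : els X & opr n1 (opr i j) : els X) &
  (ALL \<phi>:els X. ALL \<psi>:els X. opr n2 (opr \<phi> \<psi>) : els X) & (ALL i:els om. ALL \<phi>:els X. opr n3 (opr i \<phi>) : els X)"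
proof -
  have 1: "(ALL c. ALL i:S. ALL l:S. c = f i l \<or> c = h i l --> c : Y) <-> (ALL i:S. ALL l:S. f i l : Y & h i l : Y)"
    for f h :: "'v => 'v => 'v" and S Y by blast
  have 2: "(ALL c. ALL i:S. ALL l:S'. c = f i l --> c : Y) <-> (ALL i:S. ALL l:S'. f i l : Y)"
    for f :: "'v => 'v => 'v" and S S' Y by blast
  show ?thesis unfolding formula_closed_def code_iff
    unfolding 1[of "els om" "%i l. opr emp (opr i l)" "%i l. opr n1 (opr i l)" "els X"]
      2[of "els X" "els X" "%i l. opr n2 (opr i l)" "els X"] 2[of "els om" "els X" "%i l. opr n3 (opr i l)" "els X"] ..
qed

definition sub :: "'v => 'v => bool" where
  "sub z x <-> (EX y. x = opr n2 (opr z y) \<or> x = opr n2 (opr y z) \<or> x = opr n3 (opr y z))"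

lemma sub_opr:
  "x = opr n2 (opr \<phi> \<psi>) ==> sub \<phi> x" "x = opr n2 (opr \<phi> \<psi>) ==> sub \<psi> x" "x = opr n3 (opr k \<phi>) ==> sub \<phi> x"
  by (auto simp: sub_def)

lemma Dn_subf [dn]: "Fn E a ==> Fn E b ==> Dn E (%rh. sub (a rh) (b rh))" unfolding sub_def by (intro dn Fn_shift)

end

locale formulas = zs E for E :: "'v => 'v => bool" +
  fixes \<Phi> :: 'v
  assumes Phi: "is_formulas E om \<Phi>"
begin

lemma Phi_closed:
  "i : els om ==> l : els om ==> opr emp (opr i l) : els \<Phi>" "i : els om ==> l : els om ==> opr n1 (opr i l) : els \<Phi>"
  "\<phi> : els \<Phi> ==> \<psi> : els \<Phi> ==> opr n2 (opr \<phi> \<psi>) : els \<Phi>" "i : els om ==> \<phi> : els \<Phi> ==> opr n3 (opr i \<phi>) : els \<Phi>"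
  using Phi unfolding is_formulas_def formula_closed_iff by blast+

lemma Phi_induct:
  assumes c: "c : els \<Phi>" and Q: "Dn E (%rh. Q (rh 0))"
    and "!!i l. i : els om ==> l : els om ==> Q (opr emp (opr i l))" "!!i l. i : els om ==> l : els om ==> Q (opr n1 (opr i l))"
    "!!\<phi> \<psi>. \<phi> : els \<Phi> ==> \<psi> : els \<Phi> ==> Q \<phi> ==> Q \<psi> ==> Q (opr n2 (opr \<phi> \<psi>))"
    "!!i \<phi>. i : els om ==> \<phi> : els \<Phi> ==> Q \<phi> ==> Q (opr n3 (opr i \<phi>))"
  shows "Q c"
proof -
  have S: "els (mk {c : els \<Phi>. Q c}) = {c : els \<Phi>. Q c}" by (intro els_mk sepI Q)
  have "formula_closed E om (mk {c : els \<Phi>. Q c})" unfolding formula_closed_iff S using assms Phi_closed by simp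
  hence "els \<Phi> <= {c : els \<Phi>. Q c}" using Phi S unfolding is_formulas_def by metis
  thus ?thesis using c by blast
qed

lemma Phi_wf: assumes "els A <= els \<Phi>" "A ~= emp" shows "EX x:els A. ALL z:els A. ~ sub z x"
proof (rule ccontr)
  assume n: "~ ?thesis"
  have "c ~: els A" if "c : els \<Phi>" for c
  proof (rule Phi_induct[OF that, where Q = "%c. c ~: els A"])
    show "Dn E (%rh. rh 0 ~: els A)" by (intro dn)
  qed (use n in \<open>auto simp: sub_def\<close>)
  thus False using assms empty_iff_emp[of A] by blast
qed

lemma recursion:
  assumes H: "Dn E (%rh. H (rh 0) (rh 1) (rh 2))"
    and loc: "!!x y r r'. x : els \<Phi> ==> y : els Y ==>
      (!!z u. z : els \<Phi> ==> sub z x ==> opr z u : els r <-> opr z u : els r') ==> H x y r = H x y r'"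
  shows "EX R. els R <= els (prd \<Phi> Y) & (ALL x:els \<Phi>. ALL y:els Y. opr x y : els R <-> H x y R)"
proof (rule wf_rec[where lt = sub, OF _ _ H loc])
  show "Dn E (%rh. sub (rh 0) (rh 1))" by (intro dn)
qed (rule Phi_wf)

text \<open>Free variables are obtained by recursion as a relation between formulas and \<omega>.
  The finiteness of their sets is what bounds the positions of the back-and-forth game.\<close>

lemma free_vars_ex: "EX v. is_free_vars E om \<Phi> v & (ALL c:els \<Phi>. fin (ap v c))"
proof -
  define H where "H c i r <-> (EX k l. (c = opr emp (opr k l) \<or> c = opr n1 (opr k l)) & (i = k \<or> i = l)) \<or>
    (EX \<phi>:els \<Phi>. EX \<psi>:els \<Phi>. c = opr n2 (opr \<phi> \<psi>) & (opr \<phi> i : els r \<or> opr \<psi> i : els r)) \<or>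
    (EX k. EX \<phi>:els \<Phi>. c = opr n3 (opr k \<phi>) & opr \<phi> i : els r & i ~= k)" for c i r
  have "EX R. els R <= els (prd \<Phi> om) & (ALL x:els \<Phi>. ALL y:els om. opr x y : els R <-> H x y R)"
  proof (rule recursion)
    show "Dn E (%rh. H (rh 0) (rh 1) (rh 2))" unfolding H_def by (intro dn)
    fix x y r r' assume a: "!!z u. z : els \<Phi> ==> sub z x ==> opr z u : els r <-> opr z u : els r'"
    have 2: "opr \<phi> u : els r <-> opr \<phi> u : els r'" "opr \<psi> u : els r <-> opr \<psi> u : els r'"
      if "x = opr n2 (opr \<phi> \<psi>)" "\<phi> : els \<Phi>" "\<psi> : els \<Phi>" for \<phi> \<psi> u
      using a[OF that(2) sub_opr(1)[OF that(1)]] a[OF that(3) sub_opr(2)[OF that(1)]] by simp_all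
    have 3: "opr \<phi> u : els r <-> opr \<phi> u : els r'" if "x = opr n3 (opr k \<phi>)" "\<phi> : els \<Phi>" for k \<phi> u
      using a[OF that(2) sub_opr(3)[OF that(1)]] by simp
    show "H x y r = H x y r'" unfolding H_def
      by (intro arg_cong2[where f = "(\<or>)"] refl bex_cong ex_cong1 conj_cong) (rule 2 3; assumption)+
  qed
  then obtain R where R: "!!c i. c : els \<Phi> ==> i : els om ==> opr c i : els R <-> H c i R" by blast
  let ?h = "%c. mk {i : els om. opr c i : els R}"
  have S: "els (?h c) = {i : els om. opr c i : els R}" for c by (intro els_mk sepI dn)
  have h: "Fn E (%rh. ?h (rh 0))" by (rule Fn_mk) (intro sepI dn, unfold mem_Collect_eq, intro dn)
  have v: "?h c : els (pw om)" for c using S by auto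
  let ?v = "lam \<Phi> (pw om) ?h"
  have fv: "is_fun E ?v \<Phi> (pw om)" by (rule lam_fun[OF h]) (rule v)
  have L: "ap ?v c = ?h c" if "c : els \<Phi>" for c by (rule lam_ap[OF h _ that]) (rule v)
  have L': "app E ?v c = ?h c" if "c : els \<Phi>" for c using app_ap[OF fv that] L[OF that] by simp
  have e0: "els (?h (opr emp (opr i l))) = {i, l}" "els (?h (opr n1 (opr i l))) = {i, l}" if "i : els om" "l : els om" for i l
    unfolding S using R[OF Phi_closed(1)[OF that]] R[OF Phi_closed(2)[OF that]] that by (auto simp: H_def)
  have e2: "els (?h (opr n2 (opr \<phi> \<psi>))) = els (?h \<phi>) \<union> els (?h \<psi>)" if "\<phi> : els \<Phi>" "\<psi> : els \<Phi>" for \<phi> \<psi>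
    unfolding S using R[OF Phi_closed(3)[OF that]] that by (auto simp: H_def)
  have e3: "els (?h (opr n3 (opr i \<phi>))) = els (?h \<phi>) - {i}" if "i : els om" "\<phi> : els \<Phi>" for i \<phi>
    unfolding S using R[OF Phi_closed(4)[OF that]] that by (auto simp: H_def)
  have "is_free_vars E om \<Phi> ?v" unfolding is_free_vars_def code_iff
  proof (intro conjI allI ballI impI)
    show "EX p. els p = {x. els x <= els om} & is_fun E ?v \<Phi> p" using fv by (intro exI[of _ "pw om"]) simp
    show "els (app E ?v c) = {i, l}" if "i : els om" "l : els om" "c = opr emp (opr i l) \<or> c = opr n1 (opr i l)" for c i l
    proof (rule disjE[OF that(3)])
      show "els (app E ?v c) = {i, l}" if c: "c = opr emp (opr i l)"
        unfolding c L'[OF Phi_closed(1)[OF \<open>i : els om\<close> \<open>l : els om\<close>]] by (rule e0(1)) (rule \<open>i : els om\<close> \<open>l : els om\<close>)+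
      show "els (app E ?v c) = {i, l}" if c: "c = opr n1 (opr i l)"
        unfolding c L'[OF Phi_closed(2)[OF \<open>i : els om\<close> \<open>l : els om\<close>]] by (rule e0(2)) (rule \<open>i : els om\<close> \<open>l : els om\<close>)+
    qed
    show "els (app E ?v c) = els (app E ?v \<phi>) \<union> els (app E ?v \<psi>)" if "\<phi> : els \<Phi>" "\<psi> : els \<Phi>" "c = opr n2 (opr \<phi> \<psi>)" for c \<phi> \<psi>
      unfolding that(3) L'[OF that(1)] L'[OF that(2)] L'[OF Phi_closed(3)[OF that(1,2)]] by (rule e2[OF that(1,2)])
    show "els (app E ?v c) = els (app E ?v \<phi>) - {i}" if "i : els om" "\<phi> : els \<Phi>" "c = opr n3 (opr i \<phi>)" for c i \<phi>
      unfolding that(3) L'[OF that(2)] L'[OF Phi_closed(4)[OF that(1,2)]] by (rule e3[OF that(1,2)])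
  qed
  moreover have "fin (ap ?v c)" if "c : els \<Phi>" for c
  proof (rule Phi_induct[OF that, where Q = "%c. fin (ap ?v c)"])
    show "Dn E (%rh. fin (ap ?v (rh 0)))" by (intro dn)
    have p: "fin (mk {i, l})" for i l
    proof -
      have "mk {i, l} = ins i (mk {l})" by (rule ext) (simp add: els_mk)
      thus ?thesis using fin_ins[OF fin_sing] by simp
    qed
    show "fin (ap ?v (opr emp (opr i l)))" "fin (ap ?v (opr n1 (opr i l)))" if "i : els om" "l : els om" for i l
      unfolding L[OF Phi_closed(1)[OF that]] L[OF Phi_closed(2)[OF that]]
      by (rule fin_subset[OF p[of i l]], use e0[OF that] in \<open>simp add: els_mk\<close>)+
    show "fin (ap ?v (opr n2 (opr \<phi> \<psi>)))" if "\<phi> : els \<Phi>" "\<psi> : els \<Phi>" "fin (ap ?v \<phi>)" "fin (ap ?v \<psi>)" for \<phi> \<psi>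
      unfolding L[OF Phi_closed(3)[OF that(1,2)]]
      by (rule fin_subset[OF fin_un[OF that(3,4)]]) (use e2[OF that(1,2)] L[OF that(1)] L[OF that(2)] in simp)
    show "fin (ap ?v (opr n3 (opr i \<phi>)))" if "i : els om" "\<phi> : els \<Phi>" "fin (ap ?v \<phi>)" for i \<phi>
      unfolding L[OF Phi_closed(4)[OF that(1,2)]]
      by (rule fin_subset[OF that(3)]) (use e3[OF that(1,2)] L[OF that(2)] in auto)
  qed
  ultimately show ?thesis by blast
qed

lemma satisfaction_ex: "EX T. is_satisfaction E om \<Phi> A R T"
proof -
  define H where "H c a r <-> (EX k l. c = opr emp (opr k l) & opr (ap a k) (ap a l) : els R) \<or>
    (EX k l. c = opr n1 (opr k l) & ap a k = ap a l) \<or>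
    (EX \<phi>:els \<Phi>. EX \<psi>:els \<Phi>. c = opr n2 (opr \<phi> \<psi>) & ~ (opr \<phi> a : els r & opr \<psi> a : els r)) \<or>
    (EX k. EX \<phi>:els \<Phi>. c = opr n3 (opr k \<phi>) &
      (ALL b. is_fun E b om A & (ALL l:els om. l ~= k --> ap b l = ap a l) --> opr \<phi> b : els r))" for c a r
  have "EX T. els T <= els (prd \<Phi> (funs om A)) & (ALL x:els \<Phi>. ALL y:els (funs om A). opr x y : els T <-> H x y T)"
  proof (rule recursion)
    show "Dn E (%rh. H (rh 0) (rh 1) (rh 2))" unfolding H_def by (intro dn)
    fix x y r r' assume a: "!!z u. z : els \<Phi> ==> sub z x ==> opr z u : els r <-> opr z u : els r'"
    have 2: "opr \<phi> u : els r <-> opr \<phi> u : els r'" "opr \<psi> u : els r <-> opr \<psi> u : els r'"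
      if "x = opr n2 (opr \<phi> \<psi>)" "\<phi> : els \<Phi>" "\<psi> : els \<Phi>" for \<phi> \<psi> u
      using a[OF that(2) sub_opr(1)[OF that(1)]] a[OF that(3) sub_opr(2)[OF that(1)]] by simp_all
    have 3: "opr \<phi> u : els r <-> opr \<phi> u : els r'" if "x = opr n3 (opr k \<phi>)" "\<phi> : els \<Phi>" for k \<phi> u
      using a[OF that(2) sub_opr(3)[OF that(1)]] by simp
    show "H x y r = H x y r'" unfolding H_def
      by (intro arg_cong2[where f = "(\<or>)"] arg_cong[where f = Not] refl bex_cong ex_cong1 conj_cong all_cong1 imp_cong) (rule 2 3; assumption)+
  qed
  then obtain T where T0: "!!c a. c : els \<Phi> ==> is_fun E a om A ==> opr c a : els T <-> H c a T" by auto
  have "is_satisfaction E om \<Phi> A R T" unfolding is_satisfaction_def code_iff rel_iff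
  proof (intro conjI allI ballI impI)
    fix a c assume a: "is_fun E a om A"
    note T = T0[OF _ a]
    show "opr c a : els T <-> opr (app E a i) (app E a l) : els R" if "i : els om" "l : els om" "c = opr emp (opr i l)" for i l
      unfolding that(3) T[OF Phi_closed(1)[OF that(1,2)]] H_def app_ap[OF a that(1)] app_ap[OF a that(2)] by auto
    show "opr c a : els T <-> app E a i = app E a l" if "i : els om" "l : els om" "c = opr n1 (opr i l)" for i l
      unfolding that(3) T[OF Phi_closed(2)[OF that(1,2)]] H_def app_ap[OF a that(1)] app_ap[OF a that(2)] by auto
    show "opr c a : els T <-> ~ (opr \<phi> a : els T & opr \<psi> a : els T)" if "\<phi> : els \<Phi>" "\<psi> : els \<Phi>" "c = opr n2 (opr \<phi> \<psi>)" for \<phi> \<psi>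
      unfolding that(3) T[OF Phi_closed(3)[OF that(1,2)]] using that(1,2) by (simp add: H_def)
    show "opr c a : els T <-> (ALL b. is_fun E b om A & (ALL l:els om. l ~= i --> app E b l = app E a l) --> opr \<phi> b : els T)"
      if "i : els om" "\<phi> : els \<Phi>" "c = opr n3 (opr i \<phi>)" for i \<phi>
    proof -
      have "(ALL l:els om. l ~= i --> app E b l = app E a l) <-> (ALL l:els om. l ~= i --> ap b l = ap a l)" if "is_fun E b om A" for b
        using app_ap[OF a] app_ap[OF that] by auto
      moreover have "opr c a : els T <-> (ALL b. is_fun E b om A & (ALL l:els om. l ~= i --> ap b l = ap a l) --> opr \<phi> b : els T)"
        unfolding that(3) T[OF Phi_closed(4)[OF that(1,2)]] using that(1,2) by (simp add: H_def)
      ultimately show ?thesis by blast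
    qed
  qed
  thus ?thesis by blast
qed

end

text \<open>The least closed set is cut out of \<open>U\<close> by separation, which is available in
  the extension; closure of \<open>U\<close> under pairs makes \<open>U\<close> itself one of the
  closed sets.\<close>

lemma (in zs) formulas_ex:
  assumes U: "els om <= els U" "!!a b. a : els U ==> b : els U ==> opr a b : els U"
  shows "EX \<Phi>. is_formulas E om \<Phi>"
proof -
  let ?Q = "%c. ALL X. formula_closed E om X --> c : els X"
  have d: "Dn E (%rh. ?Q (rh 0))" unfolding formula_closed_iff by (intro dn)
  have S: "els (mk {c : els U. ?Q c}) = {c : els U. ?Q c}" by (intro els_mk sepI d)
  have nU: "emp : els U" "n1 : els U" "n2 : els U" "n3 : els U" using U(1) om_0 num_om by blast+
  have "formula_closed E om U" unfolding formula_closed_iff using U nU by blast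
  hence "!!c. ?Q c ==> c : els U" by blast
  hence S': "els (mk {c : els U. ?Q c}) = {c. ?Q c}" unfolding S by blast
  have "formula_closed E om (mk {c : els U. ?Q c})"
    unfolding formula_closed_iff[of "mk {c : els U. ?Q c}"] S' unfolding formula_closed_iff mem_Collect_eq by blast
  thus ?thesis unfolding is_formulas_def using S' by blast
qed

section \<open>The graphs\<close>

locale coded = zwo E for E :: "'v => 'v => bool" +
  fixes One :: "'v => 'v => bool"
  assumes Dn_One [dn]: "Fn E a ==> Fn E b ==> Dn E (%rh. One (a rh) (b rh))"
    and EP: "N : els om ==> els A <= els N ==> els B <= els N ==>
      EX m:els om. N : els m & (ALL k:els m. One k m <-> k : els A) & (ALL k:els N. One m k <-> k : els B)"
begin

lemma fin_bound:
  assumes "fin x" "Fn E (%rh. h (rh 0))" "!!z. z : els x ==> h z : els om" shows "EX n:els om. ALL z:els x. h z : els n"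
proof -
  have e: "els (mk (h ` els x)) = h ` els x" by (rule els_mk[OF fin_image(1)[OF assms(1,2)]])
  have "EX n:els om. els (mk (h ` els x)) <= els n"
    by (rule fin_om_bound[OF fin_image(2)[OF assms(1,2)]]) (use e assms(3) in auto)
  thus ?thesis unfolding e by blast
qed

abbreviation co :: "'v => 'v" where "co \<equiv> fs"
abbreviation tg :: "'v => 'v" where "tg x \<equiv> fs (sn x)"
abbreviation ix :: "'v => 'v" where "ix x \<equiv> sn (sn x)"
abbreviation vx :: "'v => 'v => 'v => 'v" where "vx n e k \<equiv> opr n (opr e k)"

text \<open>For distinct numbers this is symmetric: the bit of the larger row at the smaller column.
  \<open>Sy\<close> thus reads the matrix below the diagonal and \<open>nb\<close> reads it above,
  so that \<open>EP\<close> can prescribe both independently.\<close>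

definition Sy :: "'v => 'v => bool" where "Sy m k <-> k : els m & One m k \<or> k ~: els m & One k m"

definition nb :: "'v => 'v" where "nb m = mk {i : els m. One i m}"

lemma els_nb: "els (nb m) = {i : els m. One i m}" unfolding nb_def by (intro els_mk sepI dn)

lemma Fn_nb [dn]: "Fn E a ==> Fn E (%rh. nb (a rh))"
proof (rule Fn_comp1[where f = nb])
  show "Fn E (%rh. nb (rh 0))" unfolding nb_def by (rule Fn_mk) (intro sepI dn, unfold mem_Collect_eq, intro dn)
qed

text \<open>The tag \<open>emp\<close> marks points, \<open>n1\<close> finite sets of points, and \<open>n2\<close> vertices of a random graph, which stand in
  for points where the sets of a component are full. The sets of component \<open>n\<close> have at most \<open>n + 2\<close> points,
  unless \<open>n\<close> is \<open>emp\<close>.\<close>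

definition ad1 :: "'v => 'v => bool" where
  "ad1 x y <-> tg x = n1 & (tg y = n1 & ix x ~= ix y \<or> tg y = emp & ix y : els (nb (ix x)) \<or> tg y = n2 & Sy (ix x) (ix y))"

definition adj :: "'v => 'v => bool" where "adj x y <-> co x = co y & (ad1 x y \<or> ad1 y x)"

lemma Dn_adj [dn]: "Fn E a ==> Fn E b ==> Dn E (%rh. adj (a rh) (b rh))"
  unfolding adj_def ad1_def Sy_def by (intro dn Fn_shift)

lemma adj_sym: "adj x y <-> adj y x" unfolding adj_def by auto

definition vert :: "'v => bool" where
  "vert x <-> (EX n:els om. EX e. EX k:els om. x = vx n e k & (e = emp \<or> e = n1 \<or> e = n2) &
     (e = n1 & n ~= emp --> szle (suc (suc n)) (nb k)))"

definition VS :: "'v => 'v" where "VS Z = mk {x : els (prd om (prd om om)). vert x & co x : els Z}"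
definition ES :: "'v => 'v" where "ES Z = rc (VS Z) (VS Z) adj"

lemma VS: "x : els (VS Z) <-> vert x & co x : els Z"
proof -
  have "Dn E (%rh. vert (rh 0) & co (rh 0) : els Z)" unfolding vert_def by (intro dn)
  hence "els (VS Z) = {x : els (prd om (prd om om)). vert x & co x : els Z}" unfolding VS_def by (intro els_mk sepI)
  moreover have "vert x ==> x : els (prd om (prd om om))" using om_0 num_om unfolding vert_def by auto
  ultimately show ?thesis by blast
qed

lemma ES: "opr x y : els (ES Z) <-> x : els (VS Z) & y : els (VS Z) & adj x y"
proof -
  have "Dn E (%rh. adj (rh 0) (rh 1))" by (intro dn)
  thus ?thesis unfolding ES_def by (rule rc_iff)
qed

lemma vertE:
  assumes "vert x" obtains n e k where "x = vx n e k" "n : els om" "k : els om" "e = emp \<or> e = n1 \<or> e = n2"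
    "e = n1 ==> n ~= emp ==> szle (suc (suc n)) (nb k)"
  using assms unfolding vert_def by blast

lemma vert_eq: assumes "vert x" shows "x = vx (co x) (tg x) (ix x)" "co x : els om" "ix x : els om" "tg x = emp \<or> tg x = n1 \<or> tg x = n2"
  by (rule vertE[OF assms], simp)+

lemma graph: assumes "e : els Z" "els Z <= els om" shows "is_graph E (VS Z) (ES Z)"
  unfolding is_graph_def rel_on_iff
proof (intro conjI)
  have "vert (vx e emp emp)" unfolding vert_def using assms om_0 by auto
  hence "vx e emp emp : els (VS Z)" unfolding VS using assms by simp
  thus "els (VS Z) ~= {}" by blast
  have "Dn E (%rh. adj (rh 0) (rh 1))" by (intro dn)
  thus "els (ES Z) <= els (prd (VS Z) (VS Z))" unfolding ES_def by (subst els_rc) auto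
  show "sym (rel E (ES Z))" unfolding sym_def rel_iff ES using adj_sym by blast
  show "irrefl (rel E (ES Z))" unfolding irrefl_def rel_iff ES adj_def ad1_def by auto
qed

section \<open>Elementary equivalence\<close>

definition lg :: "'v => 'v => bool" where "lg N n <-> n = emp \<or> N : els n \<or> N = n"

text \<open>The position of a back-and-forth game with a budget of \<open>N\<close>: a partial isomorphism that may leave
  a component only if both the component and its image are indistinguishable from component \<open>0\<close>.\<close>

definition sim :: "'v => 'v => 'v => 'v => bool" where
  "sim N X a b <-> (ALL i:els X. (tg (ap a i) = n1 <-> tg (ap b i) = n1) &
      (lg N (co (ap a i)) & lg N (co (ap b i)) \<or> ap a i = ap b i) &
      (ALL l:els X. (ap a i = ap a l <-> ap b i = ap b l) & (co (ap a i) = co (ap a l) <-> co (ap b i) = co (ap b l)) &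
        (adj (ap a i) (ap a l) <-> adj (ap b i) (ap b l))))"

lemma simD:
  assumes "sim N X a b" "i : els X"
  shows "tg (ap a i) = n1 <-> tg (ap b i) = n1" "lg N (co (ap a i)) & lg N (co (ap b i)) \<or> ap a i = ap b i"
    "l : els X ==> ap a i = ap a l <-> ap b i = ap b l" "l : els X ==> co (ap a i) = co (ap a l) <-> co (ap b i) = co (ap b l)"
    "l : els X ==> adj (ap a i) (ap a l) <-> adj (ap b i) (ap b l)"
  using assms unfolding sim_def by blast+

lemma lg_mono: "lg N n ==> n : els om ==> N0 : els N \<or> N0 = N ==> lg N0 n"
  unfolding lg_def using om_trans[of n N0 N] by auto

lemma adj_ad1:
  assumes "vert x" "vert y" "co x = co y" "tg x = n1"
  shows "adj x y <-> (if tg y = n1 then x ~= y else if tg y = emp then ix y : els (nb (ix x)) else Sy (ix x) (ix y))"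
proof -
  have "x = y <-> ix x = ix y" if "tg y = n1" using that assms vert_eq(1)[OF assms(1)] vert_eq(1)[OF assms(2)] by metis
  thus ?thesis unfolding adj_def ad1_def using assms(3,4) vert_eq(4)[OF assms(2)] by auto
qed

lemma adj_not_T: "tg x ~= n1 ==> tg y ~= n1 ==> ~ adj x y" unfolding adj_def ad1_def by blast

text \<open>A component with a number above the budget and above all components in use is large and
  unrelated to the position, so only the kind of the vertex has to match.\<close>

lemma game_step_fresh:
  assumes N: "N0 : els om" and X: "fin X" "els X <= els om" and Z: "els om - {emp} <= els Z'"
    and b: "is_fun E b om (VS Z')"
  shows "EX y:els (VS Z'). (tg x = n1 <-> tg y = n1) & lg N0 (co y) & (ALL l:els X. co y ~= co (ap b l))"
proof -
  have bv: "vert (ap b l)" if "l : els X" for l using fun_val(2)[OF b, of l] that X(2) VS by blast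
  have "EX D:els om. ALL l:els X. co (ap b l) : els D"
    by (rule fin_bound[OF X(1)]) (intro dn, rule vert_eq(2)[OF bv])
  then obtain D where D: "D : els om" "ALL l:els X. co (ap b l) : els D" by blast
  obtain d where d: "d : els om" "D : els d" "N0 : els d" using om_bound2[OF D(1) N] .
  have dn: "d ~= emp" using d(3) by auto
  hence dZ: "d : els Z'" using Z d(1) by blast
  have fresh: "d ~= co (ap b l)" if "l : els X" for l
  proof
    assume "d = co (ap b l)"
    hence "d : els D" using D(2) that by auto
    thus False using om_asym[OF d(1,2)] by blast
  qed
  have lgd: "lg N0 d" unfolding lg_def using d(3) by blast
  show ?thesis
  proof (cases "tg x = n1")
    case True
    obtain m where m: "m : els om" "ALL k:els m. One k m <-> k : els emp" using EP[OF om_0, of emp emp] by auto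
    have "els (nb m) = {}" unfolding els_nb using m(2) by auto
    hence "nb m = emp" using empty_iff_emp by blast
    hence "vert (vx d n1 m)" unfolding vert_def using d(1) m(1) by auto
    thus ?thesis using True dZ fresh lgd by (intro bexI[of _ "vx d n1 m"]) (auto simp: VS)
  next
    case False
    have "vert (vx d emp emp)" unfolding vert_def using d(1) by auto
    thus ?thesis using False dZ fresh lgd by (intro bexI[of _ "vx d emp emp"]) (auto simp: VS)
  qed
qed

text \<open>A set is answered by a set whose points and random neighbours are prescribed by
  \<open>EP\<close>; it has at most \<open>N\<close> points, which a component \<open>d\<close> with
  \<open>lg N d\<close> tolerates. Any other vertex is answered by a random one, because the
  existing sets cannot be given a new point; \<open>sim\<close> only tells sets from the
  rest.\<close>

lemma game_step_near:
  assumes N: "N : els om" and X: "fin X" "els X <= els om" "szle N X"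
    and a: "is_fun E a om (VS Z)" and b: "is_fun E b om (VS Z')" and s: "sim N X a b" and x: "x : els (VS Z)"
    and new: "!!l. l : els X ==> x ~= ap a l" and i: "i : els X" "co x = co (ap a i)" "lg N (co (ap b i))"
  shows "EX y:els (VS Z'). (tg x = n1 <-> tg y = n1) & co y = co (ap b i) &
    (ALL l:els X. y ~= ap b l & (adj x (ap a l) <-> adj y (ap b l)))"
proof -
  have av: "vert (ap a l)" if "l : els X" for l using fun_val(2)[OF a, of l] that X(2) VS by blast
  have bv: "vert (ap b l)" "co (ap b l) : els Z'" if "l : els X" for l using fun_val(2)[OF b, of l] that X(2) VS by blast+
  have xv: "vert x" using x VS by blast
  define d where "d = co (ap b i)"
  have d: "d : els om" "d : els Z'" "lg N d" unfolding d_def using vert_eq(2) bv i by auto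
  have cod: "co (ap a l) = co x <-> co (ap b l) = d" if "l : els X" for l
    unfolding d_def i(2) using simD(4)[OF s that i(1)] .
  have "EX M:els om. ALL l:els X. ix (ap b l) : els M"
    by (rule fin_bound[OF X(1)]) (intro dn, rule vert_eq(3)[OF bv(1)])
  then obtain M where M: "M : els om" "!!l. l : els X ==> ix (ap b l) : els M" by blast
  \<comment> \<open>Indices of the vertices with tag \<open>e\<close> in component \<open>d\<close>
    of the position to which the answer has to be adjacent.\<close>
  define W where "W e = mk {k : els M. EX l:els X. ap b l = vx d e k & adj x (ap a l)}" for e
  have W: "els (W e) = {k : els M. EX l:els X. ap b l = vx d e k & adj x (ap a l)}" for e
    unfolding W_def by (intro els_mk sepI dn)
  have Wm: "ix (ap b l) : els (W (tg (ap b l))) <-> adj x (ap a l)" if l: "l : els X" "co (ap b l) = d" for l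
  proof
    assume "ix (ap b l) : els (W (tg (ap b l)))"
    then obtain l' where l': "l' : els X" "ap b l' = vx d (tg (ap b l)) (ix (ap b l))" "adj x (ap a l')" unfolding W by blast
    hence "ap b l' = ap b l" using vert_eq(1)[OF bv(1)[OF l(1)]] l(2) by simp
    hence "ap a l' = ap a l" using simD(3)[OF s l'(1) l(1)] by blast
    thus "adj x (ap a l)" using l'(3) by simp
  next
    assume "adj x (ap a l)"
    moreover have "ap b l = vx d (tg (ap b l)) (ix (ap b l))" using vert_eq(1)[OF bv(1)[OF l(1)]] l(2) by simp
    ultimately show "ix (ap b l) : els (W (tg (ap b l)))" unfolding W using M(2)[OF l(1)] l(1) by blast
  qed
  have W0: "szle N (W emp)"
  proof -
    obtain f Y where f: "is_fun E f N Y" "ALL z:els X. EX k:els N. ap f k = z" using X(3) unfolding szle_def by blast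
    let ?h = "%k. if ix (ap b (ap f k)) : els om then ix (ap b (ap f k)) else emp"
    show ?thesis
    proof (rule szleI[where h = ?h and Y = om])
      show "Fn E (%rh. ?h (rh 0))" by (intro Fn_if dn)
      show "?h k : els om" for k by simp
      fix z assume "z : els (W emp)"
      then obtain l where l: "l : els X" "ap b l = vx d emp z" "z : els M" unfolding W by blast
      then obtain k where k: "k : els N" "ap f k = l" using f(2) by blast
      have "z : els om" using om_sub[OF M(1) l(3)] .
      thus "EX k:els N. ?h k = z" using k l(2) by (intro bexI[of _ k]) auto
    qed
  qed
  have xa: "co x ~= co (ap a l) ==> ~ adj x (ap a l)" for l unfolding adj_def by blast
  show ?thesis
  proof (cases "tg x = n1")
    case True
    obtain m where m: "m : els om" "M : els m" "ALL k:els m. One k m <-> k : els (W emp)" "ALL k:els M. One m k <-> k : els (W n2)"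
      using EP[OF M(1), of "W emp" "W n2"] W by blast
    have Mm: "k : els m" if "k : els M" for k using om_trans[OF m(1) that m(2)] .
    have nbm: "els (nb m) = els (W emp)" unfolding els_nb using m(3) W Mm by blast
    hence "nb m = W emp" by (rule ext)
    have sz: "szle (suc (suc d)) (nb m)" if "d ~= emp"
    proof (rule szle_mono)
      show "szle N (nb m)" unfolding \<open>nb m = _\<close> by (rule W0)
      have "N = d \<or> N : els d" using d(3) that unfolding lg_def by blast
      thus "N : els (suc (suc d))" by auto
    qed (use N d(1) om_suc in auto)
    have yv: "vert (vx d n1 m)" unfolding vert_def using d(1) m(1) sz by auto
    have "vx d n1 m ~= ap b l" if "l : els X" for l
    proof
      assume "vx d n1 m = ap b l"
      hence "m : els M" using M(2)[OF that] by (metis sn_opr)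
      thus False using om_asym[OF m(1,2)] by blast
    qed
    moreover have "adj x (ap a l) <-> adj (vx d n1 m) (ap b l)" if l: "l : els X" for l
    proof (cases "co (ap b l) = d")
      case False
      hence "~ adj (vx d n1 m) (ap b l)" unfolding adj_def by auto
      moreover have "co x ~= co (ap a l)" using cod[OF l] False by auto
      ultimately show ?thesis using xa by blast
    next
      case cd: True
      have ca: "co x = co (ap a l)" using cod[OF l] cd by simp
      have y1: "adj (vx d n1 m) (ap b l) <-> (if tg (ap b l) = n1 then vx d n1 m ~= ap b l
          else if tg (ap b l) = emp then ix (ap b l) : els (nb m) else Sy m (ix (ap b l)))"
        using adj_ad1[OF yv bv(1)[OF l]] cd by simp
      consider "tg (ap b l) = n1" | "tg (ap b l) = emp" | "tg (ap b l) = n2" using vert_eq(4)[OF bv(1)[OF l]] by blast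
      thus ?thesis
      proof cases
        case 1
        hence "tg (ap a l) = n1" using simD(1)[OF s l] by blast
        hence "adj x (ap a l)" using adj_ad1[OF xv av[OF l] ca True] new[OF l] by simp
        moreover have "adj (vx d n1 m) (ap b l)" unfolding y1 using 1 calculation \<open>!!l. l : els X ==> vx d n1 m ~= ap b l\<close>[OF l] by simp
        ultimately show ?thesis by blast
      next
        case 2
        hence "adj (vx d n1 m) (ap b l) <-> ix (ap b l) : els (W emp)" unfolding y1 nbm by simp
        thus ?thesis using Wm[OF l cd] unfolding 2 by blast
      next
        case 3
        have k: "ix (ap b l) : els M" using M(2)[OF l] .
        have "adj (vx d n1 m) (ap b l) <-> Sy m (ix (ap b l))" unfolding y1 using 3 by simp
        also have "\<dots> <-> ix (ap b l) : els (W n2)" unfolding Sy_def using Mm[OF k] m(4) k by blast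
        finally show ?thesis using Wm[OF l cd] unfolding 3 by blast
      qed
    qed
    ultimately show ?thesis using True yv d(2) unfolding d_def by (intro bexI[of _ "vx d n1 m"]) (auto simp: VS d_def)
  next
    case False
    obtain m where m: "m : els om" "M : els m" "ALL k:els M. One m k <-> k : els (W n1)"
      using EP[OF M(1), of emp "W n1"] W by auto
    have Mm: "m ~: els k" if "k : els M" for k using om_asym[OF m(1)] om_trans[OF m(1) that m(2)] by blast
    have yv: "vert (vx d n2 m)" unfolding vert_def using d(1) m(1) by auto
    have "vx d n2 m ~= ap b l" if "l : els X" for l
    proof
      assume "vx d n2 m = ap b l"
      hence "m : els M" using M(2)[OF that] by (metis sn_opr)
      thus False using om_asym[OF m(1,2)] by blast
    qed
    moreover have "adj x (ap a l) <-> adj (vx d n2 m) (ap b l)" if l: "l : els X" for l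
    proof (cases "co (ap b l) = d & tg (ap b l) = n1")
      case False
      show ?thesis
      proof (cases "co (ap b l) = d")
        case True
        hence "tg (ap b l) ~= n1" "tg (ap a l) ~= n1" using False simD(1)[OF s l] by blast+
        thus ?thesis using adj_not_T \<open>tg x ~= n1\<close> by simp
      next
        case False
        hence "~ adj (vx d n2 m) (ap b l)" unfolding adj_def by auto
        moreover have "co x ~= co (ap a l)" using cod[OF l] False by auto
        ultimately show ?thesis using xa by blast
      qed
    next
      case cd: True
      have k: "ix (ap b l) : els M" using M(2)[OF l] .
      have "adj (vx d n2 m) (ap b l) <-> Sy (ix (ap b l)) m"
        unfolding adj_sym[of "vx d n2 m"] using adj_ad1[OF bv(1)[OF l] yv] cd by simp
      also have "\<dots> <-> ix (ap b l) : els (W (tg (ap b l)))" unfolding Sy_def using Mm[OF k] m(3) k cd by auto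
      finally show ?thesis using Wm[OF l] cd by blast
    qed
    ultimately show ?thesis using False yv d(2) by (intro bexI[of _ "vx d n2 m"]) (auto simp: VS d_def)
  qed
qed

end

section \<open>The complete back-and-forth step and its consequence for formulas\<close>

context coded begin

text \<open>A vertex of the position is answered by its partner. In a component already met, the
  answer stays in the partner component if both are large for \<open>N\<close>; otherwise position
  and image coincide there and \<open>x\<close> answers itself. In a new component, \<open>x\<close>
  answers itself if the number is small for \<open>N0\<close>, and a fresh component is used if
  not.\<close>

lemma game_step:
  assumes N: "N : els om" "N0 : els N" and X: "fin X" "els X <= els om" "szle N X"
    and Z: "els om - {emp} <= els Z" "els om - {emp} <= els Z'"
    and a: "is_fun E a om (VS Z)" and b: "is_fun E b om (VS Z')" and s: "sim N X a b" and x: "x : els (VS Z)"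
  shows "EX y:els (VS Z'). (tg x = n1 <-> tg y = n1) & (lg N0 (co x) & lg N0 (co y) \<or> x = y) &
    (ALL l:els X. (x = ap a l <-> y = ap b l) & (co x = co (ap a l) <-> co y = co (ap b l)) & (adj x (ap a l) <-> adj y (ap b l)))"
    (is "EX y:_. ?Q y")
proof -
  have aV: "ap a l : els (VS Z)" if "l : els X" for l using fun_val(2)[OF a, of l] that X(2) by blast
  have bV: "ap b l : els (VS Z')" if "l : els X" for l using fun_val(2)[OF b, of l] that X(2) by blast
  have N0: "N0 : els om" using om_sub[OF N] .
  have cx: "co x : els om" using x VS vert_eq(2) by blast
  have lgm: "lg N n ==> n : els om ==> lg N0 n" for n using lg_mono N(2) by blast
  have aom: "co (ap a l) : els om" "co (ap b l) : els om" if "l : els X" for l using aV[OF that] bV[OF that] VS vert_eq(2) by blast+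
  have small: "co x : els Z'" if "~ lg N0 (co x)" using Z(2) cx that unfolding lg_def by blast
  consider (old) i where "i : els X" "x = ap a i"
    | (near) i where "i : els X" "co x = co (ap a i)" "!!l. l : els X ==> x ~= ap a l"
    | (far) "!!l. l : els X ==> co x ~= co (ap a l)" by blast
  thus ?thesis
  proof cases
    case old
    have "?Q (ap b i)" unfolding old(2)
      using simD[OF s old(1)] lgm[OF _ aom(1)[OF old(1)]] lgm[OF _ aom(2)[OF old(1)]] by blast
    thus ?thesis using bV[OF old(1)] by blast
  next
    case near
    show ?thesis
    proof (cases "lg N (co (ap a i)) & lg N (co (ap b i))")
      case True
      then obtain y where y: "y : els (VS Z')" "tg x = n1 <-> tg y = n1" "co y = co (ap b i)"
        "ALL l:els X. y ~= ap b l & (adj x (ap a l) <-> adj y (ap b l))"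
        using game_step_near[OF N(1) X a b s x near(3,1,2)] by blast
      have "lg N0 (co x)" "lg N0 (co y)" unfolding near(2) y(3) using True lgm aom[OF near(1)] by blast+
      moreover have "co x = co (ap a l) <-> co y = co (ap b l)" if "l : els X" for l
        unfolding near(2) y(3) by (rule simD(4)[OF s near(1) that])
      ultimately show ?thesis using y near(3) by blast
    next
      case False
      hence eq: "ap a i = ap b i" using simD(2)[OF s near(1)] by blast
      have nl: "~ lg N (co x)" unfolding near(2) using False eq by simp
      have same: "ap a l = ap b l" if "l : els X" "co (ap a l) = co x \<or> co (ap b l) = co x" for l
      proof -
        have "~ (lg N (co (ap a l)) & lg N (co (ap b l)))" using that(2) nl by auto
        thus ?thesis using simD(2)[OF s that(1)] by blast
      qed
      have cc: "co x = co (ap a l) <-> co x = co (ap b l)" if "l : els X" for l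
        using same[OF that] by auto
      have "co x : els Z'" using bV[OF near(1)] eq near(2) VS by simp
      hence "x : els (VS Z')" using x VS by blast
      moreover have "adj x (ap a l) <-> adj x (ap b l)" if "l : els X" for l
        using same[OF that] cc[OF that] unfolding adj_def by metis
      moreover have "x = ap a l <-> x = ap b l" if "l : els X" for l
        using same[OF that] by auto
      ultimately show ?thesis using cc by blast
    qed
  next
    case far
    have na: "~ adj x (ap a l)" "x ~= ap a l" if "l : els X" for l using far[OF that] unfolding adj_def by auto
    show ?thesis
    proof (cases "lg N0 (co x)")
      case True
      obtain y where y: "y : els (VS Z')" "tg x = n1 <-> tg y = n1" "lg N0 (co y)" "ALL l:els X. co y ~= co (ap b l)"
        using game_step_fresh[OF N0 X(1,2) Z(2) b] by blast
      have "~ adj y (ap b l)" "y ~= ap b l" if "l : els X" for l using y(4) that unfolding adj_def by auto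
      thus ?thesis using y True na far by blast
    next
      case False
      have "co x ~= co (ap b l)" if l: "l : els X" for l
      proof
        assume e: "co x = co (ap b l)"
        hence "~ lg N (co (ap b l))" using False lgm cx by metis
        hence "ap a l = ap b l" using simD(2)[OF s l] by blast
        thus False using far[OF l] e by simp
      qed
      moreover from this have "~ adj x (ap b l)" "x ~= ap b l" if "l : els X" for l using that unfolding adj_def by auto
      moreover have "x : els (VS Z')" using small[OF False] x VS by blast
      ultimately show ?thesis using na far by blast
    qed
  qed
qed

lemma sim_sym: "sim N X a b ==> sim N X b a" unfolding sim_def by (metis (full_types))

lemma sim_mono:
  assumes s: "sim N X a b" and N: "N : els om" "N0 : els N \<or> N0 = N" and X: "els Y <= els X" "els X <= els om"
    and a: "is_fun E a om (VS Z)" and b: "is_fun E b om (VS Z')"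
  shows "sim N0 Y a b"
  unfolding sim_def
proof (intro ballI conjI)
  fix i assume i: "i : els Y"
  hence iX: "i : els X" using X by blast
  note d = simD[OF s iX]
  have io: "i : els om" using iX X(2) by blast
  have c: "co (ap a i) : els om" "co (ap b i) : els om"
    using fun_val(2)[OF a io] fun_val(2)[OF b io] VS vert_eq(2) by blast+
  show "tg (ap a i) = n1 <-> tg (ap b i) = n1" by (rule d(1))
  show "lg N0 (co (ap a i)) & lg N0 (co (ap b i)) \<or> ap a i = ap b i" using d(2) lg_mono[OF _ c(1) N(2)] lg_mono[OF _ c(2) N(2)] by blast
  fix l assume "l : els Y"
  hence l: "l : els X" using X by blast
  show "ap a i = ap a l <-> ap b i = ap b l" "co (ap a i) = co (ap a l) <-> co (ap b i) = co (ap b l)"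
    "adj (ap a i) (ap a l) <-> adj (ap b i) (ap b l)" by (rule d(3)[OF l], rule d(4)[OF l], rule d(5)[OF l])
qed

lemma fun_upd_ex:
  assumes "is_fun E a om A" "y : els A"
  shows "EX a'. is_fun E a' om A & ap a' i = (if i : els om then y else ap a' i) & (ALL l:els om. l ~= i --> ap a' l = ap a l)"
proof -
  let ?h = "%l. if l = i then y else ap a l"
  have h: "Fn E (%rh. ?h (rh 0))" by (intro Fn_if dn)
  have v: "?h l : els A" if "l : els om" for l using fun_val(2)[OF assms(1) that] assms(2) by simp
  have f: "is_fun E (lam om A ?h) om A" by (rule lam_fun[OF h]) (rule v)
  have L: "ap (lam om A ?h) l = ?h l" if "l : els om" for l by (rule lam_ap[OF h _ that]) (rule v)
  show ?thesis using f L by (intro exI[of _ "lam om A ?h"]) auto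
qed

lemma sim_extend:
  assumes s: "sim N0 Y a b" and i: "i : els om" "i ~: els Y" and YO: "els Y <= els om" and X: "els X <= insert i (els Y)"
    and a': "ap a' i = x" "!!l. l : els om ==> l ~= i ==> ap a' l = ap a l"
    and b': "ap b' i = y" "!!l. l : els om ==> l ~= i ==> ap b' l = ap b l"
    and xy: "tg x = n1 <-> tg y = n1" "lg N0 (co x) & lg N0 (co y) \<or> x = y"
      "ALL l:els Y. (x = ap a l <-> y = ap b l) & (co x = co (ap a l) <-> co y = co (ap b l)) & (adj x (ap a l) <-> adj y (ap b l))"
  shows "sim N0 X a' b'"
  unfolding sim_def
proof (intro ballI)
  have o: "ap a' l = ap a l" "ap b' l = ap b l" if "l : els Y" for l using a'(2) b'(2) that i(2) YO by blast+
  have irr: "~ adj z z" for z unfolding adj_def ad1_def by auto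
  fix k assume "k : els X"
  then consider (1) "k = i" | (2) "k : els Y" using X by blast
  thus "(tg (ap a' k) = n1 <-> tg (ap b' k) = n1) &
      (lg N0 (co (ap a' k)) & lg N0 (co (ap b' k)) \<or> ap a' k = ap b' k) &
      (ALL l:els X. (ap a' k = ap a' l <-> ap b' k = ap b' l) & (co (ap a' k) = co (ap a' l) <-> co (ap b' k) = co (ap b' l)) &
        (adj (ap a' k) (ap a' l) <-> adj (ap b' k) (ap b' l)))"
  proof cases
    case 1
    have "(x = ap a' l <-> y = ap b' l) & (co x = co (ap a' l) <-> co y = co (ap b' l)) & (adj x (ap a' l) <-> adj y (ap b' l))"
      if "l : els X" for l
    proof (cases "l = i")
      case True
      thus ?thesis using a'(1) b'(1) irr by simp
    next
      case False
      hence l: "l : els Y" using that X by blast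
      show ?thesis unfolding o[OF l] using xy(3) l by blast
    qed
    thus ?thesis unfolding 1 a'(1) b'(1) using xy(1,2) by blast
  next
    case 2
    have "(ap a k = ap a' l <-> ap b k = ap b' l) & (co (ap a k) = co (ap a' l) <-> co (ap b k) = co (ap b' l)) &
        (adj (ap a k) (ap a' l) <-> adj (ap b k) (ap b' l))" if "l : els X" for l
    proof (cases "l = i")
      case True
      have "(x = ap a k <-> y = ap b k) & (co x = co (ap a k) <-> co y = co (ap b k)) & (adj x (ap a k) <-> adj y (ap b k))"
        using xy(3) 2 by blast
      thus ?thesis unfolding True a'(1) b'(1) using adj_sym[of x] adj_sym[of y] by metis
    next
      case False
      hence l: "l : els Y" using that X by blast
      show ?thesis unfolding o[OF l] using simD(3-5)[OF s 2 l] by blast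
    qed
    thus ?thesis unfolding o[OF 2] using simD(1,2)[OF s 2] by blast
  qed
qed

text \<open>The induction runs over the codes in the model, which may be nonstandard, so the budget
  is a number of the model that depends on the formula. At a quantifier it exceeds the budget of the
  body and the number of free variables, since an answer of \<open>game_step_near\<close> may have
  that many points.\<close>

lemma elementary:
  assumes F: "is_formulas E om \<Phi>" and Z: "els om - {emp} <= els Z" "els om - {emp} <= els Z'"
    and v: "is_free_vars E om \<Phi> v" "!!c. c : els \<Phi> ==> fin (ap v c)"
    and T: "is_satisfaction E om \<Phi> (VS Z) (ES Z) T" "is_satisfaction E om \<Phi> (VS Z') (ES Z') T'"
    and c: "c : els \<Phi>"
  shows "EX N:els om. ALL a b. is_fun E a om (VS Z) & is_fun E b om (VS Z') & sim N (ap v c) a b -->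
    (opr c a : els T <-> opr c b : els T')"
proof -
  interpret formulas E \<Phi> by unfold_locales (rule F)
  obtain p where p: "els p = {x. els x <= els om}" "is_fun E v \<Phi> p"
    using conjunct1[OF v(1)[unfolded is_free_vars_def]] by blast
  have vap: "app E v c = ap v c" if "c : els \<Phi>" for c by (rule app_ap[OF p(2) that])
  have vom: "els (ap v c) <= els om" if "c : els \<Phi>" for c using fun_val(2)[OF p(2) that] p(1) by blast
  note fv0 = v(1)[unfolded is_free_vars_def code_iff, THEN conjunct2]
  note fv1 = fv0[THEN conjunct1, rule_format] and fv1' = fv0[THEN conjunct2, THEN conjunct1, rule_format]
    and fv1'' = fv0[THEN conjunct2, THEN conjunct2, rule_format]
  have fv: "els (ap v (opr emp (opr i l))) = {i, l}" "els (ap v (opr n1 (opr i l))) = {i, l}" if "i : els om" "l : els om" for i l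
    using fv1[OF that disjI1[OF refl]] fv1[OF that disjI2[OF refl]] vap[OF Phi_closed(1)[OF that]] vap[OF Phi_closed(2)[OF that]] by simp_all
  have fv2: "els (ap v (opr n2 (opr \<phi> \<psi>))) = els (ap v \<phi>) \<union> els (ap v \<psi>)" if "\<phi> : els \<Phi>" "\<psi> : els \<Phi>" for \<phi> \<psi>
  proof -
    have "els (app E v (opr n2 (opr \<phi> \<psi>))) = els (app E v \<phi>) \<union> els (app E v \<psi>)" by (rule fv1'[OF that refl])
    thus ?thesis unfolding vap[OF that(1)] vap[OF that(2)] vap[OF Phi_closed(3)[OF that]] .
  qed
  have fv3: "els (ap v (opr n3 (opr i \<phi>))) = els (ap v \<phi>) - {i}" if "i : els om" "\<phi> : els \<Phi>" for i \<phi>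
  proof -
    have "els (app E v (opr n3 (opr i \<phi>))) = els (app E v \<phi>) - {i}" by (rule fv1''[OF that refl])
    thus ?thesis unfolding vap[OF that(2)] vap[OF Phi_closed(4)[OF that]] .
  qed
  have sat: "i : els om ==> l : els om ==> opr (opr emp (opr i l)) a : els T <-> opr (ap a i) (ap a l) : els R"
    "i : els om ==> l : els om ==> opr (opr n1 (opr i l)) a : els T <-> ap a i = ap a l"
    "\<phi> : els \<Phi> ==> \<psi> : els \<Phi> ==> opr (opr n2 (opr \<phi> \<psi>)) a : els T <-> ~ (opr \<phi> a : els T & opr \<psi> a : els T)"
    "i : els om ==> \<phi> : els \<Phi> ==> opr (opr n3 (opr i \<phi>)) a : els T <->
      (ALL b. is_fun E b om A & (ALL l:els om. l ~= i --> ap b l = ap a l) --> opr \<phi> b : els T)"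
    if T: "is_satisfaction E om \<Phi> A R T" and a: "is_fun E a om A" for A R T a i l \<phi> \<psi>
  proof -
    note S = T[unfolded is_satisfaction_def code_iff rel_iff, rule_format, OF a]
    show "i : els om ==> l : els om ==> opr (opr emp (opr i l)) a : els T <-> opr (ap a i) (ap a l) : els R"
      using S[of "opr emp (opr i l)"] app_ap[OF a] by simp
    show "i : els om ==> l : els om ==> opr (opr n1 (opr i l)) a : els T <-> ap a i = ap a l"
      using S[of "opr n1 (opr i l)"] app_ap[OF a] by simp
    show "\<phi> : els \<Phi> ==> \<psi> : els \<Phi> ==> opr (opr n2 (opr \<phi> \<psi>)) a : els T <-> ~ (opr \<phi> a : els T & opr \<psi> a : els T)"
      using S[of "opr n2 (opr \<phi> \<psi>)"] by simp
    assume ip: "i : els om" "\<phi> : els \<Phi>"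
    have "opr (opr n3 (opr i \<phi>)) a : els T <->
      (ALL b. is_fun E b om A & (ALL l:els om. l ~= i --> app E b l = app E a l) --> opr \<phi> b : els T)"
      using S[of "opr n3 (opr i \<phi>)"] ip by simp
    moreover have "(ALL l:els om. l ~= i --> app E b l = app E a l) <-> (ALL l:els om. l ~= i --> ap b l = ap a l)" if b: "is_fun E b om A" for b
    proof -
      have "app E b l = app E a l <-> ap b l = ap a l" if "l : els om" for l using app_ap[OF a that] app_ap[OF b that] by simp
      thus ?thesis by blast
    qed
    ultimately show "opr (opr n3 (opr i \<phi>)) a : els T <->
      (ALL b. is_fun E b om A & (ALL l:els om. l ~= i --> ap b l = ap a l) --> opr \<phi> b : els T)" by blast
  qed
  define Q where "Q N c <-> (ALL a b. is_fun E a om (VS Z) & is_fun E b om (VS Z') & sim N (ap v c) a b -->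
    (opr c a : els T <-> opr c b : els T'))" for N c
  have Dn_lg: "Fn E x ==> Fn E y ==> Dn E (%rh. lg (x rh) (y rh))" for x y unfolding lg_def by (intro dn)
  have "EX N:els om. Q N c"
  proof (rule Phi_induct[OF c, where Q = "%c. EX N:els om. Q N c"])
    show "Dn E (%rh. EX N:els om. Q N (rh 0))" unfolding Q_def sim_def by (intro dn Dn_lg)
  next
    fix i l assume i: "i : els om" "l : els om"
    have "Q emp (opr emp (opr i l))" unfolding Q_def
    proof (intro allI impI, elim conjE)
      fix a b assume h: "is_fun E a om (VS Z)" "is_fun E b om (VS Z')" "sim emp (ap v (opr emp (opr i l))) a b"
      show "opr (opr emp (opr i l)) a : els T <-> opr (opr emp (opr i l)) b : els T'"
        unfolding sat(1)[OF T(1) h(1) i] sat(1)[OF T(2) h(2) i] ES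
        using simD(5)[OF h(3), of i l] fun_val(2)[OF h(1)] fun_val(2)[OF h(2)] i unfolding fv(1)[OF i] by simp
    qed
    thus "EX N:els om. Q N (opr emp (opr i l))" using om_0 by blast
  next
    fix i l assume i: "i : els om" "l : els om"
    have "Q emp (opr n1 (opr i l))" unfolding Q_def
    proof (intro allI impI, elim conjE)
      fix a b assume h: "is_fun E a om (VS Z)" "is_fun E b om (VS Z')" "sim emp (ap v (opr n1 (opr i l))) a b"
      show "opr (opr n1 (opr i l)) a : els T <-> opr (opr n1 (opr i l)) b : els T'"
        unfolding sat(2)[OF T(1) h(1) i] sat(2)[OF T(2) h(2) i]
        using simD(3)[OF h(3), of i l] unfolding fv(2)[OF i] by simp
    qed
    thus "EX N:els om. Q N (opr n1 (opr i l))" using om_0 by blast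
  next
    fix \<phi> \<psi> assume p: "\<phi> : els \<Phi>" "\<psi> : els \<Phi>" "EX N:els om. Q N \<phi>" "EX N:els om. Q N \<psi>"
    obtain N1 N2 where N: "N1 : els om" "Q N1 \<phi>" "N2 : els om" "Q N2 \<psi>" using p(3,4) by blast
    obtain M where M: "M : els om" "N1 : els M" "N2 : els M" using om_bound2[OF N(1,3)] .
    have "Q M (opr n2 (opr \<phi> \<psi>))" unfolding Q_def
    proof (intro allI impI, elim conjE)
      fix a b assume h: "is_fun E a om (VS Z)" "is_fun E b om (VS Z')" "sim M (ap v (opr n2 (opr \<phi> \<psi>))) a b"
      have X: "els (ap v (opr n2 (opr \<phi> \<psi>))) <= els om" by (rule vom[OF Phi_closed(3)[OF p(1,2)]])
      have "sim N1 (ap v \<phi>) a b" by (rule sim_mono[OF h(3) M(1) _ _ X h(1,2)]) (use M fv2[OF p(1,2)] in auto)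
      hence 1: "opr \<phi> a : els T <-> opr \<phi> b : els T'" using N(2) h(1,2) unfolding Q_def by blast
      have "sim N2 (ap v \<psi>) a b" by (rule sim_mono[OF h(3) M(1) _ _ X h(1,2)]) (use M fv2[OF p(1,2)] in auto)
      hence 2: "opr \<psi> a : els T <-> opr \<psi> b : els T'" using N(4) h(1,2) unfolding Q_def by blast
      show "opr (opr n2 (opr \<phi> \<psi>)) a : els T <-> opr (opr n2 (opr \<phi> \<psi>)) b : els T'"
        unfolding sat(3)[OF T(1) h(1) p(1,2)] sat(3)[OF T(2) h(2) p(1,2)] 1 2 ..
    qed
    thus "EX N:els om. Q N (opr n2 (opr \<phi> \<psi>))" using M(1) by blast
  next
    fix i \<phi> assume p: "i : els om" "\<phi> : els \<Phi>" "EX N:els om. Q N \<phi>"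
    obtain N0 where N0: "N0 : els om" "Q N0 \<phi>" using p(3) by blast
    let ?c = "opr n3 (opr i \<phi>)"
    have cP: "?c : els \<Phi>" by (rule Phi_closed(4)[OF p(1,2)])
    have X: "fin (ap v ?c)" "els (ap v ?c) <= els om" using v(2)[OF cP] vom[OF cP] by auto
    obtain n where n: "n : els om" "szle n (ap v ?c)" using fin_szle[OF X(1)] by blast
    obtain M where M: "M : els om" "N0 : els M" "n : els M" using om_bound2[OF N0(1) n(1)] .
    have sz: "szle M (ap v ?c)" by (rule szle_mono[OF n(2,1) M(1,3)])
    have iX: "i ~: els (ap v ?c)" "els (ap v \<phi>) <= insert i (els (ap v ?c))" unfolding fv3[OF p(1,2)] by auto
    \<comment> \<open>Stated for arbitrary data so that it serves both directions of the
      equivalence: the choice of \<open>b'\<close> on one side is answered on the other.\<close>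
    have step: "opr ?c b : els T'"
      if Z: "els om - {emp} <= els Z" "els om - {emp} <= els Z'"
        and T: "is_satisfaction E om \<Phi> (VS Z) (ES Z) T" "is_satisfaction E om \<Phi> (VS Z') (ES Z') T'"
        and q: "!!a b. is_fun E a om (VS Z) ==> is_fun E b om (VS Z') ==> sim N0 (ap v \<phi>) a b ==> opr \<phi> a : els T <-> opr \<phi> b : els T'"
        and h: "is_fun E a om (VS Z)" "is_fun E b om (VS Z')" "sim M (ap v ?c) a b" "opr ?c a : els T"
      for Z Z' T T' a b
      unfolding sat(4)[OF T(2) h(2) p(1,2)]
    proof (intro allI impI, elim conjE)
      fix b' assume b': "is_fun E b' om (VS Z')" "ALL l:els om. l ~= i --> ap b' l = ap b l"
      have y: "ap b' i : els (VS Z')" by (rule fun_val(2)[OF b'(1) p(1)])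
      obtain x where x: "x : els (VS Z)" "tg (ap b' i) = n1 <-> tg x = n1" "lg N0 (co (ap b' i)) & lg N0 (co x) \<or> ap b' i = x"
        "ALL l:els (ap v ?c). (ap b' i = ap b l <-> x = ap a l) & (co (ap b' i) = co (ap b l) <-> co x = co (ap a l)) & (adj (ap b' i) (ap b l) <-> adj x (ap a l))"
        using game_step[OF M(1,2) X sz Z(2,1) h(2,1) sim_sym[OF h(3)] y] by blast
      obtain a' where a': "is_fun E a' om (VS Z)" "ap a' i = x" "ALL l:els om. l ~= i --> ap a' l = ap a l"
        using fun_upd_ex[OF h(1) x(1), of i] p(1) by auto
      have "sim N0 (ap v ?c) a b" by (rule sim_mono[OF h(3) M(1) _ subset_refl X(2) h(1,2)]) (use M in blast)
      hence "sim N0 (ap v \<phi>) b' a'"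
        by (rule sim_extend[OF sim_sym p(1) iX(1) X(2) iX(2) refl _ a'(2) _ x(2,3,4)]) (use b'(2) a'(3) in blast)+
      hence "opr \<phi> a' : els T <-> opr \<phi> b' : els T'" using q[OF a'(1) b'(1)] sim_sym by blast
      moreover have "opr \<phi> a' : els T" using h(4) a'(1,3) unfolding sat(4)[OF T(1) h(1) p(1,2)] by blast
      ultimately show "opr \<phi> b' : els T'" by blast
    qed
    have "Q M ?c" unfolding Q_def
    proof (intro allI impI, elim conjE)
      fix a b assume h: "is_fun E a om (VS Z)" "is_fun E b om (VS Z')" "sim M (ap v ?c) a b"
      have q: "opr \<phi> a : els T <-> opr \<phi> b : els T'" if "is_fun E a om (VS Z)" "is_fun E b om (VS Z')" "sim N0 (ap v \<phi>) a b" for a b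
        using N0(2) that unfolding Q_def by blast
      show "opr ?c a : els T <-> opr ?c b : els T'"
      proof
        show "opr ?c b : els T'" if "opr ?c a : els T" by (rule step[OF Z T q h that])
        show "opr ?c a : els T" if "opr ?c b : els T'"
        proof (rule step[OF Z(2,1) T(2,1) _ h(2,1) sim_sym[OF h(3)] that])
          show "opr \<phi> b : els T' <-> opr \<phi> a : els T" if "is_fun E b om (VS Z')" "is_fun E a om (VS Z)" "sim N0 (ap v \<phi>) b a" for a b
            using q[OF that(2,1) sim_sym[OF that(3)]] by blast
        qed
      qed
    qed
    thus "EX N:els om. Q N ?c" using M(1) by blast
  qed
  thus ?thesis unfolding Q_def .
qed

lemma const_fun: assumes "x : els A" shows "is_fun E (lam om A (%_. x)) om A"
proof (rule lam_fun)
  show "Fn E (%rh. x)" by (intro dn)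
qed (rule assms)

lemma elem_equiv:
  assumes U: "els om <= els U" "!!a b. a : els U ==> b : els U ==> opr a b : els U"
    and Z: "els om - {emp} <= els Z" "els om - {emp} <= els Z'" "els Z <= els om" "els Z' <= els om"
  shows "elem_equivalent E (VS Z) (ES Z) (VS Z') (ES Z')"
proof -
  obtain \<Phi> where F: "is_formulas E om \<Phi>" using formulas_ex[OF U] by blast
  interpret formulas E \<Phi> by unfold_locales (rule F)
  obtain v where v: "is_free_vars E om \<Phi> v" "!!c. c : els \<Phi> ==> fin (ap v c)" using free_vars_ex by blast
  obtain T where T: "is_satisfaction E om \<Phi> (VS Z) (ES Z) T" using satisfaction_ex by blast
  obtain T' where T': "is_satisfaction E om \<Phi> (VS Z') (ES Z') T'" using satisfaction_ex by blast
  obtain p where p: "is_fun E v \<Phi> p" using conjunct1[OF v(1)[unfolded is_free_vars_def]] by blast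
  have ne: "EX a. is_fun E a om (VS Z)" if "els om - {emp} <= els Z" for Z
  proof -
    have "vert (vx n1 emp emp)" unfolding vert_def using num_om by auto
    moreover have "n1 : els Z" using that num_om by auto
    ultimately have "vx n1 emp emp : els (VS Z)" unfolding VS by simp
    thus ?thesis using const_fun by blast
  qed
  have "(ALL a. is_fun E a om (VS Z) --> opr \<phi> a : els T) <-> (ALL a. is_fun E a om (VS Z') --> opr \<phi> a : els T')"
    if \<phi>: "\<phi> : els \<Phi>" "els (app E v \<phi>) = {}" for \<phi>
  proof -
    have e: "els (ap v \<phi>) = {}" using \<phi> app_ap[OF p] by simp
    obtain N where N: "!!a b. is_fun E a om (VS Z) ==> is_fun E b om (VS Z') ==> sim N (ap v \<phi>) a b ==> opr \<phi> a : els T <-> opr \<phi> b : els T'"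
      using elementary[OF F Z(1,2) v T T' \<phi>(1)] by blast
    have "sim N (ap v \<phi>) a b" for a b unfolding sim_def e by simp
    thus ?thesis using N ne[OF Z(1)] ne[OF Z(2)] by blast
  qed
  thus ?thesis unfolding elem_equivalent_def rel_iff
    by (intro exI[of _ om] exI[of _ \<Phi>] exI[of _ v] exI[of _ T] exI[of _ T'] conjI ballI impI is_omega_om F v(1) T T')
qed

end

section \<open>Countability of the graphs and neighbours within a component\<close>

context coded begin

text \<open>By \<open>EP\<close> every finite set of numbers is of the form \<open>nb m\<close>;
  choice turns this into a right inverse of \<open>nb\<close>.\<close>

lemma finite_sets_code: "EX c. is_fun E c (mk {A : els (pw om). fin A}) om & (ALL A. els A <= els om & fin A --> ap c A : els om & nb (ap c A) = A)"
proof -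
  have S: "els (mk {A : els (pw om). fin A}) = {A : els (pw om). fin A}" by (intro els_mk sepI dn)
  have "EX c. is_fun E c (mk {A : els (pw om). fin A}) om & (ALL A:els (mk {A : els (pw om). fin A}). nb (ap c A) = A)"
  proof (rule choice[where K = "%A m. nb m = A"])
    show "Dn E (%rh. nb (rh 1) = rh 0)" by (intro dn)
    fix A assume "A : els (mk {A : els (pw om). fin A})"
    hence A: "els A <= els om" "fin A" unfolding S by auto
    obtain N where N: "N : els om" "els A <= els N" using fin_om_bound[OF A(2,1)] by blast
    obtain m where m: "m : els om" "N : els m" "ALL k:els m. One k m <-> k : els A" using EP[OF N, of emp] by auto
    have "els (nb m) = els A" unfolding els_nb using m(3) N(2) om_trans[OF m(1) _ m(2)] by blast
    thus "EX m:els om. nb m = A" using ext m(1) by blast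
  qed
  then obtain c where c: "is_fun E c (mk {A : els (pw om). fin A}) om" "ALL A:els (mk {A : els (pw om). fin A}). nb (ap c A) = A" by blast
  have "ap c A : els om & nb (ap c A) = A" if "els A <= els om" "fin A" for A
  proof -
    have "A : els (mk {A : els (pw om). fin A})" unfolding S using that by simp
    thus ?thesis using c(2) fun_val(2)[OF c(1)] by blast
  qed
  thus ?thesis using c(1) by blast
qed

lemma mk_inj: "mk X = mk Y ==> ss X ==> ss Y ==> X = Y" using els_mk by metis

text \<open>A pairing function without arithmetic: \<open>s x y\<close> codes the set
  \<open>{x, y}\<close>, and \<open>g x y\<close> codes the Kuratowski pair with sets replaced by
  their codes.\<close>

lemma pair_code:
  "EX g. Fn E (%rh. g (rh 0) (rh 1)) & (ALL x:els om. ALL y:els om. g x y : els om &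
     (ALL x':els om. ALL y':els om. g x y = g x' y' --> x = x' & y = y'))"
proof -
  obtain c where c: "!!A. els A <= els om ==> fin A ==> ap c A : els om & nb (ap c A) = A" using finite_sets_code by blast
  have f2: "fin (mk {x, y})" for x y
  proof -
    have "mk {x, y} = ins x (mk {y})" by (rule ext) (simp add: els_mk)
    thus ?thesis using fin_ins[OF fin_sing] by simp
  qed
  define s where "s x y = ap c (mk {x, y})" for x y
  have s: "s x y : els om" "nb (s x y) = mk {x, y}" if "x : els om" "y : els om" for x y
  proof -
    have "els (mk {x, y}) <= els om" using that by (simp add: els_mk)
    thus "s x y : els om" "nb (s x y) = mk {x, y}" unfolding s_def using c[OF _ f2] by blast+
  qed
  define g where "g x y = s (s x x) (s x y)" for x y
  have g: "g x y : els om" if "x : els om" "y : els om" for x y unfolding g_def by (rule s(1)) (rule s(1) that)+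
  have inj: "x = x' & y = y'" if o: "x : els om" "y : els om" "x' : els om" "y' : els om" "g x y = g x' y'" for x y x' y'
  proof -
    have "nb (g u v) = mk {s u u, s u v}" if "u : els om" "v : els om" for u v
      unfolding g_def by (rule s(2)) (rule s(1) that)+
    hence "mk {s x x, s x y} = mk {s x' x', s x' y'}" using o by metis
    hence "{s x x, s x y} = {s x' x', s x' y'}" by (rule mk_inj) simp_all
    hence "nb ` {s x x, s x y} = nb ` {s x' x', s x' y'}" by simp
    hence "{mk {x, x}, mk {x, y}} = {mk {x', x'}, mk {x', y'}}" using s(2) o by simp
    hence "opr x y = opr x' y'" unfolding opr_def by simp
    thus ?thesis by simp
  qed
  have "Fn E (%rh. g (rh 0) (rh 1))" unfolding g_def s_def by (intro dn)
  thus ?thesis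
    by (intro exI[of _ g] conjI ballI impI) (use inj in \<open>blast intro: g\<close>)+
qed

lemma countable: "is_countable E (VS Z)"
proof -
  obtain g where g: "Fn E (%rh. g (rh 0) (rh 1))" "!!x y. x : els om ==> y : els om ==> g x y : els om"
    "!!x y x' y'. x : els om ==> y : els om ==> x' : els om ==> y' : els om ==> g x y = g x' y' ==> x = x' & y = y'"
    using pair_code by blast
  let ?h = "%v. g (co v) (g (tg v) (ix v))"
  have Fg: "Fn E a ==> Fn E b ==> Fn E (%rh. g (a rh) (b rh))" for a b by (rule Fn_comp2[where f = g, OF g(1)])
  have h: "Fn E (%rh. ?h (rh 0))" by (intro Fg dn)
  have o: "co x : els om" "tg x : els om" "ix x : els om" "x = vx (co x) (tg x) (ix x)" if "x : els (VS Z)" for x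
    using that VS vert_eq[of x] num_om om_0 by auto
  have v: "?h x : els om" if "x : els (VS Z)" for x using g(2) o[OF that] by blast
  let ?f = "lam (VS Z) om ?h"
  have f: "is_fun E ?f (VS Z) om" by (rule lam_fun[OF h]) (rule v)
  have L: "ap ?f x = ?h x" if "x : els (VS Z)" for x by (rule lam_ap[OF h _ that]) (rule v)
  have "x = y" if xy: "x : els (VS Z)" "y : els (VS Z)" "app E ?f x = app E ?f y" for x y
  proof -
    have e: "?h x = ?h y" using xy(3) unfolding app_ap[OF f xy(1)] app_ap[OF f xy(2)] L[OF xy(1)] L[OF xy(2)] .
    have "co x = co y & g (tg x) (ix x) = g (tg y) (ix y)" by (rule g(3)[OF _ _ _ _ e]) (use o[OF xy(1)] o[OF xy(2)] g(2) in blast)+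
    moreover from this have "tg x = tg y & ix x = ix y" by (intro g(3)) (use o[OF xy(1)] o[OF xy(2)] in blast)+
    ultimately show ?thesis using o(4)[OF xy(1)] o(4)[OF xy(2)] by metis
  qed
  hence "inj_on (app E ?f) (els (VS Z))" unfolding inj_on_def by blast
  thus ?thesis unfolding is_countable_def is_omega_iff using f by blast
qed

text \<open>A set vertex is taken that contains those of the two vertices that are points and is
  joined to those that are random. It has at most two points, which respects the limit of every
  component. Lying in a common component thereby becomes a property that isomorphisms
  preserve.\<close>

lemma common_neighbour:
  assumes u: "u : els (VS Z)" and v: "v : els (VS Z)" and c: "co u = co v"
  shows "EX z:els (VS Z). adj u z & adj v z"
proof -
  have uv: "vert u" "vert v" "co u : els Z" using u v VS by blast+
  define d where "d = co u"
  have d: "d : els om" "d : els Z" unfolding d_def using vert_eq(2)[OF uv(1)] uv(3) by auto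
  obtain N where N: "N : els om" "ix u : els N" "ix v : els N" using om_bound2[OF vert_eq(3)[OF uv(1)] vert_eq(3)[OF uv(2)]] .
  define W where "W e = mk {k : els N. tg u = e & k = ix u \<or> tg v = e & k = ix v}" for e
  have W: "els (W e) = {k : els N. tg u = e & k = ix u \<or> tg v = e & k = ix v}" for e unfolding W_def by (intro els_mk sepI dn)
  obtain m where m: "m : els om" "N : els m" "ALL k:els m. One k m <-> k : els (W emp)" "ALL k:els N. One m k <-> k : els (W n2)"
    using EP[OF N(1), of "W emp" "W n2"] W by blast
  have Nm: "k : els m" if "k : els N" for k using om_trans[OF m(1) that m(2)] .
  have nbm: "els (nb m) = els (W emp)" unfolding els_nb using m(3) W Nm by blast
  hence nbW: "nb m = W emp" by (rule ext)
  have sz: "szle (suc (suc d)) (nb m)" if dn: "d ~= emp"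
  proof -
    have "szle (suc (suc emp)) (ins (ix u) (ins (ix v) emp))"
      by (intro szle_ins szle_emp om_suc om_0)
    hence "szle (suc (suc emp)) (nb m)" unfolding nbW by (rule szle_sub) (use W in auto)
    thus ?thesis
    proof (rule szle_mono)
      have "emp : els d" using om_0_least[OF d(1)] dn by blast
      thus "suc (suc emp) : els (suc (suc d))" using om_suc_mono d(1) om_suc by blast
    qed (use d(1) om_suc om_0 in blast)+
  qed
  have zv: "vert (vx d n1 m)" unfolding vert_def using d(1) m(1) sz by auto
  have "adj x (vx d n1 m)" if x: "x = u \<or> x = v" for x
  proof -
    have xv: "vert x" "co x = d" "ix x : els N" using x uv N(2,3) c d_def by auto
    have "ix x ~= m" using Nm[OF xv(3)] om_irrefl[OF m(1)] by auto
    hence "x ~= vx d n1 m" by auto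
    moreover have "tg x = emp ==> ix x : els (nb m)" unfolding nbm W using x xv(3) by auto
    moreover have "tg x = n2 ==> Sy m (ix x)" unfolding Sy_def using Nm[OF xv(3)] m(4) xv(3) W x by auto
    ultimately have "adj (vx d n1 m) x" using adj_ad1[OF zv xv(1)] xv(2) vert_eq(4)[OF xv(1)] by auto
    thus ?thesis using adj_sym by blast
  qed
  moreover have "vx d n1 m : els (VS Z)" unfolding VS using zv d(2) by simp
  ultimately show ?thesis by blast
qed

text \<open>Component \<open>emp\<close> puts no limit on the size of sets, so the set of all points
  below \<open>N\<close> is available. \<open>EP\<close> joins its code to the random vertices below
  \<open>N\<close> as well, and any two sets of a component are adjacent.\<close>

lemma dominating_vertex:
  assumes "N : els om" "emp : els Z"
  shows "EX t:els (VS Z). ALL u:els (VS Z). co u = emp & ix u : els N --> adj t u"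
proof -
  obtain m where m: "m : els om" "N : els m" "ALL k:els m. One k m <-> k : els N" "ALL k:els N. One m k <-> k : els N"
    using EP[OF assms(1), of N N] by blast
  have Nm: "k : els m" if "k : els N" for k using om_trans[OF m(1) that m(2)] .
  have zv: "vert (vx emp n1 m)" unfolding vert_def using m(1) by auto
  have "adj (vx emp n1 m) u" if u: "u : els (VS Z)" "co u = emp" "ix u : els N" for u
  proof -
    have uv: "vert u" using u(1) VS by blast
    have "ix u ~= m" using Nm[OF u(3)] om_irrefl[OF m(1)] by auto
    hence "u ~= vx emp n1 m" by auto
    moreover have "ix u : els (nb m)" unfolding els_nb using Nm[OF u(3)] m(3) u(3) by auto
    moreover have "Sy m (ix u)" unfolding Sy_def using Nm[OF u(3)] m(4) u(3) by auto
    ultimately show ?thesis using adj_ad1[OF zv uv] u(2) by auto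
  qed
  moreover have "vx emp n1 m : els (VS Z)" unfolding VS using zv assms(2) by simp
  ultimately show ?thesis by blast
qed

end

section \<open>The ultrapowers\<close>

locale ultra = coded E One for E :: "'v => 'v => bool" and One +
  fixes F :: 'v
  assumes F_sub: "els F <= els (pw om)" and F_emp: "emp ~: els F"
    and F_up: "x : els F ==> els x <= els y ==> els y <= els om ==> y : els F"
    and F_int: "x : els F ==> y : els F ==> EX z:els F. els z <= els x \<inter> els y"
    and F_dec: "els x <= els om ==> x : els F \<or> df om x : els F"
    and F_tail: "n : els om ==> EX b:els F. ALL i:els b. n : els i"
begin

text \<open>Truth for almost all \<open>i\<close>, witnessed by a member of \<open>F\<close>, so
  that the statement makes sense before the set of all such \<open>i\<close> is known to
  exist.\<close>

definition aa :: "('v => bool) => bool" where "aa Q <-> (EX b:els F. ALL i:els b. Q i)"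

lemma Dn_aa [dn]:
  assumes "Dn E (%rh. Q (rh 0) (%n. rh (Suc n)))" shows "Dn E (%rh. aa (%i. Q i rh))"
proof -
  have "Dn E (%rh. Q (rh 0) (%n. rh (Suc (Suc n))))"
    using Dn_ren[OF assms, of "case_nat 0 (%m. Suc (Suc m))"] by simp
  thus ?thesis unfolding aa_def by (intro dn)
qed

lemma F_om: "b : els F ==> i : els b ==> i : els om" using F_sub by auto

lemma aa_mono: assumes "aa Q" "!!i. i : els om ==> Q i ==> Q' i" shows "aa Q'"
proof -
  obtain b where "b : els F" "ALL i:els b. Q i" using assms(1) unfolding aa_def by blast
  thus ?thesis unfolding aa_def using assms(2) F_om by blast
qed

lemma aa_conj: assumes "aa Q" "aa Q'" shows "aa (%i. Q i & Q' i)"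
proof -
  obtain b b' where b: "b : els F" "ALL i:els b. Q i" "b' : els F" "ALL i:els b'. Q' i" using assms unfolding aa_def by blast
  obtain z where "z : els F" "els z <= els b \<inter> els b'" using F_int[OF b(1,3)] by blast
  thus ?thesis unfolding aa_def using b(2,4) by blast
qed

lemma aa_ex: assumes "aa Q" shows "EX i:els om. Q i"
proof -
  obtain b where b: "b : els F" "ALL i:els b. Q i" using assms unfolding aa_def by blast
  hence "b ~= emp" using F_emp by metis
  then obtain i where "i : els b" using empty_iff_emp by blast
  thus ?thesis using b F_om by blast
qed

lemma F_ne: "EX b. b : els F"
proof -
  have "els emp <= els om" by simp
  from F_dec[OF this] show ?thesis by blast
qed

lemma aa_all: assumes "!!i. i : els om ==> Q i" shows "aa Q"
proof -
  obtain b where b: "b : els F" using F_ne by blast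
  hence "ALL i:els b. Q i" using assms F_om[OF b] by blast
  thus ?thesis unfolding aa_def using b by blast
qed

lemma family_iff: assumes "Dn E (%rh. Q (rh 0))" shows "{i : els om. Q i} : family E F <-> aa Q"
proof
  assume "{i : els om. Q i} : family E F"
  then obtain b where b: "b : els F" "{i : els om. Q i} = els b" unfolding family_def by (elim imageE)
  have "ALL i:els b. Q i" unfolding b(2)[symmetric] by simp
  thus "aa Q" unfolding aa_def using b(1) by blast
next
  assume "aa Q"
  then obtain b where b: "b : els F" "ALL i:els b. Q i" unfolding aa_def by blast
  have S: "els (mk {i : els om. Q i}) = {i : els om. Q i}" by (intro els_mk sepI assms)
  have m: "mk {i : els om. Q i} : els F" by (rule F_up[OF b(1)], unfold S) (use b(2) F_om[OF b(1)] in blast)+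
  show "{i : els om. Q i} : family E F" using imageI[OF m, of els] unfolding family_def S .
qed

lemma nonprincipal: "nonprincipal_ultrafilter E om F"
  unfolding nonprincipal_ultrafilter_def family_def
proof (intro conjI ballI allI impI)
  fix X assume "X : els ` els F"
  then obtain x where x: "X = els x" "x : els F" by blast
  show "X <= els om" unfolding x(1) using F_om[OF x(2)] by blast
  show "els y : els ` els F" if "X <= els y & els y <= els om" for y using F_up[OF x(2)] x(1) that by blast
  fix Y assume "Y : els ` els F"
  then obtain y where y: "Y = els y" "y : els F" by blast
  obtain z where z: "z : els F" "els z <= els x \<inter> els y" using F_int[OF x(2) y(2)] by blast
  have S: "els (mk (els x \<inter> els y)) = els x \<inter> els y"
    by (rule els_mk[OF ss_Int]) (auto simp: ss_def)
  have m: "mk (els x \<inter> els y) : els F" by (rule F_up[OF z(1)], unfold S) (use z(2) F_om[OF x(2)] in blast)+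
  show "X \<inter> Y : els ` els F" using imageI[OF m, of els] unfolding x(1) y(1) S .
next
  obtain b where "b : els F" using F_ne by blast
  hence "om : els F" using F_up[of _ om] F_om by blast
  thus "els om : els ` els F" by blast
next
  show "{} ~: els ` els F"
  proof
    assume "{} : els ` els F"
    then obtain x where "x : els F" "{} = els x" by (elim imageE)
    thus False using F_emp empty_iff_emp[of x] by simp
  qed
next
  fix x assume x: "els x <= els om"
  have e: "els om - els x = els (df om x)" by simp
  show "els x : els ` els F \<or> els om - els x : els ` els F" unfolding e using F_dec[OF x] by blast
next
  fix n assume n: "n : els om"
  show "{n} ~: els ` els F"
  proof
    assume "{n} : els ` els F"
    then obtain x where x: "x : els F" "{n} = els x" by (elim imageE)
    hence "aa (%i. i = n)" unfolding aa_def by auto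
    moreover have "aa (%i. n : els i)" unfolding aa_def using F_tail[OF n] .
    ultimately have "aa (%i. i = n & n : els i)" by (rule aa_conj)
    thus False using aa_ex om_irrefl by blast
  qed
qed

definition cls :: "'v => 'v => 'v" where "cls A f = mk {g : els (funs om A). aa (%i. ap f i = ap g i)}"

definition UP :: "'v => 'v" where "UP A = mk {c : els (pw (funs om A)). EX f:els (funs om A). c = cls A f}"

definition UR :: "'v => 'v => 'v" where
  "UR A R = rc (UP A) (UP A) (%c d. EX f:els c. EX h:els d. aa (%i. opr (ap f i) (ap h i) : els R))"

lemma els_cls: "els (cls A f) = {g. is_fun E g om A & aa (%i. ap f i = ap g i)}"
proof -
  have "els (cls A f) = {g : els (funs om A). aa (%i. ap f i = ap g i)}" unfolding cls_def by (intro els_mk sepI dn)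
  thus ?thesis by simp
qed

lemma Fn_cls [dn]: "Fn E f ==> Fn E (%rh. cls A (f rh))"
proof (rule Fn_comp1[where f = "cls A"])
  show "Fn E (%rh. cls A (rh 0))" unfolding cls_def by (rule Fn_mk) (intro sepI dn, unfold mem_Collect_eq, intro dn)
qed

lemma els_UP: "els (UP A) = {cls A f |f. is_fun E f om A}"
proof -
  have "els (UP A) = {c : els (pw (funs om A)). EX f:els (funs om A). c = cls A f}" unfolding UP_def by (intro els_mk sepI dn)
  thus ?thesis using els_cls by auto
qed

lemma UR_iff: "opr c d : els (UR A R) <-> c : els (UP A) & d : els (UP A) &
    (EX f:els c. EX h:els d. aa (%i. opr (ap f i) (ap h i) : els R))"
proof -
  let ?K = "%c d. EX f:els c. EX h:els d. aa (%i. opr (ap f i) (ap h i) : els R)"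
  have "Dn E (%rh. ?K (rh 0) (rh 1))" by (intro dn)
  thus ?thesis unfolding UR_def by (rule rc_iff[where K = ?K])
qed

lemma cls_refl: "is_fun E f om A ==> f : els (cls A f)" unfolding els_cls using aa_all[of "%i. ap f i = ap f i"] by simp

lemma UR_cls:
  assumes "is_fun E f om A" "is_fun E h om A"
  shows "opr (cls A f) (cls A h) : els (UR A R) <-> aa (%i. opr (ap f i) (ap h i) : els R)"
proof
  assume "opr (cls A f) (cls A h) : els (UR A R)"
  then obtain f' h' where f': "f' : els (cls A f)" "h' : els (cls A h)" "aa (%i. opr (ap f' i) (ap h' i) : els R)"
    unfolding UR_iff by blast
  have "aa (%i. ap f i = ap f' i)" "aa (%i. ap h i = ap h' i)" using f'(1,2) unfolding els_cls by blast+
  from aa_conj[OF aa_conj[OF this] f'(3)] show "aa (%i. opr (ap f i) (ap h i) : els R)" by (rule aa_mono) auto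
next
  assume "aa (%i. opr (ap f i) (ap h i) : els R)"
  moreover have "cls A f : els (UP A)" "cls A h : els (UP A)" unfolding els_UP using assms by blast+
  ultimately show "opr (cls A f) (cls A h) : els (UR A R)" unfolding UR_iff using cls_refl assms by blast
qed

lemma ultrapower: "is_ultrapower E om F A R (UP A) (UR A R)"
proof -
  have a: "{n : els om. app E f n = app E g n} : family E F <-> aa (%i. ap f i = ap g i)"
    if fg: "is_fun E f om A" "is_fun E g om A" for f g
  proof -
    have "{n : els om. app E f n = app E g n} = {n : els om. ap f n = ap g n}" using app_ap[OF fg(1)] app_ap[OF fg(2)] by auto
    moreover have "Dn E (%rh. ap f (rh 0) = ap g (rh 0))" by (intro dn)
    ultimately show ?thesis using family_iff[of "%i. ap f i = ap g i"] by simp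
  qed
  have r: "{n : els om. (app E f n, app E g n) : rel E R} : family E F <-> aa (%i. opr (ap f i) (ap g i) : els R)"
    if fg: "is_fun E f om A" "is_fun E g om A" for f g
  proof -
    have "{n : els om. (app E f n, app E g n) : rel E R} = {n : els om. opr (ap f n) (ap g n) : els R}"
      using app_ap[OF fg(1)] app_ap[OF fg(2)] by (auto simp: rel_iff)
    moreover have "Dn E (%rh. opr (ap f (rh 0)) (ap g (rh 0)) : els R)" by (intro dn)
    ultimately show ?thesis using family_iff[of "%i. opr (ap f i) (ap g i) : els R"] by simp
  qed
  have c: "{g. is_fun E g om A & {n : els om. app E f n = app E g n} : family E F} = els (cls A f)" if f: "is_fun E f om A" for f
    unfolding els_cls using a[OF f] by blast
  have 1: "els (UP A) = {c. EX f. is_fun E f om A & els c = {g. is_fun E g om A & {n : els om. app E f n = app E g n} : family E F}}"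
    unfolding els_UP using c ext by (metis (mono_tags, lifting))
  have 2: "rel_on E (UR A R) (UP A) (UP A)"
  proof -
    let ?K = "%c d. EX f:els c. EX h:els d. aa (%i. opr (ap f i) (ap h i) : els R)"
    have "Dn E (%rh. ?K (rh 0) (rh 1))" by (intro dn)
    hence "els (UR A R) = {z. EX x:els (UP A). EX y:els (UP A). z = opr x y & ?K x y}"
      unfolding UR_def by (rule els_rc[where K = ?K])
    thus ?thesis unfolding rel_on_iff els_prd by blast
  qed
  have 3: "(c, d) : rel E (UR A R) <-> c : els (UP A) & d : els (UP A) &
      (EX f:els c. EX g:els d. {n : els om. (app E f n, app E g n) : rel E R} : family E F)" for c d
  proof -
    have "is_fun E f om A" if "c : els (UP A)" "f : els c" for c f using that unfolding els_UP by (auto simp: els_cls)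
    thus ?thesis unfolding rel_iff[of c d] UR_iff using r by meson
  qed
  show ?thesis unfolding is_ultrapower_def
  proof (intro conjI 1 2)
    show "rel E (UR A R) = {(c, d). c : els (UP A) & d : els (UP A) &
      (EX f:els c. EX g:els d. {n : els om. (app E f n, app E g n) : rel E R} : family E F)}"
      unfolding 3[symmetric] by simp
  qed
qed

end

section \<open>Non-isomorphism of the ultrapowers from domination and evasion\<close>

locale evading = ultra E One F for E :: "'v => 'v => bool" and One F +
  fixes K :: 'v
  assumes dominate: "is_fun E h (prd K om) om ==>
      EX f. is_fun E f om om & (ALL \<alpha>:els K. aa (%i. ap h (opr \<alpha> i) : els (ap f i)))"
    and evade: "is_fun E f om om ==> EX x. is_fun E x (prd K om) om & (ALL w. is_fun E w (prd om om) om -->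
      (EX \<alpha>:els K. aa (%i. ALL l:els (ap f i). ap w (opr i l) ~= ap x (opr \<alpha> i))))"
begin

lemma fun2:
  assumes "Fn E (%rh. h (rh 0) (rh 1))" "!!x y. x : els a ==> y : els b ==> h x y : els c"
  shows "EX f. is_fun E f (prd a b) c & (ALL x:els a. ALL y:els b. ap f (opr x y) = h x y)"
proof -
  have F2: "Fn E s ==> Fn E t ==> Fn E (%rh. h (s rh) (t rh))" for s t by (rule Fn_comp2[where f = h, OF assms(1)])
  let ?h = "%z. h (fs z) (sn z)"
  have h: "Fn E (%rh. ?h (rh 0))" by (intro F2 dn)
  have v: "?h z : els c" if z: "z : els (prd a b)" for z
  proof -
    obtain x y where "z = opr x y" "x : els a" "y : els b" using prdE[OF z] .
    thus ?thesis using assms(2) by simp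
  qed
  have f: "is_fun E (lam (prd a b) c ?h) (prd a b) c" by (rule lam_fun[OF h]) (rule v)
  have L: "ap (lam (prd a b) c ?h) z = ?h z" if "z : els (prd a b)" for z by (rule lam_ap[OF h _ that]) (rule v)
  have "ap (lam (prd a b) c ?h) (opr x y) = h x y" if "x : els a" "y : els b" for x y
    using L[of "opr x y"] that by simp
  thus ?thesis using f by blast
qed

text \<open>Only sets have points as neighbours, and a set in a component other than
  \<open>emp\<close> has a limited number of them. The enumeration is made a total function on
  \<omega>, with default value \<open>emp\<close>, so that such enumerations can be put together
  into a single \<open>w\<close>.\<close>

lemma P_neighbours:
  assumes t: "t : els (VS Z)" and ne: "co t ~= emp"
  shows "EX e:els (funs om om). ALL k:els om. adj t (vx (co t) emp k) --> (EX l:els (suc (suc (co t))). ap e l = k)"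
proof -
  have tv: "vert t" "co t : els om" "ix t : els om" using t VS vert_eq by blast+
  have vk: "vert (vx (co t) emp k)" if "k : els om" for k unfolding vert_def using tv(2) that by auto
  have sz: "suc (suc (co t)) : els om" using tv(2) om_suc by blast
  show ?thesis
  proof (cases "tg t = n1")
    case True
    obtain n e k where te: "t = vx n e k" "e = n1 ==> n ~= emp ==> szle (suc (suc n)) (nb k)" using vertE[OF tv(1)] by metis
    have "szle (suc (suc (co t))) (nb (ix t))" using te True ne by simp
    then obtain f Y where f: "is_fun E f (suc (suc (co t))) Y" "ALL z:els (nb (ix t)). EX l:els (suc (suc (co t))). ap f l = z"
      unfolding szle_def by blast
    let ?h = "%l. if ap f l : els om then ap f l else emp"
    have h: "Fn E (%rh. ?h (rh 0))" by (intro Fn_if dn)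
    have v: "?h l : els om" for l by simp
    have e: "is_fun E (lam om om ?h) om om" by (rule lam_fun[OF h]) (rule v)
    have L: "ap (lam om om ?h) l = ?h l" if "l : els om" for l by (rule lam_ap[OF h _ that]) (rule v)
    have "EX l:els (suc (suc (co t))). ap (lam om om ?h) l = k" if k: "k : els om" "adj t (vx (co t) emp k)" for k
    proof -
      have "k : els (nb (ix t))" using adj_ad1[OF tv(1) vk[OF k(1)] _ True] k(2) by simp
      then obtain l where l: "l : els (suc (suc (co t)))" "ap f l = k" using f(2) by blast
      have "ap (lam om om ?h) l = k" using L[OF om_sub[OF sz l(1)]] l(2) k(1) by simp
      thus ?thesis using l(1) by blast
    qed
    thus ?thesis using e by (intro bexI[of _ "lam om om ?h"]) auto
  next
    case False
    have "~ adj t (vx (co t) emp k)" for k by (rule adj_not_T[OF False]) simp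
    moreover have "is_fun E (lam om om (%_. emp)) om om" by (rule const_fun) simp
    ultimately show ?thesis by (intro bexI[of _ "lam om om (%_. emp)"]) auto
  qed
qed

text \<open>Suppose that \<open>H\<close> is an isomorphism, and let \<open>t0\<close> correspond to
  a point \<open>x0\<close> of component 0. The points \<open>y \<alpha>\<close> in the component of
  \<open>t0\<close>, given by \<open>evade\<close>, share neighbours with \<open>t0\<close>, so
  their images lie in component 0, where by \<open>dominate\<close> a single vertex is adjacent to
  all of them. Its preimage \<open>t1\<close> is adjacent to all \<open>y \<alpha>\<close>, and
  listing the neighbours of \<open>t1\<close> gives a \<open>w\<close> that none of the
  \<open>y \<alpha>\<close> evades.\<close>

lemma not_isomorphic:
  assumes Z1: "emp ~: els Z1" "els Z1 <= els om" and Z2: "emp : els Z2"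
  shows "~ graph_isomorphic E (UP (VS Z1)) (UR (VS Z1) (ES Z1)) (UP (VS Z2)) (UR (VS Z2) (ES Z2))"
proof
  let ?A1 = "VS Z1" and ?A2 = "VS Z2"
  let ?B1 = "UP ?A1" and ?S1 = "UR ?A1 (ES Z1)" and ?B2 = "UP ?A2" and ?S2 = "UR ?A2 (ES Z2)"
  assume "graph_isomorphic E ?B1 ?S1 ?B2 ?S2"
  then obtain H where H: "is_fun E H ?B1 ?B2" "bij_betw (app E H) (els ?B1) (els ?B2)"
    "!!x y. x : els ?B1 ==> y : els ?B1 ==> opr x y : els ?S1 <-> opr (app E H x) (app E H y) : els ?S2"
    unfolding graph_isomorphic_def rel_iff by blast
  note Hap = app_ap[OF H(1)]
  have iso: "opr x y : els ?S1 <-> opr (ap H x) (ap H y) : els ?S2" if "x : els ?B1" "y : els ?B1" for x y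
    using H(3)[OF that] unfolding Hap[OF that(1)] Hap[OF that(2)] .
  have sur: "EX x:els ?B1. ap H x = y" if "y : els ?B2" for y
  proof -
    obtain x where "x : els ?B1" "app E H x = y" using H(2) \<open>y : els ?B2\<close> unfolding bij_betw_def by (metis imageE)
    thus ?thesis using Hap by auto
  qed
  have adj1: "opr (cls ?A1 f) (cls ?A1 h) : els ?S1 <-> aa (%i. adj (ap f i) (ap h i))"
    if fh: "is_fun E f om ?A1" "is_fun E h om ?A1" for f h
    unfolding UR_cls[OF fh] ES using fun_val(2)[OF fh(1)] fun_val(2)[OF fh(2)] aa_mono by (metis (no_types, lifting))
  have adj2: "opr (cls ?A2 f) (cls ?A2 h) : els ?S2 <-> aa (%i. adj (ap f i) (ap h i))"
    if fh: "is_fun E f om ?A2" "is_fun E h om ?A2" for f h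
    unfolding UR_cls[OF fh] ES using fun_val(2)[OF fh(1)] fun_val(2)[OF fh(2)] aa_mono by (metis (no_types, lifting))
  have mem2: "g : els c ==> c : els ?B2 ==> is_fun E g om ?A2 & c = cls ?A2 g" for g c
  proof -
    assume g: "g : els c" "c : els ?B2"
    obtain f where f: "c = cls ?A2 f" "is_fun E f om ?A2" using g(2) unfolding els_UP by blast
    have gf: "is_fun E g om ?A2" "aa (%i. ap f i = ap g i)" using g(1) unfolding f(1) els_cls by blast+
    have "aa (%i. ap f i = ap h i) <-> aa (%i. ap g i = ap h i)" for h
    proof
      assume "aa (%i. ap f i = ap h i)"
      from aa_conj[OF gf(2) this] show "aa (%i. ap g i = ap h i)" by (rule aa_mono) auto
    next
      assume "aa (%i. ap g i = ap h i)"
      from aa_conj[OF gf(2) this] show "aa (%i. ap f i = ap h i)" by (rule aa_mono) auto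
    qed
    hence "els (cls ?A2 f) = els (cls ?A2 g)" unfolding els_cls by simp
    thus "is_fun E g om ?A2 & c = cls ?A2 g" using gf(1) f(1) ext by metis
  qed

  define x0 where "x0 = lam om ?A2 (%_. vx emp emp emp)"
  have "vert (vx emp emp emp)" unfolding vert_def by auto
  hence x0V: "vx emp emp emp : els ?A2" unfolding VS using Z2 by simp
  have x0f: "is_fun E x0 om ?A2" unfolding x0_def by (rule const_fun[OF x0V])
  have Fc: "Fn E (%rh. vx emp emp emp)" by (intro dn)
  have x0v: "ap x0 i = vx emp emp emp" if "i : els om" for i unfolding x0_def by (rule lam_ap[OF Fc x0V that])
  have x0B: "cls ?A2 x0 : els ?B2" unfolding els_UP using x0f by blast
  obtain t0 where t0: "is_fun E t0 om ?A1" "ap H (cls ?A1 t0) = cls ?A2 x0"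
    using sur[OF x0B] unfolding els_UP by blast
  have t0V: "ap t0 i : els ?A1" if "i : els om" for i by (rule fun_val(2)[OF t0(1) that])
  have co0: "co (ap t0 i) : els om" "co (ap t0 i) ~= emp" "co (ap t0 i) : els Z1" if "i : els om" for i
    using t0V[OF that] VS vert_eq(2) Z1(1) by metis+
  \<comment> \<open>The limit on the number of points of a set in the component of \<open>t0\<close>
    at \<open>i\<close>.\<close>
  define f where "f = lam om om (%i. suc (suc (co (ap t0 i))))"
  have Ff: "Fn E (%rh. suc (suc (co (ap t0 (rh 0)))))" by (intro dn)
  have fo: "suc (suc (co (ap t0 i))) : els om" if "i : els om" for i using co0(1)[OF that] om_suc by blast
  have f: "is_fun E f om om" unfolding f_def by (rule lam_fun[OF Ff]) (rule fo)
  have fv: "ap f i = suc (suc (co (ap t0 i)))" if "i : els om" for i unfolding f_def by (rule lam_ap[OF Ff _ that]) (rule fo)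
  obtain x where x: "is_fun E x (prd K om) om"
    "!!w. is_fun E w (prd om om) om ==> EX \<alpha>:els K. aa (%i. ALL l:els (ap f i). ap w (opr i l) ~= ap x (opr \<alpha> i))"
    using evade[OF f] by blast
  have xo: "ap x (opr \<alpha> i) : els om" if "\<alpha> : els K" "i : els om" for \<alpha> i using fun_val(2)[OF x(1)] that by simp
  define y where "y \<alpha> = lam om ?A1 (%i. vx (co (ap t0 i)) emp (ap x (opr \<alpha> i)))" for \<alpha>
  have Fy: "Fn E (%rh. vx (co (ap t0 (rh 0))) emp (ap x (opr \<alpha> (rh 0))))" for \<alpha> by (intro dn)
  have yV: "vx (co (ap t0 i)) emp (ap x (opr \<alpha> i)) : els ?A1" if "\<alpha> : els K" "i : els om" for \<alpha> i
  proof -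
    have "vert (vx (co (ap t0 i)) emp (ap x (opr \<alpha> i)))" unfolding vert_def using co0(1)[OF that(2)] xo[OF that] by auto
    thus ?thesis unfolding VS using co0(3)[OF that(2)] by simp
  qed
  have y: "is_fun E (y \<alpha>) om ?A1" if "\<alpha> : els K" for \<alpha> unfolding y_def by (rule lam_fun[OF Fy]) (rule yV[OF that])
  have yv: "ap (y \<alpha>) i = vx (co (ap t0 i)) emp (ap x (opr \<alpha> i))" if "\<alpha> : els K" "i : els om" for \<alpha> i
    unfolding y_def by (rule lam_ap[OF Fy _ that(2)]) (rule yV[OF that(1)])
  have yB: "cls ?A1 (y \<alpha>) : els ?B1" if "\<alpha> : els K" for \<alpha> unfolding els_UP using y[OF that] by blast
  \<comment> \<open>Definability of \<open>y\<close> in its index, needed where choice is applied to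
    the images of all \<open>y \<alpha>\<close> at once. \<open>lam\<close> is unfolded because its
    body depends on \<open>\<alpha>\<close>.\<close>
  have Fyl: "Fn E a ==> Fn E (%rh. y (a rh))" for a
  proof (rule Fn_comp1[where f = y])
    have "Dn E (%rh. rh 2 = vx (co (ap t0 (rh 1))) emp (ap x (opr (rh 0) (rh 1))))" by (intro dn)
    show "Fn E (%rh. y (rh 0))" unfolding y_def lam_def rc_def
    proof (rule Fn_mk)
      have "Dn E (%rh. rh 1 = vx (co (ap t0 (rh 0))) emp (ap x (opr \<alpha> (rh 0))))" for \<alpha> by (intro dn)
      hence "els (rc om ?A1 (%k z. z = vx (co (ap t0 k)) emp (ap x (opr \<alpha> k)))) =
        {z. EX k:els om. EX u:els ?A1. z = opr k u & u = vx (co (ap t0 k)) emp (ap x (opr \<alpha> k))}" for \<alpha>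
        by (rule els_rc[where K = "%k z. z = vx (co (ap t0 k)) emp (ap x (opr \<alpha> k))"])
      thus "ss {z. EX k:els om. EX u:els ?A1. z = opr k u & u = vx (co (ap t0 k)) emp (ap x (opr (rh 0) k))}" for rh :: "nat => 'v"
        unfolding ss_def by blast
      show "Dn E (%rh. rh 0 : {z. EX k:els om. EX u:els ?A1. z = opr k u & u = vx (co (ap t0 k)) emp (ap x (opr (rh (Suc 0)) k))})"
        unfolding mem_Collect_eq by (intro dn)
    qed
  qed

  \<comment> \<open>A common neighbour of \<open>y \<alpha>\<close> and \<open>t0\<close> is mapped
    to a common neighbour of their images, and adjacent vertices have the same component.\<close>
  have step: "aa (%i. co (ap g i) = emp)" if \<alpha>: "\<alpha> : els K" and g: "g : els (ap H (cls ?A1 (y \<alpha>)))" for \<alpha> g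
  proof -
    have "EX z. is_fun E z om ?A1 & (ALL i:els om. adj (ap (y \<alpha>) i) (ap z i) & adj (ap t0 i) (ap z i))"
    proof (rule choice[where K = "%i u. adj (ap (y \<alpha>) i) u & adj (ap t0 i) u"])
      show "Dn E (%rh. adj (ap (y \<alpha>) (rh 0)) (rh 1) & adj (ap t0 (rh 0)) (rh 1))" by (intro dn)
      fix i assume i: "i : els om"
      have "co (ap (y \<alpha>) i) = co (ap t0 i)" unfolding yv[OF \<alpha> i] by simp
      thus "EX u:els ?A1. adj (ap (y \<alpha>) i) u & adj (ap t0 i) u"
        by (rule common_neighbour[OF fun_val(2)[OF y[OF \<alpha>] i] t0V[OF i]])
    qed
    then obtain z where z: "is_fun E z om ?A1" "!!i. i : els om ==> adj (ap (y \<alpha>) i) (ap z i)" "!!i. i : els om ==> adj (ap t0 i) (ap z i)" by blast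
    have zB: "cls ?A1 z : els ?B1" "cls ?A1 t0 : els ?B1" unfolding els_UP using z(1) t0(1) by blast+
    have "opr (cls ?A1 (y \<alpha>)) (cls ?A1 z) : els ?S1" unfolding adj1[OF y[OF \<alpha>] z(1)] by (rule aa_all) (rule z(2))
    hence e1: "opr (ap H (cls ?A1 (y \<alpha>))) (ap H (cls ?A1 z)) : els ?S2" unfolding iso[OF yB[OF \<alpha>] zB(1)] .
    have "opr (cls ?A1 t0) (cls ?A1 z) : els ?S1" unfolding adj1[OF t0(1) z(1)] by (rule aa_all) (rule z(3))
    hence e2: "opr (cls ?A2 x0) (ap H (cls ?A1 z)) : els ?S2" unfolding iso[OF zB(2,1)] t0(2) .
    obtain u where u: "ap H (cls ?A1 z) = cls ?A2 u" "is_fun E u om ?A2" using fun_val(2)[OF H(1) zB(1)] unfolding els_UP by blast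
    have g': "is_fun E g om ?A2" "ap H (cls ?A1 (y \<alpha>)) = cls ?A2 g"
      using mem2[OF g fun_val(2)[OF H(1) yB[OF \<alpha>]]] by blast+
    have "aa (%i. adj (ap g i) (ap u i))" using e1 unfolding g'(2) u(1) adj2[OF g'(1) u(2)] .
    moreover have "aa (%i. adj (ap x0 i) (ap u i))" using e2 unfolding u(1) adj2[OF x0f u(2)] .
    ultimately have "aa (%i. adj (ap g i) (ap u i) & adj (ap x0 i) (ap u i))" by (rule aa_conj)
    thus ?thesis
    proof (rule aa_mono)
      fix i assume i: "i : els om" "adj (ap g i) (ap u i) & adj (ap x0 i) (ap u i)"
      hence "co (ap g i) = co (ap x0 i)" unfolding adj_def by auto
      thus "co (ap g i) = emp" unfolding x0v[OF i(1)] by simp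
    qed
  qed

  \<comment> \<open>Representatives of the images are chosen simultaneously for all
    \<open>\<alpha>\<close>, so that their indices form one function \<open>h\<close> to be
    dominated.\<close>
  have "EX \<phi>. is_fun E \<phi> K (funs om ?A2) & (ALL \<alpha>:els K. ap \<phi> \<alpha> : els (ap H (cls ?A1 (y \<alpha>))))"
  proof (rule choice[where K = "%\<alpha> g. g : els (ap H (cls ?A1 (y \<alpha>)))"])
    show "Dn E (%rh. rh 1 : els (ap H (cls ?A1 (y (rh 0)))))" by (intro dn Fyl)
    fix \<alpha> assume \<alpha>: "\<alpha> : els K"
    obtain u where u: "ap H (cls ?A1 (y \<alpha>)) = cls ?A2 u" "is_fun E u om ?A2"
      using fun_val(2)[OF H(1) yB[OF \<alpha>]] unfolding els_UP by blast
    thus "EX g:els (funs om ?A2). g : els (ap H (cls ?A1 (y \<alpha>)))" using cls_refl[OF u(2)] by (intro bexI[of _ u]) simp_all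
  qed
  then obtain \<phi> where \<phi>: "is_fun E \<phi> K (funs om ?A2)" "!!\<alpha>. \<alpha> : els K ==> ap \<phi> \<alpha> : els (ap H (cls ?A1 (y \<alpha>)))" by blast
  have \<phi>f: "is_fun E (ap \<phi> \<alpha>) om ?A2" if "\<alpha> : els K" for \<alpha> using fun_val(2)[OF \<phi>(1) that] by simp
  have \<phi>V: "ap (ap \<phi> \<alpha>) i : els ?A2" if "\<alpha> : els K" "i : els om" for \<alpha> i by (rule fun_val(2)[OF \<phi>f[OF that(1)] that(2)])
  have "EX h. is_fun E h (prd K om) om & (ALL \<alpha>:els K. ALL i:els om. ap h (opr \<alpha> i) = ix (ap (ap \<phi> \<alpha>) i))"
  proof (rule fun2)
    show "Fn E (%rh. ix (ap (ap \<phi> (rh 0)) (rh 1)))" by (intro dn)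
    show "ix (ap (ap \<phi> \<alpha>) i) : els om" if "\<alpha> : els K" "i : els om" for \<alpha> i using \<phi>V[OF that] VS vert_eq(3) by blast
  qed
  then obtain h where h: "is_fun E h (prd K om) om" "!!\<alpha> i. \<alpha> : els K ==> i : els om ==> ap h (opr \<alpha> i) = ix (ap (ap \<phi> \<alpha>) i)" by blast
  obtain b where b: "is_fun E b om om" "!!\<alpha>. \<alpha> : els K ==> aa (%i. ap h (opr \<alpha> i) : els (ap b i))" using dominate[OF h(1)] by blast
  have "EX t. is_fun E t om ?A2 & (ALL i:els om. ALL u:els ?A2. co u = emp & ix u : els (ap b i) --> adj (ap t i) u)"
  proof (rule choice[where K = "%i t. ALL u:els ?A2. co u = emp & ix u : els (ap b i) --> adj t u"])
    show "Dn E (%rh. ALL u:els ?A2. co u = emp & ix u : els (ap b (rh 0)) --> adj (rh 1) u)" by (intro dn)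
    fix i assume "i : els om"
    thus "EX t:els ?A2. ALL u:els ?A2. co u = emp & ix u : els (ap b i) --> adj t u"
      by (rule dominating_vertex[OF fun_val(2)[OF b(1)] Z2])
  qed
  then obtain t where t: "is_fun E t om ?A2"
    "!!i u. i : els om ==> u : els ?A2 ==> co u = emp ==> ix u : els (ap b i) ==> adj (ap t i) u" by blast
  have tB: "cls ?A2 t : els ?B2" unfolding els_UP using t(1) by blast
  obtain t1 where t1: "is_fun E t1 om ?A1" "ap H (cls ?A1 t1) = cls ?A2 t" using sur[OF tB] unfolding els_UP by blast
  have t1B: "cls ?A1 t1 : els ?B1" unfolding els_UP using t1(1) by blast
  have nbr: "aa (%i. adj (ap t1 i) (ap (y \<alpha>) i))" if \<alpha>: "\<alpha> : els K" for \<alpha>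
  proof -
    have "aa (%i. co (ap (ap \<phi> \<alpha>) i) = emp & ap h (opr \<alpha> i) : els (ap b i))" by (rule aa_conj[OF step[OF \<alpha> \<phi>(2)[OF \<alpha>]] b(2)[OF \<alpha>]])
    hence "aa (%i. adj (ap t i) (ap (ap \<phi> \<alpha>) i))"
    proof (rule aa_mono)
      fix i assume i: "i : els om" "co (ap (ap \<phi> \<alpha>) i) = emp & ap h (opr \<alpha> i) : els (ap b i)"
      show "adj (ap t i) (ap (ap \<phi> \<alpha>) i)" by (rule t(2)[OF i(1) \<phi>V[OF \<alpha> i(1)]]) (use i h(2)[OF \<alpha> i(1)] in auto)
    qed
    hence "opr (cls ?A2 t) (cls ?A2 (ap \<phi> \<alpha>)) : els ?S2" unfolding adj2[OF t(1) \<phi>f[OF \<alpha>]] .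
    moreover have "ap H (cls ?A1 (y \<alpha>)) = cls ?A2 (ap \<phi> \<alpha>)" using mem2[OF \<phi>(2)[OF \<alpha>] fun_val(2)[OF H(1) yB[OF \<alpha>]]] by blast
    ultimately have "opr (cls ?A1 t1) (cls ?A1 (y \<alpha>)) : els ?S1" unfolding iso[OF t1B yB[OF \<alpha>]] t1(2) by simp
    thus ?thesis unfolding adj1[OF t1(1) y[OF \<alpha>]] .
  qed

  have t1V: "ap t1 i : els ?A1" if "i : els om" for i by (rule fun_val(2)[OF t1(1) that])
  have "EX e. is_fun E e om (funs om om) & (ALL i:els om. ALL k:els om. adj (ap t1 i) (vx (co (ap t1 i)) emp k) -->
      (EX l:els (suc (suc (co (ap t1 i)))). ap (ap e i) l = k))"
  proof (rule choice[where K = "%i e. ALL k:els om. adj (ap t1 i) (vx (co (ap t1 i)) emp k) --> (EX l:els (suc (suc (co (ap t1 i)))). ap e l = k)"])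
    show "Dn E (%rh. ALL k:els om. adj (ap t1 (rh 0)) (vx (co (ap t1 (rh 0))) emp k) --> (EX l:els (suc (suc (co (ap t1 (rh 0))))). ap (rh 1) l = k))"
      by (intro dn)
    fix i assume i: "i : els om"
    have "co (ap t1 i) ~= emp" using t1V[OF i] VS Z1(1) by metis
    thus "EX e:els (funs om om). ALL k:els om. adj (ap t1 i) (vx (co (ap t1 i)) emp k) --> (EX l:els (suc (suc (co (ap t1 i)))). ap e l = k)"
      by (rule P_neighbours[OF t1V[OF i]])
  qed
  then obtain e where e: "is_fun E e om (funs om om)"
    "!!i k. i : els om ==> k : els om ==> adj (ap t1 i) (vx (co (ap t1 i)) emp k) ==> EX l:els (suc (suc (co (ap t1 i)))). ap (ap e i) l = k" by blast
  have ef: "is_fun E (ap e i) om om" if "i : els om" for i using fun_val(2)[OF e(1) that] by simp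
  have "EX w. is_fun E w (prd om om) om & (ALL i:els om. ALL l:els om. ap w (opr i l) = ap (ap e i) l)"
  proof (rule fun2)
    show "Fn E (%rh. ap (ap e (rh 0)) (rh 1))" by (intro dn)
    show "ap (ap e i) l : els om" if "i : els om" "l : els om" for i l by (rule fun_val(2)[OF ef[OF that(1)] that(2)])
  qed
  then obtain w where w: "is_fun E w (prd om om) om" "!!i l. i : els om ==> l : els om ==> ap w (opr i l) = ap (ap e i) l" by blast
  obtain \<alpha> where \<alpha>: "\<alpha> : els K" "aa (%i. ALL l:els (ap f i). ap w (opr i l) ~= ap x (opr \<alpha> i))" using x(2)[OF w(1)] by blast
  from aa_ex[OF aa_conj[OF \<alpha>(2) nbr[OF \<alpha>(1)]]] obtain i where i: "i : els om"
    "!!l. l : els (ap f i) ==> ap w (opr i l) ~= ap x (opr \<alpha> i)" "adj (ap t1 i) (ap (y \<alpha>) i)" by blast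
  have a: "adj (ap t1 i) (vx (co (ap t0 i)) emp (ap x (opr \<alpha> i)))" using i(3) unfolding yv[OF \<alpha>(1) i(1)] .
  \<comment> \<open>At this \<open>i\<close>, adjacency puts \<open>t1\<close> into the component of
    \<open>t0\<close>, so its neighbours among the points are listed by the first
    \<open>f(i)\<close> entries of the row of \<open>w\<close>; the listed value contradicts
    evasion.\<close>
  hence c: "co (ap t1 i) = co (ap t0 i)" unfolding adj_def by simp
  obtain l where l: "l : els (suc (suc (co (ap t0 i))))" "ap (ap e i) l = ap x (opr \<alpha> i)"
    using e(2)[OF i(1) xo[OF \<alpha>(1) i(1)]] a unfolding c by blast
  have "l : els om" using om_sub[OF fo[OF i(1)] l(1)] .
  hence "ap w (opr i l) = ap x (opr \<alpha> i)" using w(2)[OF i(1)] l(2) by simp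
  thus False using i(2) l(1) unfolding fv[OF i(1)] by blast
qed

end

lemma (in cohen) evading: "evading E' ONE F (j k2)"
proof -
  interpret u: ultra E' ONE F
  proof unfold_locales
    show "Dn E' (%rh. ONE (a rh) (b rh))" if "Fn E' a" "Fn E' b" for a b by (rule Dn_ONE[OF that])
    show "EX m:els' W.om. N : els' m & (ALL k:els' m. ONE k m = (k : els' A)) & (ALL k:els' N. ONE m k = (k : els' B))"
      if "N : els' W.om" "els' A <= els' N" "els' B <= els' N" for N A B by (rule EP[OF that])
    show "EX b:els' F. ALL i:els' b. n : els' i" if n: "n : els' W.om" for n
    proof -
      obtain m where m: "n = j m" "m : els om" using n unfolding j_om els_j[of om] by blast
      obtain b where b: "b : els' F" "ALL i:els om. j i : els' b --> m : els i" using F(6)[OF m(2)] by blast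
      have "n : els' i" if i: "i : els' b" for i
      proof -
        have "i : els' (j om)" using F(1) b(1) i unfolding j_om by auto
        thus ?thesis using b(2) i m(1) unfolding els_j[of om] by auto
      qed
      thus ?thesis using b(1) by blast
    qed
  qed (rule F; assumption)+
  show ?thesis
  proof unfold_locales
    show "EX f. is_fun E' f W.om W.om & (ALL \<alpha>:els' (j k2). u.aa (%i. W.ap h (W.opr \<alpha> i) : els' (W.ap f i)))"
      if "is_fun E' h (W.prd (j k2) W.om) W.om" for h unfolding u.aa_def by (rule domination[OF that])
    show "EX x. is_fun E' x (W.prd (j k2) W.om) W.om & (ALL w. is_fun E' w (W.prd W.om W.om) W.om -->
      (EX \<alpha>:els' (j k2). u.aa (%i. ALL l:els' (W.ap f i). W.ap w (W.opr i l) ~= W.ap x (W.opr \<alpha> i))))"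
      if "is_fun E' f W.om W.om" for f unfolding u.aa_def by (rule evasion[OF that])
  qed
qed

lemma (in cohen) pair_closed_ext:
  "EX U. els' W.om <= els' U & (ALL a:els' U. ALL b:els' U. W.opr a b : els' U)"
proof -
  obtain U where U: "els om <= els U" "ALL a:els U. ALL b:els U. opr a b : els U" using pair_closed[of om] by blast
  show ?thesis
  proof (rule exI[of _ "j U"], intro conjI ballI)
    show "els' W.om <= els' (j U)" unfolding j_om els_j using U(1) by blast
    fix a b assume "a : els' (j U)" "b : els' (j U)"
    thus "W.opr a b : els' (j U)" using U(2) unfolding els_j by (auto simp: j_opr)
  qed
qed

theorem corollary3p2:
  fixes V :: "'v \<Rightarrow> 'v \<Rightarrow> bool" and V' :: "'w \<Rightarrow> 'w \<Rightarrow> bool"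
    and \<kappa>\<^sub>1 \<kappa>\<^sub>2 \<kappa>\<^sub>3 s P L :: 'v and G :: "'v set"
  assumes "ZFC V"
    and "is_aleph V 1 \<kappa>\<^sub>1" and "is_aleph V 2 \<kappa>\<^sub>2" and "is_aleph V 3 \<kappa>\<^sub>3"
    and "two_power_eq V \<kappa>\<^sub>1 \<kappa>\<^sub>2" and "two_power_eq V \<kappa>\<^sub>2 \<kappa>\<^sub>3"
    and "elts V s = {\<delta> \<in> elts V \<kappa>\<^sub>3. is_cof V \<delta> \<kappa>\<^sub>2}" and "diamond V \<kappa>\<^sub>3 s"
    and "is_cohen_forcing V \<kappa>\<^sub>3 P L" and "is_generic V P L G"
    and "is_generic_extension V P L G V'"
  shows "\<exists>\<omega> \<Gamma>\<^sub>1 R\<^sub>1 \<Gamma>\<^sub>2 R\<^sub>2 F. is_omega V' \<omega> \<and>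
     is_graph V' \<Gamma>\<^sub>1 R\<^sub>1 \<and> is_countable V' \<Gamma>\<^sub>1 \<and>
     is_graph V' \<Gamma>\<^sub>2 R\<^sub>2 \<and> is_countable V' \<Gamma>\<^sub>2 \<and>
     elem_equivalent V' \<Gamma>\<^sub>1 R\<^sub>1 \<Gamma>\<^sub>2 R\<^sub>2 \<and>
     nonprincipal_ultrafilter V' \<omega> F \<and>
     (\<exists>B\<^sub>1 S\<^sub>1 B\<^sub>2 S\<^sub>2.
        is_ultrapower V' \<omega> F \<Gamma>\<^sub>1 R\<^sub>1 B\<^sub>1 S\<^sub>1 \<and>
        is_ultrapower V' \<omega> F \<Gamma>\<^sub>2 R\<^sub>2 B\<^sub>2 S\<^sub>2 \<and>
        \<not> graph_isomorphic V' B\<^sub>1 S\<^sub>1 B\<^sub>2 S\<^sub>2)"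
proof -
  interpret zfc V by (rule ZFC_zfc) fact
  interpret ground V \<kappa>\<^sub>2 \<kappa>\<^sub>3 s P L by unfold_locales (fact assms)+
  obtain val where val: "surj val" "ALL \<sigma> \<tau>. val \<sigma> = val \<tau> <-> (EX p:G. FE p \<sigma> \<tau>)"
    "ALL \<sigma> \<tau>. V' (val \<sigma>) (val \<tau>) <-> (EX p:G. FM p \<sigma> \<tau>)"
    using \<open>is_generic_extension V P L G V'\<close> unfolding is_generic_extension_def forces_eq_iff forces_mem_iff
    by (elim exE conjE)
  note g1 = \<open>is_generic V P L G\<close>[unfolded is_generic_def rel_iff]
  note g2 = g1[THEN conjunct2] note g3 = g2[THEN conjunct2] note g4 = g3[THEN conjunct2] note g5 = g4[THEN conjunct2]
  interpret cohen V \<kappa>\<^sub>2 \<kappa>\<^sub>3 s P L G V' val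
  proof unfold_locales
    show "p : els P" if "p : G" for p using g1[THEN conjunct1] that by blast
    show "G ~= {}" by (rule g2[THEN conjunct1])
    show "q : G" if "p : G" "le p q" for p q
      using g3[THEN conjunct1, rule_format, OF that(1) _ that(2)] le_dom[OF that(2)] by blast
    show "EX r:G. le r p & le r q" if "p : G" "q : G" for p q by (rule g4[THEN conjunct1, rule_format, OF that])
    show "EX q:G. q : els D" if D: "els D <= els P" "!!p. p : els P ==> EX q:els D. le q p" for D
    proof -
      have "G \<inter> els D ~= {}" by (rule g5[rule_format]) (use D in blast)
      thus ?thesis by blast
    qed
    show "EX x. u = val x" for u by (rule surjD[OF val(1)])
  qed (rule val[rule_format])+
  interpret u: evading V' ONE F "j \<kappa>\<^sub>2" by (rule evading)
  obtain U where U: "els' W.om <= els' U" "!!a b. a : els' U ==> b : els' U ==> W.opr a b : els' U" using pair_closed_ext by blast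
  \<comment> \<open>\<open>?Z1\<close> omits component 0 and \<open>?Z2\<close> has it; otherwise
    the two graphs have the same components.\<close>
  let ?Z1 = "W.df W.om (W.mk {W.emp})" and ?Z2 = "W.om"
  let ?A1 = "u.VS ?Z1" and ?A2 = "u.VS ?Z2" and ?R1 = "u.ES ?Z1" and ?R2 = "u.ES ?Z2"
  have Z1: "els' ?Z1 = els' W.om - {W.emp}" by (simp add: W.els_mk)
  have n1: "W.n1 : els' ?Z1" unfolding Z1 using W.num_om by simp
  have "elem_equivalent V' ?A1 ?R1 ?A2 ?R2"
    by (rule u.elem_equiv[OF U], unfold Z1) blast+
  moreover have "~ graph_isomorphic V' (u.UP ?A1) (u.UR ?A1 ?R1) (u.UP ?A2) (u.UR ?A2 ?R2)"
    by (rule u.not_isomorphic, unfold Z1) (use W.om_0 in blast)+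
  moreover have "is_graph V' ?A1 ?R1" by (rule u.graph[OF n1], unfold Z1) blast
  moreover have "is_graph V' ?A2 ?R2" by (rule u.graph[OF W.om_0]) simp
  ultimately show ?thesis using W.is_omega_om u.countable[of ?Z1] u.countable[of ?Z2] u.nonprincipal
    u.ultrapower[of ?A1 ?R1] u.ultrapower[of ?A2 ?R2] by blast
qed

end
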